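(* Let $n\ge1$, let $k$ be a field such that the group algebra $kS[\lambda]$ is semisimple for every propagating index $\lambda$ with $\#^{env}(\lambda)\le n$ (for example $k$ of characteristic zero), and let $\mathbf Q=(Q_1,Q_2)\in k^2$ with $Q_1Q_2$ invertible in $k$. Let $P=P_n^{(\underline 2)}(\mathbf Q)$, and let $\mathcal I_1,\ldots,\mathcal I_{2n}\in P$ be idempotents such that $P\mathcal I_mP=\sum_{\lambda\in\Lambda^m}P\mathcal I'_\lambda P$ for $m=1,\ldots,2n$ (such idempotents exist). Then $P$ is quasi-hereditary with heredity chain $(\mathcal I_{2n},\mathcal I_{2n-1},\ldots,\mathcal I_1,\mathcal I_{()})$, that is, the chain of two-sided ideals $$0\subset P\mathcal I_{()}P\subset P\mathcal I_1P\subset\cdots\subset P\mathcal I_{2n}P=P$$ is a heredity chain.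
   Context: Write $\underline n=\{1,\ldots,n\}$, and let $\underline n'$, $\underline n''$ be disjoint (primed, doubly primed) copies. $p_n$ is the set of partitions of $\underline n\cup\underline n'$ (identified with equivalence relations). For $a,b\in p_n$ let $b^{+}$ be the partition of $\underline n'\cup\underline n''$ obtained from $b$ by renaming $i\mapsto i'$, $i'\mapsto i''$; let $d_u(ab)$ be the equivalence relation on $\underline n\cup\underline n'\cup\underline n''$ generated by $a$ and $b^{+}$; $c(a,b)$ is the number of parts of $d_u(ab)$ contained in $\underline n'$; $d(ab)\in p_n$ is obtained by restricting $d_u(ab)$ to $\underline n\cup\underline n''$ and renaming $i''\mapsto i'$. $p_n^{(\underline 2)}$ is the set of pairs $(a_1,a_2)\in p_n\times p_n$ such that $a_1$ (inner) is a refinement of $a_2$ (outer), i.e. each part of $a_2$ is a union of parts of $a_1$. $P_n^{(\underline 2)}(\mathbf Q)$ is the (unital, associative) $k$-algebra with basis $p_n^{(\underline 2)}$ and product $ab=Q_1^{c(a_1,b_1)}Q_2^{c(a_2,b_2)}(d(a_1b_1),d(a_2b_2))$. A propagating index is a finite weakly decreasing sequence $\lambda=(\lambda_1,\ldots,\lambda_l)$ of non-negative integers (zeros allowed; the empty sequence is $()$); $\#^{env}(\lambda)=\sum_i\max(1,\lambda_i)$. $\Lambda^m$ is the set of propagating indices $\lambda=(\lambda_1,\ldots,\lambda_l)$ with $\#^{env}(\lambda)\le n$ and $l+\sum_i\lambda_i=m$. If the distinct entries of $\lambda$ are $u_1,u_2,\ldots$ occurring with multiplicities $m_1,m_2,\ldots$,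 then $S[\lambda]=\prod_iS_{u_i}\wr S_{m_i}$, where $S_u$ is the symmetric group and $S_0$ is the trivial group (so $S_0\wr S_m=S_m$); $S[()]$ is trivial. For $\lambda\ne()$ with $e=\#^{env}(\lambda)\le n$, split $\{1,\ldots,e\}$ into consecutive intervals $B_1,\ldots,B_l$ with $|B_i|=\max(1,\lambda_i)$. $\mathcal I_\lambda'\in p_n^{(\underline 2)}$ is the element whose inner partition has parts $\{j,j'\}$ for $j\in B_i$ with $\lambda_i\ge1$, and $\{j\},\{j'\}$ for all other $j\in\underline n$; and whose outer partition has parts $B_i\cup B_i'$ for $1\le i<l$ and one further part $B_l\cup B_l'\cup\{j,j':e<j\le n\}$. $\mathcal I_{()}$ is the idempotent $(Q_1Q_2)^{-n}(a_0,a_0)$, where $a_0\in p_n$ is the partition into singletons. A two-sided ideal $J$ of a finite dimensional algebra $A$ is a heredity ideal if $J=AeA$ for an idempotent $e$ with $eAe$ semisimple and such that the multiplication map $Ae\otimes_{eAe}eA\to AeA$ is bijective. A chain $0=J_{-1}\subset J_0\subset J_1\subset\cdots\subset J_r=A$ of two-sided ideals is a heredity chain if each $J_i/J_{i-1}$ is a heredity ideal of $A/J_{i-1}$; $A$ is quasi-hereditary if it has a heredity chain. *)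

theory Defs
  imports "HOL-Library.Poly_Mapping" "HOL-Library.Disjoint_Sets" "HOL-Algebra.Algebra"
begin

section \<open>Ring theory\<close>

text \<open>For a unital algebra over a field the (left, two-sided) ideals, corners, quotients and
  tensor products over corners are those of the underlying ring, so they are defined for rings.\<close>

definition idempotent :: "('a, 'm) ring_scheme \<Rightarrow> 'a \<Rightarrow> bool" where
  "idempotent A e \<longleftrightarrow> e \<in> carrier A \<and> e \<otimes>\<^bsub>A\<^esub> e = e"

definition left_ideal :: "'a set \<Rightarrow> ('a, 'm) ring_scheme \<Rightarrow> bool" where
  "left_ideal I A \<longleftrightarrow> additive_subgroup I A \<and> (\<forall>r\<in>carrier A. \<forall>x\<in>I. r \<otimes>\<^bsub>A\<^esub> x \<in> I)"

text \<open>The left regular module is semisimple: every submodule is a direct summand.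
  The zero ring counts as semisimple.\<close>

definition semisimple_ring :: "('a, 'm) ring_scheme \<Rightarrow> bool" where
  "semisimple_ring A \<longleftrightarrow> ring A \<and>
     (\<forall>I. left_ideal I A \<longrightarrow>
        (\<exists>J. left_ideal J A \<and> I \<inter> J = {\<zero>\<^bsub>A\<^esub>} \<and> I <+>\<^bsub>A\<^esub> J = carrier A))"

text \<open>The set \<open>A e A\<close> of finite sums of elements \<open>a e b\<close>.\<close>

definition sandwich :: "('a, 'm) ring_scheme \<Rightarrow> 'a \<Rightarrow> 'a set" where
  "sandwich A e = generate (add_monoid A)
     {a \<otimes>\<^bsub>A\<^esub> e \<otimes>\<^bsub>A\<^esub> b | a b. a \<in> carrier A \<and> b \<in> carrier A}"

definition left_mults :: "('a, 'm) ring_scheme \<Rightarrow> 'a \<Rightarrow> 'a set" where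
  "left_mults A e = {a \<otimes>\<^bsub>A\<^esub> e | a. a \<in> carrier A}"

definition right_mults :: "('a, 'm) ring_scheme \<Rightarrow> 'a \<Rightarrow> 'a set" where
  "right_mults A e = {e \<otimes>\<^bsub>A\<^esub> a | a. a \<in> carrier A}"

definition corner_ring :: "('a, 'm) ring_scheme \<Rightarrow> 'a \<Rightarrow> ('a, 'm) ring_scheme" where
  "corner_ring A e =
     A\<lparr>carrier := {e \<otimes>\<^bsub>A\<^esub> a \<otimes>\<^bsub>A\<^esub> e | a. a \<in> carrier A}, one := e\<rparr>"

text \<open>For additive subgroups \<open>M\<close>, \<open>N\<close> of \<open>A\<close> and a subset \<open>B\<close> with \<open>M B \<subseteq> M\<close> and \<open>B N \<subseteq> N\<close>,
  the tensor product \<open>M \<otimes>\<^bsub>B\<^esub> N\<close> is the free abelian group on \<open>M \<times> N\<close> modulo the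
  bilinearity and balancing relations.\<close>

definition tensor_relations ::
    "('a, 'm) ring_scheme \<Rightarrow> 'a set \<Rightarrow> 'a set \<Rightarrow> 'a set \<Rightarrow> ('a \<times> 'a \<Rightarrow>\<^sub>0 int) set" where
  "tensor_relations A B M N = generate (free_Abelian_group (M \<times> N))
     ({frag_of (x \<oplus>\<^bsub>A\<^esub> x', y) - frag_of (x, y) - frag_of (x', y) | x x' y. x \<in> M \<and> x' \<in> M \<and> y \<in> N}
    \<union> {frag_of (x, y \<oplus>\<^bsub>A\<^esub> y') - frag_of (x, y) - frag_of (x, y') | x y y'. x \<in> M \<and> y \<in> N \<and> y' \<in> N}
    \<union> {frag_of (x \<otimes>\<^bsub>A\<^esub> b, y) - frag_of (x, b \<otimes>\<^bsub>A\<^esub> y) | x b y. x \<in> M \<and> b \<in> B \<and> y \<in> N})"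

definition tensor_product ::
    "('a, 'm) ring_scheme \<Rightarrow> 'a set \<Rightarrow> 'a set \<Rightarrow> 'a set \<Rightarrow> ('a \<times> 'a \<Rightarrow>\<^sub>0 int) set monoid" where
  "tensor_product A B M N = free_Abelian_group (M \<times> N) Mod tensor_relations A B M N"

text \<open>The map induced on cosets by \<open>(x, y) \<mapsto> x y\<close>; the value does not depend on the
  representative, so the image of a coset is a singleton.\<close>

definition tensor_mult :: "('a, 'm) ring_scheme \<Rightarrow> ('a \<times> 'a \<Rightarrow>\<^sub>0 int) set \<Rightarrow> 'a" where
  "tensor_mult A C = the_elem
     ((\<lambda>c. \<Oplus>\<^bsub>A\<^esub>p\<in>Poly_Mapping.keys c.
         [Poly_Mapping.lookup c p] \<cdot>\<^bsub>A\<^esub> (fst p \<otimes>\<^bsub>A\<^esub> snd p)) ` C)"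

definition heredity_ideal :: "'a set \<Rightarrow> ('a, 'm) ring_scheme \<Rightarrow> bool" where
  "heredity_ideal J A \<longleftrightarrow> ideal J A \<and>
     (\<exists>e. idempotent A e \<and> J = sandwich A e \<and> semisimple_ring (corner_ring A e) \<and>
        bij_betw (tensor_mult A)
          (carrier (tensor_product A (carrier (corner_ring A e)) (left_mults A e) (right_mults A e)))
          (sandwich A e))"

text \<open>Strictly increasing chains \<open>J 0, \<dots>, J r\<close>; the ideal preceding \<open>J 0\<close> is zero.\<close>

definition prev_ideal :: "('a, 'm) ring_scheme \<Rightarrow> (nat \<Rightarrow> 'a set) \<Rightarrow> nat \<Rightarrow> 'a set" where
  "prev_ideal A J i = (case i of 0 \<Rightarrow> {\<zero>\<^bsub>A\<^esub>} | Suc j \<Rightarrow> J j)"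

definition heredity_chain :: "('a, 'm) ring_scheme \<Rightarrow> nat \<Rightarrow> (nat \<Rightarrow> 'a set) \<Rightarrow> bool" where
  "heredity_chain A r J \<longleftrightarrow> ring A \<and> J r = carrier A \<and>
     (\<forall>i\<le>r. ideal (J i) A \<and> prev_ideal A J i \<subset> J i \<and>
        heredity_ideal ((\<lambda>x. prev_ideal A J i +>\<^bsub>A\<^esub> x) ` J i) (A Quot prev_ideal A J i))"

definition quasi_hereditary :: "('a, 'm) ring_scheme \<Rightarrow> bool" where
  "quasi_hereditary A \<longleftrightarrow> (\<exists>r J. heredity_chain A r J)"


section \<open>Algebras given by a basis and structure constants\<close>

text \<open>The vector space over the field \<open>'k\<close> with basis \<open>B\<close> and the bilinear extension of the
  product \<open>\<tau>\<close> of basis elements; the unit is the basis element \<open>u\<close>.\<close>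

definition basis_algebra ::
    "'b set \<Rightarrow> 'b \<Rightarrow> ('b \<Rightarrow> 'b \<Rightarrow> 'b \<Rightarrow>\<^sub>0 'k::field) \<Rightarrow> ('k, 'b \<Rightarrow>\<^sub>0 'k) module" where
  "basis_algebra B u \<tau> =
     \<lparr>carrier = {f. Poly_Mapping.keys f \<subseteq> B},
      monoid.mult = (\<lambda>f g. \<Sum>a\<in>Poly_Mapping.keys f. \<Sum>b\<in>Poly_Mapping.keys g.
        Poly_Mapping.map ((*) (Poly_Mapping.lookup f a * Poly_Mapping.lookup g b)) (\<tau> a b)),
      one = Poly_Mapping.single u 1,
      ring.zero = 0,
      add = (+),
      smult = (\<lambda>c. Poly_Mapping.map ((*) c))\<rparr>"

definition group_algebra :: "('g, 'm) monoid_scheme \<Rightarrow> ('k::field, 'g \<Rightarrow>\<^sub>0 'k) module" where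
  "group_algebra G = basis_algebra (carrier G) \<one>\<^bsub>G\<^esub> (\<lambda>g h. Poly_Mapping.single (g \<otimes>\<^bsub>G\<^esub> h) 1)"


section \<open>The groups \<open>S[\<lambda>]\<close>\<close>

text \<open>\<open>G \<wr> S\<^sub>m\<close>, the semidirect product of \<open>G\<^sup>m\<close> and \<open>S\<^sub>m\<close>, where \<open>p\<close> moves the entry at
  position \<open>i\<close> to position \<open>p i\<close>.\<close>

definition wreath_sym ::
    "('g, 'm) monoid_scheme \<Rightarrow> nat \<Rightarrow> ((nat \<Rightarrow> 'g) \<times> (nat \<Rightarrow> nat)) monoid" where
  "wreath_sym G m =
     \<lparr>carrier = (\<Pi>\<^sub>E i\<in>{1..m}. carrier G) \<times> carrier (sym_group m),
      monoid.mult = (\<lambda>(f, p) (g, q). (\<lambda>i\<in>{1..m}. f i \<otimes>\<^bsub>G\<^esub> g (inv_into UNIV p i), p \<circ> q)),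
      one = (\<lambda>i\<in>{1..m}. \<one>\<^bsub>G\<^esub>, id)\<rparr>"

definition index_group :: "nat list \<Rightarrow> (nat \<Rightarrow> (nat \<Rightarrow> nat \<Rightarrow> nat) \<times> (nat \<Rightarrow> nat)) monoid" where
  "index_group ls = product_group (set ls) (\<lambda>u. wreath_sym (sym_group u) (count_list ls u))"


section \<open>Propagating indices\<close>

definition propagating_index :: "nat list \<Rightarrow> bool" where
  "propagating_index ls \<longleftrightarrow> sorted_wrt (\<ge>) ls"

definition env_size :: "nat list \<Rightarrow> nat" where
  "env_size ls = (\<Sum>u\<leftarrow>ls. max 1 u)"

definition level_indices :: "nat \<Rightarrow> nat \<Rightarrow> nat list set" where
  "level_indices n m =
     {ls. propagating_index ls \<and> env_size ls \<le> n \<and> length ls + sum_list ls = m}"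


section \<open>Diagrams\<close>

text \<open>The pair \<open>(i, t)\<close> is the point \<open>i\<close> carrying \<open>t\<close> primes.\<close>

type_synonym point = "nat \<times> nat"
type_synonym diagram = "point set set"

definition row :: "nat \<Rightarrow> nat \<Rightarrow> point set" where
  "row n t = {1..n} \<times> {t}"

definition diagrams :: "nat \<Rightarrow> diagram set" where
  "diagrams n = {a. partition_on (row n 0 \<union> row n 1) a}"

definition rel_of :: "diagram \<Rightarrow> (point \<times> point) set" where
  "rel_of a = {(x, y). \<exists>p\<in>a. x \<in> p \<and> y \<in> p}"

definition shift :: "diagram \<Rightarrow> diagram" where
  "shift b = (\<lambda>p. (\<lambda>(i, t). (i, Suc t)) ` p) ` b"

text \<open>Both relations are reflexive on their rows and symmetric, so the transitive closure of
  their union is the equivalence relation on all three rows that they generate.\<close>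

definition stacked :: "nat \<Rightarrow> diagram \<Rightarrow> diagram \<Rightarrow> diagram" where
  "stacked n a b =
     (row n 0 \<union> row n 1 \<union> row n 2) // (rel_of a \<union> rel_of (shift b))\<^sup>+"

definition closed_count :: "nat \<Rightarrow> diagram \<Rightarrow> diagram \<Rightarrow> nat" where
  "closed_count n a b = card {p \<in> stacked n a b. p \<subseteq> row n 1}"

definition compose :: "nat \<Rightarrow> diagram \<Rightarrow> diagram \<Rightarrow> diagram" where
  "compose n a b =
     (\<lambda>p. (\<lambda>(i, t). (i, if t = 2 then 1 else t)) ` p) `
       ((\<lambda>p. p \<inter> (row n 0 \<union> row n 2)) ` stacked n a b - {{}})"

definition identity_diagram :: "nat \<Rightarrow> diagram" where
  "identity_diagram n = {{(i, 0), (i, 1)} | i. i \<in> {1..n}}"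

definition discrete_diagram :: "nat \<Rightarrow> diagram" where
  "discrete_diagram n = {{x} | x. x \<in> row n 0 \<union> row n 1}"

text \<open>Pairs (inner, outer).\<close>

definition ramified_diagrams :: "nat \<Rightarrow> (diagram \<times> diagram) set" where
  "ramified_diagrams n =
     {(a1, a2). a1 \<in> diagrams n \<and> a2 \<in> diagrams n \<and> refines (row n 0 \<union> row n 1) a1 a2}"

definition ramified_partition_algebra ::
    "nat \<Rightarrow> 'k::field \<Rightarrow> 'k \<Rightarrow> ('k, (diagram \<times> diagram) \<Rightarrow>\<^sub>0 'k) module" where
  "ramified_partition_algebra n Q1 Q2 =
     basis_algebra (ramified_diagrams n) (identity_diagram n, identity_diagram n)
       (\<lambda>(a1, a2) (b1, b2).
          Poly_Mapping.single (compose n a1 b1, compose n a2 b2)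
            (Q1 ^ closed_count n a1 b1 * Q2 ^ closed_count n a2 b2))"


section \<open>The distinguished elements\<close>

text \<open>The block of index \<open>i\<close>, counting from \<open>0\<close>.\<close>

definition block :: "nat list \<Rightarrow> nat \<Rightarrow> nat set" where
  "block ls i = {env_size (take i ls) <.. env_size (take (Suc i) ls)}"

definition inner_support :: "nat list \<Rightarrow> nat set" where
  "inner_support ls = (\<Union>i\<in>{i. i < length ls \<and> ls ! i \<ge> 1}. block ls i)"

definition index_inner :: "nat \<Rightarrow> nat list \<Rightarrow> diagram" where
  "index_inner n ls =
     {{(j, 0), (j, 1)} | j. j \<in> inner_support ls} \<union>
     {{(j, t)} | j t. j \<in> {1..n} - inner_support ls \<and> t \<in> {0, 1}}"

definition index_outer :: "nat \<Rightarrow> nat list \<Rightarrow> diagram" where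
  "index_outer n ls =
     {block ls i \<times> {0, 1} | i. Suc i < length ls} \<union>
     {(block ls (length ls - 1) \<union> {env_size ls <.. n}) \<times> {0, 1}}"

text \<open>Only meaningful for \<open>ls \<noteq> []\<close>; the empty index is treated separately.\<close>

definition index_element :: "nat \<Rightarrow> nat list \<Rightarrow> (diagram \<times> diagram) \<Rightarrow>\<^sub>0 'k::field" where
  "index_element n ls = Poly_Mapping.single (index_inner n ls, index_outer n ls) 1"

definition empty_idempotent :: "nat \<Rightarrow> 'k::field \<Rightarrow> 'k \<Rightarrow> (diagram \<times> diagram) \<Rightarrow>\<^sub>0 'k" where
  "empty_idempotent n Q1 Q2 =
     Poly_Mapping.single (discrete_diagram n, discrete_diagram n) (inverse ((Q1 * Q2) ^ n))"

definition level_idempotents ::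
    "nat \<Rightarrow> 'k::field \<Rightarrow> 'k \<Rightarrow> (nat \<Rightarrow> (diagram \<times> diagram) \<Rightarrow>\<^sub>0 'k) \<Rightarrow> bool" where
  "level_idempotents n Q1 Q2 E \<longleftrightarrow>
     (let P = ramified_partition_algebra n Q1 Q2 in
      \<forall>m\<in>{1..2 * n}. idempotent P (E m) \<and>
        sandwich P (E m) =
          generate (add_monoid P) (\<Union>ls\<in>level_indices n m. sandwich P (index_element n ls)))"

end

theory Submission
  imports Defs
begin

text \<open>
  Ramified diagrams form a finite regular star-monoid (\<open>a a\<^sup>* a = a\<close>), and \<open>P\<close> is its algebra twisted by a
  cocycle with invertible values. The rank of a diagram is the number of its inner plus the number of
  its outer propagating parts; diagrams of rank at most \<open>m\<close> span the ideal \<open>P I\<^sub>m P\<close>. Multiplication that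
  preserves the rank preserves the R-class, which is determined by the projection \<open>a a\<^sup>*\<close>. So modulo
  lower ranks the ideal of rank \<open>m\<close> is generated by orthogonal idempotents \<open>e\<^sub>\<lambda>\<close> with corners quotients
  of \<open>k S[\<lambda>]\<close>, and choosing for every projection \<open>p\<close> an element \<open>x\<close> with \<open>x x\<^sup>* = p\<close>, \<open>x\<^sup>* x = e\<^sub>\<lambda>\<close>
  gives a basis of \<open>P e\<close> over \<open>e P e\<close>, whence the multiplication map on the tensor product is bijective.
  The generators \<open>I'\<^sub>\<lambda>\<close> of one level commute, so they have a common idempotent join \<open>I\<^sub>m\<close>.
\<close>

section \<open>Semisimplicity under surjections and under sums of strongly orthogonal
  idempotents\<close>

section \<open>Semisimple rings\<close>

text \<open>Whether an ideal is a heredity ideal is witnessed by some idempotent of the quotient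
  ring, which may differ from the image of the prescribed one. So the given level idempotents matter
  only through the ideals they generate. Each layer is tested with the sum of the
  \<open>idem e\<close> instead, which is an idempotent only after lower ranks have been divided
  out. The obstacle on the side of diagrams is that parts are hard to follow through a composition.
  Subsets of \<open>{1..n}\<close> form a vector space over the field with two elements under
  symmetric difference, and a diagram is recorded as a linear relation on it. The number of closed
  parts is the dimension of a space of intermediate vectors, the rank is the dimension of the domain
  modulo the kernel, and stability says that equal rank leaves domain and kernel unchanged. Moving
  up one rank at a time has two uses: it shows that the elements of rank exactly \<open>m\<close>
  generate everything below, and that every rank from 0 to \<open>2 * n\<close> occurs, so that the
  inclusions are strict.\<close>

lemma left_idealI:
  assumes "ring A" and "I \<subseteq> carrier A" and "\<zero>\<^bsub>A\<^esub> \<in> I"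
    and "\<And>x y. x \<in> I \<Longrightarrow> y \<in> I \<Longrightarrow> x \<oplus>\<^bsub>A\<^esub> y \<in> I"
    and "\<And>r x. r \<in> carrier A \<Longrightarrow> x \<in> I \<Longrightarrow> r \<otimes>\<^bsub>A\<^esub> x \<in> I"
  shows "left_ideal I A"
proof -
  interpret ring A by fact
  have "\<ominus>\<^bsub>A\<^esub> x \<in> I" if "x \<in> I" for x
  proof -
    have "(\<ominus>\<^bsub>A\<^esub> \<one>\<^bsub>A\<^esub>) \<otimes>\<^bsub>A\<^esub> x \<in> I" using assms(5) that by blast
    then show ?thesis using that assms(2) l_minus[of "\<one>\<^bsub>A\<^esub>" x] by auto
  qed
  then show ?thesis
    using assms unfolding left_ideal_def
    by (auto intro!: additive_subgroup.intro subgroup.intro simp: a_inv_def[symmetric])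
qed

lemma left_idealD:
  assumes "left_ideal I A"
  shows "I \<subseteq> carrier A" "\<zero>\<^bsub>A\<^esub> \<in> I"
    "\<And>x y. x \<in> I \<Longrightarrow> y \<in> I \<Longrightarrow> x \<oplus>\<^bsub>A\<^esub> y \<in> I"
    "\<And>r x. r \<in> carrier A \<Longrightarrow> x \<in> I \<Longrightarrow> r \<otimes>\<^bsub>A\<^esub> x \<in> I"
  using assms unfolding left_ideal_def
  by (auto simp: additive_subgroup.zero_closed additive_subgroup.a_closed additive_subgroup.a_subset)

lemma set_add_iff: "x \<in> I <+>\<^bsub>A\<^esub> J \<longleftrightarrow> (\<exists>i\<in>I. \<exists>j\<in>J. x = i \<oplus>\<^bsub>A\<^esub> j)"
  by (auto simp: set_add_def set_mult_def)

text \<open>A left ideal \<open>I\<close> of \<open>B\<close> is pulled back to \<open>I0\<close>,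
  which contains the kernel of \<open>h\<close>. If \<open>J0\<close> is a complement of
  \<open>I0\<close>, then \<open>h j\<close> in \<open>I\<close> forces \<open>j\<close> into both
  \<open>I0\<close> and \<open>J0\<close>, so the image of \<open>J0\<close> meets \<open>I\<close>
  in zero only.\<close>

lemma semisimple_ring_surj_image:
  assumes A: "semisimple_ring A" and B: "ring B"
    and h: "h \<in> ring_hom A B" and surj: "carrier B \<subseteq> h ` carrier A"
  shows "semisimple_ring B"
proof -
  interpret A: ring A using A unfolding semisimple_ring_def by simp
  interpret B: ring B by fact
  interpret h: ring_hom_ring A B h
    by (rule ring_hom_ringI2) (use h A.ring_axioms B.ring_axioms in auto)
  have "\<exists>J. left_ideal J B \<and> I \<inter> J = {\<zero>\<^bsub>B\<^esub>} \<and> I <+>\<^bsub>B\<^esub> J = carrier B"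
    if I: "left_ideal I B" for I
  proof -
    note I' = left_idealD[OF I]
    define I0 where "I0 = {x \<in> carrier A. h x \<in> I}"
    have "left_ideal I0 A"
      by (rule left_idealI) (use I' A.ring_axioms in \<open>auto simp: I0_def\<close>)
    then obtain J0 where J0: "left_ideal J0 A" "I0 \<inter> J0 = {\<zero>\<^bsub>A\<^esub>}" "I0 <+>\<^bsub>A\<^esub> J0 = carrier A"
      using A unfolding semisimple_ring_def by blast
    note J0' = left_idealD[OF J0(1)]
    have J: "left_ideal (h ` J0) B"
    proof (rule left_idealI[OF B])
      show "h ` J0 \<subseteq> carrier B" using J0'(1) by auto
      show "\<zero>\<^bsub>B\<^esub> \<in> h ` J0" using J0'(2) by (metis h.hom_zero imageI)
      show "x \<oplus>\<^bsub>B\<^esub> y \<in> h ` J0" if xy: "x \<in> h ` J0" "y \<in> h ` J0" for x y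
      proof -
        obtain x' y' where *: "x' \<in> J0" "y' \<in> J0" "x = h x'" "y = h y'" using xy by blast
        then have "x \<oplus>\<^bsub>B\<^esub> y = h (x' \<oplus>\<^bsub>A\<^esub> y')" using J0'(1) by (simp add: subset_iff)
        then show ?thesis using * J0'(3) by blast
      qed
      show "r \<otimes>\<^bsub>B\<^esub> x \<in> h ` J0" if rx: "r \<in> carrier B" "x \<in> h ` J0" for r x
      proof -
        obtain r' x' where *: "r' \<in> carrier A" "x' \<in> J0" "r = h r'" "x = h x'" using rx surj by blast
        then have "r \<otimes>\<^bsub>B\<^esub> x = h (r' \<otimes>\<^bsub>A\<^esub> x')" using J0'(1) by (simp add: subset_iff)
        then show ?thesis using * J0'(4) by blast
      qed
    qed
    moreover have "I \<inter> h ` J0 = {\<zero>\<^bsub>B\<^esub>}"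
    proof (intro equalityI subsetI)
      fix x assume "x \<in> I \<inter> h ` J0"
      then obtain j where j: "j \<in> J0" "x = h j" "h j \<in> I" by blast
      then have "j \<in> I0 \<inter> J0" using J0'(1) by (auto simp: I0_def)
      then show "x \<in> {\<zero>\<^bsub>B\<^esub>}" using J0(2) j by auto
    next
      fix x assume "x \<in> {\<zero>\<^bsub>B\<^esub>}"
      then show "x \<in> I \<inter> h ` J0" using I'(2) left_idealD(2)[OF J] by simp
    qed
    moreover have "I <+>\<^bsub>B\<^esub> h ` J0 = carrier B"
    proof (intro equalityI subsetI)
      fix x assume "x \<in> I <+>\<^bsub>B\<^esub> h ` J0"
      then show "x \<in> carrier B" using I'(1) left_idealD(1)[OF J] by (auto simp: set_add_iff)
    next
      fix x assume "x \<in> carrier B"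
      then obtain y where y: "y \<in> carrier A" "x = h y" using surj by blast
      then obtain i j where ij: "i \<in> I0" "j \<in> J0" "y = i \<oplus>\<^bsub>A\<^esub> j"
        using J0(3) by (metis set_add_iff)
      then have "x = h i \<oplus>\<^bsub>B\<^esub> h j" "h i \<in> I"
        using y(2) J0'(1) by (auto simp: I0_def subset_iff)
      then show "x \<in> I <+>\<^bsub>B\<^esub> h ` J0" using ij by (auto simp: set_add_iff)
    qed
    ultimately show ?thesis by blast
  qed
  then show ?thesis using B unfolding semisimple_ring_def by blast
qed

context ring
begin

lemma corner_carrier_iff:
  assumes "idempotent R e"
  shows "x \<in> carrier (corner_ring R e) \<longleftrightarrow> x \<in> carrier R \<and> e \<otimes> x = x \<and> x \<otimes> e = x"
proof
  assume "x \<in> carrier (corner_ring R e)"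
  then obtain a where a: "a \<in> carrier R" "x = e \<otimes> a \<otimes> e" by (auto simp: corner_ring_def)
  have e: "e \<in> carrier R" "e \<otimes> e = e" using assms by (auto simp: idempotent_def)
  have "e \<otimes> x = (e \<otimes> e) \<otimes> a \<otimes> e" "x \<otimes> e = e \<otimes> a \<otimes> (e \<otimes> e)"
    using a(1) e(1) unfolding a(2) by (simp_all only: m_assoc m_closed)
  then show "x \<in> carrier R \<and> e \<otimes> x = x \<and> x \<otimes> e = x" using a e by simp
next
  assume x: "x \<in> carrier R \<and> e \<otimes> x = x \<and> x \<otimes> e = x"
  then have "x = e \<otimes> x \<otimes> e" by simp
  then show "x \<in> carrier (corner_ring R e)" using x by (simp add: corner_ring_def) metis
qed

lemma corner_memI: "a \<in> carrier R \<Longrightarrow> e \<otimes> a \<otimes> e \<in> carrier (corner_ring R e)"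
  unfolding corner_ring_def by auto

lemma corner_ring_simps [simp]:
  "\<zero>\<^bsub>corner_ring R e\<^esub> = \<zero>" "\<one>\<^bsub>corner_ring R e\<^esub> = e"
  "x \<oplus>\<^bsub>corner_ring R e\<^esub> y = x \<oplus> y" "x \<otimes>\<^bsub>corner_ring R e\<^esub> y = x \<otimes> y"
  by (auto simp: corner_ring_def)

lemma corner_ring_ring:
  assumes e: "idempotent R e"
  shows "ring (corner_ring R e)"
proof -
  have e': "e \<in> carrier R" "e \<otimes> e = e" using e by (auto simp: idempotent_def)
  note iff = corner_carrier_iff[OF e]
  show ?thesis
  proof (rule ringI)
    show "abelian_group (corner_ring R e)"
    proof (rule abelian_groupI)
      fix x assume x: "x \<in> carrier (corner_ring R e)"
      then have "\<ominus> x \<in> carrier (corner_ring R e)"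
        using e' by (simp add: iff r_minus l_minus)
      then show "\<exists>y\<in>carrier (corner_ring R e). y \<oplus>\<^bsub>corner_ring R e\<^esub> x = \<zero>\<^bsub>corner_ring R e\<^esub>"
        using x by (intro bexI[of _ "\<ominus> x"]) (simp_all add: iff l_neg)
    qed (use e' in \<open>auto simp: iff r_distr l_distr a_assoc intro: a_comm\<close>)
    show "Group.monoid (corner_ring R e)"
      by (rule monoidI) (use e' in \<open>auto simp: iff m_assoc\<close>, metis m_assoc)
  qed (auto simp: iff l_distr r_distr)
qed

lemma sandwich_memI:
  assumes "a \<in> carrier R" "b \<in> carrier R" shows "a \<otimes> e \<otimes> b \<in> sandwich R e"
  unfolding sandwich_def by (rule generate.incl) (use assms in auto)

text \<open>Orthogonality is assumed in the strong form
  \<open>e \<otimes> r \<otimes> f = \<zero>\<close> for all \<open>r\<close>. Then the corner at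
  \<open>E\<close> is the product of the corners at the members of \<open>F\<close>, and a
  complement can be chosen in each of them separately.\<close>

lemma semisimple_corner_sum:
  assumes fin: "finite F" and idem: "\<And>e. e \<in> F \<Longrightarrow> idempotent R e"
    and orth: "\<And>e f r. e \<in> F \<Longrightarrow> f \<in> F \<Longrightarrow> e \<noteq> f \<Longrightarrow> r \<in> carrier R \<Longrightarrow> e \<otimes> r \<otimes> f = \<zero>"
    and ss: "\<And>e. e \<in> F \<Longrightarrow> semisimple_ring (corner_ring R e)"
  defines "E \<equiv> (\<Oplus>e\<in>F. e)"
  shows "idempotent R E" "semisimple_ring (corner_ring R E)"
    "\<And>e. e \<in> F \<Longrightarrow> E \<otimes> e = e \<and> e \<otimes> E = e"
proof -
  have F: "e \<in> carrier R" "e \<otimes> e = e" if "e \<in> F" for e using idem that by (auto simp: idempotent_def)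
  have orth': "e \<otimes> f = \<zero>" if "e \<in> F" "f \<in> F" "e \<noteq> f" for e f
    using orth[OF that, of \<one>] F that by simp
  have E: "E \<in> carrier R" unfolding E_def using F by (auto intro!: finsum_closed)
  have Fs: "(\<lambda>e. e) \<in> F \<rightarrow> carrier R" using F by auto
  have Ee: "E \<otimes> e = e" if e: "e \<in> F" for e
  proof -
    have "E \<otimes> e = (\<Oplus>f\<in>F. f \<otimes> e)" unfolding E_def by (rule finsum_ldistr) (use fin F e in auto)
    also have "\<dots> = (\<Oplus>f\<in>F. if e = f then e else \<zero>)"
      by (rule finsum_cong') (use F e orth' in auto)
    also have "\<dots> = e" using finsum_singleton[OF e fin, of "\<lambda>_. e"] F e by simp
    finally show ?thesis .
  qed
  have eE: "e \<otimes> E = e" if e: "e \<in> F" for e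
  proof -
    have "e \<otimes> E = (\<Oplus>f\<in>F. e \<otimes> f)" unfolding E_def by (rule finsum_rdistr) (use fin F e in auto)
    also have "\<dots> = (\<Oplus>f\<in>F. if e = f then e else \<zero>)"
      by (rule finsum_cong') (use F e orth' in auto)
    also have "\<dots> = e" using finsum_singleton[OF e fin, of "\<lambda>_. e"] F e by simp
    finally show ?thesis .
  qed
  show "\<And>e. e \<in> F \<Longrightarrow> E \<otimes> e = e \<and> e \<otimes> E = e" using Ee eE by simp
  have sumE: "(\<Oplus>e\<in>F. e \<otimes> x) = E \<otimes> x" if "x \<in> carrier R" for x
    unfolding E_def using finsum_ldistr[OF fin that Fs] by simp
  have "E \<otimes> E = (\<Oplus>e\<in>F. e \<otimes> E)" using sumE[OF E] by simp
  also have "\<dots> = (\<Oplus>e\<in>F. e)" by (rule finsum_cong') (use F eE in auto)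
  finally have EE: "E \<otimes> E = E" by (simp add: E_def)
  show idE: "idempotent R E" using E EE by (simp add: idempotent_def)
  note iffE = corner_carrier_iff[OF idE]
  let ?S = "corner_ring R E"
  interpret S: ring ?S by (rule corner_ring_ring[OF idE])
  have FE: "e \<in> carrier ?S" if "e \<in> F" for e using F Ee eE that by (simp add: iffE)
  \<comment> \<open>Writing \<open>e \<otimes> x\<close> as \<open>e \<otimes> x \<otimes> E\<close>
    and expanding \<open>E\<close>, strong orthogonality removes all terms but one: left
    multiplication by \<open>e\<close> already lands in the corner at \<open>e\<close>.\<close>
  have mid: "e \<otimes> x = e \<otimes> x \<otimes> e" if e: "e \<in> F" and x: "x \<in> carrier ?S" for e x
  proof -
    have x': "x \<in> carrier R" "x \<otimes> E = x" using x by (auto simp: iffE)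
    have "e \<otimes> x = (e \<otimes> x) \<otimes> E" using x' F[OF e] E by (simp add: m_assoc)
    also have "\<dots> = (\<Oplus>f\<in>F. (e \<otimes> x) \<otimes> f)" unfolding E_def
      by (rule finsum_rdistr) (use fin F e x' in auto)
    also have "\<dots> = (\<Oplus>f\<in>F. if e = f then e \<otimes> x \<otimes> e else \<zero>)"
      by (rule finsum_cong') (use F e orth x' in auto)
    also have "\<dots> = e \<otimes> x \<otimes> e"
      using finsum_singleton[OF e fin, of "\<lambda>_. e \<otimes> x \<otimes> e"] F e x' by simp
    finally show ?thesis .
  qed
  have "\<exists>J. left_ideal J ?S \<and> I \<inter> J = {\<zero>\<^bsub>?S\<^esub>} \<and> I <+>\<^bsub>?S\<^esub> J = carrier ?S"
    if I: "left_ideal I ?S" for I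
  proof -
    note I' = left_idealD[OF I, simplified]
    define K where "K e = I \<inter> carrier (corner_ring R e)" for e
    have sub: "carrier (corner_ring R e) \<subseteq> carrier ?S" if "e \<in> F" for e
    proof
      fix x assume "x \<in> carrier (corner_ring R e)"
      then have x: "x \<in> carrier R" "e \<otimes> x = x" "x \<otimes> e = x"
        by (auto simp: corner_carrier_iff[OF idem[OF that]])
      have "E \<otimes> x = E \<otimes> (e \<otimes> x)" using x by simp
      also have "\<dots> = x" using x F[OF that] E Ee[OF that] m_assoc[of E e x] by simp
      finally have "E \<otimes> x = x" .
      moreover have "x \<otimes> E = (x \<otimes> e) \<otimes> E" using x by simp
      then have "x \<otimes> E = x" using x F[OF that] E eE[OF that] m_assoc[of x e E] by simp
      ultimately show "x \<in> carrier ?S" using x by (simp add: iffE)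
    qed
    have "\<exists>J. left_ideal J (corner_ring R e) \<and> K e \<inter> J = {\<zero>} \<and>
            K e <+>\<^bsub>corner_ring R e\<^esub> J = carrier (corner_ring R e)" if e: "e \<in> F" for e
    proof -
      interpret C: ring "corner_ring R e" by (rule corner_ring_ring[OF idem[OF e]])
      have "left_ideal (K e) (corner_ring R e)"
      proof (rule left_idealI[OF corner_ring_ring[OF idem[OF e]]])
        show "\<zero>\<^bsub>corner_ring R e\<^esub> \<in> K e" using I'(2) C.zero_closed by (simp add: K_def)
        show "x \<oplus>\<^bsub>corner_ring R e\<^esub> y \<in> K e" if "x \<in> K e" "y \<in> K e" for x y
          using that I'(3) C.a_closed[of x y] by (simp add: K_def)
        show "r \<otimes>\<^bsub>corner_ring R e\<^esub> x \<in> K e" if "r \<in> carrier (corner_ring R e)" "x \<in> K e" for r x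
          using that I'(4)[of r x] C.m_closed[of r x] sub[OF e] by (auto simp: K_def)
      qed (auto simp: K_def)
      then show ?thesis using ss[OF e] unfolding semisimple_ring_def by simp
    qed
    then obtain L where L: "\<And>e. e \<in> F \<Longrightarrow> left_ideal (L e) (corner_ring R e)"
      "\<And>e. e \<in> F \<Longrightarrow> K e \<inter> L e = {\<zero>}"
      "\<And>e. e \<in> F \<Longrightarrow> K e <+>\<^bsub>corner_ring R e\<^esub> L e = carrier (corner_ring R e)"
      by metis
    note L' = left_idealD[OF L(1), simplified]
    \<comment> \<open>The complement of \<open>I\<close> is assembled from the complements
      \<open>L e\<close>; the components of \<open>x\<close> are the \<open>e \<otimes> x\<close>,
      which add up to \<open>x\<close> inside the corner at \<open>E\<close>.\<close>
    define J where "J = {x \<in> carrier ?S. \<forall>e\<in>F. e \<otimes> x \<in> L e}"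
    have J: "left_ideal J ?S"
    proof (rule left_idealI[OF S.ring_axioms])
      show "\<zero>\<^bsub>?S\<^esub> \<in> J" using S.zero_closed L'(2) F by (simp add: J_def)
      show "x \<oplus>\<^bsub>?S\<^esub> y \<in> J" if xy: "x \<in> J" "y \<in> J" for x y
        using xy S.a_closed[of x y] L'(3) F by (auto simp: J_def iffE r_distr)
      show "r \<otimes>\<^bsub>?S\<^esub> x \<in> J" if rx: "r \<in> carrier ?S" "x \<in> J" for r x
      proof -
        have x: "x \<in> carrier ?S" using rx by (simp add: J_def)
        have "e \<otimes> (r \<otimes> x) \<in> L e" if e: "e \<in> F" for e
        proof -
          have "e \<otimes> (r \<otimes> x) = (e \<otimes> r) \<otimes> x"
            using rx(1) x F[OF e] by (simp add: iffE m_assoc)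
          also have "\<dots> = (e \<otimes> r \<otimes> e) \<otimes> x" using mid[OF e rx(1)] by simp
          also have "\<dots> = (e \<otimes> r \<otimes> e) \<otimes> (e \<otimes> x)"
          proof -
            have "(e \<otimes> r \<otimes> e) \<otimes> (e \<otimes> x) = (e \<otimes> r \<otimes> (e \<otimes> e)) \<otimes> x"
              using rx(1) x F(1)[OF e] by (simp only: iffE m_assoc m_closed)
            then show ?thesis using F(2)[OF e] by simp
          qed
          finally have eq: "e \<otimes> (r \<otimes> x) = (e \<otimes> r \<otimes> e) \<otimes> (e \<otimes> x)" .
          have "e \<otimes> r \<otimes> e \<in> carrier (corner_ring R e)"
            using rx(1) corner_memI by (simp add: iffE)
          then show ?thesis using eq L'(4)[OF e] rx(2) e by (auto simp: J_def)
        qed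
        then show ?thesis using S.m_closed[OF rx(1) x] by (simp add: J_def)
      qed
    qed (auto simp: J_def)
    note J' = left_idealD[OF J, simplified]
    have decomp: "x = (\<Oplus>e\<in>F. e \<otimes> x)" if "x \<in> carrier ?S" for x
      using that sumE[of x] by (simp add: iffE)
    have "I \<inter> J = {\<zero>}"
    proof (intro equalityI subsetI)
      fix x assume x: "x \<in> I \<inter> J"
      then have xS: "x \<in> carrier ?S" by (simp add: J_def)
      have "e \<otimes> x = \<zero>" if e: "e \<in> F" for e
      proof -
        have "e \<otimes> x \<in> I" using I'(4) FE[OF e] x by simp
        moreover have "e \<otimes> x \<in> L e" using x e by (simp add: J_def)
        moreover have "L e \<subseteq> carrier (corner_ring R e)" using L'(1)[OF e] .
        ultimately have "e \<otimes> x \<in> K e \<inter> L e" by (auto simp: K_def)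
        then show ?thesis using L(2)[OF e] by simp
      qed
      then have "(\<Oplus>e\<in>F. e \<otimes> x) = (\<Oplus>e\<in>F. \<zero>)" by (intro finsum_cong') auto
      then show "x \<in> {\<zero>}" using decomp[OF xS] by simp
    qed (use I'(2) J'(2) in auto)
    moreover have "I <+>\<^bsub>?S\<^esub> J = carrier ?S"
    proof (intro equalityI subsetI)
      fix x assume "x \<in> I <+>\<^bsub>?S\<^esub> J"
      then show "x \<in> carrier ?S" using I'(1) J'(1) S.a_closed by (auto simp: set_add_iff)
    next
      fix x assume x: "x \<in> carrier ?S"
      then have xR: "x \<in> carrier R" by (simp add: iffE)
      have "\<exists>i j. i \<in> K e \<and> j \<in> L e \<and> e \<otimes> x = i \<oplus> j" if e: "e \<in> F" for e
      proof -
        have "e \<otimes> x \<in> carrier (corner_ring R e)"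
          using mid[OF e x] corner_memI[OF xR, of e] by simp
        then show ?thesis using L(3)[OF e] by (metis set_add_iff corner_ring_simps(3))
      qed
      then obtain i j where ij: "\<And>e. e \<in> F \<Longrightarrow> i e \<in> K e" "\<And>e. e \<in> F \<Longrightarrow> j e \<in> L e"
        "\<And>e. e \<in> F \<Longrightarrow> e \<otimes> x = i e \<oplus> j e" by metis
      have iC: "i e \<in> carrier R" "i e \<in> I" if "e \<in> F" for e
        using ij(1)[OF that] sub[OF that] by (auto simp: K_def iffE)
      have jC: "j e \<in> carrier R" "e \<otimes> j e = j e" "j e \<in> carrier ?S" if "e \<in> F" for e
        using ij(2)[OF that] sub[OF that] L'(1)[OF that]
        by (auto simp: iffE corner_carrier_iff[OF idem[OF that]])
      have closed: "(\<Oplus>e\<in>G. y e) \<in> Z" if "finite G" "G \<subseteq> F" "\<zero> \<in> Z" "Z \<subseteq> carrier R"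
        "\<And>e. e \<in> F \<Longrightarrow> y e \<in> Z" "\<And>u v. u \<in> Z \<Longrightarrow> v \<in> Z \<Longrightarrow> u \<oplus> v \<in> Z" for G y Z
        using that(1,2)
      proof (induction G)
        case (insert e G)
        have "(\<Oplus>e\<in>insert e G. y e) = y e \<oplus> (\<Oplus>e\<in>G. y e)"
          using insert that(4,5) by (intro finsum_insert) blast+
        then show ?case using insert that(5,6) by simp
      qed (use that(3) in simp)
      have SR: "carrier ?S \<subseteq> carrier R" by (auto simp: iffE)
      have iI: "(\<Oplus>e\<in>F. i e) \<in> I"
        by (rule closed) (use fin iC I' SR in auto)
      have jS: "(\<Oplus>e\<in>F. j e) \<in> carrier ?S"
        by (rule closed) (use fin jC SR S.zero_closed S.a_closed in auto)
      have "e \<otimes> (\<Oplus>f\<in>F. j f) = j e" if e: "e \<in> F" for e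
      proof -
        have "e \<otimes> (\<Oplus>f\<in>F. j f) = (\<Oplus>f\<in>F. e \<otimes> j f)"
          by (rule finsum_rdistr) (use fin F e jC in auto)
        also have "\<dots> = (\<Oplus>f\<in>F. if e = f then j f else \<zero>)"
        proof (rule finsum_cong')
          fix f assume f: "f \<in> F"
          have "e \<otimes> j f = e \<otimes> f \<otimes> j f" using F e f jC[OF f] by (simp add: m_assoc)
          then show "e \<otimes> j f = (if e = f then j f else \<zero>)"
            using orth'[OF e f] F e f jC[OF f] by auto
        qed (use jC in auto)
        also have "\<dots> = j e"
          using finsum_singleton[OF e fin, of j] jC by auto
        finally show ?thesis .
      qed
      then have jJ: "(\<Oplus>e\<in>F. j e) \<in> J" using jS ij(2) by (simp add: J_def)
      have "x = (\<Oplus>e\<in>F. i e \<oplus> j e)"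
      proof -
        have "(\<Oplus>e\<in>F. e \<otimes> x) = (\<Oplus>e\<in>F. i e \<oplus> j e)"
          by (rule finsum_cong') (use ij(3) iC jC in auto)
        then show ?thesis using decomp[OF x] by simp
      qed
      also have "\<dots> = (\<Oplus>e\<in>F. i e) \<oplus> (\<Oplus>e\<in>F. j e)"
        by (rule finsum_addf) (use iC jC in auto)
      finally show "x \<in> I <+>\<^bsub>?S\<^esub> J" using iI jJ unfolding set_add_iff corner_ring_simps by blast
    qed
    ultimately show ?thesis using J by auto
  qed
  then show "semisimple_ring ?S" using S.ring_axioms unfolding semisimple_ring_def by blast
qed

end

section \<open>Bijectivity of multiplication on the tensor product of \<open>Re\<close> and
  \<open>eR\<close> over \<open>eRe\<close>\<close>

section \<open>The multiplication map on a tensor product over a corner\<close>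

text \<open>The universal property of the free abelian group, in the explicit form that
  \<open>tensor_mult\<close> uses. The product over \<open>Poly_Mapping.keys\<close> ranges over a
  set depending on the argument, and cancellation can make the support of \<open>c + d\<close>
  smaller than the union of the supports; all products are therefore first extended to that
  union.\<close>

lemma (in comm_group) free_Abelian_group_extend_hom:
  fixes g :: "'i \<Rightarrow> 'a"
  assumes g: "g \<in> S \<rightarrow> carrier G"
  shows "(\<lambda>c. \<Otimes>p\<in>Poly_Mapping.keys c. g p [^] Poly_Mapping.lookup c p) \<in> hom (free_Abelian_group S) G"
proof (rule homI)
  have ext: "(\<Otimes>p\<in>Poly_Mapping.keys c. g p [^] Poly_Mapping.lookup c p) =
      (\<Otimes>p\<in>K. g p [^] Poly_Mapping.lookup c p)"
    if "Poly_Mapping.keys c \<subseteq> K" "K \<subseteq> S" "finite K" for c :: "'i \<Rightarrow>\<^sub>0 int" and K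
    by (rule finprod_mono_neutral_cong_left)
       (use that g in \<open>auto simp: in_keys_iff Pi_iff subset_iff\<close>)
  fix c d
  assume c: "c \<in> carrier (free_Abelian_group S)" and d: "d \<in> carrier (free_Abelian_group S)"
  let ?K = "Poly_Mapping.keys c \<union> Poly_Mapping.keys d"
  have K: "?K \<subseteq> S" "finite ?K" using c d by auto
  have "(\<Otimes>p\<in>?K. g p [^] Poly_Mapping.lookup (c + d) p) =
     (\<Otimes>p\<in>?K. g p [^] Poly_Mapping.lookup c p \<otimes> g p [^] Poly_Mapping.lookup d p)"
    by (rule finprod_cong') (use K g in \<open>auto simp: lookup_add int_pow_mult Pi_iff subset_iff\<close>)
  also have "\<dots> = (\<Otimes>p\<in>?K. g p [^] Poly_Mapping.lookup c p) \<otimes> (\<Otimes>p\<in>?K. g p [^] Poly_Mapping.lookup d p)"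
    by (rule finprod_multf) (use K g in \<open>auto simp: Pi_iff subset_iff\<close>)
  finally show "(\<Otimes>p\<in>Poly_Mapping.keys (c \<otimes>\<^bsub>free_Abelian_group S\<^esub> d).
        g p [^] Poly_Mapping.lookup (c \<otimes>\<^bsub>free_Abelian_group S\<^esub> d) p) =
      (\<Otimes>p\<in>Poly_Mapping.keys c. g p [^] Poly_Mapping.lookup c p) \<otimes>
      (\<Otimes>p\<in>Poly_Mapping.keys d. g p [^] Poly_Mapping.lookup d p)"
    using ext[of c ?K] ext[of d ?K] ext[of "c + d" ?K] K keys_add[of c d] by simp
next
  fix c assume "c \<in> carrier (free_Abelian_group S)"
  then show "(\<Otimes>p\<in>Poly_Mapping.keys c. g p [^] Poly_Mapping.lookup c p) \<in> carrier G"
    using g by (intro finprod_closed) (auto simp: Pi_iff subset_iff)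
qed

context ring
begin

text \<open>The elements \<open>x t\<close> form a generating system of \<open>R e\<close> over \<open>e R e\<close>, and the relations among
  them with coefficients in \<open>e R\<close> are only the obvious ones, \<open>x t w = x t c w\<close>.\<close>

lemma tensor_mult_bij:
  fixes x c :: "'t \<Rightarrow> 'a"
  assumes e: "idempotent R e" and T: "finite T"
    and xM: "\<And>t. t \<in> T \<Longrightarrow> x t \<in> left_mults R e"
    and cB: "\<And>t. t \<in> T \<Longrightarrow> c t \<in> carrier (corner_ring R e)"
    and xc: "\<And>t. t \<in> T \<Longrightarrow> x t \<otimes> c t = x t"
    and span: "\<And>z. z \<in> left_mults R e \<Longrightarrow>
        \<exists>b. (\<forall>t\<in>T. b t \<in> carrier (corner_ring R e)) \<and> z = (\<Oplus>t\<in>T. x t \<otimes> b t)"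
    and indep: "\<And>w t. (\<And>s. s \<in> T \<Longrightarrow> w s \<in> right_mults R e) \<Longrightarrow>
        (\<Oplus>s\<in>T. x s \<otimes> w s) = \<zero> \<Longrightarrow> t \<in> T \<Longrightarrow> c t \<otimes> w t = \<zero>"
  shows "bij_betw (tensor_mult R)
          (carrier (tensor_product R (carrier (corner_ring R e)) (left_mults R e) (right_mults R e)))
          (sandwich R e)"
proof -
  define M N B where "M = left_mults R e" and "N = right_mults R e" and "B = carrier (corner_ring R e)"
  have e': "e \<in> carrier R" "e \<otimes> e = e" using e by (auto simp: idempotent_def)
  have M_iff: "z \<in> M \<longleftrightarrow> z \<in> carrier R \<and> z \<otimes> e = z" for z
  proof -
    have "a \<otimes> e \<otimes> e = a \<otimes> e" if "a \<in> carrier R" for a using that e' by (simp add: m_assoc)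
    then show ?thesis unfolding M_def left_mults_def using e' by force
  qed
  have N_iff: "z \<in> N \<longleftrightarrow> z \<in> carrier R \<and> e \<otimes> z = z" for z
  proof -
    have "e \<otimes> (e \<otimes> a) = e \<otimes> a" if "a \<in> carrier R" for a using that e' by (simp add: m_assoc[symmetric])
    then show ?thesis unfolding N_def right_mults_def using e' by force
  qed
  have B_iff: "z \<in> B \<longleftrightarrow> z \<in> carrier R \<and> e \<otimes> z = z \<and> z \<otimes> e = z" for z
    unfolding B_def using corner_carrier_iff[OF e] .
  have Madd: "a \<oplus> b \<in> M" if "a \<in> M" "b \<in> M" for a b using that e' by (simp add: M_iff l_distr)
  have MB: "a \<otimes> b \<in> M" if "a \<in> M" "b \<in> B" for a b using that e' by (simp add: M_iff B_iff m_assoc)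
  have BN: "b \<otimes> a \<in> N" if "a \<in> N" "b \<in> B" for a b
    using that e' by (simp add: N_iff B_iff m_assoc[symmetric])
  have Nadd: "a \<oplus> b \<in> N" if "a \<in> N" "b \<in> N" for a b using that e' by (simp add: N_iff r_distr)
  have Nminus: "a \<ominus> b \<in> N" if "a \<in> N" "b \<in> N" for a b
    using that e' by (simp add: N_iff r_distr r_minus minus_eq)
  have zM: "\<zero> \<in> M" and zN: "\<zero> \<in> N" using e' by (auto simp: M_iff N_iff)
  define F where "F = free_Abelian_group (M \<times> N)"
  define S where "S = {frag_of (a \<oplus> a', y) - frag_of (a, y) - frag_of (a', y) | a a' y. a \<in> M \<and> a' \<in> M \<and> y \<in> N}
    \<union> {frag_of (a, y \<oplus> y') - frag_of (a, y) - frag_of (a, y') | a y y'. a \<in> M \<and> y \<in> N \<and> y' \<in> N}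
    \<union> {frag_of (a \<otimes> b, y) - frag_of (a, b \<otimes> y) | a b y. a \<in> M \<and> b \<in> B \<and> y \<in> N}"
  define H where "H = generate F S"
  have H_eq: "tensor_relations R B M N = H"
    unfolding tensor_relations_def H_def S_def F_def ..
  interpret F: comm_group F unfolding F_def by (rule abelian_free_Abelian_group)
  have F_simps: "\<one>\<^bsub>F\<^esub> = 0" "\<And>a b. a \<otimes>\<^bsub>F\<^esub> b = a + b"
    "\<And>a. a \<in> carrier F \<longleftrightarrow> Poly_Mapping.keys a \<subseteq> M \<times> N"
    "\<And>a. a \<in> carrier F \<Longrightarrow> inv\<^bsub>F\<^esub> a = - a"
    by (simp_all add: F_def)
  have fragF: "frag_of p \<in> carrier F \<longleftrightarrow> p \<in> M \<times> N" for p by (simp add: F_def)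
  have Fminus: "a - b \<in> carrier F" if "a \<in> carrier F" "b \<in> carrier F" for a b
    using F.m_closed[OF that(1) F.inv_closed[OF that(2)]] that by (simp add: F_simps(2,4))
  have SF: "S \<subseteq> carrier F"
    unfolding S_def by (auto intro!: Fminus simp: fragF Madd Nadd MB BN)
  have Hsub: "subgroup H F" unfolding H_def by (rule F.generate_is_subgroup[OF SF])
  have HF: "H \<subseteq> carrier F" using subgroup.subset[OF Hsub] .
  have H0: "0 \<in> H" using subgroup.one_closed[OF Hsub] by (simp add: F_simps)
  have Hadd: "a + b \<in> H" if "a \<in> H" "b \<in> H" for a b
    using subgroup.m_closed[OF Hsub that] by (simp add: F_simps)
  have Hneg: "- a \<in> H" if "a \<in> H" for a
    using subgroup.m_inv_closed[OF Hsub that] HF that by (simp add: F_simps subset_iff)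
  have Hdiff: "a - b \<in> H" if "a \<in> H" "b \<in> H" for a b
    using Hadd[OF that(1) Hneg[OF that(2)]] by simp
  have SH: "a \<in> H" if "a \<in> S" for a using that unfolding H_def by (rule generate.incl)
  have rel1: "frag_of (a \<oplus> a', y) - (frag_of (a, y) + frag_of (a', y)) \<in> H"
    if "a \<in> M" "a' \<in> M" "y \<in> N" for a a' y
  proof -
    have "frag_of (a \<oplus> a', y) - frag_of (a, y) - frag_of (a', y) \<in> H"
      by (rule SH) (use that in \<open>unfold S_def, blast\<close>)
    then show ?thesis by (simp add: algebra_simps)
  qed
  have rel2: "frag_of (a, y \<oplus> y') - (frag_of (a, y) + frag_of (a, y')) \<in> H"
    if "a \<in> M" "y \<in> N" "y' \<in> N" for a y y'
  proof -
    have "frag_of (a, y \<oplus> y') - frag_of (a, y) - frag_of (a, y') \<in> H"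
      by (rule SH) (use that in \<open>unfold S_def, blast\<close>)
    then show ?thesis by (simp add: algebra_simps)
  qed
  have rel3: "frag_of (a \<otimes> b, y) - frag_of (a, b \<otimes> y) \<in> H"
    if "a \<in> M" "b \<in> B" "y \<in> N" for a b y
    by (rule SH) (use that in \<open>unfold S_def, blast\<close>)
  have rel_zero_r: "frag_of (a, \<zero>) \<in> H" if "a \<in> M" for a
    using Hneg[OF rel2[OF that zN zN]] by simp
  have rel_zero_l: "frag_of (\<zero>, y) \<in> H" if "y \<in> N" for y
    using Hneg[OF rel1[OF zM zM that]] by simp
  \<comment> \<open>The relations speak of sums only, whereas the induction over the free abelian
    group below proceeds by differences.\<close>
  have rel_minus: "frag_of (a, y \<ominus> y') - (frag_of (a, y) - frag_of (a, y')) \<in> H"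
    if "a \<in> M" "y \<in> N" "y' \<in> N" for a y y'
  proof -
    have "(y \<ominus> y') \<oplus> y' = y" using that by (simp add: N_iff minus_eq a_assoc l_neg)
    then have "frag_of (a, y) - (frag_of (a, y \<ominus> y') + frag_of (a, y')) \<in> H"
      using rel2[OF that(1) Nminus[OF that(2,3)] that(3)] by simp
    from Hneg[OF this] show ?thesis by (simp add: algebra_simps)
  qed
  have rel_sum: "frag_of (\<Oplus>t\<in>G. a t, y) - (\<Sum>t\<in>G. frag_of (a t, y)) \<in> H"
    if "finite G" "\<And>t. t \<in> G \<Longrightarrow> a t \<in> M" "y \<in> N" for G and a :: "'t \<Rightarrow> 'a" and y
    using that(1,2)
  proof (induction G)
    case empty
    then show ?case using rel_zero_l[OF that(3)] by simp
  next
    case (insert t G)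
    have M': "(\<Oplus>t\<in>G. a t) \<in> M"
      using insert(1,4)
    proof (induction G)
      case (insert s G')
      have "(\<Oplus>t\<in>insert s G'. a t) = a s \<oplus> (\<Oplus>t\<in>G'. a t)"
        using insert by (intro finsum_insert) (auto simp: M_iff)
      then show ?case using insert Madd by auto
    qed (use zM in simp)
    have "(\<Oplus>t\<in>insert t G. a t) = a t \<oplus> (\<Oplus>t\<in>G. a t)"
      using insert by (intro finsum_insert) (auto simp: M_iff)
    then have "frag_of (\<Oplus>t\<in>insert t G. a t, y) - (frag_of (a t, y) + frag_of (\<Oplus>t\<in>G. a t, y)) \<in> H"
      using rel1[OF _ M' that(3), of "a t"] insert by simp
    from Hadd[OF this insert.IH] insert show ?case by (simp add: algebra_simps)
  qed
  have sumH: "(\<Sum>t\<in>G. h t) \<in> H" if "\<And>t. t \<in> G \<Longrightarrow> h t \<in> H" for G and h :: "'t \<Rightarrow> _"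
    using that by (induction G rule: infinite_finite_induct) (auto simp: H0 Hadd)
  have xM': "x t \<in> M" if "t \<in> T" for t using xM that by (simp add: M_def)

  \<comment> \<open>Normal form modulo the relations: a sum of \<open>x t\<close> tensored with
    \<open>w t\<close>. A generator \<open>(z, y)\<close> is reduced by expanding \<open>z\<close>
    over the \<open>x t\<close> and moving the coefficients across to \<open>y\<close>.\<close>
  have normal: "\<exists>w. (\<forall>t\<in>T. w t \<in> N) \<and> d - (\<Sum>t\<in>T. frag_of (x t, w t)) \<in> H" if d: "d \<in> carrier F" for d
  proof -
    have "Poly_Mapping.keys d \<subseteq> M \<times> N" using d by (simp add: F_simps)
    then show ?thesis
    proof (induct d rule: free_Abelian_group_induct[consumes 1, case_names zero diff gen])
      case zero
      have "(\<Sum>t\<in>T. frag_of (x t, \<zero>)) \<in> H" by (rule sumH) (use rel_zero_r xM' in auto)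
      then show ?case using zN Hneg by (intro exI[of _ "\<lambda>_. \<zero>"]) auto
    next
      case (diff d d')
      then obtain w w' where w: "\<forall>t\<in>T. w t \<in> N" "d - (\<Sum>t\<in>T. frag_of (x t, w t)) \<in> H"
        and w': "\<forall>t\<in>T. w' t \<in> N" "d' - (\<Sum>t\<in>T. frag_of (x t, w' t)) \<in> H" by blast
      have "(\<Sum>t\<in>T. frag_of (x t, w t \<ominus> w' t) - (frag_of (x t, w t) - frag_of (x t, w' t))) \<in> H"
        by (rule sumH) (use rel_minus xM' w w' in auto)
      from Hdiff[OF Hdiff[OF w(2) w'(2)] this]
      have "d - d' - (\<Sum>t\<in>T. frag_of (x t, w t \<ominus> w' t)) \<in> H"
        by (simp add: sum_subtractf sum.distrib algebra_simps)
      then show ?case using w w' Nminus by (intro exI[of _ "\<lambda>t. w t \<ominus> w' t"]) auto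
    next
      case (gen p)
      obtain z y where p: "p = (z, y)" "z \<in> M" "y \<in> N" using gen by auto
      obtain b where b: "\<forall>t\<in>T. b t \<in> B" "z = (\<Oplus>t\<in>T. x t \<otimes> b t)"
        using span p(2) unfolding M_def B_def by blast
      have "frag_of (z, y) - (\<Sum>t\<in>T. frag_of (x t \<otimes> b t, y)) \<in> H"
        unfolding b(2) by (rule rel_sum) (use T b p xM' MB in auto)
      moreover have "(\<Sum>t\<in>T. frag_of (x t \<otimes> b t, y) - frag_of (x t, b t \<otimes> y)) \<in> H"
        by (rule sumH) (use rel3 xM' b p in auto)
      ultimately have "frag_of (z, y) - (\<Sum>t\<in>T. frag_of (x t, b t \<otimes> y)) \<in> H"
        using Hadd by (fastforce simp: sum_subtractf algebra_simps)
      then show ?case using p b BN by (intro exI[of _ "\<lambda>t. b t \<otimes> y"]) auto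
    qed
  qed

  \<comment> \<open>Evaluation on representatives; \<open>tensor_mult\<close> is the map that it
    induces on cosets once it is known to vanish on \<open>H\<close>.\<close>
  define ev where "ev d = (\<Oplus>p\<in>Poly_Mapping.keys d. [Poly_Mapping.lookup d p] \<cdot> (fst p \<otimes> snd p))"
    for d :: "'a \<times> 'a \<Rightarrow>\<^sub>0 int"
  have ev_eq: "ev = (\<lambda>d. finprod (add_monoid R) (\<lambda>p. (fst p \<otimes> snd p) [^]\<^bsub>add_monoid R\<^esub> Poly_Mapping.lookup d p)
      (Poly_Mapping.keys d))"
    unfolding ev_def finsum_def add_pow_def by simp
  have ev_hom: "ev \<in> hom F (add_monoid R)"
    unfolding ev_eq F_def
    using comm_group.free_Abelian_group_extend_hom[OF a_comm_group, of "\<lambda>p. fst p \<otimes> snd p" "M \<times> N"]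
    by (simp add: M_iff N_iff Pi_iff)
  interpret ev: group_hom F "add_monoid R" ev
    by (rule group_hom.intro) (auto simp: ev_hom group_hom_axioms_def a_group F.is_group)
  have ev_closed: "ev d \<in> carrier R" if "d \<in> carrier F" for d using ev.hom_closed[OF that] by simp
  have ev_add: "ev (d + d') = ev d \<oplus> ev d'" if "d \<in> carrier F" "d' \<in> carrier F" for d d'
    using ev.hom_mult[OF that] by (simp add: F_simps)
  have ev_zero: "ev 0 = \<zero>" using ev.hom_one by (simp add: F_simps)
  have ev_minus: "ev (d - d') = ev d \<ominus> ev d'" if "d \<in> carrier F" "d' \<in> carrier F" for d d'
    using ev_add[OF that(1) F.inv_closed[OF that(2)]] ev.hom_inv[OF that(2)] that
    by (simp add: F_simps(4) minus_eq a_inv_def)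
  have ev_frag: "ev (frag_of (a, b)) = a \<otimes> b" if "a \<in> M" "b \<in> N" for a b
    using that by (simp add: ev_def keys_frag_of M_iff N_iff add.finprod_insert add.int_pow_1 del: One_nat_def)
  have ev_sum: "ev (\<Sum>t\<in>G. frag_of (x t, w t)) = (\<Oplus>t\<in>G. x t \<otimes> w t) \<and> (\<Sum>t\<in>G. frag_of (x t, w t)) \<in> carrier F"
    if "finite G" "G \<subseteq> T" "\<And>t. t \<in> T \<Longrightarrow> w t \<in> N" for G w
    using that(1,2)
  proof (induction G)
    case empty
    then show ?case using F.one_closed by (simp add: ev_zero F_simps)
  next
    case (insert t G)
    have f: "frag_of (x t, w t) \<in> carrier F" using insert that xM' by (simp add: fragF)
    have "(\<Oplus>t\<in>insert t G. x t \<otimes> w t) = x t \<otimes> w t \<oplus> (\<Oplus>t\<in>G. x t \<otimes> w t)"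
      using insert that xM' by (intro finsum_insert) (auto simp: M_iff N_iff)
    then show ?case
      using insert f that xM' ev_add[OF f] F.m_closed[OF f] by (simp add: ev_frag F_simps(2))
  qed
  have MNc: "M \<subseteq> carrier R" "N \<subseteq> carrier R" "a \<in> M \<Longrightarrow> a \<in> carrier R" "a \<in> N \<Longrightarrow> a \<in> carrier R" for a
    by (auto simp: M_iff N_iff)
  have ev_S: "ev s = \<zero>" if s: "s \<in> S" for s
  proof -
    consider a a' y where "s = frag_of (a \<oplus> a', y) - frag_of (a, y) - frag_of (a', y)" "a \<in> M" "a' \<in> M" "y \<in> N"
      | a y y' where "s = frag_of (a, y \<oplus> y') - frag_of (a, y) - frag_of (a, y')" "a \<in> M" "y \<in> N" "y' \<in> N"
      | a b y where "s = frag_of (a \<otimes> b, y) - frag_of (a, b \<otimes> y)" "a \<in> M" "b \<in> B" "y \<in> N"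
      using s unfolding S_def by blast
    then show ?thesis
    proof cases
      case 1
      then have "ev s = (a \<otimes> y \<oplus> a' \<otimes> y) \<ominus> a \<otimes> y \<ominus> a' \<otimes> y"
        using MNc by (simp add: ev_minus Fminus fragF Madd ev_frag l_distr)
      also have "\<dots> = \<zero>" using 1 by (simp add: M_iff N_iff) algebra
      finally show ?thesis .
    next
      case 2
      then have "ev s = (a \<otimes> y \<oplus> a \<otimes> y') \<ominus> a \<otimes> y \<ominus> a \<otimes> y'"
        using MNc by (simp add: ev_minus Fminus fragF Nadd ev_frag r_distr)
      also have "\<dots> = \<zero>" using 2 by (simp add: M_iff N_iff) algebra
      finally show ?thesis .
    next
      case 3
      then have "ev s = a \<otimes> b \<otimes> y \<ominus> a \<otimes> (b \<otimes> y)"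
        by (simp add: ev_minus fragF MB BN ev_frag)
      then show ?thesis using 3 by (simp add: m_assoc M_iff N_iff B_iff minus_eq r_neg)
    qed
  qed
  have ev_H: "ev d = \<zero>" if "d \<in> H" for d
    using that unfolding H_def
  proof (induction rule: generate.induct)
    case (inv h)
    then show ?case using ev_S ev.hom_inv[of h] SF by (auto simp: a_inv_def[symmetric])
  next
    case (eng h1 h2)
    then have "h1 \<in> carrier F" "h2 \<in> carrier F" using HF by (auto simp: H_def)
    then show ?case using eng ev_add by (simp add: F_simps)
  qed (auto simp: ev_S ev_zero F_simps)
  \<comment> \<open>If the normal form evaluates to zero, \<open>indep\<close> gives
    \<open>c t \<otimes> w t = \<zero>\<close>. Since \<open>x t \<otimes> c t = x t\<close>, the
    generator \<open>(x t, w t)\<close> is congruent to \<open>(x t, \<zero>)\<close>, hence to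
    zero.\<close>
  have ker: "d \<in> H" if d: "d \<in> carrier F" "ev d = \<zero>" for d
  proof -
    obtain w where w: "\<forall>t\<in>T. w t \<in> N" "d - (\<Sum>t\<in>T. frag_of (x t, w t)) \<in> H"
      using normal[OF d(1)] by blast
    have s: "ev (\<Sum>t\<in>T. frag_of (x t, w t)) = (\<Oplus>t\<in>T. x t \<otimes> w t)"
      "(\<Sum>t\<in>T. frag_of (x t, w t)) \<in> carrier F"
      using ev_sum[OF T, of w] w by auto
    have sc: "(\<Oplus>t\<in>T. x t \<otimes> w t) \<in> carrier R" using s ev_closed by metis
    have "\<zero> \<ominus> (\<Oplus>t\<in>T. x t \<otimes> w t) = \<zero>"
      using ev_H[OF w(2)] ev_minus[OF d(1) s(2)] d(2) s(1) by simp
    then have z: "(\<Oplus>t\<in>T. x t \<otimes> w t) = \<zero>"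
      using sc by (metis minus_equality minus_eq l_zero minus_zero a_inv_closed minus_minus)
    have "frag_of (x t, w t) \<in> H" if t: "t \<in> T" for t
    proof -
      have "c t \<otimes> w t = \<zero>" by (rule indep[OF _ z t]) (use w in \<open>auto simp: N_def\<close>)
      then have "frag_of (x t, w t) - frag_of (x t, \<zero>) \<in> H"
        using rel3[OF xM'[OF t], of "c t" "w t"] cB xc w t by (simp add: B_def)
      from Hadd[OF this rel_zero_r[OF xM'[OF t]]] show ?thesis by simp
    qed
    then have "(\<Sum>t\<in>T. frag_of (x t, w t)) \<in> H" by (rule sumH)
    from Hadd[OF w(2) this] show ?thesis by simp
  qed

  have coset: "H #>\<^bsub>F\<^esub> d = {h + d | h. h \<in> H}" for d by (auto simp: r_coset_def F_simps)
  have tm: "tensor_mult R (H #>\<^bsub>F\<^esub> d) = ev d" if d: "d \<in> carrier F" for d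
  proof -
    have "ev (h + d) = ev d" if "h \<in> H" for h
      using ev_add[OF _ d, of h] that HF ev_H[OF that] ev_closed[OF d] by (auto simp: subset_iff)
    then have "ev ` (H #>\<^bsub>F\<^esub> d) = {ev d}" using H0 unfolding coset by fastforce
    moreover have "tensor_mult R C = the_elem (ev ` C)" for C
      unfolding tensor_mult_def ev_def ..
    ultimately show ?thesis by simp
  qed
  have carrier_tp: "carrier (tensor_product R B M N) = {H #>\<^bsub>F\<^esub> d | d. d \<in> carrier F}"
    unfolding tensor_product_def H_eq F_def[symmetric] FactGroup_def RCOSETS_def by auto
  have "inj_on (tensor_mult R) (carrier (tensor_product R B M N))"
  proof (rule inj_onI)
    fix C C' assume "C \<in> carrier (tensor_product R B M N)" "C' \<in> carrier (tensor_product R B M N)"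
      and eq: "tensor_mult R C = tensor_mult R C'"
    then obtain d d' where d: "d \<in> carrier F" "C = H #>\<^bsub>F\<^esub> d" "d' \<in> carrier F" "C' = H #>\<^bsub>F\<^esub> d'"
      unfolding carrier_tp by blast
    have "ev d = ev d'" using eq d tm by simp
    then have "ev (d - d') = \<zero>" using ev_minus d ev_closed by (simp add: minus_eq r_neg)
    then have dd: "d - d' \<in> H" using ker Fminus d by blast
    show "C = C'" unfolding d coset
    proof (intro equalityI subsetI)
      fix u assume "u \<in> {h + d |h. h \<in> H}"
      then obtain h where h: "h \<in> H" "u = h + d" by blast
      then have "u = (h + (d - d')) + d'" "h + (d - d') \<in> H" using Hadd[OF h(1) dd] by simp_all
      then show "u \<in> {h + d' |h. h \<in> H}" by blast
    next
      fix u assume "u \<in> {h + d' |h. h \<in> H}"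
      then obtain h where h: "h \<in> H" "u = h + d'" by blast
      then have "u = (h - (d - d')) + d" "h - (d - d') \<in> H" using Hdiff[OF h(1) dd] by simp_all
      then show "u \<in> {h + d |h. h \<in> H}" by blast
    qed
  qed
  moreover have "tensor_mult R ` carrier (tensor_product R B M N) = sandwich R e"
  proof -
    have im: "tensor_mult R ` carrier (tensor_product R B M N) = ev ` carrier F"
    proof -
      have "carrier (tensor_product R B M N) = (\<lambda>d. H #>\<^bsub>F\<^esub> d) ` carrier F"
        unfolding carrier_tp by blast
      then show ?thesis by (simp add: image_image tm)
    qed
    have gens: "ev (frag_of p) \<in> sandwich R e" if "p \<in> M \<times> N" for p
    proof -
      from that obtain a b where p: "p = (a, b)" "a \<in> M" "b \<in> N" by auto
      then have "ev (frag_of p) = a \<otimes> e \<otimes> b" using ev_frag by (simp add: M_iff N_iff)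
      moreover have "a \<in> carrier R" "b \<in> carrier R" using p by (auto simp: M_iff N_iff)
      ultimately show ?thesis using sandwich_memI by simp
    qed
    have subS: "subgroup (sandwich R e) (add_monoid R)"
      unfolding sandwich_def by (rule group.generate_is_subgroup[OF a_group]) (use e' in auto)
    have "ev d \<in> sandwich R e" if "d \<in> carrier F" for d
    proof -
      have "Poly_Mapping.keys d \<subseteq> M \<times> N" using that by (simp add: F_simps)
      then show ?thesis
      proof (induct d rule: free_Abelian_group_induct[consumes 1, case_names zero diff gen])
        case (diff d d')
        have "ev d \<otimes>\<^bsub>add_monoid R\<^esub> inv\<^bsub>add_monoid R\<^esub> ev d' \<in> sandwich R e"
          using diff subgroup.m_closed[OF subS] subgroup.m_inv_closed[OF subS] by blast
        then show ?case using diff ev_minus[of d d'] by (simp add: F_simps minus_eq a_inv_def)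
      qed (use gens subgroup.one_closed[OF subS] ev_zero in auto)
    qed
    moreover have "sandwich R e \<subseteq> ev ` carrier F"
      unfolding sandwich_def
    proof (rule group.generate_subgroup_incl[OF a_group])
      show "subgroup (ev ` carrier F) (add_monoid R)" by (rule ev.img_is_subgroup)
      show "{a \<otimes> e \<otimes> b |a b. a \<in> carrier R \<and> b \<in> carrier R} \<subseteq> ev ` carrier F"
      proof
        fix u assume "u \<in> {a \<otimes> e \<otimes> b |a b. a \<in> carrier R \<and> b \<in> carrier R}"
        then obtain a b where u: "u = a \<otimes> e \<otimes> b" "a \<in> carrier R" "b \<in> carrier R" by blast
        have mem: "a \<otimes> e \<in> M" "e \<otimes> b \<in> N"
          using u e' by (auto simp: M_iff N_iff m_assoc) (simp add: m_assoc[symmetric])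
        have "a \<otimes> e \<otimes> (e \<otimes> b) = a \<otimes> (e \<otimes> e) \<otimes> b" using u e'(1) by (simp only: m_assoc m_closed)
        then have "u = ev (frag_of (a \<otimes> e, e \<otimes> b))" using ev_frag[OF mem] u e' by simp
        then show "u \<in> ev ` carrier F" using mem by (auto simp: fragF)
      qed
    qed
    ultimately show ?thesis unfolding im by blast
  qed
  ultimately show ?thesis unfolding bij_betw_def B_def M_def N_def by blast
qed

end

section \<open>Two-sided ideals of idempotents, and joins of commuting idempotents\<close>

section \<open>Ideals generated by idempotents\<close>

context ring
begin

lemma ideal_generate:
  assumes S: "S \<subseteq> carrier R"
    and l: "\<And>r s. r \<in> carrier R \<Longrightarrow> s \<in> S \<Longrightarrow> r \<otimes> s \<in> S"
    and r: "\<And>r s. r \<in> carrier R \<Longrightarrow> s \<in> S \<Longrightarrow> s \<otimes> r \<in> S"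
  shows "ideal (generate (add_monoid R) S) R"
proof -
  let ?G = "generate (add_monoid R) S"
  have sg: "subgroup ?G (add_monoid R)"
    by (rule group.generate_is_subgroup[OF a_group]) (use S in auto)
  have GR: "?G \<subseteq> carrier R" using subgroup.subset[OF sg] by simp
  have Gadd: "x \<oplus> y \<in> ?G" if "x \<in> ?G" "y \<in> ?G" for x y
    using subgroup.m_closed[OF sg that] by simp
  have Gneg: "\<ominus> x \<in> ?G" if "x \<in> ?G" for x
    using subgroup.m_inv_closed[OF sg that] by (simp add: a_inv_def)
  have G0: "\<zero> \<in> ?G" using subgroup.one_closed[OF sg] by simp
  have GS: "s \<in> ?G" if "s \<in> S" for s using that by (rule generate.incl)
  have "r \<otimes> x \<in> ?G \<and> x \<otimes> r \<in> ?G" if "x \<in> ?G" "r \<in> carrier R" for x r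
    using that(1)
  proof (induction rule: generate.induct)
    case one
    then show ?case using G0 that by simp
  next
    case (incl h)
    then show ?case using l r GS that by blast
  next
    case (inv h)
    have "h \<in> carrier R" using inv S by auto
    moreover have "r \<otimes> h \<in> ?G" "h \<otimes> r \<in> ?G" using l r GS that inv by blast+
    ultimately show ?case using Gneg that by (auto simp: a_inv_def[symmetric] r_minus l_minus)
  next
    case (eng h1 h2)
    then have "h1 \<in> carrier R" "h2 \<in> carrier R" using GR by auto
    then show ?case using eng Gadd that by (simp add: r_distr l_distr)
  qed
  then show ?thesis
    by (intro idealI sg) (auto simp: ring_axioms)
qed

lemma sandwich_ideal:
  assumes e: "e \<in> carrier R"
  shows "ideal (sandwich R e) R"
  unfolding sandwich_def
proof (rule ideal_generate)
  fix r s assume r: "r \<in> carrier R" and "s \<in> {a \<otimes> e \<otimes> b |a b. a \<in> carrier R \<and> b \<in> carrier R}"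
  then obtain a b where s: "s = a \<otimes> e \<otimes> b" "a \<in> carrier R" "b \<in> carrier R" by blast
  have "r \<otimes> s = (r \<otimes> a) \<otimes> e \<otimes> b" "s \<otimes> r = a \<otimes> e \<otimes> (b \<otimes> r)"
    using r s e by (simp_all add: m_assoc)
  then show "r \<otimes> s \<in> {a \<otimes> e \<otimes> b |a b. a \<in> carrier R \<and> b \<in> carrier R}"
    "s \<otimes> r \<in> {a \<otimes> e \<otimes> b |a b. a \<in> carrier R \<and> b \<in> carrier R}"
    using r s m_closed by blast+
qed (use e in auto)

lemma sandwich_subset_ideal:
  assumes "ideal J R" "e \<in> J"
  shows "sandwich R e \<subseteq> J"
proof -
  interpret J: ideal J R by fact
  show ?thesis unfolding sandwich_def
    by (rule group.generate_subgroup_incl[OF a_group])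
       (use assms J.I_l_closed J.I_r_closed J.a_subgroup in \<open>auto simp: additive_subgroup.a_subgroup\<close>)
qed

lemma idempotent_mem_sandwich:
  assumes "idempotent R e" shows "e \<in> sandwich R e"
  using sandwich_memI[of \<one> \<one> e] assms by (simp add: idempotent_def)

text \<open>The witness is \<open>1 - \<Prod>(1 - e)\<close>.\<close>

lemma commuting_idempotents_join:
  assumes "finite F" and "\<And>e. e \<in> F \<Longrightarrow> idempotent R e"
    and "\<And>e f. e \<in> F \<Longrightarrow> f \<in> F \<Longrightarrow> e \<otimes> f = f \<otimes> e"
  shows "\<exists>E. idempotent R E \<and> (\<forall>e\<in>F. E \<otimes> e = e) \<and> (\<forall>I. ideal I R \<longrightarrow> F \<subseteq> I \<longrightarrow> E \<in> I) \<and>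
    (\<forall>x\<in>carrier R. (\<forall>e\<in>F. e \<otimes> x = x \<otimes> e) \<longrightarrow> E \<otimes> x = x \<otimes> E)"
  using assms
proof (induction F)
  case empty
  then show ?case
    by (intro exI[of _ \<zero>])
       (auto simp: idempotent_def intro: additive_subgroup.zero_closed[OF ideal.axioms(1)])
next
  case (insert f F)
  then obtain E where E: "idempotent R E" "\<forall>e\<in>F. E \<otimes> e = e"
    "\<And>I. ideal I R \<Longrightarrow> F \<subseteq> I \<Longrightarrow> E \<in> I"
    "\<And>x. x \<in> carrier R \<Longrightarrow> (\<forall>e\<in>F. e \<otimes> x = x \<otimes> e) \<Longrightarrow> E \<otimes> x = x \<otimes> E"
    by auto
  have f: "f \<in> carrier R" "f \<otimes> f = f" using insert by (auto simp: idempotent_def)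
  have Ec: "E \<in> carrier R" "E \<otimes> E = E" using E by (auto simp: idempotent_def)
  \<comment> \<open>The last clause of the claim, that \<open>E\<close> commutes with whatever
    commutes with all of \<open>F\<close>, is carried through the induction for this
    purpose.\<close>
  have Ef: "E \<otimes> f = f \<otimes> E" using E(4)[OF f(1)] insert by blast
  \<comment> \<open>One factor of the product, expanded from \<open>1 - (1 - E)(1 - f)\<close>, so
    that membership in every ideal containing \<open>E\<close> and \<open>f\<close> is
    visible.\<close>
  let ?E = "E \<oplus> (f \<ominus> E \<otimes> f)"
  have Ec': "?E \<in> carrier R" using Ec f by simp
  have EEf: "E \<otimes> (E \<otimes> f) = E \<otimes> f" using Ec f by (simp add: m_assoc[symmetric])
  have fEf: "f \<otimes> (E \<otimes> f) = E \<otimes> f" using Ec f Ef by (metis m_assoc)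
  have fE: "f \<otimes> ?E = f"
  proof -
    have "f \<otimes> ?E = f \<otimes> E \<oplus> (f \<otimes> f \<ominus> f \<otimes> (E \<otimes> f))"
      using Ec f by (simp add: r_distr minus_eq r_minus)
    also have "\<dots> = E \<otimes> f \<oplus> (f \<ominus> E \<otimes> f)" using f fEf Ef by simp
    also have "\<dots> = f" using f Ec m_closed[OF Ec(1) f(1)] by algebra
    finally show ?thesis .
  qed
  have EE: "E \<otimes> ?E = E"
  proof -
    have "E \<otimes> ?E = E \<otimes> E \<oplus> (E \<otimes> f \<ominus> E \<otimes> (E \<otimes> f))"
      using Ec f by (simp add: r_distr minus_eq r_minus)
    also have "\<dots> = E" using Ec f EEf by (simp add: minus_eq r_neg)
    finally show ?thesis .
  qed
  have comm: "?E \<otimes> x = x \<otimes> ?E" if x: "x \<in> carrier R" "\<forall>e\<in>insert f F. e \<otimes> x = x \<otimes> e" for x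
  proof -
    have Ex: "E \<otimes> x = x \<otimes> E" using E(4) x by blast
    have "E \<otimes> f \<otimes> x = x \<otimes> (E \<otimes> f)"
      using x Ec f Ex by (simp add: m_assoc) (simp add: m_assoc[symmetric])
    then show ?thesis using x Ec f Ex by (simp add: l_distr r_distr minus_eq l_minus r_minus)
  qed
  have "?E \<otimes> ?E = E \<otimes> ?E \<oplus> (f \<otimes> ?E \<ominus> E \<otimes> (f \<otimes> ?E))"
    using Ec Ec' f by (simp add: l_distr minus_eq l_minus m_assoc)
  then have "idempotent R ?E" using EE fE Ec' by (simp add: idempotent_def)
  moreover have "?E \<otimes> e = e" if e: "e \<in> insert f F" for e
  proof -
    have ec: "e \<in> carrier R" using insert e by (auto simp: idempotent_def)
    have "?E \<otimes> e = e \<otimes> ?E" using comm[OF ec] insert e by blast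
    show ?thesis
    proof (cases "e = f")
      case True
      then show ?thesis using fE \<open>?E \<otimes> e = e \<otimes> ?E\<close> by simp
    next
      case False
      then have "E \<otimes> e = e" "f \<otimes> e = e \<otimes> f" using E e insert(5)[of f e] by auto
      then have "E \<otimes> f \<otimes> e = f \<otimes> e"
        using Ec f ec by (simp add: m_assoc) (simp add: m_assoc[symmetric])
      then show ?thesis using Ec f ec \<open>E \<otimes> e = e\<close>
        by (simp add: l_distr minus_eq l_minus r_neg)
    qed
  qed
  moreover have "?E \<in> I" if I: "ideal I R" "insert f F \<subseteq> I" for I
  proof -
    interpret I: ideal I R by fact
    have "E \<in> I" "f \<in> I" using E(3)[OF I(1)] I by auto
    moreover have "E \<otimes> f \<in> I" using I.I_l_closed[OF \<open>f \<in> I\<close> Ec(1)] .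
    ultimately show ?thesis by (simp add: minus_eq)
  qed
  ultimately show ?case using comm by blast
qed

end

section \<open>Algebras with a monoid as basis, multiplied up to a 2-cocycle\<close>

section \<open>Twisted monoid algebras\<close>

text \<open>\<open>cocycle\<close> is associativity of the twisted product on three basis elements,
  and \<open>twist_unit\<close> makes the basis element of \<open>u\<close> a unit without
  rescaling.\<close>

locale twisted_monoid =
  fixes M :: "'b set" and u :: 'b and mul :: "'b \<Rightarrow> 'b \<Rightarrow> 'b" (infixl \<open>\<bullet>\<close> 70)
    and \<alpha> :: "'b \<Rightarrow> 'b \<Rightarrow> 'k::field"
  assumes fin: "finite M" and unit_mem [simp]: "u \<in> M"
    and mul_closed [simp]: "a \<in> M \<Longrightarrow> b \<in> M \<Longrightarrow> a \<bullet> b \<in> M"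
    and mul_assoc: "a \<in> M \<Longrightarrow> b \<in> M \<Longrightarrow> c \<in> M \<Longrightarrow> a \<bullet> b \<bullet> c = a \<bullet> (b \<bullet> c)"
    and unit_left [simp]: "a \<in> M \<Longrightarrow> u \<bullet> a = a" and unit_right [simp]: "a \<in> M \<Longrightarrow> a \<bullet> u = a"
    and twist_unit: "a \<in> M \<Longrightarrow> \<alpha> u a = 1" "a \<in> M \<Longrightarrow> \<alpha> a u = 1"
    and cocycle: "a \<in> M \<Longrightarrow> b \<in> M \<Longrightarrow> c \<in> M \<Longrightarrow>
      \<alpha> a b * \<alpha> (a \<bullet> b) c = \<alpha> a (b \<bullet> c) * \<alpha> b c"
begin

definition alg :: "('k, 'b \<Rightarrow>\<^sub>0 'k) module" where
  "alg = basis_algebra M u (\<lambda>a b. Poly_Mapping.single (a \<bullet> b) (\<alpha> a b))"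

abbreviation sng :: "'b \<Rightarrow> 'k \<Rightarrow> 'b \<Rightarrow>\<^sub>0 'k" where "sng \<equiv> Poly_Mapping.single"

text \<open>Sums over all of \<open>M\<close> instead of the two supports: the additional terms
  vanish, and an index set that does not depend on the arguments makes additivity in each of them
  immediate.\<close>

definition conv :: "('b \<Rightarrow>\<^sub>0 'k) \<Rightarrow> ('b \<Rightarrow>\<^sub>0 'k) \<Rightarrow> 'b \<Rightarrow>\<^sub>0 'k" where
  "conv f g = (\<Sum>a\<in>M. \<Sum>b\<in>M.
     sng (a \<bullet> b) (Poly_Mapping.lookup f a * Poly_Mapping.lookup g b * \<alpha> a b))"

lemma alg_simps [simp]:
  "f \<in> carrier alg \<longleftrightarrow> Poly_Mapping.keys f \<subseteq> M" "\<one>\<^bsub>alg\<^esub> = sng u 1" "\<zero>\<^bsub>alg\<^esub> = 0"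
  "f \<oplus>\<^bsub>alg\<^esub> g = f + g"
  by (simp_all add: alg_def basis_algebra_def)

lemma alg_mult [simp]:
  assumes "Poly_Mapping.keys f \<subseteq> M" "Poly_Mapping.keys g \<subseteq> M"
  shows "f \<otimes>\<^bsub>alg\<^esub> g = conv f g"
proof -
  have "f \<otimes>\<^bsub>alg\<^esub> g = (\<Sum>a\<in>Poly_Mapping.keys f. \<Sum>b\<in>Poly_Mapping.keys g.
     sng (a \<bullet> b) (Poly_Mapping.lookup f a * Poly_Mapping.lookup g b * \<alpha> a b))"
    by (simp add: alg_def basis_algebra_def map_single when_def mult.assoc)
  also have "\<dots> = (\<Sum>a\<in>Poly_Mapping.keys f. \<Sum>b\<in>M.
     sng (a \<bullet> b) (Poly_Mapping.lookup f a * Poly_Mapping.lookup g b * \<alpha> a b))"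
    by (intro sum.cong sum.mono_neutral_left) (use fin assms in \<open>auto simp: in_keys_iff\<close>)
  also have "\<dots> = conv f g" unfolding conv_def
    by (intro sum.mono_neutral_left) (use fin assms in \<open>auto simp: in_keys_iff\<close>)
  finally show ?thesis .
qed

lemma conv_add: "conv (f + f') g = conv f g + conv f' g" "conv f (g + g') = conv f g + conv f g'"
  by (simp_all add: conv_def lookup_add algebra_simps single_add sum.distrib)

lemma conv_0 [simp]: "conv 0 g = 0" "conv f 0 = 0"
  by (simp_all add: conv_def)

lemma conv_single [simp]:
  assumes "a \<in> M" "b \<in> M"
  shows "conv (sng a x) (sng b y) = sng (a \<bullet> b) (x * y * \<alpha> a b)"
proof -
  have "conv (sng a x) (sng b y) = (\<Sum>a'\<in>M. \<Sum>b'\<in>M. if a' = a \<and> b' = b then sng (a \<bullet> b) (x * y * \<alpha> a b) else 0)"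
    unfolding conv_def by (intro sum.cong) (auto simp: lookup_single when_def)
  also have "\<dots> = (\<Sum>a'\<in>M. if a' = a then sng (a \<bullet> b) (x * y * \<alpha> a b) else 0)"
    using fin assms by (intro sum.cong) (auto simp: sum.delta)
  also have "\<dots> = sng (a \<bullet> b) (x * y * \<alpha> a b)"
    using fin assms by (simp add: sum.delta)
  finally show ?thesis .
qed

lemma keys_conv_subset:
  "Poly_Mapping.keys (conv f g) \<subseteq> {a \<bullet> b | a b. a \<in> M \<inter> Poly_Mapping.keys f \<and> b \<in> M \<inter> Poly_Mapping.keys g}"
proof
  fix d assume "d \<in> Poly_Mapping.keys (conv f g)"
  then obtain a where a: "a \<in> M" "d \<in> Poly_Mapping.keys (\<Sum>b\<in>M.
     sng (a \<bullet> b) (Poly_Mapping.lookup f a * Poly_Mapping.lookup g b * \<alpha> a b))"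
    unfolding conv_def using keys_sum by fastforce
  then obtain b where b: "b \<in> M"
    "d \<in> Poly_Mapping.keys (sng (a \<bullet> b) (Poly_Mapping.lookup f a * Poly_Mapping.lookup g b * \<alpha> a b))"
    using keys_sum by fastforce
  then have "d = a \<bullet> b" "Poly_Mapping.lookup f a \<noteq> 0" "Poly_Mapping.lookup g b \<noteq> 0"
    by (auto split: if_splits)
  then show "d \<in> {a \<bullet> b | a b. a \<in> M \<inter> Poly_Mapping.keys f \<and> b \<in> M \<inter> Poly_Mapping.keys g}"
    using a b by (auto simp: in_keys_iff)
qed

lemma keys_conv [simp]: "Poly_Mapping.keys (conv f g) \<subseteq> M"
  using keys_conv_subset[of f g] by auto

lemma poly_mapping_expand:
  assumes "Poly_Mapping.keys f \<subseteq> (S :: 'c set)" "finite S"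
  shows "f = (\<Sum>a\<in>S. Poly_Mapping.single a (Poly_Mapping.lookup f a))"
proof (rule poly_mapping_eqI)
  fix k
  have "Poly_Mapping.lookup (\<Sum>a\<in>S. Poly_Mapping.single a (Poly_Mapping.lookup f a)) k =
      (\<Sum>a\<in>S. if a = k then Poly_Mapping.lookup f k else 0)"
    by (simp add: lookup_sum lookup_single when_def) (intro sum.cong, auto)
  also have "\<dots> = Poly_Mapping.lookup f k"
    using assms by (auto simp: sum.delta in_keys_iff)
  finally show "Poly_Mapping.lookup f k = Poly_Mapping.lookup (\<Sum>a\<in>S. Poly_Mapping.single a (Poly_Mapping.lookup f a)) k"
    by simp
qed

text \<open>Reduces additive statements to multiples of one basis element. A set \<open>S\<close>
  smaller than \<open>M\<close> is allowed because the ideals of the rank filtration are spanned by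
  such sets.\<close>

lemma span_induct [consumes 2, case_names zero add single]:
  assumes f: "Poly_Mapping.keys f \<subseteq> S" and S: "S \<subseteq> M"
    and "P 0" "\<And>f g. Poly_Mapping.keys f \<subseteq> S \<Longrightarrow> Poly_Mapping.keys g \<subseteq> S \<Longrightarrow> P f \<Longrightarrow> P g \<Longrightarrow> P (f + g)"
    and "\<And>a x. a \<in> S \<Longrightarrow> P (sng a x)"
  shows "P f"
proof -
  have finS: "finite S" using S fin finite_subset by blast
  have "Poly_Mapping.keys (\<Sum>a\<in>T. sng a (Poly_Mapping.lookup f a)) \<subseteq> S \<and>
      P (\<Sum>a\<in>T. sng a (Poly_Mapping.lookup f a))" if "finite T" "T \<subseteq> S" for T
    using that
  proof (induction T)
    case (insert a T)
    define s where "s = sng a (Poly_Mapping.lookup f a)"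
    define t where "t = (\<Sum>a\<in>T. sng a (Poly_Mapping.lookup f a))"
    have "Poly_Mapping.keys s \<subseteq> S" "P s" using insert assms(5) by (auto simp: s_def)
    moreover have "Poly_Mapping.keys t \<subseteq> S" "P t" using insert by (auto simp: t_def)
    moreover have "(\<Sum>a\<in>insert a T. sng a (Poly_Mapping.lookup f a)) = s + t"
      using insert by (simp add: s_def t_def)
    ultimately show ?case using assms(4)[of s t] keys_add[of s t] by auto
  qed (use assms(3) in auto)
  then have "P (\<Sum>a\<in>S. sng a (Poly_Mapping.lookup f a))" using finS by blast
  then show ?thesis by (rule ssubst[OF poly_mapping_expand[OF f finS], of P])
qed

lemmas alg_induct = span_induct[OF _ order_refl, consumes 1, case_names zero add single]

lemma conv_assoc:
  assumes "Poly_Mapping.keys f \<subseteq> M" "Poly_Mapping.keys g \<subseteq> M" "Poly_Mapping.keys h \<subseteq> M"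
  shows "conv (conv f g) h = conv f (conv g h)"
  using assms(1)
proof (induction f rule: alg_induct)
  case (single a x)
  note a = this
  show ?case using assms(2)
  proof (induction g rule: alg_induct)
    case (single b y)
    note b = this
    show ?case using assms(3)
    proof (induction h rule: alg_induct)
      case (single c z)
      have "\<alpha> a b * \<alpha> (a \<bullet> b) c = \<alpha> a (b \<bullet> c) * \<alpha> b c" using cocycle a b single by blast
      then have eq: "x * y * \<alpha> a b * z * \<alpha> (a \<bullet> b) c = x * (y * z * \<alpha> b c) * \<alpha> a (b \<bullet> c)"
        by (simp add: mult_ac)
      show ?case using a b single by (simp add: mul_assoc eq)
    qed (simp_all add: conv_add)
  qed (simp_all add: conv_add)
qed (simp_all add: conv_add)

lemma conv_unit:
  assumes "Poly_Mapping.keys f \<subseteq> M"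
  shows "conv (sng u 1) f = f" "conv f (sng u 1) = f"
proof -
  have "conv (sng u 1) f = f \<and> conv f (sng u 1) = f"
    using assms by (induction f rule: alg_induct) (simp_all add: conv_add twist_unit)
  then show "conv (sng u 1) f = f" "conv f (sng u 1) = f" by auto
qed

lemma keys_add_closed [simp]:
  "Poly_Mapping.keys f \<subseteq> S \<Longrightarrow> Poly_Mapping.keys g \<subseteq> S \<Longrightarrow> Poly_Mapping.keys (f + g) \<subseteq> S"
  using keys_add[of f g] by auto

lemma alg_ring: "ring alg"
proof (rule ringI)
  show "abelian_group alg"
  proof (rule abelian_groupI)
    fix x assume "x \<in> carrier alg"
    then show "\<exists>y\<in>carrier alg. y \<oplus>\<^bsub>alg\<^esub> x = \<zero>\<^bsub>alg\<^esub>" by (intro bexI[of _ "- x"]) auto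
  qed (simp_all add: add_ac)
  show "Group.monoid alg"
    by (rule monoidI) (auto simp: conv_assoc conv_unit)
qed (simp_all add: conv_add)

sublocale A: ring alg by (rule alg_ring)

lemma alg_a_inv: "Poly_Mapping.keys f \<subseteq> M \<Longrightarrow> \<ominus>\<^bsub>alg\<^esub> f = - f"
  by (rule A.minus_equality) auto

end

section \<open>The filtration by rank, and its successive quotients as heredity ideals\<close>

section \<open>Heredity chains of twisted regular star-monoid algebras\<close>

text \<open>The \<open>\<Lambda> m\<close> are projections representing the J-classes of rank \<open>m\<close>; two elements \<open>a\<close>, \<open>b\<close> are
  R-related iff \<open>a a\<^sup>* = b b\<^sup>*\<close>.\<close>

locale ranked_star_monoid = twisted_monoid M u mul \<alpha>
  for M :: "'b set" and u and mul (infixl \<open>\<bullet>\<close> 70) and \<alpha> :: "'b \<Rightarrow> 'b \<Rightarrow> 'k::field" +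
  fixes star :: "'b \<Rightarrow> 'b" and w :: "'b \<Rightarrow> nat" and N :: nat and \<Lambda> :: "nat \<Rightarrow> 'b set"
  assumes twist_nz: "a \<in> M \<Longrightarrow> b \<in> M \<Longrightarrow> \<alpha> a b \<noteq> 0"
    and star_closed [simp]: "a \<in> M \<Longrightarrow> star a \<in> M"
    and star_star [simp]: "a \<in> M \<Longrightarrow> star (star a) = a"
    and star_mul: "a \<in> M \<Longrightarrow> b \<in> M \<Longrightarrow> star (a \<bullet> b) = star b \<bullet> star a"
    and regular: "a \<in> M \<Longrightarrow> a \<bullet> star a \<bullet> a = a"
    and twist_proj: "a \<in> M \<Longrightarrow> b \<in> M \<Longrightarrow> \<alpha> a b = \<alpha> (star a \<bullet> a) (b \<bullet> star b)"
    and rank_le1: "a \<in> M \<Longrightarrow> b \<in> M \<Longrightarrow> w (a \<bullet> b) \<le> w a"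
    and rank_le2: "a \<in> M \<Longrightarrow> b \<in> M \<Longrightarrow> w (a \<bullet> b) \<le> w b"
    and rank_bound: "a \<in> M \<Longrightarrow> w a \<le> N"
    and stable: "a \<in> M \<Longrightarrow> b \<in> M \<Longrightarrow> w (a \<bullet> b) = w a \<Longrightarrow>
      (a \<bullet> b) \<bullet> star (a \<bullet> b) = a \<bullet> star a"
    and reps: "m \<le> N \<Longrightarrow> e \<in> \<Lambda> m \<Longrightarrow> e \<in> M \<and> e \<bullet> e = e \<and> star e = e \<and> w e = m"
    and reps_ex: "a \<in> M \<Longrightarrow> \<exists>x\<in>M. x \<bullet> star x = a \<bullet> star a \<and> star x \<bullet> x \<in> \<Lambda> (w a)"
    and reps_distinct: "m \<le> N \<Longrightarrow> x \<in> M \<Longrightarrow> x \<bullet> star x \<in> \<Lambda> m \<Longrightarrow> star x \<bullet> x \<in> \<Lambda> m \<Longrightarrow>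
      x \<bullet> star x = star x \<bullet> x"
    and rank_step: "a \<in> M \<Longrightarrow> w a < N \<Longrightarrow>
      \<exists>b\<in>M. w b = Suc (w a) \<and> (\<exists>s\<in>M. \<exists>t\<in>M. a = s \<bullet> b \<bullet> t)"
    and rank_zero: "\<exists>a\<in>M. w a = 0"
begin

text \<open>From \<open>star a = star a \<bullet> (a \<bullet> star a)\<close> the rank of
  \<open>star a\<close> is at most that of \<open>a \<bullet> star a\<close>, hence at most that of
  \<open>a\<close>. Applying this to \<open>star a\<close> gives the other inequality.\<close>

lemma rank_star [simp]: assumes "a \<in> M" shows "w (star a) = w a"
proof -
  have le: "w (star a) \<le> w a" if a: "a \<in> M" for a
  proof -
    have "star a = star a \<bullet> (a \<bullet> star a)"
      using regular[of "star a"] a by (simp add: mul_assoc)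
    then have "w (star a) \<le> w (a \<bullet> star a)" using rank_le2 a by (metis mul_closed star_closed)
    also have "\<dots> \<le> w a" using rank_le1 a by simp
    finally show ?thesis .
  qed
  show ?thesis using le[OF assms] le[of "star a"] assms by simp
qed

lemma rank_proj: assumes "a \<in> M" shows "w (a \<bullet> star a) = w a" "w (star a \<bullet> a) = w a"
proof -
  show "w (a \<bullet> star a) = w a"
    using rank_le1[of a "star a"] rank_le1[of "a \<bullet> star a" a] regular[of a] assms by simp
  show "w (star a \<bullet> a) = w a"
    using rank_le2[of "star a" a] rank_le2[of a "star a \<bullet> a"] regular[of a] assms
    by (simp add: mul_assoc)
qed

text \<open>The bound is strict: \<open>span m\<close> is the ideal below level \<open>m\<close>,
  and \<open>span (Suc m)\<close> is the ideal of level \<open>m\<close>. At level 0 the former is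
  zero, as the start of the chain requires.\<close>

definition span :: "nat \<Rightarrow> ('b \<Rightarrow>\<^sub>0 'k) set" where
  "span m = {f. Poly_Mapping.keys f \<subseteq> {a \<in> M. w a < m}}"

lemma span_0 [simp]: "span 0 = {0}"
  by (auto simp: span_def)

lemma single_span: "a \<in> M \<Longrightarrow> w a < m \<Longrightarrow> sng a x \<in> span m"
  by (auto simp: span_def)

lemma span_closed:
  "span m \<subseteq> carrier alg" "f \<in> span m \<Longrightarrow> g \<in> span m \<Longrightarrow> f + g \<in> span m" "0 \<in> span m"
  "f \<in> span m \<Longrightarrow> - f \<in> span m"
  using keys_add[of f g] by (auto simp: span_def)

lemma span_ideal: "ideal (span m) alg"
proof (rule idealI[OF alg_ring])
  show "subgroup (span m) (add_monoid alg)"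
  proof (rule A.add.subgroupI)
    show "span m \<subseteq> carrier alg" "span m \<noteq> {}" using span_closed(1,3) by blast+
    show "\<And>a. a \<in> span m \<Longrightarrow> \<ominus>\<^bsub>alg\<^esub> a \<in> span m"
      using span_closed by (metis alg_a_inv alg_simps(1) subset_iff)
    show "\<And>a b. a \<in> span m \<Longrightarrow> b \<in> span m \<Longrightarrow> a \<oplus>\<^bsub>alg\<^esub> b \<in> span m" using span_closed by simp
  qed
  fix f g assume f: "f \<in> span m" and g: "g \<in> carrier alg"
  have fM: "Poly_Mapping.keys f \<subseteq> M" using f by (auto simp: span_def)
  have wf: "w a < m" if "a \<in> Poly_Mapping.keys f" for a using f that by (auto simp: span_def)
  have "w d < m" if "d \<in> Poly_Mapping.keys (conv g f)" for d
  proof -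
    from that keys_conv_subset[of g f] obtain a b
      where "a \<in> M" "b \<in> M" "b \<in> Poly_Mapping.keys f" "d = a \<bullet> b" by blast
    then show ?thesis using rank_le2[of a b] wf[of b] by simp
  qed
  moreover have "w d < m" if "d \<in> Poly_Mapping.keys (conv f g)" for d
  proof -
    from that keys_conv_subset[of f g] obtain a b
      where "a \<in> M" "b \<in> M" "a \<in> Poly_Mapping.keys f" "d = a \<bullet> b" by blast
    then show ?thesis using rank_le1[of a b] wf[of a] by simp
  qed
  ultimately have "Poly_Mapping.keys (conv g f) \<subseteq> {a\<in>M. w a < m}"
    "Poly_Mapping.keys (conv f g) \<subseteq> {a\<in>M. w a < m}"
    using keys_conv[of f g] keys_conv[of g f] by blast+
  then show "g \<otimes>\<^bsub>alg\<^esub> f \<in> span m" "f \<otimes>\<^bsub>alg\<^esub> g \<in> span m" using fM g by (auto simp: span_def)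
qed

text \<open>A basis element with \<open>e \<bullet> e = e\<close> squares to
  \<open>\<alpha> e e\<close> times itself; this coefficient turns it into an idempotent.\<close>

definition idem :: "'b \<Rightarrow> 'b \<Rightarrow>\<^sub>0 'k" where "idem e = sng e (inverse (\<alpha> e e))"

lemma keys_idem [simp]: "e \<in> M \<Longrightarrow> Poly_Mapping.keys (idem e) \<subseteq> M"
  by (simp add: idem_def)

text \<open>The cocycle identity for \<open>e\<close>, \<open>e\<close>, \<open>s\<close> with
  \<open>e \<bullet> s = s\<close> cancels to \<open>\<alpha> e s = \<alpha> e e\<close>, so the
  coefficient of \<open>idem e\<close> also removes the twist between \<open>e\<close> and
  \<open>s\<close>. The other side is symmetric.\<close>

lemma idem_absorb:
  assumes "e \<in> M" "e \<bullet> e = e" "s \<in> M"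
  shows "e \<bullet> s = s \<Longrightarrow> conv (idem e) (sng s y) = sng s y"
    and "s \<bullet> e = s \<Longrightarrow> conv (sng s y) (idem e) = sng s y"
proof -
  show "conv (idem e) (sng s y) = sng s y" if "e \<bullet> s = s"
    using cocycle[of e e s] twist_nz[of e s] twist_nz[of e e] assms that by (simp add: idem_def field_simps)
  show "conv (sng s y) (idem e) = sng s y" if "s \<bullet> e = s"
    using cocycle[of s e e] twist_nz[of s e] twist_nz[of e e] assms that by (simp add: idem_def field_simps)
qed

lemma idem_idempotent: assumes "e \<in> M" "e \<bullet> e = e" shows "idempotent alg (idem e)"
  unfolding idempotent_def using assms idem_absorb(1)[of e e] by (simp add: idem_def[of e])

lemma factor_through_rep:
  assumes a: "a \<in> M" and x: "x \<in> M" "x \<bullet> star x = a \<bullet> star a"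
  defines "e \<equiv> star x \<bullet> x"
  shows "x \<bullet> e = x" "e \<bullet> (star x \<bullet> a) = star x \<bullet> a" "x \<bullet> (star x \<bullet> a) = a"
proof -
  show "x \<bullet> e = x" using regular[OF x(1)] x(1) by (simp add: e_def mul_assoc)
  show "e \<bullet> (star x \<bullet> a) = star x \<bullet> a"
    using regular[of "star x"] x a by (simp add: e_def mul_assoc[symmetric])
  show "x \<bullet> (star x \<bullet> a) = a" using x a regular[OF a] by (simp add: mul_assoc[symmetric])
qed

text \<open>Transport along an R-class: \<open>x\<close> has the same projection as
  \<open>a\<close>, so \<open>a = x \<bullet> (star x \<bullet> a)\<close>, and the idempotent at
  \<open>star x \<bullet> x\<close> may be inserted between the factors. The quotient by
  \<open>\<alpha>\<close> undoes the one remaining twist.\<close>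

lemma single_factor:
  assumes a: "a \<in> M" and x: "x \<in> M" "x \<bullet> star x = a \<bullet> star a"
  shows "sng a y = conv (sng x 1) (conv (idem (star x \<bullet> x)) (sng (star x \<bullet> a) (y / \<alpha> x (star x \<bullet> a))))"
proof -
  note * = factor_through_rep[OF a x]
  have ee: "(star x \<bullet> x) \<bullet> (star x \<bullet> x) = star x \<bullet> x"
    using regular[OF x(1)] x(1) by (simp add: mul_assoc)
  show ?thesis using idem_absorb(1)[OF _ ee _ *(2)] * a x twist_nz[of x "star x \<bullet> a"] by simp
qed

text \<open>Descending induction on the rank. At rank \<open>m\<close> an element factors through
  some \<open>idem e\<close>; below \<open>m\<close>, \<open>rank_step\<close> exhibits it as a
  product with a factor of the next higher rank, which is in \<open>I\<close> already.\<close>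

lemma span_subset_ideal:
  assumes m: "m \<le> N" and I: "ideal I alg" and e: "\<And>e. e \<in> \<Lambda> m \<Longrightarrow> idem e \<in> I"
  shows "span (Suc m) \<subseteq> I"
proof -
  interpret I: ideal I alg by fact
  have l: "conv f g \<in> I" if "g \<in> I" "Poly_Mapping.keys f \<subseteq> M" for f g
    using I.I_l_closed[of g f] that I.a_subset by (auto simp: subset_iff)
  have r: "conv f g \<in> I" if "f \<in> I" "Poly_Mapping.keys g \<subseteq> M" for f g
    using I.I_r_closed[of f g] that I.a_subset by (auto simp: subset_iff)
  have single: "sng a y \<in> I" if "a \<in> M" "w a \<le> m" for a y
    using that
  proof (induction "m - w a" arbitrary: a y)
    case 0
    then have wa: "w a = m" by simp
    obtain x where x: "x \<in> M" "x \<bullet> star x = a \<bullet> star a" "star x \<bullet> x \<in> \<Lambda> (w a)"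
      using reps_ex[OF 0(2)] by blast
    show ?case unfolding single_factor[OF 0(2) x(1,2), of y]
      by (intro l r e) (use x 0 wa in auto)
  next
    case (Suc d)
    then obtain b s t where b: "b \<in> M" "w b = Suc (w a)" "s \<in> M" "t \<in> M" "a = s \<bullet> b \<bullet> t"
      using rank_step[of a] m by (metis Suc_diff_le diff_is_0_eq' less_le_trans not_less_eq_eq
          old.nat.distinct(2) not_le)
    then have "sng b 1 \<in> I" using Suc by auto
    \<comment> \<open>The last coefficient cancels the two twists that the triple product
      creates.\<close>
    then have "conv (conv (sng s 1) (sng b 1)) (sng t (y / (\<alpha> s b * \<alpha> (s \<bullet> b) t))) \<in> I"
      using b by (intro l r) auto
    then show ?case using b twist_nz[of s b] twist_nz[of "s \<bullet> b" t] by simp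
  qed
  show ?thesis
  proof
    fix f assume "f \<in> span (Suc m)"
    then have "Poly_Mapping.keys f \<subseteq> {a\<in>M. w a \<le> m}" "{a\<in>M. w a \<le> m} \<subseteq> M" by (auto simp: span_def)
    then show "f \<in> I"
    proof (induction f rule: span_induct)
      case zero
      show ?case using I.zero_closed by simp
    next
      case (add f g)
      then show ?case using I.a_closed[of f g] by simp
    qed (use single in auto)
  qed
qed

lemma idem_span: "m \<le> N \<Longrightarrow> e \<in> \<Lambda> m \<Longrightarrow> idem e \<in> span (Suc m)"
  using reps[of m e] by (auto simp: idem_def intro!: single_span)

text \<open>The coefficients are left free since the distinguished elements have coefficient 1 at
  positive level and an inverse power of the parameters at level 0. Multiplying by a multiple of the
  unit turns either into \<open>idem e\<close> without changing the ideal.\<close>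

lemma sandwich_reps_span:
  assumes m: "m \<le> N" and c: "\<And>e. e \<in> \<Lambda> m \<Longrightarrow> c e \<noteq> 0"
  shows "generate (add_monoid alg) (\<Union>e\<in>\<Lambda> m. sandwich alg (sng e (c e))) = span (Suc m)"
proof
  let ?S = "\<Union>e\<in>\<Lambda> m. sandwich alg (sng e (c e))"
  have mem: "e \<in> M" "w e = m" if "e \<in> \<Lambda> m" for e using reps[OF m that] by auto
  have id: "ideal (sandwich alg (sng e (c e))) alg" if "e \<in> \<Lambda> m" for e
    by (rule A.sandwich_ideal) (use mem[OF that] in auto)
  have sub: "sandwich alg (sng e (c e)) \<subseteq> span (Suc m)" if "e \<in> \<Lambda> m" for e
    by (rule A.sandwich_subset_ideal[OF span_ideal]) (use mem[OF that] single_span in auto)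
  show "generate (add_monoid alg) ?S \<subseteq> span (Suc m)"
    by (rule group.generate_subgroup_incl[OF A.a_group _
          additive_subgroup.a_subgroup[OF ideal.axioms(1)[OF span_ideal]]]) (use sub in blast)
  show "span (Suc m) \<subseteq> generate (add_monoid alg) ?S"
  proof (rule span_subset_ideal[OF m])
    show "ideal (generate (add_monoid alg) ?S) alg"
    proof (rule A.ideal_generate)
      show "?S \<subseteq> carrier alg" using sub span_closed(1) by blast
      show "r \<otimes>\<^bsub>alg\<^esub> s \<in> ?S" "s \<otimes>\<^bsub>alg\<^esub> r \<in> ?S" if r: "r \<in> carrier alg" and s: "s \<in> ?S" for r s
      proof -
        obtain e where e: "e \<in> \<Lambda> m" "s \<in> sandwich alg (sng e (c e))" using s by blast
        show "r \<otimes>\<^bsub>alg\<^esub> s \<in> ?S" using ideal.I_l_closed[OF id[OF e(1)] e(2) r] e(1) by blast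
        show "s \<otimes>\<^bsub>alg\<^esub> r \<in> ?S" using ideal.I_r_closed[OF id[OF e(1)] e(2) r] e(1) by blast
      qed
    qed
    fix e assume e: "e \<in> \<Lambda> m"
    have "sng e (c e) \<in> sandwich alg (sng e (c e))"
      using A.sandwich_memI[of "sng u 1" "sng u 1" "sng e (c e)"] mem[OF e] by (simp add: twist_unit)
    then have "conv (sng u (inverse (c e * \<alpha> e e))) (sng e (c e)) \<in> sandwich alg (sng e (c e))"
      using ideal.I_l_closed[OF id[OF e], of "sng e (c e)" "sng u (inverse (c e * \<alpha> e e))"] mem[OF e] by simp
    then have "idem e \<in> sandwich alg (sng e (c e))"
      using mem[OF e] c[OF e] by (simp add: idem_def twist_unit field_simps)
    then show "idem e \<in> generate (add_monoid alg) ?S" using e by (intro generate.incl) auto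
  qed
qed

text \<open>The join \<open>E\<close> lies in every ideal that contains the \<open>idem e\<close>,
  which bounds its own ideal from above; \<open>E \<otimes> idem e = idem e\<close> bounds it from
  below.\<close>

lemma span_idempotent_ex:
  assumes m: "m \<le> N" and comm: "\<And>e f. e \<in> \<Lambda> m \<Longrightarrow> f \<in> \<Lambda> m \<Longrightarrow> e \<bullet> f = f \<bullet> e \<and> \<alpha> e f = \<alpha> f e"
  shows "\<exists>E. idempotent alg E \<and> sandwich alg E = span (Suc m)"
proof -
  have mem: "e \<in> M" "e \<bullet> e = e" if "e \<in> \<Lambda> m" for e using reps[OF m that] by auto
  have "\<Lambda> m \<subseteq> M" using mem by auto
  then have fi: "finite (idem ` \<Lambda> m)" using fin finite_subset by blast
  have c: "e' \<otimes>\<^bsub>alg\<^esub> f' = f' \<otimes>\<^bsub>alg\<^esub> e'" if ef: "e' \<in> idem ` \<Lambda> m" "f' \<in> idem ` \<Lambda> m" for e' f'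
  proof -
    obtain e f where "e \<in> \<Lambda> m" "f \<in> \<Lambda> m" "e' = idem e" "f' = idem f" using ef by blast
    then show ?thesis using comm[of e f] mem by (simp add: idem_def mult.commute)
  qed
  have i: "idempotent alg e'" if "e' \<in> idem ` \<Lambda> m" for e' using that idem_idempotent mem by blast
  obtain E where E: "idempotent alg E" "\<forall>e\<in>idem ` \<Lambda> m. E \<otimes>\<^bsub>alg\<^esub> e = e"
    "\<forall>I. ideal I alg \<longrightarrow> idem ` \<Lambda> m \<subseteq> I \<longrightarrow> E \<in> I"
    using A.commuting_idempotents_join[OF fi i c] by blast
  have Ec: "E \<in> carrier alg" using E by (simp add: idempotent_def)
  have id: "ideal (sandwich alg E) alg" by (rule A.sandwich_ideal[OF Ec])
  have "E \<in> span (Suc m)" using E(3) span_ideal idem_span[OF m] by blast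
  then have "sandwich alg E \<subseteq> span (Suc m)" by (rule A.sandwich_subset_ideal[OF span_ideal])
  moreover have "span (Suc m) \<subseteq> sandwich alg E"
  proof (rule span_subset_ideal[OF m id])
    fix e assume e: "e \<in> \<Lambda> m"
    have "E \<otimes>\<^bsub>alg\<^esub> idem e \<in> sandwich alg E"
      by (rule ideal.I_r_closed[OF id A.idempotent_mem_sandwich[OF E(1)]]) (use e mem in simp)
    then show "idem e \<in> sandwich alg E" using E(2) e by simp
  qed
  ultimately show ?thesis using E(1) by blast
qed

lemma keys_sum_closed:
  "(\<And>i. i \<in> S \<Longrightarrow> Poly_Mapping.keys (f i) \<subseteq> T) \<Longrightarrow> Poly_Mapping.keys (sum f S) \<subseteq> T"
  by (rule subset_trans[OF keys_sum]) blast

section \<open>The layers: quotients by the elements of lower rank\<close>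

abbreviation layer_quot :: "nat \<Rightarrow> ('b \<Rightarrow>\<^sub>0 'k) set ring" where
  "layer_quot m \<equiv> alg Quot span m"

abbreviation proj :: "nat \<Rightarrow> ('b \<Rightarrow>\<^sub>0 'k) \<Rightarrow> ('b \<Rightarrow>\<^sub>0 'k) set" where
  "proj m f \<equiv> span m +>\<^bsub>alg\<^esub> f"

lemma proj_hom_ring: "ring_hom_ring alg (layer_quot m) (proj m)"
  by (rule ideal.rcos_ring_hom_ring[OF span_ideal])

lemma proj_closed: "Poly_Mapping.keys f \<subseteq> M \<Longrightarrow> proj m f \<in> carrier (layer_quot m)"
  using ring_hom_closed[OF ring_hom_ring.homh[OF proj_hom_ring]] by simp

lemma proj_mult: "Poly_Mapping.keys f \<subseteq> M \<Longrightarrow> Poly_Mapping.keys g \<subseteq> M \<Longrightarrow>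
    proj m f \<otimes>\<^bsub>layer_quot m\<^esub> proj m g = proj m (conv f g)"
  using ring_hom_mult[OF ring_hom_ring.homh[OF proj_hom_ring], of f g m] by simp

lemma proj_add: "Poly_Mapping.keys f \<subseteq> M \<Longrightarrow> Poly_Mapping.keys g \<subseteq> M \<Longrightarrow>
    proj m f \<oplus>\<^bsub>layer_quot m\<^esub> proj m g = proj m (f + g)"
  using ring_hom_add[OF ring_hom_ring.homh[OF proj_hom_ring], of f g m] by simp

lemma proj_surj: assumes "r \<in> carrier (layer_quot m)" obtains f where "Poly_Mapping.keys f \<subseteq> M" "r = proj m f"
  using assms unfolding FactRing_def by (auto simp: A_RCOSETS_def')

lemma proj_eq_zero_iff:
  assumes "Poly_Mapping.keys f \<subseteq> M"
  shows "proj m f = \<zero>\<^bsub>layer_quot m\<^esub> \<longleftrightarrow> f \<in> span m"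
proof -
  interpret I: ideal "span m" alg by (rule span_ideal)
  have "\<zero>\<^bsub>layer_quot m\<^esub> = span m" by (simp add: FactRing_def)
  then show ?thesis using I.a_rcos_const[of f] I.a_rcos_self[of f] assms by auto
qed

lemma proj_finsum:
  assumes "\<And>i. i \<in> S \<Longrightarrow> Poly_Mapping.keys (f i) \<subseteq> M"
  shows "finsum (layer_quot m) (\<lambda>i. proj m (f i)) S = proj m (sum f S) \<and> Poly_Mapping.keys (sum f S) \<subseteq> M"
proof -
  interpret h: ring_hom_ring alg "layer_quot m" "proj m" by (rule proj_hom_ring)
  have z: "proj m 0 = \<zero>\<^bsub>layer_quot m\<^esub>" using proj_eq_zero_iff[of 0 m] span_closed by simp
  show ?thesis using assms
  proof (induction S rule: infinite_finite_induct)
    case (insert i S)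
    have "finsum (layer_quot m) (\<lambda>i. proj m (f i)) (insert i S) =
        proj m (f i) \<oplus>\<^bsub>layer_quot m\<^esub> finsum (layer_quot m) (\<lambda>i. proj m (f i)) S"
      using insert proj_closed by (intro h.S.finsum_insert) auto
    then show ?case using insert by (simp add: proj_add)
  qed (auto simp: z h.S.finsum_infinite)
qed

text \<open>Stability for the product \<open>e \<bullet> d\<close>, and for
  \<open>e \<bullet> star d\<close> on the other side. An element of \<open>eMe\<close> that keeps
  the rank of \<open>e\<close> thus has both projections equal to \<open>e\<close>, so it belongs to
  the group at \<open>e\<close>.\<close>

lemma H_class:
  assumes e: "e \<in> M" "e \<bullet> e = e" "star e = e" and d: "d \<in> M" "w d = w e"
  shows "e \<bullet> d = d \<Longrightarrow> d \<bullet> star d = e" "d \<bullet> e = d \<Longrightarrow> star d \<bullet> d = e"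
proof -
  have R: "c \<bullet> star c = e" if c: "c \<in> M" "w c = w e" "e \<bullet> c = c" for c
    using stable[of e c] c e by simp
  show "e \<bullet> d = d \<Longrightarrow> d \<bullet> star d = e" using R d by blast
  assume "d \<bullet> e = d"
  then have "e \<bullet> star d = star d" using star_mul[of d e] d e by simp
  then show "star d \<bullet> d = e" using R[of "star d"] d by simp
qed

text \<open>If the rank stayed \<open>m\<close>, then \<open>e \<bullet> a \<bullet> f\<close> would
  have the projections \<open>e\<close> and \<open>f\<close>, contrary to
  \<open>reps_distinct\<close>. In the layer this becomes strong orthogonality of the
  representatives.\<close>

lemma cross_rank:
  assumes m: "m \<le> N" and e: "e \<in> \<Lambda> m" and f: "f \<in> \<Lambda> m" and ne: "e \<noteq> f" and a: "a \<in> M"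
  shows "w (e \<bullet> a \<bullet> f) < m"
proof (rule ccontr)
  note E = reps[OF m e] and F = reps[OF m f]
  define d where "d = e \<bullet> a \<bullet> f"
  have d: "d \<in> M" using E F a by (simp add: d_def)
  assume "\<not> w (e \<bullet> a \<bullet> f) < m"
  then have w: "w d = m" using rank_le2[of "e \<bullet> a" f] E F a by (simp add: d_def)
  have "e \<bullet> d = d" "d \<bullet> f = d"
    unfolding d_def using E F a mul_assoc[of e e "a \<bullet> f"] by (simp_all add: mul_assoc)
  then have "d \<bullet> star d = e" "star d \<bullet> d = f"
    using H_class(1)[of e d] H_class(2)[of f d] E F d w by auto
  then show False using reps_distinct[OF m d] e f ne by simp
qed

text \<open>Modulo lower rank the corner is spanned by the elements with both projections equal to
  \<open>e\<close>, which are the image of \<open>\<phi>\<close>. The twist depends on projections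
  only, hence is constant there and can be scaled away, so the corner is a homomorphic image of the
  untwisted group algebra.\<close>

lemma corner_semisimple:
  fixes G :: "('g, 'z) monoid_scheme"
  assumes m: "m \<le> N" and e: "e \<in> \<Lambda> m"
    and G: "Group.monoid G" "finite (carrier G)"
    and ss: "semisimple_ring (group_algebra G :: ('k, 'g \<Rightarrow>\<^sub>0 'k) module)"
    and \<phi>: "\<phi> ` carrier G = {d \<in> M. d \<bullet> star d = e \<and> star d \<bullet> d = e}"
    and \<phi>_mult: "\<And>g h. g \<in> carrier G \<Longrightarrow> h \<in> carrier G \<Longrightarrow> \<phi> (g \<otimes>\<^bsub>G\<^esub> h) = \<phi> g \<bullet> \<phi> h"
    and \<phi>_one: "\<phi> \<one>\<^bsub>G\<^esub> = e"
  shows "semisimple_ring (corner_ring (layer_quot m) (proj m (idem e)))"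
proof -
  note E = reps[OF m e]
  interpret G: Group.monoid G by fact
  interpret K: twisted_monoid "carrier G" "\<one>\<^bsub>G\<^esub>" "\<lambda>g h. g \<otimes>\<^bsub>G\<^esub> h" "\<lambda>_ _. 1 :: 'k"
    by unfold_locales (auto simp: G G.m_assoc)
  have Kalg: "K.alg = group_algebra G" unfolding K.alg_def group_algebra_def ..
  let ?R = "layer_quot m" and ?c = "proj m (idem e)"
  interpret h: ring_hom_ring alg ?R "proj m" by (rule proj_hom_ring)
  have idem: "idempotent alg (idem e)" using idem_idempotent E by blast
  then have idc: "idempotent ?R ?c"
    using E proj_closed by (simp add: idempotent_def proj_mult)
  let ?C = "corner_ring ?R ?c"
  interpret C: ring ?C by (rule h.S.corner_ring_ring[OF idc])
  have \<phi>M: "\<phi> g \<in> M" "\<phi> g \<bullet> star (\<phi> g) = e" "star (\<phi> g) \<bullet> \<phi> g = e" if "g \<in> carrier G" for g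
    using \<phi> that by blast+
  have tw: "\<alpha> (\<phi> g) (\<phi> h) = \<alpha> e e" if "g \<in> carrier G" "h \<in> carrier G" for g h
    using twist_proj[of "\<phi> g" "\<phi> h"] \<phi>M that by simp
  have ez: "\<alpha> e e \<noteq> 0" using twist_nz E by blast
  \<comment> \<open>A product of two basis elements at \<open>e\<close> picks up
    \<open>\<alpha> e e\<close> once and is divided by it twice, so the division makes the map
    multiplicative.\<close>
  define \<psi> where "\<psi> f = (\<Sum>g\<in>carrier G. sng (\<phi> g) (Poly_Mapping.lookup f g / \<alpha> e e))" for f :: "'g \<Rightarrow>\<^sub>0 'k"
  have \<psi>_keys: "Poly_Mapping.keys (\<psi> f) \<subseteq> M" for f
    unfolding \<psi>_def by (rule keys_sum_closed) (use \<phi>M in auto)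
  have \<psi>_add: "\<psi> (f + f') = \<psi> f + \<psi> f'" for f f'
    by (simp add: \<psi>_def lookup_add add_divide_distrib single_add sum.distrib)
  have \<psi>_0: "\<psi> 0 = 0" by (simp add: \<psi>_def)
  have \<psi>_single: "\<psi> (Poly_Mapping.single g x) = sng (\<phi> g) (x / \<alpha> e e)" if "g \<in> carrier G" for g x
  proof -
    have "\<psi> (Poly_Mapping.single g x) = (\<Sum>h\<in>carrier G. if h = g then sng (\<phi> g) (x / \<alpha> e e) else 0)"
      unfolding \<psi>_def by (intro sum.cong) (auto simp: lookup_single when_def)
    then show ?thesis using G that by (simp add: sum.delta)
  qed
  have \<psi>_mult: "\<psi> (K.conv f f') = conv (\<psi> f) (\<psi> f')"
    if "Poly_Mapping.keys f \<subseteq> carrier G" "Poly_Mapping.keys f' \<subseteq> carrier G" for f f'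
    using that(1)
  proof (induction f rule: K.alg_induct)
    case (single g x)
    note g = this
    show ?case using that(2)
    proof (induction f' rule: K.alg_induct)
      case (single g' x')
      have eq: "x / \<alpha> e e * (x' / \<alpha> e e) * \<alpha> e e = x * x' / \<alpha> e e" using ez by simp
      have "\<psi> (K.conv (Poly_Mapping.single g x) (Poly_Mapping.single g' x')) =
          sng (\<phi> (g \<otimes>\<^bsub>G\<^esub> g')) (x * x' / \<alpha> e e)"
        using \<psi>_single[of "g \<otimes>\<^bsub>G\<^esub> g'" "x * x'"] K.conv_single[OF g single] g single by simp
      also have "\<dots> = sng (\<phi> g \<bullet> \<phi> g') (x / \<alpha> e e * (x' / \<alpha> e e) * \<alpha> (\<phi> g) (\<phi> g'))"
        unfolding tw[OF g single] eq \<phi>_mult[OF g single] ..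
      also have "\<dots> = conv (\<psi> (Poly_Mapping.single g x)) (\<psi> (Poly_Mapping.single g' x'))"
        unfolding \<psi>_single[OF g] \<psi>_single[OF single] conv_single[OF \<phi>M(1)[OF g] \<phi>M(1)[OF single]] ..
      finally show ?case .
    qed (simp_all add: \<psi>_0 \<psi>_add conv_add K.conv_add)
  qed (simp_all add: \<psi>_0 \<psi>_add conv_add K.conv_add)
  have absorb: "conv (idem e) (\<psi> f) = \<psi> f \<and> conv (\<psi> f) (idem e) = \<psi> f"
    if "Poly_Mapping.keys f \<subseteq> carrier G" for f
    using that
  proof (induction f rule: K.alg_induct)
    case (single g x)
    have "e \<bullet> \<phi> g = \<phi> g" "\<phi> g \<bullet> e = \<phi> g"
      using \<phi>_mult[of "\<one>\<^bsub>G\<^esub>" g] \<phi>_mult[of g "\<one>\<^bsub>G\<^esub>"] single by (simp_all add: \<phi>_one)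
    then show ?case using idem_absorb[of e "\<phi> g"] E \<phi>M single by (simp add: \<psi>_single)
  qed (simp_all add: \<psi>_0 \<psi>_add conv_add)
  let ?h = "\<lambda>f. proj m (\<psi> f)"
  have hC: "?h f \<in> carrier ?C" if "Poly_Mapping.keys f \<subseteq> carrier G" for f
    using absorb[OF that] \<psi>_keys E proj_closed
    by (simp add: h.S.corner_carrier_iff[OF idc] proj_mult)
  have hom: "?h \<in> ring_hom (group_algebra G) ?C"
    unfolding Kalg[symmetric]
  proof (rule ring_hom_memI)
    show "?h x \<in> carrier ?C" if "x \<in> carrier K.alg" for x using hC that by simp
    show "?h (x \<otimes>\<^bsub>K.alg\<^esub> y) = ?h x \<otimes>\<^bsub>?C\<^esub> ?h y" if "x \<in> carrier K.alg" "y \<in> carrier K.alg" for x y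
      using that \<psi>_keys by (simp add: \<psi>_mult proj_mult h.S.corner_ring_simps)
    show "?h (x \<oplus>\<^bsub>K.alg\<^esub> y) = ?h x \<oplus>\<^bsub>?C\<^esub> ?h y" for x y
      using \<psi>_keys by (simp add: \<psi>_add proj_add h.S.corner_ring_simps)
    show "?h \<one>\<^bsub>K.alg\<^esub> = \<one>\<^bsub>?C\<^esub>"
      by (simp add: \<psi>_single \<phi>_one h.S.corner_ring_simps idem_def field_simps)
  qed
  have surj: "carrier ?C \<subseteq> ?h ` carrier K.alg"
  proof
    fix r assume r: "r \<in> carrier ?C"
    then obtain f where f: "Poly_Mapping.keys f \<subseteq> M" "r = proj m f"
      using proj_surj h.S.corner_carrier_iff[OF idc] by metis
    \<comment> \<open>A corner element is fixed by the idempotent on both sides. The two-sided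
      product with \<open>idem e\<close> is additive in \<open>f\<close>, so it need only be
      examined on a single basis element.\<close>
    have "proj m (conv (conv (idem e) f) (idem e)) \<in> ?h ` carrier K.alg" using f(1)
    proof (induction f rule: alg_induct)
      case zero
      show ?case using \<psi>_0 by (intro image_eqI[of _ _ 0]) auto
    next
      case (add f g)
      then obtain f' g' where "f' \<in> carrier K.alg" "g' \<in> carrier K.alg"
        "proj m (conv (conv (idem e) f) (idem e)) = ?h f'" "proj m (conv (conv (idem e) g) (idem e)) = ?h g'"
        by blast
      then have "proj m (conv (conv (idem e) (f + g)) (idem e)) = ?h (f' + g')"
        using \<psi>_keys by (simp add: conv_add proj_add[symmetric] \<psi>_add)
      then show ?case using \<open>f' \<in> carrier K.alg\<close> \<open>g' \<in> carrier K.alg\<close> by (intro image_eqI[of _ _ "f' + g'"]) auto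
    next
      case (single a x)
      define d where "d = e \<bullet> a \<bullet> e"
      obtain y where y: "conv (conv (idem e) (sng a x)) (idem e) = sng d y"
        using E single by (simp add: idem_def d_def)
      have d: "d \<in> M" using E single by (simp add: d_def)
      have ed: "e \<bullet> d = d" "d \<bullet> e = d"
        unfolding d_def using E single mul_assoc[of e e "a \<bullet> e"] by (simp_all add: mul_assoc)
      show ?case
      proof (cases "w d < m")
        case True
        then have "proj m (sng d y) = proj m (\<psi> 0)"
          using proj_eq_zero_iff[of "sng d y" m] proj_eq_zero_iff[of 0 m] d single_span span_closed
          by (simp add: \<psi>_0)
        then show ?thesis unfolding y by (intro image_eqI[of _ _ 0]) auto
      next
        case False
        then have "w d = w e" using rank_le2[of d e] d ed E by simp
        then have "d \<bullet> star d = e \<and> star d \<bullet> d = e" using H_class[of e d] E d ed by simp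
        then obtain g where g: "g \<in> carrier G" "d = \<phi> g" using \<phi> d by blast
        then have "sng d y = \<psi> (Poly_Mapping.single g (y * \<alpha> e e))" using ez by (simp add: \<psi>_single)
        then show ?thesis unfolding y using g by (intro image_eqI[of _ _ "Poly_Mapping.single g (y * \<alpha> e e)"]) auto
      qed
    qed
    moreover have "proj m (conv (conv (idem e) f) (idem e)) = r"
      using r f E by (simp add: h.S.corner_carrier_iff[OF idc] proj_mult[symmetric])
    ultimately show "r \<in> ?h ` carrier K.alg" by simp
  qed
  show ?thesis
    by (rule semisimple_ring_surj_image[OF ss C.ring_axioms hom]) (use surj Kalg in simp)
qed

text \<open>Supplies \<open>tensor_mult_bij\<close> with one generator for each projection of rank
  \<open>m\<close>, the class of the chosen \<open>x p\<close>, fixed on the right by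
  \<open>c (e p)\<close>. Independence is a matter of supports: at rank \<open>m\<close>, products
  with different \<open>x p\<close> on the left have no basis element in common.\<close>

lemma heredity_layer:
  assumes m: "m \<le> N"
    and ss: "\<And>e. e \<in> \<Lambda> m \<Longrightarrow> semisimple_ring (corner_ring (layer_quot m) (proj m (idem e)))"
  shows "heredity_ideal (proj m ` span (Suc m)) (layer_quot m)"
proof -
  let ?R = "layer_quot m"
  interpret h: ring_hom_ring alg ?R "proj m" by (rule proj_hom_ring)
  have mem: "e \<in> M" "e \<bullet> e = e" "star e = e" "w e = m" if "e \<in> \<Lambda> m" for e using reps[OF m that] by auto
  have \<Lambda>M: "\<Lambda> m \<subseteq> M" using mem by auto
  define c where "c e = proj m (idem e)" for e
  define F where "F = c ` \<Lambda> m"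
  have finF: "finite F" using \<Lambda>M fin finite_subset by (auto simp: F_def)
  have proj0: "proj m 0 = \<zero>\<^bsub>?R\<^esub>" using proj_eq_zero_iff[of 0 m] span_closed by simp
  have low: "proj m (sng a x) = \<zero>\<^bsub>?R\<^esub>" if "a \<in> M" "w a < m" for a x
    using proj_eq_zero_iff[of "sng a x" m] single_span that by simp
  have idc: "idempotent ?R e'" if "e' \<in> F" for e'
    using that idem_idempotent mem unfolding F_def c_def
    by (auto simp: idempotent_def proj_mult proj_closed)
  have cross: "c e \<otimes>\<^bsub>?R\<^esub> r \<otimes>\<^bsub>?R\<^esub> c f = \<zero>\<^bsub>?R\<^esub>"
    if e: "e \<in> \<Lambda> m" and f: "f \<in> \<Lambda> m" and ne: "e \<noteq> f" and r: "r \<in> carrier ?R" for e f r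
  proof -
    obtain g where g: "Poly_Mapping.keys g \<subseteq> M" "r = proj m g" using proj_surj[OF r] by blast
    have "proj m (conv (conv (idem e) g) (idem f)) = \<zero>\<^bsub>?R\<^esub>" using g(1)
    proof (induction g rule: alg_induct)
      case (add g g')
      then show ?case by (simp add: conv_add proj_add[symmetric])
    next
      case (single a x)
      then show ?case using low[of "e \<bullet> a \<bullet> f"] cross_rank[OF m e f ne single] mem[OF e] mem[OF f]
        by (simp add: idem_def)
    qed (simp add: proj0)
    then show ?thesis using g mem[OF e] mem[OF f] by (simp add: c_def proj_mult)
  qed
  have orth: "e' \<otimes>\<^bsub>?R\<^esub> r \<otimes>\<^bsub>?R\<^esub> f' = \<zero>\<^bsub>?R\<^esub>"
    if "e' \<in> F" "f' \<in> F" "e' \<noteq> f'" "r \<in> carrier ?R" for e' f' r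
    using that cross unfolding F_def by blast
  have ssF: "semisimple_ring (corner_ring ?R e')" if "e' \<in> F" for e'
    using that ss unfolding F_def c_def by blast
  define E where "E = (\<Oplus>\<^bsub>?R\<^esub>e'\<in>F. e')"
  note sum_facts = h.S.semisimple_corner_sum[OF finF idc orth ssF, folded E_def]
  have idE: "idempotent ?R E" by (rule sum_facts(1)) auto
  have ssE: "semisimple_ring (corner_ring ?R E)" by (rule sum_facts(2)) auto
  have Ec: "E \<otimes>\<^bsub>?R\<^esub> c e = c e" "c e \<otimes>\<^bsub>?R\<^esub> E = c e" if "e \<in> \<Lambda> m" for e
    using sum_facts(3)[of "c e"] that by (auto simp: F_def)
  have E: "E \<in> carrier ?R" "E \<otimes>\<^bsub>?R\<^esub> E = E" using idE by (auto simp: idempotent_def)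
  have cc: "c e \<in> carrier ?R" if "e \<in> \<Lambda> m" for e using that mem proj_closed by (simp add: c_def)
  have Eabs: "E \<otimes>\<^bsub>?R\<^esub> r = r" if "e \<in> \<Lambda> m" "r \<in> carrier ?R" "c e \<otimes>\<^bsub>?R\<^esub> r = r" for e r
  proof -
    have "E \<otimes>\<^bsub>?R\<^esub> r = E \<otimes>\<^bsub>?R\<^esub> (c e \<otimes>\<^bsub>?R\<^esub> r)" using that by simp
    also have "\<dots> = r" using E cc that Ec h.S.m_assoc[of E "c e" r] by simp
    finally show ?thesis .
  qed
  have absE: "r \<otimes>\<^bsub>?R\<^esub> E = r" if "e \<in> \<Lambda> m" "r \<in> carrier ?R" "r \<otimes>\<^bsub>?R\<^esub> c e = r" for e r
  proof -
    have "r \<otimes>\<^bsub>?R\<^esub> E = (r \<otimes>\<^bsub>?R\<^esub> c e) \<otimes>\<^bsub>?R\<^esub> E" using that by simp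
    also have "\<dots> = r" using E cc that Ec h.S.m_assoc[of r "c e" E] by simp
    finally show ?thesis .
  qed

  \<comment> \<open>\<open>p \<bullet> star p = p\<close> singles out projections. Each R-class of
    rank \<open>m\<close> contains exactly one of them, so \<open>T\<close> indexes these
    classes.\<close>
  define T where "T = {p \<in> M. w p = m \<and> p \<bullet> star p = p}"
  have finT: "finite T" using fin by (simp add: T_def)
  have "\<exists>x. \<forall>p\<in>T. x p \<in> M \<and> x p \<bullet> star (x p) = p \<and> star (x p) \<bullet> x p \<in> \<Lambda> m"
    using reps_ex by (intro bchoice) (fastforce simp: T_def)
  then obtain x where x: "\<And>p. p \<in> T \<Longrightarrow> x p \<in> M" "\<And>p. p \<in> T \<Longrightarrow> x p \<bullet> star (x p) = p"
    "\<And>p. p \<in> T \<Longrightarrow> star (x p) \<bullet> x p \<in> \<Lambda> m" by blast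
  define e where "e p = star (x p) \<bullet> x p" for p
  have e: "e p \<in> \<Lambda> m" if "p \<in> T" for p using x that by (simp add: e_def)
  define y where "y p = proj m (sng (x p) 1)" for p
  have T_of: "d \<bullet> star d \<in> T" if "d \<in> M" "w d = m" for d
    using that regular[of d] rank_proj[of d] by (simp add: T_def star_mul mul_assoc[symmetric])
  have yc: "y p \<in> carrier ?R" "y p \<otimes>\<^bsub>?R\<^esub> c (e p) = y p" if p: "p \<in> T" for p
  proof -
    show "y p \<in> carrier ?R" using x p proj_closed by (simp add: y_def)
    have "x p \<bullet> e p = x p" using regular[OF x(1)[OF p]] x(1)[OF p] by (simp add: e_def mul_assoc)
    then show "y p \<otimes>\<^bsub>?R\<^esub> c (e p) = y p"
      using idem_absorb(2)[of "e p" "x p"] mem[OF e[OF p]] x p by (simp add: y_def c_def proj_mult)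
  qed
  have factor: "\<exists>b. Poly_Mapping.keys b \<subseteq> M \<and> proj m (sng d z) = y p \<otimes>\<^bsub>?R\<^esub> (c (e p) \<otimes>\<^bsub>?R\<^esub> proj m b) \<and>
      b = sng (star (x p) \<bullet> d) (z / \<alpha> (x p) (star (x p) \<bullet> d))"
    if "d \<in> M" "w d = m" "p = d \<bullet> star d" for d z p
  proof -
    have p: "p \<in> T" using T_of that by blast
    show ?thesis using single_factor[of d "x p" z] that x[OF p] mem[OF e[OF p]]
      by (simp add: y_def c_def proj_mult e_def[symmetric])
  qed

  \<comment> \<open>By additivity it suffices to multiply one basis element by one
    \<open>c f\<close>. If the rank drops, the class is zero; otherwise \<open>factor\<close> gives
    a single term, at the projection of the product.\<close>
  have span: "\<exists>b. (\<forall>t\<in>T. b t \<in> carrier (corner_ring ?R E)) \<and> z = (\<Oplus>\<^bsub>?R\<^esub>t\<in>T. y t \<otimes>\<^bsub>?R\<^esub> b t)"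
    if z: "z \<in> left_mults ?R E" for z
  proof -
    interpret C: ring "corner_ring ?R E" by (rule h.S.corner_ring_ring[OF idE])
    note iff = h.S.corner_carrier_iff[OF idE]
    define P where "P z \<longleftrightarrow> (\<exists>b. (\<forall>t\<in>T. b t \<in> carrier (corner_ring ?R E)) \<and> z = (\<Oplus>\<^bsub>?R\<^esub>t\<in>T. y t \<otimes>\<^bsub>?R\<^esub> b t))" for z
    have P0: "P \<zero>\<^bsub>?R\<^esub>"
    proof -
      have "(\<Oplus>\<^bsub>?R\<^esub>t\<in>T. y t \<otimes>\<^bsub>?R\<^esub> \<zero>\<^bsub>?R\<^esub>) = (\<Oplus>\<^bsub>?R\<^esub>t\<in>T. \<zero>\<^bsub>?R\<^esub>)"
        by (rule h.S.finsum_cong') (use yc in auto)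
      then show ?thesis unfolding P_def using C.zero_closed by (intro exI[of _ "\<lambda>_. \<zero>\<^bsub>?R\<^esub>"]) simp
    qed
    have Padd: "P (z \<oplus>\<^bsub>?R\<^esub> z')" if zz: "P z" "P z'" for z z'
    proof -
      obtain b b' where b: "\<And>t. t \<in> T \<Longrightarrow> b t \<in> carrier (corner_ring ?R E)" "z = (\<Oplus>\<^bsub>?R\<^esub>t\<in>T. y t \<otimes>\<^bsub>?R\<^esub> b t)"
        "\<And>t. t \<in> T \<Longrightarrow> b' t \<in> carrier (corner_ring ?R E)" "z' = (\<Oplus>\<^bsub>?R\<^esub>t\<in>T. y t \<otimes>\<^bsub>?R\<^esub> b' t)"
        using zz unfolding P_def by blast
      have bc: "b t \<in> carrier ?R" "b' t \<in> carrier ?R" if "t \<in> T" for t using b that iff by auto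
      have "(\<Oplus>\<^bsub>?R\<^esub>t\<in>T. y t \<otimes>\<^bsub>?R\<^esub> (b t \<oplus>\<^bsub>?R\<^esub> b' t)) = (\<Oplus>\<^bsub>?R\<^esub>t\<in>T. y t \<otimes>\<^bsub>?R\<^esub> b t \<oplus>\<^bsub>?R\<^esub> y t \<otimes>\<^bsub>?R\<^esub> b' t)"
        by (rule h.S.finsum_cong') (use bc yc in \<open>auto simp: h.S.r_distr\<close>)
      also have "\<dots> = z \<oplus>\<^bsub>?R\<^esub> z'" unfolding b(2,4)
        by (rule h.S.finsum_addf) (use bc yc in auto)
      finally show ?thesis unfolding P_def using b(1,3) C.a_closed
        by (intro exI[of _ "\<lambda>t. b t \<oplus>\<^bsub>?R\<^esub> b' t"]) simp
    qed
    have Psum: "P (\<Oplus>\<^bsub>?R\<^esub>e'\<in>G. z e')" if "finite G" "\<And>e'. e' \<in> G \<Longrightarrow> P (z e') \<and> z e' \<in> carrier ?R" for G and z :: "_ \<Rightarrow> _"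
      using that
    proof (induction G)
      case (insert e' G)
      have "(\<Oplus>\<^bsub>?R\<^esub>e'\<in>insert e' G. z e') = z e' \<oplus>\<^bsub>?R\<^esub> (\<Oplus>\<^bsub>?R\<^esub>e'\<in>G. z e')"
        by (rule h.S.finsum_insert) (use insert in auto)
      then show ?case using insert Padd by simp
    qed (use P0 in simp)
    have single: "P (proj m (sng a s) \<otimes>\<^bsub>?R\<^esub> c f)" if a: "a \<in> M" and f: "f \<in> \<Lambda> m" for a s f
    proof -
      define d where "d = a \<bullet> f"
      have d: "d \<in> M" "d \<bullet> f = d" using a mem[OF f] by (auto simp: d_def mul_assoc)
      obtain z where z: "proj m (sng a s) \<otimes>\<^bsub>?R\<^esub> c f = proj m (sng d z)"
        using a mem[OF f] by (simp add: c_def proj_mult idem_def d_def)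
      show ?thesis
      proof (cases "w d < m")
        case True
        then show ?thesis unfolding z using low[OF d(1)] P0 by simp
      next
        case False
        then have wd: "w d = m" using rank_le2[of a f] a mem[OF f] by (simp add: d_def)
        define p where "p = d \<bullet> star d"
        have p: "p \<in> T" using T_of d wd by (simp add: p_def)
        obtain b where b: "Poly_Mapping.keys b \<subseteq> M"
          "proj m (sng d z) = y p \<otimes>\<^bsub>?R\<^esub> (c (e p) \<otimes>\<^bsub>?R\<^esub> proj m b)"
          "b = sng (star (x p) \<bullet> d) (z / \<alpha> (x p) (star (x p) \<bullet> d))"
          using factor[OF d(1) wd p_def] by blast
        let ?b = "c (e p) \<otimes>\<^bsub>?R\<^esub> proj m b"
        have eb: "c (e p) \<otimes>\<^bsub>?R\<^esub> ?b = ?b"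
          using cc[OF e[OF p]] idc[of "c (e p)"] e[OF p] proj_closed[OF b(1)]
          by (simp add: h.S.m_assoc[symmetric] idempotent_def F_def)
        have bf: "proj m b \<otimes>\<^bsub>?R\<^esub> c f = proj m b"
          using idem_absorb(2)[of f "star (x p) \<bullet> d"] mem[OF f] x[OF p] d
          by (simp add: b(3) c_def proj_mult mul_assoc)
        have b1: "?b \<in> carrier ?R" using cc[OF e[OF p]] proj_closed[OF b(1)] by simp
        have b2: "E \<otimes>\<^bsub>?R\<^esub> ?b = ?b" by (rule Eabs[OF e[OF p] b1 eb])
        have b3: "?b \<otimes>\<^bsub>?R\<^esub> E = ?b"
          by (rule absE[OF f b1]) (use bf cc[OF e[OF p]] cc[OF f] proj_closed[OF b(1)] in \<open>simp add: h.S.m_assoc\<close>)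
        have bC: "?b \<in> carrier (corner_ring ?R E)" using b1 b2 b3 iff by simp
        have "(\<Oplus>\<^bsub>?R\<^esub>t\<in>T. y t \<otimes>\<^bsub>?R\<^esub> (if p = t then ?b else \<zero>\<^bsub>?R\<^esub>)) = (\<Oplus>\<^bsub>?R\<^esub>t\<in>T. if p = t then y t \<otimes>\<^bsub>?R\<^esub> ?b else \<zero>\<^bsub>?R\<^esub>)"
          by (rule h.S.finsum_cong') (use yc b1 in auto)
        also have "\<dots> = y p \<otimes>\<^bsub>?R\<^esub> ?b"
          using h.S.finsum_singleton[OF p finT, of "\<lambda>t. y t \<otimes>\<^bsub>?R\<^esub> ?b"] yc b1 by simp
        finally show ?thesis unfolding z b(2) P_def using bC C.zero_closed
          by (intro exI[of _ "\<lambda>t. if p = t then ?b else \<zero>\<^bsub>?R\<^esub>"]) simp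
      qed
    qed
    have all: "P (proj m g \<otimes>\<^bsub>?R\<^esub> c f)" if f: "f \<in> \<Lambda> m" and g: "Poly_Mapping.keys g \<subseteq> M" for f g
      using g
    proof (induction g rule: alg_induct)
      case zero
      show ?case using P0 cc[OF f] by (simp add: proj0)
    next
      case (add g g')
      then show ?case using Padd[OF add(3,4)] cc[OF f] proj_closed
        by (simp add: proj_add[symmetric] h.S.l_distr)
    qed (use single f in simp)
    obtain a where a: "a \<in> carrier ?R" "z = a \<otimes>\<^bsub>?R\<^esub> E" using z unfolding left_mults_def by blast
    obtain g where g: "Poly_Mapping.keys g \<subseteq> M" "a = proj m g" using proj_surj[OF a(1)] by blast
    have Fc: "F \<subseteq> carrier ?R" using cc by (auto simp: F_def)
    have "z = (\<Oplus>\<^bsub>?R\<^esub>e'\<in>F. a \<otimes>\<^bsub>?R\<^esub> e')"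
      unfolding a(2) E_def by (rule h.S.finsum_rdistr) (use finF a Fc in auto)
    also have "P \<dots>"
      by (rule Psum[OF finF]) (use all g a Fc in \<open>auto simp: F_def\<close>)
    finally show ?thesis unfolding P_def .
  qed

  \<comment> \<open>By stability, every basis element of rank \<open>m\<close> occurring in a
    product with \<open>x s\<close> on the left has projection \<open>s\<close>. At rank
    \<open>m\<close> a vanishing sum therefore vanishes summand by summand.\<close>
  have indep: "c (e p) \<otimes>\<^bsub>?R\<^esub> v p = \<zero>\<^bsub>?R\<^esub>"
    if v: "\<And>s. s \<in> T \<Longrightarrow> v s \<in> right_mults ?R E"
      and sum0: "(\<Oplus>\<^bsub>?R\<^esub>s\<in>T. y s \<otimes>\<^bsub>?R\<^esub> v s) = \<zero>\<^bsub>?R\<^esub>" and p: "p \<in> T" for v p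
  proof -
    have vc: "v s \<in> carrier ?R" if "s \<in> T" for s using v[OF that] E by (auto simp: right_mults_def)
    have "\<forall>s\<in>T. \<exists>f. Poly_Mapping.keys f \<subseteq> M \<and> v s = proj m f" using vc proj_surj by metis
    then obtain f where f: "\<And>s. s \<in> T \<Longrightarrow> Poly_Mapping.keys (f s) \<subseteq> M" "\<And>s. s \<in> T \<Longrightarrow> v s = proj m (f s)"
      by metis
    define g where "g s = conv (sng (x s) 1) (f s)" for s
    have gk: "Poly_Mapping.keys (g s) \<subseteq> M" for s by (simp add: g_def)
    have yv: "y s \<otimes>\<^bsub>?R\<^esub> v s = proj m (g s)" if "s \<in> T" for s
      using that f x by (simp add: y_def g_def proj_mult)
    have "(\<Oplus>\<^bsub>?R\<^esub>s\<in>T. y s \<otimes>\<^bsub>?R\<^esub> v s) = (\<Oplus>\<^bsub>?R\<^esub>s\<in>T. proj m (g s))"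
      by (rule h.S.finsum_cong') (use yv proj_closed[OF gk] in auto)
    then have "proj m (sum g T) = \<zero>\<^bsub>?R\<^esub>" "Poly_Mapping.keys (sum g T) \<subseteq> M"
      using proj_finsum[of T g m] gk sum0 by auto
    then have "sum g T \<in> span m" using proj_eq_zero_iff by blast
    then have low_keys: "w d < m" if "d \<in> Poly_Mapping.keys (sum g T)" for d using that by (auto simp: span_def)
    have wx: "w (x s) = m" if "s \<in> T" for s
      using rank_proj(2)[of "x s"] x[OF that] mem by force
    have top: "d \<bullet> star d = s" if s: "s \<in> T" and d: "d \<in> Poly_Mapping.keys (g s)" "\<not> w d < m" for s d
    proof -
      obtain a b where ab: "a \<in> M" "b \<in> M" "a \<in> Poly_Mapping.keys (sng (x s) 1)" "d = a \<bullet> b"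
        using keys_conv_subset[of "sng (x s) 1" "f s"] d(1) unfolding g_def by blast
      then have "a = x s" by (simp split: if_splits)
      then show ?thesis using stable[of "x s" b] rank_le1[of "x s" b] wx[OF s] ab d(2) x[OF s] by simp
    qed
    have "g p \<in> span m"
    proof -
      have "w d < m" if d: "d \<in> Poly_Mapping.keys (g p)" for d
      proof (rule ccontr)
        assume nw: "\<not> w d < m"
        have "Poly_Mapping.lookup (g s) d = 0" if "s \<in> T - {p}" for s
        proof (rule ccontr)
          assume "Poly_Mapping.lookup (g s) d \<noteq> 0"
          then have "d \<bullet> star d = s" using top[of s d] that nw by (simp add: in_keys_iff)
          then show False using top[OF p d nw] that by simp
        qed
        then have "Poly_Mapping.lookup (sum g T) d = Poly_Mapping.lookup (g p) d"
          using sum.remove[OF finT p, of "\<lambda>s. Poly_Mapping.lookup (g s) d"] by (simp add: lookup_sum)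
        then show False using low_keys[of d] d nw by (simp add: in_keys_iff)
      qed
      then show ?thesis using gk by (auto simp: span_def)
    qed
    then have yv0: "y p \<otimes>\<^bsub>?R\<^esub> v p = \<zero>\<^bsub>?R\<^esub>" using yv[OF p] proj_eq_zero_iff[OF gk] by simp
    \<comment> \<open>A left inverse of \<open>y p\<close> up to \<open>c (e p)\<close>: the product
      \<open>star (x p) \<bullet> x p\<close> is \<open>e p\<close>, and the coefficient exchanges
      its twist for the normalisation of \<open>idem\<close>.\<close>
    define q where "q = proj m (sng (star (x p)) (inverse (\<alpha> (e p) (e p)) / \<alpha> (star (x p)) (x p)))"
    have qc: "q \<in> carrier ?R" using x[OF p] proj_closed by (simp add: q_def)
    have "q \<otimes>\<^bsub>?R\<^esub> y p = c (e p)"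
      using x[OF p] twist_nz[of "star (x p)" "x p"]
      by (simp add: q_def y_def c_def proj_mult idem_def e_def[symmetric])
    then have "c (e p) \<otimes>\<^bsub>?R\<^esub> v p = q \<otimes>\<^bsub>?R\<^esub> (y p \<otimes>\<^bsub>?R\<^esub> v p)"
      using qc yc[OF p] vc[OF p] h.S.m_assoc[of q "y p" "v p"] by simp
    then show ?thesis using yv0 qc by simp
  qed

  have bij: "bij_betw (tensor_mult ?R)
          (carrier (tensor_product ?R (carrier (corner_ring ?R E)) (left_mults ?R E) (right_mults ?R E)))
          (sandwich ?R E)"
  proof (rule h.S.tensor_mult_bij[OF idE finT, of y "\<lambda>p. c (e p)"])
    show "y t \<in> left_mults ?R E" if t: "t \<in> T" for t
    proof -
      have "y t = y t \<otimes>\<^bsub>?R\<^esub> E" using absE[OF e[OF t] yc[OF t]] by simp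
      then show ?thesis using yc[OF t] unfolding left_mults_def by blast
    qed
    show "c (e t) \<in> carrier (corner_ring ?R E)" if "t \<in> T" for t
      using Ec[OF e[OF that]] cc[OF e[OF that]] by (simp add: h.S.corner_carrier_iff[OF idE])
  qed (use yc span indep in blast)+

  \<comment> \<open>An element of rank \<open>m\<close> has a left factor \<open>y p\<close>, which
    absorbs \<open>E\<close>; conversely \<open>E\<close> is a sum of classes of elements of rank
    \<open>m\<close>.\<close>
  have sand: "proj m ` span (Suc m) = sandwich ?R E"
  proof
    have id: "ideal (sandwich ?R E) ?R" by (rule h.S.sandwich_ideal[OF E(1)])
    then interpret I: ideal "sandwich ?R E" ?R .
    show "proj m ` span (Suc m) \<subseteq> sandwich ?R E"
    proof
      fix r assume "r \<in> proj m ` span (Suc m)"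
      then obtain f where f: "f \<in> span (Suc m)" and r: "r = proj m f" by blast
      have "Poly_Mapping.keys f \<subseteq> {a\<in>M. w a \<le> m}" "{a\<in>M. w a \<le> m} \<subseteq> M" using f by (auto simp: span_def)
      then show "r \<in> sandwich ?R E" unfolding r
      proof (induction f rule: span_induct)
        case zero
        show ?case using I.zero_closed by (simp add: proj0)
      next
        case (add f g)
        then have "Poly_Mapping.keys f \<subseteq> M" "Poly_Mapping.keys g \<subseteq> M" by auto
        then show ?case using I.a_closed[OF add(3,4)] by (simp add: proj_add)
      next
        case (single a z)
        show ?case
        proof (cases "w a < m")
          case True
          then show ?thesis using low single I.zero_closed by simp
        next
          case False
          then have wa: "a \<in> M" "w a = m" using single by auto
          define p where "p = a \<bullet> star a"
          have p: "p \<in> T" using T_of wa by (simp add: p_def)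
          obtain b where b: "Poly_Mapping.keys b \<subseteq> M"
            "proj m (sng a z) = y p \<otimes>\<^bsub>?R\<^esub> (c (e p) \<otimes>\<^bsub>?R\<^esub> proj m b)"
            using factor[OF wa p_def] by blast
          let ?b = "c (e p) \<otimes>\<^bsub>?R\<^esub> proj m b"
          have "?b \<in> carrier ?R" using cc[OF e[OF p]] proj_closed[OF b(1)] by simp
          moreover have "y p = y p \<otimes>\<^bsub>?R\<^esub> E" using absE[OF e[OF p] yc[OF p]] by simp
          ultimately show ?thesis unfolding b(2)
            using h.S.sandwich_memI[of "y p" ?b E] yc[OF p] by simp
        qed
      qed
    qed
    let ?J = "proj m ` span (Suc m)"
    have FJ: "e' \<in> ?J" if "e' \<in> F" for e'
      using idem_span[OF m] that unfolding c_def F_def by blast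
    have Jadd: "r \<oplus>\<^bsub>?R\<^esub> s \<in> ?J" if rs: "r \<in> ?J" "s \<in> ?J" for r s
    proof -
      obtain f g where fg: "f \<in> span (Suc m)" "g \<in> span (Suc m)" "r = proj m f" "s = proj m g" using rs by blast
      then have "r \<oplus>\<^bsub>?R\<^esub> s = proj m (f + g)" using span_closed(1)[of "Suc m"] by (simp add: proj_add subset_iff)
      then show ?thesis using fg span_closed(2) by blast
    qed
    have J0: "\<zero>\<^bsub>?R\<^esub> \<in> ?J" using proj0 span_closed(3) by (metis imageI)
    have EJ: "E \<in> ?J"
    proof -
      have "(\<Oplus>\<^bsub>?R\<^esub>e'\<in>G. e') \<in> ?J" if "finite G" "G \<subseteq> F" for G
        using that
      proof (induction G)
        case (insert e' G)
        have "(\<Oplus>\<^bsub>?R\<^esub>e'\<in>insert e' G. e') = e' \<oplus>\<^bsub>?R\<^esub> (\<Oplus>\<^bsub>?R\<^esub>e'\<in>G. e')"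
          by (rule h.S.finsum_insert) (use insert cc in \<open>auto simp: F_def\<close>)
        then show ?case using insert Jadd[OF FJ[of e']] by simp
      qed (use J0 in simp)
      then show ?thesis unfolding E_def using finF by blast
    qed
    show "sandwich ?R E \<subseteq> ?J"
    proof -
      have Jc: "?J \<subseteq> carrier ?R"
        using span_closed(1)[of "Suc m"] proj_closed by (auto simp: subset_iff)
      have Jl: "r \<otimes>\<^bsub>?R\<^esub> s \<in> ?J" "s \<otimes>\<^bsub>?R\<^esub> r \<in> ?J" if r: "r \<in> carrier ?R" and s: "s \<in> ?J" for r s
      proof -
        obtain f g where fg: "Poly_Mapping.keys f \<subseteq> M" "r = proj m f" "g \<in> span (Suc m)" "s = proj m g"
          using proj_surj[OF r] s by blast
        have gM: "Poly_Mapping.keys g \<subseteq> M" using fg by (auto simp: span_def)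
        have "conv f g \<in> span (Suc m)" "conv g f \<in> span (Suc m)"
          using ideal.I_l_closed[OF span_ideal fg(3), of f] ideal.I_r_closed[OF span_ideal fg(3), of f] fg gM by auto
        then show "r \<otimes>\<^bsub>?R\<^esub> s \<in> ?J" "s \<otimes>\<^bsub>?R\<^esub> r \<in> ?J" using fg gM by (auto simp: proj_mult)
      qed
      have "subgroup ?J (add_monoid ?R)"
      proof (rule h.S.add.subgroupI)
        show "?J \<subseteq> carrier ?R" "?J \<noteq> {}" using Jc J0 by auto
        show "\<ominus>\<^bsub>?R\<^esub> r \<in> ?J" if "r \<in> ?J" for r
        proof -
          have "\<ominus>\<^bsub>?R\<^esub> \<one>\<^bsub>?R\<^esub> \<otimes>\<^bsub>?R\<^esub> r \<in> ?J" using Jl(1) that by simp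
          moreover have "r \<in> carrier ?R" using Jc that by blast
          ultimately show ?thesis using h.S.l_minus[of "\<one>\<^bsub>?R\<^esub>" r] by simp
        qed
      qed (use Jadd in blast)
      then have "ideal ?J ?R" by (intro idealI h.S.ring_axioms) (use Jl in auto)
      then show ?thesis using h.S.sandwich_subset_ideal EJ by blast
    qed
  qed
  show ?thesis unfolding heredity_ideal_def sand
    using idE ssE bij h.S.sandwich_ideal[OF E(1)] by blast
qed

text \<open>Speaks of the ideals \<open>J m\<close> alone; the idempotents that witness heredity are
  those constructed in \<open>heredity_layer\<close>.\<close>

theorem heredity_chain_span:
  assumes J: "\<And>m. m \<le> N \<Longrightarrow> J m = span (Suc m)"
    and ss: "\<And>m e. m \<le> N \<Longrightarrow> e \<in> \<Lambda> m \<Longrightarrow> semisimple_ring (corner_ring (layer_quot m) (proj m (idem e)))"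
  shows "heredity_chain alg N J"
proof -
  have prev: "prev_ideal alg J m = span m" if "m \<le> N" for m
    using J[of "m - 1"] that by (cases m) (auto simp: prev_ideal_def)
  \<comment> \<open>Climbing from rank 0 by \<open>rank_step\<close>. A basis element of each rank
    is what makes the inclusions strict.\<close>
  have ranks: "\<exists>a\<in>M. w a = m" if "m \<le> N" for m
    using that
  proof (induction m)
    case (Suc m)
    then show ?case using rank_step by (metis Suc_le_eq less_imp_le)
  qed (rule rank_zero)
  have strict: "span m \<subset> span (Suc m)" if "m \<le> N" for m
  proof
    show "span m \<subseteq> span (Suc m)" by (auto simp: span_def)
    obtain a where a: "a \<in> M" "w a = m" using ranks[OF \<open>m \<le> N\<close>] by blast
    then have "sng a 1 \<in> span (Suc m)" "sng a 1 \<notin> span m" by (auto simp: span_def)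
    then show "span m \<noteq> span (Suc m)" by blast
  qed
  have "J N = carrier alg" using J[of N] rank_bound by (force simp: span_def)
  then show ?thesis
    unfolding heredity_chain_def
    using prev J strict span_ideal heredity_layer ss alg_ring by simp
qed

end

section \<open>Diagrams as linear relations over the field with two elements\<close>

section \<open>Partition diagrams as relations on subsets\<close>

text \<open>A diagram is encoded by the relation \<open>sat n a\<close> between subsets of \<open>{1..n}\<close> consisting of the
  pairs \<open>(X, Y)\<close> such that \<open>X \<union> Y'\<close> is a union of parts. Composition of diagrams becomes relational
  composition, and \<open>2 ^ closed_count\<close> counts intermediate subsets; associativity of composition and
  the cocycle identity for \<open>closed_count\<close> are then immediate.\<close>

abbreviation verts :: "nat \<Rightarrow> point set" where "verts n \<equiv> row n 0 \<union> row n 1"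

lemma mem_row [simp]: "(i, t) \<in> row n s \<longleftrightarrow> i \<in> {1..n} \<and> t = s"
  by (auto simp: row_def)

lemma equivDs:
  assumes "equiv A E"
  shows "E \<subseteq> A \<times> A" "x \<in> A \<Longrightarrow> (x, x) \<in> E" "(x, y) \<in> E \<Longrightarrow> (y, x) \<in> E"
    "(x, y) \<in> E \<Longrightarrow> (y, z) \<in> E \<Longrightarrow> (x, z) \<in> E" "(x, y) \<in> E \<Longrightarrow> x \<in> A \<and> y \<in> A"
  using assms unfolding equiv_def by (auto dest: refl_onD symD transD)

lemma rel_of_equiv: "partition_on A a \<Longrightarrow> equiv A (rel_of a)"
  unfolding rel_of_def by (rule equiv_partition_on)

lemma rel_of_quotient: assumes "equiv A E" shows "rel_of (A // E) = E"
proof -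
  have "(x, y) \<in> E \<longleftrightarrow> (\<exists>p\<in>A // E. x \<in> p \<and> y \<in> p)" for x y
  proof
    assume xy: "(x, y) \<in> E"
    then have "x \<in> A" using equivDs(5)[OF assms] by blast
    then have "E `` {x} \<in> A // E" "x \<in> E `` {x}" "y \<in> E `` {x}"
      using xy equivDs(2)[OF assms] by (auto intro: quotientI)
    then show "\<exists>p\<in>A // E. x \<in> p \<and> y \<in> p" by blast
  next
    assume "\<exists>p\<in>A // E. x \<in> p \<and> y \<in> p"
    then show "(x, y) \<in> E" using quotient_eq_iff[OF assms] by blast
  qed
  then show ?thesis by (auto simp: rel_of_def)
qed

lemma quotient_rel_of: assumes "partition_on A a" shows "A // rel_of a = a"
  using partition_on_eq_quotient[OF assms] by (simp add: rel_of_def)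

lemma quotient_diagram: "equiv (verts n) E \<Longrightarrow> verts n // E \<in> diagrams n"
  unfolding diagrams_def by (simp add: partition_on_quotient)

lemma diagram_equiv: "a \<in> diagrams n \<Longrightarrow> equiv (verts n) (rel_of a)"
  unfolding diagrams_def by (simp add: rel_of_equiv)

lemma diagram_eq_quotient: "a \<in> diagrams n \<Longrightarrow> verts n // rel_of a = a"
  unfolding diagrams_def by (simp add: quotient_rel_of)

lemma diagram_eqI: "a \<in> diagrams n \<Longrightarrow> b \<in> diagrams n \<Longrightarrow> rel_of a = rel_of b \<Longrightarrow> a = b"
  using diagram_eq_quotient by metis

lemma finite_diagrams: "finite (diagrams n)"
proof -
  have "diagrams n \<subseteq> Pow (Pow (verts n))" by (auto simp: diagrams_def partition_on_def)
  moreover have "finite (verts n)" by (auto simp: row_def)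
  ultimately show ?thesis by (meson finite_Pow_iff finite_subset)
qed

lemma refines_iff_rel_of:
  assumes a: "a \<in> diagrams n" and b: "b \<in> diagrams n"
  shows "refines (verts n) a b \<longleftrightarrow> rel_of a \<subseteq> rel_of b"
proof
  assume "refines (verts n) a b"
  then have *: "\<exists>q\<in>b. p \<subseteq> q" if "p \<in> a" for p using that by (simp add: refines_def)
  show "rel_of a \<subseteq> rel_of b"
  proof (rule subrelI)
    fix x y assume "(x, y) \<in> rel_of a"
    then obtain p where p: "p \<in> a" "x \<in> p" "y \<in> p" by (auto simp: rel_of_def)
    obtain q where "q \<in> b" "p \<subseteq> q" using *[OF p(1)] by blast
    then have "q \<in> b \<and> x \<in> q \<and> y \<in> q" using p by blast
    then show "(x, y) \<in> rel_of b" by (auto simp: rel_of_def)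
  qed
next
  assume *: "rel_of a \<subseteq> rel_of b"
  have "\<exists>Y\<in>b. p \<subseteq> Y" if p: "p \<in> a" for p
  proof -
    have a': "partition_on (verts n) a" using a by (simp add: diagrams_def)
    obtain x where x: "x \<in> p" using p a' by (metis partition_onD3 ex_in_conv)
    have "x \<in> verts n" using x p a' partition_onD1 by fastforce
    then have "rel_of b `` {x} \<in> verts n // rel_of b" by (rule quotientI)
    then have "rel_of b `` {x} \<in> b" using diagram_eq_quotient[OF b] by simp
    moreover have "p \<subseteq> rel_of b `` {x}"
    proof
      fix y assume "y \<in> p"
      then have "(x, y) \<in> rel_of a" using x p by (auto simp: rel_of_def)
      then show "y \<in> rel_of b `` {x}" using * by blast
    qed
    ultimately show ?thesis by blast
  qed
  then show "refines (verts n) a b" using a b by (simp add: refines_def diagrams_def)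
qed

definition lift :: "nat set \<Rightarrow> nat set \<Rightarrow> point set" where
  "lift X' Y' = X' \<times> {0} \<union> Y' \<times> {1}"

definition sat :: "nat \<Rightarrow> diagram \<Rightarrow> (nat set \<times> nat set) set" where
  "sat n a = {(X', Y'). X' \<subseteq> {1..n} \<and> Y' \<subseteq> {1..n} \<and>
     (\<forall>(x, y)\<in>rel_of a. x \<in> lift X' Y' \<longleftrightarrow> y \<in> lift X' Y')}"

lemma sat_subset: "sat n a \<subseteq> Pow {1..n} \<times> Pow {1..n}"
  by (auto simp: sat_def)

lemma finite_sat: "finite (sat n a)"
  by (rule finite_subset[OF sat_subset]) auto

lemma sat_quotient:
  "equiv (verts n) E \<Longrightarrow> (U, W) \<in> sat n (verts n // E) \<longleftrightarrow> U \<subseteq> {1..n} \<and> W \<subseteq> {1..n} \<and>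
     (\<forall>(x, y)\<in>E. x \<in> lift U W \<longleftrightarrow> y \<in> lift U W)"
  by (simp add: sat_def rel_of_quotient)

text \<open>The direction from subsets to vertices uses one test set: the part of \<open>b\<close>
  containing a vertex is saturated for \<open>b\<close>, hence for \<open>a\<close>, so it contains
  every vertex that \<open>a\<close> joins to that one.\<close>

lemma sat_le_iff:
  assumes a: "a \<in> diagrams n" and b: "b \<in> diagrams n"
  shows "sat n b \<subseteq> sat n a \<longleftrightarrow> rel_of a \<subseteq> rel_of b"
proof
  assume "rel_of a \<subseteq> rel_of b"
  then show "sat n b \<subseteq> sat n a" by (fastforce simp: sat_def)
next
  assume *: "sat n b \<subseteq> sat n a"
  show "rel_of a \<subseteq> rel_of b"
  proof clarify
    fix i s j t assume xy: "((i, s), (j, t)) \<in> rel_of a"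
    let ?x = "(i, s)" and ?y = "(j, t)"
    note eb = diagram_equiv[OF b] and ea = diagram_equiv[OF a]
    have V: "?x \<in> verts n" using equivDs(5)[OF ea xy] by blast
    define C where "C = rel_of b `` {?x}"
    have CV: "C \<subseteq> verts n" using equivDs(5)[OF eb] by (auto simp: C_def)
    define U W where "U = {i. (i, 0) \<in> C}" and "W = {i. (i, 1) \<in> C}"
    have L: "lift U W = C"
    proof -
      have "(i, t) \<in> C \<longleftrightarrow> (i, t) \<in> lift U W" for i t
        using CV by (auto simp: lift_def U_def W_def)
      then show ?thesis by auto
    qed
    have "x \<in> C \<longleftrightarrow> y \<in> C" if "(x, y) \<in> rel_of b" for x y
      using that equivDs(3,4)[OF eb] unfolding C_def by blast
    moreover have "U \<subseteq> {1..n}" "W \<subseteq> {1..n}" using CV by (auto simp: U_def W_def)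
    ultimately have "(U, W) \<in> sat n b" by (auto simp: sat_def L)
    then have "(U, W) \<in> sat n a" using * by blast
    then have "\<forall>(x, y)\<in>rel_of a. x \<in> C \<longleftrightarrow> y \<in> C" by (simp add: sat_def L)
    then have "?x \<in> C \<longleftrightarrow> ?y \<in> C" using xy by blast
    moreover have "?x \<in> C" unfolding C_def using equiv_class_self[OF eb V] .
    ultimately show "(?x, ?y) \<in> rel_of b" by (simp add: C_def)
  qed
qed

lemma sat_inj: "a \<in> diagrams n \<Longrightarrow> b \<in> diagrams n \<Longrightarrow> sat n a = sat n b \<Longrightarrow> a = b"
  using sat_le_iff[of a n b] sat_le_iff[of b n a] by (intro diagram_eqI) auto

lemma refines_iff_sat: "a \<in> diagrams n \<Longrightarrow> b \<in> diagrams n \<Longrightarrow> refines (verts n) a b \<longleftrightarrow> sat n b \<subseteq> sat n a"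
  using refines_iff_rel_of sat_le_iff by simp

lemma sat_empty: "({}, {}) \<in> sat n a"
  by (auto simp: sat_def lift_def)

text \<open>Symmetric difference is addition over the field with two elements, and
  \<open>sat n a\<close> is a subspace, that is, a linear relation. The counts below rest on the
  fibres being cosets of one kernel.\<close>

lemma sat_sym_diff:
  assumes "(U, W) \<in> sat n a" "(U', W') \<in> sat n a"
  shows "(sym_diff U U', sym_diff W W') \<in> sat n a"
proof -
  have "lift (sym_diff U U') (sym_diff W W') = sym_diff (lift U W) (lift U' W')"
    by (auto simp: lift_def)
  then show ?thesis using assms by (fastforce simp: sat_def)
qed

subsection \<open>Composition\<close>

definition stack_rel :: "diagram \<Rightarrow> diagram \<Rightarrow> (point \<times> point) set" where
  "stack_rel a b = (rel_of a \<union> rel_of (shift b))\<^sup>+"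

definition lift3 :: "nat set \<Rightarrow> nat set \<Rightarrow> nat set \<Rightarrow> point set" where
  "lift3 U Y' W = U \<times> {0} \<union> Y' \<times> {1} \<union> W \<times> {2}"

lemma rel_of_shift: "((i, s), (j, t)) \<in> rel_of (shift b) \<longleftrightarrow>
    (\<exists>s' t'. s = Suc s' \<and> t = Suc t' \<and> ((i, s'), (j, t')) \<in> rel_of b)"
proof -
  have "((i, s) \<in> (\<lambda>(i, t). (i, Suc t)) ` p) \<longleftrightarrow> (\<exists>s'. s = Suc s' \<and> (i, s') \<in> p)" for i s and p :: "point set"
    by (force simp: image_iff)
  then show ?thesis unfolding rel_of_def shift_def by auto
qed

lemma stack_equiv:
  assumes a: "a \<in> diagrams n" and b: "b \<in> diagrams n"
  shows "equiv (row n 0 \<union> row n 1 \<union> row n 2) (stack_rel a b)"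
proof -
  let ?R = "rel_of a \<union> rel_of (shift b)" and ?V = "row n 0 \<union> row n 1 \<union> row n 2"
  note ea = diagram_equiv[OF a] and eb = diagram_equiv[OF b]
  have Va: "(x, y) \<in> rel_of a \<Longrightarrow> x \<in> verts n \<and> y \<in> verts n" for x y
    using equivDs(5)[OF ea] by blast
  have Vb: "(x, y) \<in> rel_of b \<Longrightarrow> x \<in> verts n \<and> y \<in> verts n" for x y
    using equivDs(5)[OF eb] by blast
  have sub: "?R \<subseteq> ?V \<times> ?V"
  proof (rule subrelI)
    fix x y assume xy: "(x, y) \<in> ?R"
    obtain i s j t where p: "x = (i, s)" "y = (j, t)" by fastforce
    show "(x, y) \<in> ?V \<times> ?V"
      using xy Va[of "(i, s)" "(j, t)"] Vb[of "(i, s - 1)" "(j, t - 1)"] unfolding p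
      by (auto simp: rel_of_shift)
  qed
  have "sym ?R"
  proof (rule symI)
    fix x y assume xy: "(x, y) \<in> ?R"
    obtain i s j t where p: "x = (i, s)" "y = (j, t)" by fastforce
    show "(y, x) \<in> ?R"
      using xy equivDs(3)[OF ea] equivDs(3)[OF eb] unfolding p by (auto simp: rel_of_shift)
  qed
  then have "sym (?R\<^sup>+)" by (rule sym_trancl)
  moreover have "refl_on ?V (?R\<^sup>+)"
  proof (rule refl_onI)
    fix x assume "x \<in> ?V"
    then obtain i t where x: "x = (i, t)" "i \<in> {1..n}" "t = 0 \<or> t = 1 \<or> t = 2" by (cases x) auto
    have "((i, 0), (i, 0)) \<in> rel_of a" "((i, 1), (i, 1)) \<in> rel_of a" "((i, 1), (i, 1)) \<in> rel_of b"
      using equivDs(2)[OF ea] equivDs(2)[OF eb] x by auto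
    then have "(x, x) \<in> ?R" using x(3) unfolding x(1) by (auto simp: rel_of_shift numeral_2_eq_2)
    then show "(x, x) \<in> ?R\<^sup>+" by blast
  qed
  moreover have "?R\<^sup>+ \<subseteq> ?V \<times> ?V" using sub by (rule trancl_subset_Sigma)
  ultimately show ?thesis unfolding equiv_def stack_rel_def by (simp add: trans_trancl)
qed

lemma stacked_eq: "stacked n a b = (row n 0 \<union> row n 1 \<union> row n 2) // stack_rel a b"
  by (simp add: stacked_def stack_rel_def)

text \<open>A set saturated for generating pairs is saturated for the relation they generate, and
  every generating pair stays within two adjacent rows.\<close>

lemma stack_closed_iff:
  assumes "U \<subseteq> {1..n}" "Y' \<subseteq> {1..n}" "W \<subseteq> {1..n}" and a: "a \<in> diagrams n" and b: "b \<in> diagrams n"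
  shows "(U, Y') \<in> sat n a \<and> (Y', W) \<in> sat n b \<longleftrightarrow>
    (\<forall>(x, y)\<in>stack_rel a b. x \<in> lift3 U Y' W \<longleftrightarrow> y \<in> lift3 U Y' W)"
proof -
  let ?L = "lift3 U Y' W" and ?R = "rel_of a \<union> rel_of (shift b)"
  have "(\<forall>(x, y)\<in>stack_rel a b. x \<in> ?L \<longleftrightarrow> y \<in> ?L) \<longleftrightarrow> (\<forall>(x, y)\<in>?R. x \<in> ?L \<longleftrightarrow> y \<in> ?L)"
  proof
    assume *: "\<forall>(x, y)\<in>?R. x \<in> ?L \<longleftrightarrow> y \<in> ?L"
    have "x \<in> ?L \<longleftrightarrow> y \<in> ?L" if "(x, y) \<in> ?R\<^sup>+" for x y
      using that by (induction rule: trancl_induct) (use * in auto)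
    then show "\<forall>(x, y)\<in>stack_rel a b. x \<in> ?L \<longleftrightarrow> y \<in> ?L" by (auto simp: stack_rel_def)
  qed (auto simp: stack_rel_def)
  also have "\<dots> \<longleftrightarrow> (\<forall>(x, y)\<in>rel_of a. x \<in> ?L \<longleftrightarrow> y \<in> ?L) \<and> (\<forall>(x, y)\<in>rel_of (shift b). x \<in> ?L \<longleftrightarrow> y \<in> ?L)"
    by blast
  also have "(\<forall>(x, y)\<in>rel_of a. x \<in> ?L \<longleftrightarrow> y \<in> ?L) \<longleftrightarrow> (\<forall>(x, y)\<in>rel_of a. x \<in> lift U Y' \<longleftrightarrow> y \<in> lift U Y')"
  proof -
    have "x \<in> ?L \<longleftrightarrow> x \<in> lift U Y'" if "x \<in> verts n" for x
      using that by (auto simp: lift_def lift3_def row_def)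
    moreover have "x \<in> verts n \<and> y \<in> verts n" if "(x, y) \<in> rel_of a" for x y
      using equivDs(5)[OF diagram_equiv[OF a] that] .
    ultimately show ?thesis by blast
  qed
  also have "(\<forall>(x, y)\<in>rel_of (shift b). x \<in> ?L \<longleftrightarrow> y \<in> ?L) \<longleftrightarrow> (\<forall>(x, y)\<in>rel_of b. x \<in> lift Y' W \<longleftrightarrow> y \<in> lift Y' W)"
  proof -
    have "(i, Suc s) \<in> ?L \<longleftrightarrow> (i, s) \<in> lift Y' W" for i s
      by (auto simp: lift_def lift3_def)
    then show ?thesis by (fastforce simp: rel_of_shift)
  qed
  finally show ?thesis using assms by (auto simp: sat_def)
qed

text \<open>Places the rows of a diagram as the outer rows of a stack, past the middle row
  \<open>1\<close>; on these rows it is inverse to the renaming in \<open>compose\<close>.\<close>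

definition up :: "point \<Rightarrow> point" where "up = (\<lambda>(i, t). (i, 2 * t))"

text \<open>Pulling the relation of the stack back along \<open>up\<close> takes the place of
  restricting and renaming parts, which makes \<open>sat_quotient\<close> applicable to a
  composite.\<close>

lemma compose_eq_quotient:
  assumes a: "a \<in> diagrams n" and b: "b \<in> diagrams n"
  defines "E \<equiv> {(x, y). x \<in> verts n \<and> y \<in> verts n \<and> (up x, up y) \<in> stack_rel a b}"
  shows "equiv (verts n) E" "compose n a b = verts n // E"
proof -
  note eq = stack_equiv[OF a b]
  let ?T = "stack_rel a b" and ?V = "row n 0 \<union> row n 1 \<union> row n 2" and ?O = "row n 0 \<union> row n 2"
  define dn :: "point \<Rightarrow> point" where "dn = (\<lambda>(i, t). (i, if t = 2 then 1 else t))"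
  have upV: "up x \<in> ?V" "up x \<in> ?O" "dn (up x) = x" if "x \<in> verts n" for x
    using that by (auto simp: up_def dn_def split: prod.splits)
  have dnV: "dn x \<in> verts n" "up (dn x) = x" if "x \<in> ?O" for x
    using that by (auto simp: up_def dn_def split: prod.splits)
  show E: "equiv (verts n) E"
  proof (rule equivI)
    show "E \<subseteq> verts n \<times> verts n" by (auto simp: E_def)
    show "refl_on (verts n) E" using equivDs(2)[OF eq] upV(1) by (intro refl_onI) (simp add: E_def)
    show "sym E" using equivDs(3)[OF eq] unfolding E_def sym_def by blast
    show "trans E" using equivDs(4)[OF eq] unfolding E_def trans_def by blast
  qed
  have cls: "dn ` (?T `` {up x} \<inter> ?O) = E `` {x}" if x: "x \<in> verts n" for x
  proof (intro equalityI subsetI)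
    fix y assume "y \<in> dn ` (?T `` {up x} \<inter> ?O)"
    then obtain z where "z \<in> ?O" "(up x, z) \<in> ?T" "y = dn z" by blast
    then show "y \<in> E `` {x}" using x dnV[of z] by (simp add: E_def)
  next
    fix y assume "y \<in> E `` {x}"
    then have "y \<in> verts n" "(up x, up y) \<in> ?T" by (auto simp: E_def)
    then have "dn (up y) \<in> dn ` (?T `` {up x} \<inter> ?O)" using upV by blast
    then show "y \<in> dn ` (?T `` {up x} \<inter> ?O)" using upV \<open>y \<in> verts n\<close> by simp
  qed
  have comp: "compose n a b = (\<lambda>p. dn ` p) ` ((\<lambda>p. p \<inter> ?O) ` (?V // ?T) - {{}})"
    unfolding compose_def stacked_eq dn_def ..
  show "compose n a b = verts n // E"
  proof (intro equalityI subsetI)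
    fix q assume "q \<in> compose n a b"
    then obtain p where p: "p \<in> ?V // ?T" "p \<inter> ?O \<noteq> {}" "q = dn ` (p \<inter> ?O)" unfolding comp by blast
    then obtain z where z: "z \<in> p" "z \<in> ?O" by blast
    obtain v where v: "p = ?T `` {v}" using p(1) by (blast elim: quotientE)
    then have "?T `` {z} = p" using z(1) equiv_class_eq[OF eq] by blast
    then have "q = E `` {dn z}" using cls[OF dnV(1)[OF z(2)]] dnV(2)[OF z(2)] p(3) by simp
    then show "q \<in> verts n // E" using dnV(1)[OF z(2)] by (simp add: quotientI)
  next
    fix q assume "q \<in> verts n // E"
    then obtain x where x: "x \<in> verts n" "q = E `` {x}" by (blast elim: quotientE)
    have "?T `` {up x} \<in> ?V // ?T" using upV[OF x(1)] by (intro quotientI)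
    moreover have "up x \<in> ?T `` {up x} \<inter> ?O" using upV[OF x(1)] equiv_class_self[OF eq] by blast
    ultimately have "?T `` {up x} \<inter> ?O \<in> (\<lambda>p. p \<inter> ?O) ` (?V // ?T) - {{}}" by blast
    then show "q \<in> compose n a b" unfolding comp x(2) cls[OF x(1), symmetric] by (rule imageI)
  qed
qed

lemma compose_diagram: "a \<in> diagrams n \<Longrightarrow> b \<in> diagrams n \<Longrightarrow> compose n a b \<in> diagrams n"
  using compose_eq_quotient(2)[of a n b] quotient_diagram[OF compose_eq_quotient(1)[of a n b]] by simp

text \<open>A saturated set of the stack restricts to one of the composite. Conversely, a saturated
  pair of outer subsets has a saturated hull in the stack, which adds nothing on the outer
  rows.\<close>

lemma sat_compose:
  assumes a: "a \<in> diagrams n" and b: "b \<in> diagrams n"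
  shows "sat n (compose n a b) = sat n a O sat n b"
proof -
  note eq = stack_equiv[OF a b] and ce = compose_eq_quotient[OF a b]
  let ?T = "stack_rel a b" and ?V = "row n 0 \<union> row n 1 \<union> row n 2"
  define E where "E = {(x, y). x \<in> verts n \<and> y \<in> verts n \<and> (up x, up y) \<in> ?T}"
  have upL: "up x \<in> lift3 U Y' W \<longleftrightarrow> x \<in> lift U W" if "x \<in> verts n" for x U Y' W
    using that by (auto simp: up_def lift_def lift3_def row_def)
  have mem: "(U, W) \<in> sat n (compose n a b) \<longleftrightarrow> U \<subseteq> {1..n} \<and> W \<subseteq> {1..n} \<and>
      (\<forall>(x, y)\<in>E. x \<in> lift U W \<longleftrightarrow> y \<in> lift U W)" for U W
    unfolding ce(2) using sat_quotient[OF ce(1)] by (simp add: E_def)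
  have "(U, W) \<in> sat n (compose n a b) \<longleftrightarrow> (\<exists>Y'. (U, Y') \<in> sat n a \<and> (Y', W) \<in> sat n b)" for U W
  proof
    assume "\<exists>Y'. (U, Y') \<in> sat n a \<and> (Y', W) \<in> sat n b"
    then obtain Y' where Y': "(U, Y') \<in> sat n a" "(Y', W) \<in> sat n b" by blast
    then have sub: "U \<subseteq> {1..n}" "Y' \<subseteq> {1..n}" "W \<subseteq> {1..n}" using sat_subset by blast+
    have "\<forall>(x, y)\<in>?T. x \<in> lift3 U Y' W \<longleftrightarrow> y \<in> lift3 U Y' W"
      using stack_closed_iff[OF sub a b] Y' by blast
    then have "\<forall>(x, y)\<in>E. x \<in> lift U W \<longleftrightarrow> y \<in> lift U W"
      using upL[of _ U Y' W] unfolding E_def by blast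
    then show "(U, W) \<in> sat n (compose n a b)" using sub mem by blast
  next
    assume UW: "(U, W) \<in> sat n (compose n a b)"
    then have sub: "U \<subseteq> {1..n}" "W \<subseteq> {1..n}" and cl: "\<forall>(x, y)\<in>E. x \<in> lift U W \<longleftrightarrow> y \<in> lift U W"
      using mem by auto
    \<comment> \<open>The hull of the outer subsets in the stack; its trace on the middle row is the
      intermediate subset.\<close>
    define S where "S = ?T `` (up ` lift U W)"
    define Y' where "Y' = {i. (i, 1) \<in> S}"
    have LV: "lift U W \<subseteq> verts n" using sub by (auto simp: lift_def)
    have SV: "S \<subseteq> ?V" using equivDs(5)[OF eq] unfolding S_def by blast
    have upS: "up x \<in> S \<longleftrightarrow> x \<in> lift U W" if x: "x \<in> verts n" for x
    proof
      assume "up x \<in> S"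
      then obtain y where y: "y \<in> lift U W" "(up y, up x) \<in> ?T" by (auto simp: S_def)
      then have "(y, x) \<in> E" using LV x unfolding E_def by blast
      then show "x \<in> lift U W" using cl y by blast
    next
      assume x': "x \<in> lift U W"
      have "up x \<in> ?V" using x by (auto simp: up_def row_def)
      then show "up x \<in> S" using x' equivDs(2)[OF eq] unfolding S_def by blast
    qed
    have L: "lift3 U Y' W = S"
    proof -
      have "(i, t) \<in> lift3 U Y' W \<longleftrightarrow> (i, t) \<in> S" for i t
        using upS[of "(i, 0)"] upS[of "(i, 1)"] SV sub
        by (cases "t = 0"; cases "t = 1"; cases "t = 2") (auto simp: up_def lift_def lift3_def Y'_def)
      then show ?thesis by auto
    qed
    have Y'n: "Y' \<subseteq> {1..n}" using SV by (auto simp: Y'_def)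
    have "\<forall>(x, y)\<in>?T. x \<in> S \<longleftrightarrow> y \<in> S"
      using equivDs(3,4)[OF eq] unfolding S_def by blast
    then show "\<exists>Y'. (U, Y') \<in> sat n a \<and> (Y', W) \<in> sat n b"
      using stack_closed_iff[OF sub(1) Y'n sub(2) a b] unfolding L by blast
  qed
  then show ?thesis by auto
qed

text \<open>A saturated set of middle vertices is a union of parts inside the middle row, and each
  selection of such parts yields one.\<close>

lemma closed_count_card:
  assumes a: "a \<in> diagrams n" and b: "b \<in> diagrams n"
  shows "card {Y'. ({}, Y') \<in> sat n a \<and> (Y', {}) \<in> sat n b} = 2 ^ closed_count n a b"
proof -
  note eq = stack_equiv[OF a b]
  let ?T = "stack_rel a b" and ?V = "row n 0 \<union> row n 1 \<union> row n 2"
  define C where "C = {p \<in> stacked n a b. p \<subseteq> row n 1}"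
  have CQ: "C \<subseteq> ?V // ?T" by (auto simp: C_def stacked_eq)
  have finC: "finite C"
    by (rule finite_subset[OF CQ]) (rule finite_quotient, use equivDs(1)[OF eq] in \<open>auto simp: row_def\<close>)
  have disj: "p = q" if "p \<in> C" "q \<in> C" "x \<in> p" "x \<in> q" for p q x
    using that CQ quotient_disj[OF eq] by blast
  let ?f = "\<lambda>P. {i. (i, 1) \<in> \<Union>P}"
  let ?Y = "{Y'. ({}, Y') \<in> sat n a \<and> (Y', {}) \<in> sat n b}"
  have f_lift: "lift3 {} (?f P) {} = \<Union>P" if "P \<subseteq> C" for P
    using that by (fastforce simp: lift3_def C_def row_def)
  have "bij_betw ?f (Pow C) ?Y"
  proof (rule bij_betw_imageI)
    show "inj_on ?f (Pow C)"
    proof (rule inj_onI)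
      fix P Q assume PQ: "P \<in> Pow C" "Q \<in> Pow C" and "?f P = ?f Q"
      then have U: "\<Union>P = \<Union>Q" using f_lift by (metis PowD)
      have ne: "p \<noteq> {}" if "p \<in> C" for p using that CQ in_quotient_imp_non_empty[OF eq] by blast
      have "P' \<subseteq> Q'" if "P' \<subseteq> C" "Q' \<subseteq> C" "\<Union>P' = \<Union>Q'" for P' Q'
      proof
        fix p assume p: "p \<in> P'"
        then have "p \<in> C" using that(1) by blast
        then obtain x where x: "x \<in> p" using ne by blast
        then have "x \<in> \<Union>Q'" using p that(3) by blast
        then obtain q where q: "q \<in> Q'" "x \<in> q" by blast
        then have "p = q" using disj[OF \<open>p \<in> C\<close> _ x q(2)] that(2) by blast
        then show "p \<in> Q'" using q by simp
      qed
      from this[of P Q] this[of Q P] show "P = Q" using PQ U by simp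
    qed
    show "?f ` Pow C = ?Y"
    proof (intro equalityI subsetI)
      fix Z assume "Z \<in> ?f ` Pow C"
      then obtain P where P: "P \<subseteq> C" "Z = ?f P" by blast
      have Z: "Z \<subseteq> {1..n}" using P by (fastforce simp: C_def row_def)
      have "\<forall>(x, y)\<in>?T. x \<in> \<Union>P \<longleftrightarrow> y \<in> \<Union>P"
      proof -
        have "x \<in> p \<longleftrightarrow> y \<in> p" if "(x, y) \<in> ?T" "p \<in> P" for x y p
        proof -
          have "p \<in> ?V // ?T" using that P CQ by blast
          then obtain v where "p = ?T `` {v}" by (blast elim: quotientE)
          then show ?thesis using that(1) equivDs(3,4)[OF eq] by blast
        qed
        then show ?thesis by blast
      qed
      then show "Z \<in> ?Y"
        using stack_closed_iff[OF _ Z _ a b, of "{}" "{}"] f_lift[OF P(1)] P(2) by auto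
    next
      fix Z assume Z: "Z \<in> ?Y"
      then have Zn: "Z \<subseteq> {1..n}" using sat_subset by blast
      have cl: "\<forall>(x, y)\<in>?T. x \<in> lift3 {} Z {} \<longleftrightarrow> y \<in> lift3 {} Z {}"
        using stack_closed_iff[OF _ Zn _ a b, of "{}" "{}"] Z by auto
      let ?P = "{?T `` {(i, 1)} | i. i \<in> Z}"
      have self: "(i, 1) \<in> ?T `` {(i, 1)}" if "i \<in> Z" for i
        by (rule equiv_class_self[OF eq]) (use Zn that in auto)
      have sub: "?T `` {(i, 1)} \<subseteq> Z \<times> {1}" if "i \<in> Z" for i
        using cl that by (fastforce simp: lift3_def)
      have "?P \<subseteq> C"
      proof clarify
        fix i assume i: "i \<in> Z"
        have "?T `` {(i, 1)} \<in> ?V // ?T" using Zn i by (intro quotientI) auto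
        moreover have "?T `` {(i, 1)} \<subseteq> row n 1" using sub[OF i] Zn by (auto simp: row_def)
        ultimately show "?T `` {(i, 1)} \<in> C" by (simp add: C_def stacked_eq)
      qed
      moreover have "?f ?P = Z"
      proof (intro equalityI subsetI)
        fix j assume "j \<in> ?f ?P"
        then obtain i where "i \<in> Z" "(j, 1) \<in> ?T `` {(i, 1)}" by blast
        then show "j \<in> Z" using sub by blast
      qed (use self in blast)
      ultimately have "Z = ?f ?P" "?P \<in> Pow C" by (simp, blast)
      then show "Z \<in> ?f ` Pow C" by (rule image_eqI)
    qed
  qed
  then have "card ?Y = card (Pow C)" by (simp add: bij_betw_same_card)
  also have "\<dots> = 2 ^ closed_count n a b" using finC by (simp add: card_Pow closed_count_def C_def)
  finally show ?thesis .
qed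

lemma sat_kernel_translate:
  assumes "(U, W) \<in> sat n a"
  shows "(U', W) \<in> sat n a \<longleftrightarrow> (sym_diff U U', {}) \<in> sat n a"
proof
  assume "(U', W) \<in> sat n a"
  from sat_sym_diff[OF assms this] show "(sym_diff U U', {}) \<in> sat n a" by simp
next
  assume "(sym_diff U U', {}) \<in> sat n a"
  moreover have "sym_diff U (sym_diff U U') = U'" "sym_diff W {} = W" by auto
  ultimately show "(U', W) \<in> sat n a" using sat_sym_diff[OF assms, of "sym_diff U U'" "{}"] by simp
qed

text \<open>The three pairs add up to \<open>(U, W)\<close>. This property of linear relations is
  what makes a diagram regular with its flip as inverse.\<close>

lemma sat_three:
  assumes "(U, Y') \<in> sat n a" "(U', Y') \<in> sat n a" "(U', W) \<in> sat n a"
  shows "(U, W) \<in> sat n a"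
proof -
  have "sym_diff (sym_diff U U') U' = U" "sym_diff (sym_diff Y' Y') W = W" by auto
  then show ?thesis using sat_sym_diff[OF sat_sym_diff[OF assms(1,2)] assms(3)] by simp
qed

text \<open>Translation by one solution \<open>Y0\<close> identifies the intermediate subsets for
  \<open>(U, W)\<close> with those for the pair of empty sets, so their number does not depend on
  the pair.\<close>

lemma card_middle:
  assumes a: "a \<in> diagrams n" and b: "b \<in> diagrams n" and UW: "(U, W) \<in> sat n (compose n a b)"
  shows "card {Y'. (U, Y') \<in> sat n a \<and> (Y', W) \<in> sat n b} = 2 ^ closed_count n a b"
proof -
  obtain Y0 where Y0: "(U, Y0) \<in> sat n a" "(Y0, W) \<in> sat n b" using UW sat_compose[OF a b] by auto
  let ?A = "{Y'. ({}, Y') \<in> sat n a \<and> (Y', {}) \<in> sat n b}"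
  let ?B = "{Y'. (U, Y') \<in> sat n a \<and> (Y', W) \<in> sat n b}"
  have inv: "sym_diff Y0 (sym_diff Y0 Y') = Y'" for Y' by auto
  have "bij_betw (sym_diff Y0) ?A ?B"
  proof (rule bij_betw_byWitness[of _ "sym_diff Y0"])
    show "sym_diff Y0 ` ?A \<subseteq> ?B"
      using sat_sym_diff[OF Y0(1), of "{}"] sat_sym_diff[OF Y0(2), of _ "{}"] by auto
    show "sym_diff Y0 ` ?B \<subseteq> ?A"
      using sat_sym_diff[OF Y0(1), of U] sat_sym_diff[OF Y0(2), of _ W] by auto
  qed (use inv in auto)
  then show ?thesis using closed_count_card[OF a b] bij_betw_same_card by fastforce
qed

lemma compose_assoc:
  assumes "a \<in> diagrams n" "b \<in> diagrams n" "c \<in> diagrams n"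
  shows "compose n (compose n a b) c = compose n a (compose n b c)"
  by (rule sat_inj[of _ n]) (use assms in \<open>auto simp: compose_diagram sat_compose O_assoc\<close>)

text \<open>Double counting of the pairs of intermediate subsets that lead through \<open>a\<close>,
  \<open>b\<close>, \<open>c\<close> from the empty set to the empty set. Summing last over one or
  the other of the two subsets gives the two sides as exponents of 2.\<close>

lemma closed_count_cocycle:
  assumes a: "a \<in> diagrams n" and b: "b \<in> diagrams n" and c: "c \<in> diagrams n"
  shows "closed_count n a b + closed_count n (compose n a b) c =
    closed_count n a (compose n b c) + closed_count n b c"
proof -
  note ab = compose_diagram[OF a b] and bc = compose_diagram[OF b c]
  define S where "S = {(Y', Z). ({}, Y') \<in> sat n a \<and> (Y', Z) \<in> sat n b \<and> (Z, {}) \<in> sat n c}"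
  let ?P = "Pow {1..n}"
  let ?A = "{Z. ({}, Z) \<in> sat n (compose n a b) \<and> (Z, {}) \<in> sat n c}"
  let ?B = "{Y'. ({}, Y') \<in> sat n a \<and> (Y', {}) \<in> sat n (compose n b c)}"
  have fin: "finite D" if "D \<subseteq> ?P" for D using that finite_subset by auto
  have finA: "finite ?A" and finB: "finite ?B" by (rule fin, use sat_subset in blast)+
  have finm: "finite {Y'. (U, Y') \<in> sat n a \<and> (Y', W) \<in> sat n b}" for U W and a b
    by (rule fin) (use sat_subset in blast)
  have "bij_betw (\<lambda>(Y', Z). (Z, Y')) S (Sigma ?A (\<lambda>Z. {Y'. ({}, Y') \<in> sat n a \<and> (Y', Z) \<in> sat n b}))"
    by (rule bij_betw_byWitness[of _ "\<lambda>(Z, Y'). (Y', Z)"]) (auto simp: S_def sat_compose[OF a b])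
  then have "card S = (\<Sum>Z\<in>?A. card {Y'. ({}, Y') \<in> sat n a \<and> (Y', Z) \<in> sat n b})"
    using finA finm by (simp add: bij_betw_same_card card_SigmaI)
  also have "\<dots> = (\<Sum>Z\<in>?A. 2 ^ closed_count n a b)"
    by (rule sum.cong) (auto simp: card_middle[OF a b])
  also have "\<dots> = 2 ^ (closed_count n a b + closed_count n (compose n a b) c)"
    using closed_count_card[OF ab c] by (simp add: power_add)
  finally have 1: "card S = 2 ^ (closed_count n a b + closed_count n (compose n a b) c)" .
  have "S = Sigma ?B (\<lambda>Y'. {Z. (Y', Z) \<in> sat n b \<and> (Z, {}) \<in> sat n c})"
    by (auto simp: S_def sat_compose[OF b c])
  then have "card S = (\<Sum>Y'\<in>?B. card {Z. (Y', Z) \<in> sat n b \<and> (Z, {}) \<in> sat n c})"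
    using finB finm by (simp add: card_SigmaI)
  also have "\<dots> = (\<Sum>Y'\<in>?B. 2 ^ closed_count n b c)"
    by (rule sum.cong) (auto simp: card_middle[OF b c])
  also have "\<dots> = 2 ^ (closed_count n a (compose n b c) + closed_count n b c)"
    using closed_count_card[OF a bc] by (simp add: power_add)
  finally show ?thesis using 1 by simp
qed

text \<open>The bounds on \<open>s\<close> and \<open>t\<close> keep the truncated subtraction
  \<open>1 - s\<close> from carrying other rows to row 0.\<close>

definition flip :: "nat \<Rightarrow> diagram \<Rightarrow> diagram" where
  "flip n a = verts n // {((i, s), (j, t)). s \<le> 1 \<and> t \<le> 1 \<and> ((i, 1 - s), (j, 1 - t)) \<in> rel_of a}"

lemma flip_equiv:
  assumes a: "a \<in> diagrams n"
  shows "equiv (verts n) {((i, s), (j, t)). s \<le> 1 \<and> t \<le> 1 \<and> ((i, 1 - s), (j, 1 - t)) \<in> rel_of a}"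
    (is "equiv _ ?E")
proof (rule equivI)
  note ea = diagram_equiv[OF a]
  show "?E \<subseteq> verts n \<times> verts n" using equivDs(5)[OF ea] by fastforce
  show "refl_on (verts n) ?E" using equivDs(2)[OF ea] by (intro refl_onI) auto
  show "sym ?E" using equivDs(3)[OF ea] by (auto intro!: symI)
  show "trans ?E" using equivDs(4)[OF ea] by (intro transI) blast
qed

lemma flip_diagram: "a \<in> diagrams n \<Longrightarrow> flip n a \<in> diagrams n"
  unfolding flip_def by (rule quotient_diagram[OF flip_equiv])

lemma sat_flip: assumes a: "a \<in> diagrams n" shows "sat n (flip n a) = (sat n a)\<inverse>"
proof -
  have l: "(i, 1 - s) \<in> lift W U \<longleftrightarrow> (i, s) \<in> lift U W" if "s \<le> 1" for i s U W
    using that by (cases s) (auto simp: lift_def)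
  have V: "s \<le> 1 \<and> t \<le> 1" if "((i, s), (j, t)) \<in> rel_of a" for i s j t
    using equivDs(5)[OF diagram_equiv[OF a] that] by auto
  have "(U, W) \<in> sat n (flip n a) \<longleftrightarrow> (W, U) \<in> sat n a" for U W
  proof
    assume L: "(U, W) \<in> sat n (flip n a)"
    then have LL: "(i, s) \<in> lift U W \<longleftrightarrow> (j, t) \<in> lift U W"
      if "s \<le> 1" "t \<le> 1" "((i, 1 - s), (j, 1 - t)) \<in> rel_of a" for i s j t
      using that unfolding flip_def sat_quotient[OF flip_equiv[OF a]] by blast
    have "(i, s) \<in> lift W U \<longleftrightarrow> (j, t) \<in> lift W U" if st: "((i, s), (j, t)) \<in> rel_of a" for i s j t
      using LL[of "1 - s" "1 - t" i j] V[OF st] st l[of "1 - s" i W U] l[of "1 - t" j W U] by simp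
    then show "(W, U) \<in> sat n a" using L unfolding flip_def sat_quotient[OF flip_equiv[OF a]] by (auto simp: sat_def)
  next
    assume R: "(W, U) \<in> sat n a"
    then show "(U, W) \<in> sat n (flip n a)"
      using l unfolding flip_def sat_quotient[OF flip_equiv[OF a]] by (fastforce simp: sat_def)
  qed
  then show ?thesis by auto
qed

lemma sat_identity: "sat n (identity_diagram n) = Id_on (Pow {1..n})"
  and identity_in_diagrams: "identity_diagram n \<in> diagrams n"
proof -
  show "identity_diagram n \<in> diagrams n"
  proof -
    have "identity_diagram n = (\<lambda>i. {(i, 0), (i, 1)}) ` {1..n}" by (auto simp: identity_diagram_def)
    moreover have "partition_on (verts n) ((\<lambda>i. {(i, 0), (i, 1)}) ` {1..n})"
    proof (rule partition_onI)
      show "\<Union>((\<lambda>i. {(i, 0), (i, 1)}) ` {1..n}) = verts n" unfolding row_def by auto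
    qed (auto simp: disjnt_def)
    ultimately show ?thesis by (simp add: diagrams_def del: One_nat_def)
  qed
  have "((i, s), (j, t)) \<in> rel_of (identity_diagram n) \<longleftrightarrow> i = j \<and> i \<in> {1..n} \<and> s \<in> {0, 1} \<and> t \<in> {0, 1}" for i s j t
    unfolding rel_of_def identity_diagram_def by auto
  then have "rel_of (identity_diagram n) = (\<Union>i\<in>{1..n}. \<Union>s\<in>{0, 1}. \<Union>t\<in>{0, 1}. {((i, s), (i, t))})"
    by auto
  then have "(U, W) \<in> sat n (identity_diagram n) \<longleftrightarrow> U \<subseteq> {1..n} \<and> W \<subseteq> {1..n} \<and>
      (\<forall>i\<in>{1..n}. \<forall>s\<in>{0, 1}. \<forall>t\<in>{0, 1}. (i, s) \<in> lift U W \<longleftrightarrow> (i, t) \<in> lift U W)" for U W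
    by (simp add: sat_def) blast
  moreover have "(\<forall>i\<in>{1..n}. \<forall>s\<in>{0, 1}. \<forall>t\<in>{0, 1}. (i, s) \<in> lift U W \<longleftrightarrow> (i, t) \<in> lift U W) \<longleftrightarrow>
      (\<forall>i\<in>{1..n}. i \<in> U \<longleftrightarrow> i \<in> W)" for U W
    by (auto simp: lift_def)
  ultimately have "(U, W) \<in> sat n (identity_diagram n) \<longleftrightarrow> U \<subseteq> {1..n} \<and> W \<subseteq> {1..n} \<and>
      (\<forall>i\<in>{1..n}. i \<in> U \<longleftrightarrow> i \<in> W)" for U W
    by simp
  also have "\<dots> U W \<longleftrightarrow> (U, W) \<in> Id_on (Pow {1..n})" for U W
    unfolding Id_on_iff by blast
  finally show "sat n (identity_diagram n) = Id_on (Pow {1..n})" by auto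
qed

lemma compose_identity:
  assumes a: "a \<in> diagrams n"
  shows "compose n (identity_diagram n) a = a" "compose n a (identity_diagram n) = a"
    "closed_count n (identity_diagram n) a = 0" "closed_count n a (identity_diagram n) = 0"
proof -
  note i = identity_in_diagrams[of n]
  have sub: "sat n a \<subseteq> Pow {1..n} \<times> Pow {1..n}" by (rule sat_subset)
  show "compose n (identity_diagram n) a = a"
    by (rule sat_inj[OF compose_diagram[OF i a] a]) (use sub in \<open>auto simp: sat_compose[OF i a] sat_identity relcomp_unfold Id_on_iff\<close>)
  show "compose n a (identity_diagram n) = a"
    by (rule sat_inj[OF compose_diagram[OF a i] a]) (use sub in \<open>auto simp: sat_compose[OF a i] sat_identity relcomp_unfold Id_on_iff\<close>)
  have e: "({}, {}) \<in> sat n a" by (rule sat_empty)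
  have "{Y'. ({}, Y') \<in> sat n (identity_diagram n) \<and> (Y', {}) \<in> sat n a} = {{}}"
    "{Y'. ({}, Y') \<in> sat n a \<and> (Y', {}) \<in> sat n (identity_diagram n)} = {{}}"
    using e by (auto simp: sat_identity)
  then have "2 ^ closed_count n (identity_diagram n) a = (1 :: nat)"
    "2 ^ closed_count n a (identity_diagram n) = (1 :: nat)"
    using closed_count_card[OF i a] closed_count_card[OF a i] by simp_all
  then show "closed_count n (identity_diagram n) a = 0" "closed_count n a (identity_diagram n) = 0" by simp_all
qed

lemma flip_flip: "a \<in> diagrams n \<Longrightarrow> flip n (flip n a) = a"
  by (rule sat_inj[of _ n]) (auto simp: flip_diagram sat_flip)

lemma flip_compose: "a \<in> diagrams n \<Longrightarrow> b \<in> diagrams n \<Longrightarrow>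
    flip n (compose n a b) = compose n (flip n b) (flip n a)"
  by (rule sat_inj[of _ n]) (auto simp: flip_diagram compose_diagram sat_flip sat_compose)

lemma compose_flip_regular:
  assumes a: "a \<in> diagrams n" shows "compose n (compose n a (flip n a)) a = a"
proof (rule sat_inj[of _ n])
  show "sat n (compose n (compose n a (flip n a)) a) = sat n a"
  proof -
    have "(sat n a O (sat n a)\<inverse>) O sat n a = sat n a"
    proof (rule equalityI; rule subrelI)
      fix U W assume "(U, W) \<in> (sat n a O (sat n a)\<inverse>) O sat n a"
      then obtain Y' U' where "(U, Y') \<in> sat n a" "(U', Y') \<in> sat n a" "(U', W) \<in> sat n a" by blast
      then show "(U, W) \<in> sat n a" by (rule sat_three)
    qed blast
    then show ?thesis by (simp add: a flip_diagram compose_diagram sat_compose sat_flip)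
  qed
qed (auto simp: a flip_diagram compose_diagram)

text \<open>Exponents are compared through the powers of 2 that count intermediate subsets, so no
  bijection between closed parts has to be constructed.\<close>

lemma closed_count_cong:
  assumes "a \<in> diagrams n" "b \<in> diagrams n" "a' \<in> diagrams n" "b' \<in> diagrams n"
    and "\<And>Y'. ({}, Y') \<in> sat n a \<and> (Y', {}) \<in> sat n b \<longleftrightarrow> ({}, Y') \<in> sat n a' \<and> (Y', {}) \<in> sat n b'"
  shows "closed_count n a b = closed_count n a' b'"
proof -
  have "2 ^ closed_count n a b = (2 ^ closed_count n a' b' :: nat)"
    unfolding closed_count_card[OF assms(1,2), symmetric] closed_count_card[OF assms(3,4), symmetric]
    using assms(5) by simp
  then show ?thesis by simp
qed

text \<open>Closed parts depend only on the kernel of \<open>a\<close> on its bottom row and that of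
  \<open>b\<close> on its top row, and a diagram shares this kernel with its projection on the same
  side.\<close>

lemma closed_count_proj:
  assumes a: "a \<in> diagrams n" and b: "b \<in> diagrams n"
  shows "closed_count n a b = closed_count n (compose n (flip n a) a) (compose n b (flip n b))"
proof (rule closed_count_cong[OF a b])
  fix Y'
  have "({}, Y') \<in> sat n a \<longleftrightarrow> ({}, Y') \<in> sat n (compose n (flip n a) a)"
    using sat_empty[of n a] sat_three[of "{}" "{}" n a] by (auto simp: sat_compose sat_flip flip_diagram a)
  moreover have "(Y', {}) \<in> sat n b \<longleftrightarrow> (Y', {}) \<in> sat n (compose n b (flip n b))"
    using sat_empty[of n b] sat_three[of Y' _ n b "{}" "{}"] by (auto simp: sat_compose sat_flip flip_diagram b)
  ultimately show "({}, Y') \<in> sat n a \<and> (Y', {}) \<in> sat n b \<longleftrightarrow>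
    ({}, Y') \<in> sat n (compose n (flip n a) a) \<and> (Y', {}) \<in> sat n (compose n b (flip n b))" by blast
qed (auto simp: a b flip_diagram compose_diagram)

section \<open>Vertex labellings with a partial bijection of labels as a calculus for
  composition\<close>

subsection \<open>Diagrams given by labellings\<close>

text \<open>Partial bijections; for a diagram the domain consists of the labels of propagating parts
  at the top, the range of those at the bottom.\<close>

definition pbij :: "('l \<times> 'm) set \<Rightarrow> bool" where
  "pbij \<theta> \<longleftrightarrow> single_valued \<theta> \<and> single_valued (\<theta>\<inverse>)"

lemma pbij_converse [simp]: "pbij (\<theta>\<inverse>) \<longleftrightarrow> pbij \<theta>"
  by (auto simp: pbij_def)

lemma pbij_Id_on [simp]: "pbij (Id_on A)"
  by (auto simp: pbij_def single_valued_def)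

lemma pbij_fun: "pbij \<theta> \<Longrightarrow> (x, y) \<in> \<theta> \<Longrightarrow> (x, y') \<in> \<theta> \<Longrightarrow> y = y'"
  by (auto simp: pbij_def dest: single_valuedD)

lemma pbij_inj: "pbij \<theta> \<Longrightarrow> (x, y) \<in> \<theta> \<Longrightarrow> (x', y) \<in> \<theta> \<Longrightarrow> x = x'"
  by (auto simp: pbij_def dest: single_valuedD)

lemma pbij_relcomp: "pbij \<theta> \<Longrightarrow> pbij \<eta> \<Longrightarrow> pbij (\<theta> O \<eta>)"
  by (auto simp: pbij_def converse_relcomp intro: single_valued_relcomp)

text \<open>The top vertices are labelled by \<open>f\<close>, the bottom ones by \<open>g\<close>. Equally labelled vertices of the
  same row are joined, and \<open>\<theta>\<close> says which top labels are joined to which bottom labels.\<close>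

definition label_rel :: "nat \<Rightarrow> (nat \<Rightarrow> 'l) \<Rightarrow> ('l \<times> 'm) set \<Rightarrow> (nat \<Rightarrow> 'm) \<Rightarrow> (point \<times> point) set" where
  "label_rel n f \<theta> g = {((i, s), (j, t)). i \<in> {1..n} \<and> j \<in> {1..n} \<and>
     (s = 0 \<and> t = 0 \<and> f i = f j \<or> s = 1 \<and> t = 1 \<and> g i = g j \<or>
      s = 0 \<and> t = 1 \<and> (f i, g j) \<in> \<theta> \<or> s = 1 \<and> t = 0 \<and> (f j, g i) \<in> \<theta>)}"

definition label_diagram :: "nat \<Rightarrow> (nat \<Rightarrow> 'l) \<Rightarrow> ('l \<times> 'm) set \<Rightarrow> (nat \<Rightarrow> 'm) \<Rightarrow> diagram" where
  "label_diagram n f \<theta> g = verts n // label_rel n f \<theta> g"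

lemma label_rel_equiv: assumes "pbij \<theta>" shows "equiv (verts n) (label_rel n f \<theta> g)"
proof (rule equivI)
  show "label_rel n f \<theta> g \<subseteq> verts n \<times> verts n" by (auto simp: label_rel_def)
  show "refl_on (verts n) (label_rel n f \<theta> g)" by (rule refl_onI) (auto simp: label_rel_def)
  show "sym (label_rel n f \<theta> g)" by (rule symI) (auto simp: label_rel_def)
  show "trans (label_rel n f \<theta> g)"
    by (rule transI) (use assms in \<open>auto simp: label_rel_def pbij_def dest: single_valuedD\<close>)
qed

lemma label_diagram [simp]: "pbij \<theta> \<Longrightarrow> label_diagram n f \<theta> g \<in> diagrams n"
  unfolding label_diagram_def by (rule quotient_diagram[OF label_rel_equiv])

lemma rel_of_label_diagram: "pbij \<theta> \<Longrightarrow> rel_of (label_diagram n f \<theta> g) = label_rel n f \<theta> g"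
  unfolding label_diagram_def by (rule rel_of_quotient[OF label_rel_equiv])

lemma label_diagram_eq_iff:
  assumes "pbij \<theta>" "pbij \<theta>'"
  shows "label_diagram n f \<theta> g = label_diagram n f' \<theta>' g' \<longleftrightarrow>
    (\<forall>i\<in>{1..n}. \<forall>j\<in>{1..n}. (f i = f j \<longleftrightarrow> f' i = f' j) \<and> (g i = g j \<longleftrightarrow> g' i = g' j) \<and>
      ((f i, g j) \<in> \<theta> \<longleftrightarrow> (f' i, g' j) \<in> \<theta>'))"
proof -
  have "label_diagram n f \<theta> g = label_diagram n f' \<theta>' g' \<longleftrightarrow> label_rel n f \<theta> g = label_rel n f' \<theta>' g'"
    using rel_of_label_diagram assms by (metis label_diagram_def)
  also have "\<dots> \<longleftrightarrow> (\<forall>i j. i \<in> {1..n} \<and> j \<in> {1..n} \<longrightarrow> (f i = f j \<longleftrightarrow> f' i = f' j) \<and> (g i = g j \<longleftrightarrow> g' i = g' j) \<and>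
      ((f i, g j) \<in> \<theta> \<longleftrightarrow> (f' i, g' j) \<in> \<theta>'))" (is "?L \<longleftrightarrow> ?R")
  proof
    assume L: ?L
    show ?R
    proof (intro allI impI)
      fix i j assume ij: "i \<in> {1..n} \<and> j \<in> {1..n}"
      have "((i, s), (j, t)) \<in> label_rel n f \<theta> g \<longleftrightarrow> ((i, s), (j, t)) \<in> label_rel n f' \<theta>' g'" for s t
        using L by simp
      from this[of 0 0] this[of 1 1] this[of 0 1] ij
      show "(f i = f j \<longleftrightarrow> f' i = f' j) \<and> (g i = g j \<longleftrightarrow> g' i = g' j) \<and> ((f i, g j) \<in> \<theta> \<longleftrightarrow> (f' i, g' j) \<in> \<theta>')"
        by (simp add: label_rel_def)
    qed
  qed (auto simp: label_rel_def)
  finally show ?thesis by blast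
qed

lemma label_refines_iff:
  assumes "pbij \<theta>" "pbij \<theta>'"
  shows "refines (verts n) (label_diagram n f \<theta> g) (label_diagram n f' \<theta>' g') \<longleftrightarrow>
    (\<forall>i\<in>{1..n}. \<forall>j\<in>{1..n}. (f i = f j \<longrightarrow> f' i = f' j) \<and> (g i = g j \<longrightarrow> g' i = g' j) \<and>
      ((f i, g j) \<in> \<theta> \<longrightarrow> (f' i, g' j) \<in> \<theta>'))"
proof -
  have "refines (verts n) (label_diagram n f \<theta> g) (label_diagram n f' \<theta>' g') \<longleftrightarrow>
      label_rel n f \<theta> g \<subseteq> label_rel n f' \<theta>' g'"
    using assms by (simp add: refines_iff_rel_of rel_of_label_diagram del: One_nat_def)
  also have "\<dots> \<longleftrightarrow> (\<forall>i j. i \<in> {1..n} \<and> j \<in> {1..n} \<longrightarrow> (f i = f j \<longrightarrow> f' i = f' j) \<and> (g i = g j \<longrightarrow> g' i = g' j) \<and>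
      ((f i, g j) \<in> \<theta> \<longrightarrow> (f' i, g' j) \<in> \<theta>'))" (is "?L \<longleftrightarrow> ?R")
  proof
    assume L: ?L
    show ?R
    proof (intro allI impI)
      fix i j assume ij: "i \<in> {1..n} \<and> j \<in> {1..n}"
      have "((i, s), (j, t)) \<in> label_rel n f \<theta> g \<longrightarrow> ((i, s), (j, t)) \<in> label_rel n f' \<theta>' g'" for s t
        using L by blast
      from this[of 0 0] this[of 1 1] this[of 0 1] ij
      show "(f i = f j \<longrightarrow> f' i = f' j) \<and> (g i = g j \<longrightarrow> g' i = g' j) \<and> ((f i, g j) \<in> \<theta> \<longrightarrow> (f' i, g' j) \<in> \<theta>')"
        by (simp add: label_rel_def)
    qed
  qed (auto simp: label_rel_def)
  finally show ?thesis by blast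
qed

lemma sat_label:
  assumes "pbij \<theta>"
  shows "(U, W) \<in> sat n (label_diagram n f \<theta> g) \<longleftrightarrow> U \<subseteq> {1..n} \<and> W \<subseteq> {1..n} \<and>
    (\<forall>i\<in>{1..n}. \<forall>j\<in>{1..n}. (f i = f j \<longrightarrow> (i \<in> U \<longleftrightarrow> j \<in> U)) \<and> (g i = g j \<longrightarrow> (i \<in> W \<longleftrightarrow> j \<in> W)) \<and>
      ((f i, g j) \<in> \<theta> \<longrightarrow> (i \<in> U \<longleftrightarrow> j \<in> W)))"
proof -
  have "(\<forall>(x, y)\<in>label_rel n f \<theta> g. x \<in> lift U W \<longleftrightarrow> y \<in> lift U W) \<longleftrightarrow>
    (\<forall>i j. i \<in> {1..n} \<and> j \<in> {1..n} \<longrightarrow> (f i = f j \<longrightarrow> (i \<in> U \<longleftrightarrow> j \<in> U)) \<and> (g i = g j \<longrightarrow> (i \<in> W \<longleftrightarrow> j \<in> W)) \<and>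
      ((f i, g j) \<in> \<theta> \<longrightarrow> (i \<in> U \<longleftrightarrow> j \<in> W)))" (is "?L \<longleftrightarrow> ?R")
  proof
    assume L: ?L
    show ?R
    proof (intro allI impI)
      fix i j assume ij: "i \<in> {1..n} \<and> j \<in> {1..n}"
      have "((i, s), (j, t)) \<in> label_rel n f \<theta> g \<Longrightarrow> (i, s) \<in> lift U W \<longleftrightarrow> (j, t) \<in> lift U W" for s t
        using L by blast
      from this[of 0 0] this[of 1 1] this[of 0 1] ij
      show "(f i = f j \<longrightarrow> (i \<in> U \<longleftrightarrow> j \<in> U)) \<and> (g i = g j \<longrightarrow> (i \<in> W \<longleftrightarrow> j \<in> W)) \<and>
          ((f i, g j) \<in> \<theta> \<longrightarrow> (i \<in> U \<longleftrightarrow> j \<in> W))"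
        by (simp add: label_rel_def lift_def)
    qed
  next
    assume R: ?R
    have "(i, s) \<in> lift U W \<longleftrightarrow> (j, t) \<in> lift U W" if "((i, s), (j, t)) \<in> label_rel n f \<theta> g" for i s j t
      using that R unfolding label_rel_def lift_def by auto
    then show ?L by auto
  qed
  then show ?thesis unfolding label_diagram_def sat_quotient[OF label_rel_equiv[OF assms]] by blast
qed

lemma sat_labelI:
  assumes "pbij \<theta>" "U \<subseteq> {1..n}" "W \<subseteq> {1..n}"
    and "\<And>i j. i \<in> {1..n} \<Longrightarrow> j \<in> {1..n} \<Longrightarrow> f i = f j \<Longrightarrow> i \<in> U \<longleftrightarrow> j \<in> U"
    and "\<And>i j. i \<in> {1..n} \<Longrightarrow> j \<in> {1..n} \<Longrightarrow> g i = g j \<Longrightarrow> i \<in> W \<longleftrightarrow> j \<in> W"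
    and "\<And>i j. i \<in> {1..n} \<Longrightarrow> j \<in> {1..n} \<Longrightarrow> (f i, g j) \<in> \<theta> \<Longrightarrow> i \<in> U \<longleftrightarrow> j \<in> W"
  shows "(U, W) \<in> sat n (label_diagram n f \<theta> g)"
  unfolding sat_label[OF assms(1)] by (intro conjI ballI impI assms(2,3)) (fact assms(4) assms(5) assms(6))+

lemma sat_labelD:
  assumes "pbij \<theta>" "(U, W) \<in> sat n (label_diagram n f \<theta> g)"
  shows "U \<subseteq> {1..n}" "W \<subseteq> {1..n}"
    "\<And>i j. i \<in> {1..n} \<Longrightarrow> j \<in> {1..n} \<Longrightarrow> f i = f j \<Longrightarrow> i \<in> U \<longleftrightarrow> j \<in> U"
    "\<And>i j. i \<in> {1..n} \<Longrightarrow> j \<in> {1..n} \<Longrightarrow> g i = g j \<Longrightarrow> i \<in> W \<longleftrightarrow> j \<in> W"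
    "\<And>i j. i \<in> {1..n} \<Longrightarrow> j \<in> {1..n} \<Longrightarrow> (f i, g j) \<in> \<theta> \<Longrightarrow> i \<in> U \<longleftrightarrow> j \<in> W"
  using assms(2) unfolding sat_label[OF assms(1)] by blast+

lemma flip_label:
  assumes "pbij \<theta>" shows "flip n (label_diagram n f \<theta> g) = label_diagram n g (\<theta>\<inverse>) f"
proof (rule sat_inj[of _ n])
  have \<theta>': "pbij (\<theta>\<inverse>)" using assms by simp
  have "(U, W) \<in> sat n (flip n (label_diagram n f \<theta> g)) \<longleftrightarrow> (U, W) \<in> sat n (label_diagram n g (\<theta>\<inverse>) f)" for U W
    unfolding sat_flip[OF label_diagram[OF assms]] converse_iff
  proof
    assume "(W, U) \<in> sat n (label_diagram n f \<theta> g)"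
    note L = sat_labelD[OF assms this]
    show "(U, W) \<in> sat n (label_diagram n g (\<theta>\<inverse>) f)"
      by (rule sat_labelI[OF \<theta>' L(2,1)]) (use L(3,4,5) in \<open>blast+\<close>)
  next
    assume "(U, W) \<in> sat n (label_diagram n g (\<theta>\<inverse>) f)"
    note L = sat_labelD[OF \<theta>' this]
    show "(W, U) \<in> sat n (label_diagram n f \<theta> g)"
      by (rule sat_labelI[OF assms L(2,1)]) (use L(3,4,5) in \<open>blast+\<close>)
  qed
  then show "sat n (flip n (label_diagram n f \<theta> g)) = sat n (label_diagram n g (\<theta>\<inverse>) f)" by auto
qed (use assms in \<open>simp_all add: flip_diagram\<close>)

text \<open>\<open>r\<close> demands that a middle label matched by both \<open>\<theta>\<close> and
  \<open>\<eta>\<close> be carried by a vertex. Otherwise \<open>\<theta> O \<eta>\<close> would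
  join parts through a label that is absent from the middle row.\<close>

lemma compose_label:
  assumes \<theta>: "pbij \<theta>" and \<eta>: "pbij \<eta>" and r: "Range \<theta> \<inter> Domain \<eta> \<subseteq> g ` {1..n}"
  shows "compose n (label_diagram n f \<theta> g) (label_diagram n g \<eta> h) = label_diagram n f (\<theta> O \<eta>) h"
proof (rule sat_inj[of _ n])
  note o = pbij_relcomp[OF \<theta> \<eta>]
  show "compose n (label_diagram n f \<theta> g) (label_diagram n g \<eta> h) \<in> diagrams n"
    using \<theta> \<eta> by (simp add: compose_diagram)
  show "label_diagram n f (\<theta> O \<eta>) h \<in> diagrams n" using o by simp
  have "(U, W) \<in> sat n (label_diagram n f (\<theta> O \<eta>) h) \<longleftrightarrow>
    (\<exists>Y'. (U, Y') \<in> sat n (label_diagram n f \<theta> g) \<and> (Y', W) \<in> sat n (label_diagram n g \<eta> h))" for U W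
  proof
    assume L: "(U, W) \<in> sat n (label_diagram n f (\<theta> O \<eta>) h)"
    note L' = sat_labelD[OF o L]
    \<comment> \<open>The middle vertices that are forced into the set, by \<open>U\<close> from
      above or by \<open>W\<close> from below.\<close>
    define Y' where "Y' = {j\<in>{1..n}. (\<exists>i\<in>U. (f i, g j) \<in> \<theta>) \<or> (\<exists>k\<in>W. (g j, h k) \<in> \<eta>)}"
    have 1: "i \<in> U \<longleftrightarrow> j \<in> Y'" if ij: "i \<in> {1..n}" "j \<in> {1..n}" "(f i, g j) \<in> \<theta>" for i j
    proof
      assume "j \<in> Y'"
      then consider i' where "i' \<in> U" "(f i', g j) \<in> \<theta>" | k where "k \<in> W" "(g j, h k) \<in> \<eta>"
        by (auto simp: Y'_def)
      then show "i \<in> U"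
      proof cases
        case 1
        then have "f i' = f i" using \<theta> ij(3) unfolding pbij_def single_valued_def by blast
        moreover have "i' \<in> {1..n}" using 1 L'(1) by blast
        ultimately show ?thesis using L'(3)[of i' i] ij 1 by simp
      next
        case 2
        then have "(f i, h k) \<in> \<theta> O \<eta>" "k \<in> {1..n}" using ij L'(2) by blast+
        then show ?thesis using L'(5)[of i k] ij 2 by blast
      qed
    qed (use ij in \<open>auto simp: Y'_def\<close>)
    have 2: "j \<in> Y' \<longleftrightarrow> k \<in> W" if jk: "j \<in> {1..n}" "k \<in> {1..n}" "(g j, h k) \<in> \<eta>" for j k
    proof
      assume "j \<in> Y'"
      then consider i where "i \<in> U" "(f i, g j) \<in> \<theta>" | k' where "k' \<in> W" "(g j, h k') \<in> \<eta>"
        by (auto simp: Y'_def)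
      then show "k \<in> W"
      proof cases
        case 1
        then have "(f i, h k) \<in> \<theta> O \<eta>" "i \<in> {1..n}" using jk L'(1) by blast+
        then show ?thesis using L'(5)[of i k] jk 1 by blast
      next
        case 2
        then have "h k' = h k" using \<eta> jk(3) unfolding pbij_def single_valued_def by blast
        moreover have "k' \<in> {1..n}" using 2 L'(2) by blast
        ultimately show ?thesis using L'(4)[of k' k] jk 2 by simp
      qed
    qed (use jk in \<open>auto simp: Y'_def\<close>)
    have 3: "j \<in> Y' \<longleftrightarrow> j' \<in> Y'" if "j \<in> {1..n}" "j' \<in> {1..n}" "g j = g j'" for j j'
      using that by (auto simp: Y'_def)
    have "Y' \<subseteq> {1..n}" by (auto simp: Y'_def)
    have "(U, Y') \<in> sat n (label_diagram n f \<theta> g)"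
      by (rule sat_labelI[OF \<theta> L'(1) \<open>Y' \<subseteq> {1..n}\<close>]) (fact L'(3) 3 1)+
    moreover have "(Y', W) \<in> sat n (label_diagram n g \<eta> h)"
      by (rule sat_labelI[OF \<eta> \<open>Y' \<subseteq> {1..n}\<close> L'(2)]) (fact L'(4) 3 2)+
    ultimately show "\<exists>Y'. (U, Y') \<in> sat n (label_diagram n f \<theta> g) \<and> (Y', W) \<in> sat n (label_diagram n g \<eta> h)" by blast
  next
    assume "\<exists>Y'. (U, Y') \<in> sat n (label_diagram n f \<theta> g) \<and> (Y', W) \<in> sat n (label_diagram n g \<eta> h)"
    then obtain Y' where Y': "(U, Y') \<in> sat n (label_diagram n f \<theta> g)" "(Y', W) \<in> sat n (label_diagram n g \<eta> h)"
      by blast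
    note Yf = sat_labelD[OF \<theta> Y'(1)] and Yg = sat_labelD[OF \<eta> Y'(2)]
    have mid: "i \<in> U \<longleftrightarrow> k \<in> W" if ik: "i \<in> {1..n}" "k \<in> {1..n}" "(f i, h k) \<in> \<theta> O \<eta>" for i k
    proof -
      obtain y where y: "(f i, y) \<in> \<theta>" "(y, h k) \<in> \<eta>" using ik by blast
      then obtain j where j: "j \<in> {1..n}" "y = g j" using r by blast
      then show ?thesis using Yf(5)[OF ik(1) j(1)] Yg(5)[OF j(1) ik(2)] y by blast
    qed
    show "(U, W) \<in> sat n (label_diagram n f (\<theta> O \<eta>) h)"
      by (rule sat_labelI[OF o Yf(1) Yg(2)]) (fact Yf(3) Yg(4) mid)+
  qed
  then show "sat n (compose n (label_diagram n f \<theta> g) (label_diagram n g \<eta> h)) = sat n (label_diagram n f (\<theta> O \<eta>) h)"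
    using \<theta> \<eta> by (auto simp: sat_compose)
qed

text \<open>The classes themselves serve as labels, and a class propagates exactly when it labels
  vertices of both rows. Classes are nonempty, which leaves \<open>{}\<close> as a fresh label for
  \<open>rrank_step\<close>.\<close>

lemma diagram_labelling:
  assumes a: "a \<in> diagrams n"
  obtains f g and A :: "point set set" where "A \<subseteq> f ` {1..n}" "A \<subseteq> g ` {1..n}" "a = label_diagram n f (Id_on A) g"
    "{} \<notin> f ` {1..n}"
proof -
  note ea = diagram_equiv[OF a]
  define f where "f i = rel_of a `` {(i, 0)}" for i
  define g where "g i = rel_of a `` {(i, 1)}" for i
  define A where "A = f ` {1..n} \<inter> g ` {1..n}"
  have cls: "(rel_of a `` {x} = rel_of a `` {y}) \<longleftrightarrow> (x, y) \<in> rel_of a" if "x \<in> verts n" "y \<in> verts n" for x y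
    by (rule eq_equiv_class_iff[OF ea that])
  have "label_rel n f (Id_on A) g = rel_of a"
  proof -
    have "((i, s), (j, t)) \<in> label_rel n f (Id_on A) g \<longleftrightarrow> ((i, s), (j, t)) \<in> rel_of a" for i s j t
    proof (cases "(i, s) \<in> verts n \<and> (j, t) \<in> verts n")
      case True
      then have "s = 0 \<or> s = 1" "t = 0 \<or> t = 1" "i \<in> {1..n}" "j \<in> {1..n}" by auto
      moreover have "(f i = f j) = (((i, 0), (j, 0)) \<in> rel_of a)" "(g i = g j) = (((i, 1), (j, 1)) \<in> rel_of a)"
        "(f i = g j) = (((i, 0), (j, 1)) \<in> rel_of a)" "(g i = f j) = (((i, 1), (j, 0)) \<in> rel_of a)"
        unfolding f_def g_def using calculation(3,4) by (intro cls; simp)+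
      moreover have "((f i, g j) \<in> Id_on A) = (f i = g j)" "((f j, g i) \<in> Id_on A) = (g i = f j)"
        using calculation(3,4) by (auto simp: A_def Id_on_iff)
      ultimately show ?thesis by (auto simp: label_rel_def)
    next
      case False
      then have "((i, s), (j, t)) \<notin> rel_of a" using equivDs(5)[OF ea] by blast
      moreover have "((i, s), (j, t)) \<notin> label_rel n f (Id_on A) g"
        using False equivDs(5)[OF label_rel_equiv[OF pbij_Id_on]] by blast
      ultimately show ?thesis by blast
    qed
    then show ?thesis by auto
  qed
  then have "a = label_diagram n f (Id_on A) g" unfolding label_diagram_def using diagram_eq_quotient[OF a] by simp
  moreover have "{} \<notin> f ` {1..n}" using equivDs(2)[OF ea] by (fastforce simp: f_def)
  ultimately show ?thesis using that[of A f g] by (auto simp: A_def)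
qed

section \<open>Propagating parts counted by domain and kernel\<close>

subsection \<open>The propagating number\<close>

text \<open>The number of propagating parts, expressed as the dimension of the domain of
  \<open>sat n a\<close> modulo its kernel. Domain and kernel behave monotonically under
  composition.\<close>

definition prop_rank :: "nat \<Rightarrow> diagram \<Rightarrow> nat" where
  "prop_rank n a = (THE r. card (Domain (sat n a)) = 2 ^ r * card {U. (U, {}) \<in> sat n a})"

lemma sat_kernel_finite: "finite {U. (U, {}) \<in> sat n a}" "card {U. (U, {}) \<in> sat n a} > 0"
proof -
  have "{U. (U, {}) \<in> sat n a} \<subseteq> Pow {1..n}" using sat_subset by blast
  then show f: "finite {U. (U, {}) \<in> sat n a}" by (rule finite_subset) simp
  then show "card {U. (U, {}) \<in> sat n a} > 0" using sat_empty[of n a] by (auto simp: card_gt_0_iff)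
qed

lemma prop_rank_eqI:
  assumes "card (Domain (sat n a)) = 2 ^ r * card {U. (U, {}) \<in> sat n a}"
  shows "prop_rank n a = r"
  unfolding prop_rank_def
proof (rule the_equality)
  show "card (Domain (sat n a)) = 2 ^ r * card {U. (U, {}) \<in> sat n a}" by (rule assms)
next
  fix r' assume "card (Domain (sat n a)) = 2 ^ r' * card {U. (U, {}) \<in> sat n a}"
  then have "2 ^ r' = (2 ^ r :: nat)" using assms sat_kernel_finite(2)[of n a] by simp
  then show "r' = r" by simp
qed

text \<open>The domain consists of all unions of top classes, the kernel of the unions of those
  classes that \<open>\<theta>\<close> leaves unmatched. Being a partial bijection,
  \<open>\<theta>\<close> has as many pairs as matched top labels.\<close>

lemma card_Domain_sat_label:
  assumes \<theta>: "pbij \<theta>" and sub: "\<theta> \<subseteq> f ` {1..n} \<times> g ` {1..n}"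
  shows "card (Domain (sat n (label_diagram n f \<theta> g))) =
    2 ^ card \<theta> * card {U. (U, {}) \<in> sat n (label_diagram n f \<theta> g)}"
proof -
  let ?F = "\<lambda>P. {i\<in>{1..n}. f i \<in> P}" and ?a = "label_diagram n f \<theta> g"
  have inj: "inj_on ?F (Pow (f ` {1..n}))"
  proof (rule inj_onI)
    fix P Q assume P: "P \<in> Pow (f ` {1..n})" and Q: "Q \<in> Pow (f ` {1..n})" and PQ: "?F P = ?F Q"
    have "f ` ?F P = P" "f ` ?F Q = Q" using P Q by auto
    then show "P = Q" using PQ by metis
  qed
  have recover: "?F (f ` U) = U" if "U \<subseteq> {1..n}" "\<And>i j. i \<in> {1..n} \<Longrightarrow> j \<in> {1..n} \<Longrightarrow> f i = f j \<Longrightarrow> i \<in> U \<longleftrightarrow> j \<in> U" for U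
  proof (intro equalityI subsetI)
    fix i assume "i \<in> ?F (f ` U)"
    then obtain j where "i \<in> {1..n}" "j \<in> U" "f i = f j" by blast
    then show "i \<in> U" using that(2)[of i j] that(1) by blast
  qed (use that(1) in blast)
  have dom: "Domain (sat n ?a) = ?F ` Pow (f ` {1..n})"
  proof (intro equalityI subsetI)
    fix U assume "U \<in> Domain (sat n ?a)"
    then obtain W where "(U, W) \<in> sat n ?a" by blast
    note L = sat_labelD[OF \<theta> this]
    have "U = ?F (f ` U)" by (rule recover[OF L(1) L(3), symmetric])
    then show "U \<in> ?F ` Pow (f ` {1..n})" using L(1) by blast
  next
    fix U assume "U \<in> ?F ` Pow (f ` {1..n})"
    then obtain P where P: "P \<subseteq> f ` {1..n}" "U = ?F P" by blast
    have "(U, {j\<in>{1..n}. \<exists>x\<in>P. (x, g j) \<in> \<theta>}) \<in> sat n ?a"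
      using \<theta> by (intro sat_labelI[OF \<theta>]) (auto simp: P(2) pbij_def dest: single_valuedD)
    then show "U \<in> Domain (sat n ?a)" by blast
  qed
  have ker: "{U. (U, {}) \<in> sat n ?a} = ?F ` Pow (f ` {1..n} - Domain \<theta>)"
  proof (intro equalityI subsetI)
    fix U assume "U \<in> {U. (U, {}) \<in> sat n ?a}"
    then have "(U, {}) \<in> sat n ?a" by simp
    note L = sat_labelD[OF \<theta> this]
    have "U = ?F (f ` U)" by (rule recover[OF L(1) L(3), symmetric])
    moreover have "f ` U \<subseteq> f ` {1..n} - Domain \<theta>"
    proof
      fix x assume "x \<in> f ` U"
      then obtain i where i: "i \<in> U" "x = f i" by blast
      have "(f i, y) \<notin> \<theta>" for y
      proof
        assume y: "(f i, y) \<in> \<theta>"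
        then obtain j where "j \<in> {1..n}" "y = g j" using sub by blast
        then show False using L(5)[of i j] L(1) i y by blast
      qed
      then show "x \<in> f ` {1..n} - Domain \<theta>" using i L(1) by blast
    qed
    ultimately show "U \<in> ?F ` Pow (f ` {1..n} - Domain \<theta>)" by blast
  next
    fix U assume "U \<in> ?F ` Pow (f ` {1..n} - Domain \<theta>)"
    then obtain P where P: "P \<subseteq> f ` {1..n} - Domain \<theta>" "U = ?F P" by blast
    have "(U, {}) \<in> sat n ?a"
      by (rule sat_labelI[OF \<theta>]) (use P in auto)
    then show "U \<in> {U. (U, {}) \<in> sat n ?a}" by simp
  qed
  have fin: "finite (f ` {1..n})" by simp
  have "inj_on fst \<theta>"
    using \<theta> by (auto simp: inj_on_def pbij_def dest: single_valuedD)
  then have cd: "card (Domain \<theta>) = card \<theta>" by (simp add: Domain_fst card_image)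
  have ds: "Domain \<theta> \<subseteq> f ` {1..n}" using sub by blast
  have "card (Domain (sat n ?a)) = 2 ^ card (f ` {1..n})"
    unfolding dom card_image[OF inj] by (rule card_Pow[OF fin])
  moreover have "card {U. (U, {}) \<in> sat n ?a} = 2 ^ (card (f ` {1..n}) - card \<theta>)"
  proof -
    have "inj_on ?F (Pow (f ` {1..n} - Domain \<theta>))" by (rule inj_on_subset[OF inj]) blast
    moreover have "card (f ` {1..n} - Domain \<theta>) = card (f ` {1..n}) - card \<theta>"
      using card_Diff_subset[OF finite_subset[OF ds fin] ds] cd by simp
    ultimately show ?thesis unfolding ker using fin by (simp only: card_image card_Pow finite_Diff)
  qed
  moreover have "card \<theta> \<le> card (f ` {1..n})" using card_mono[OF fin ds] cd by simp
  ultimately show ?thesis by (simp add: power_add[symmetric])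
qed

lemma prop_rank_label:
  "pbij \<theta> \<Longrightarrow> \<theta> \<subseteq> f ` {1..n} \<times> g ` {1..n} \<Longrightarrow> prop_rank n (label_diagram n f \<theta> g) = card \<theta>"
  by (rule prop_rank_eqI[OF card_Domain_sat_label])

lemma card_Domain_sat:
  assumes a: "a \<in> diagrams n"
  shows "card (Domain (sat n a)) = 2 ^ prop_rank n a * card {U. (U, {}) \<in> sat n a}"
proof -
  obtain f g and A :: "point set set" where A: "A \<subseteq> f ` {1..n}" "A \<subseteq> g ` {1..n}" "a = label_diagram n f (Id_on A) g"
    using diagram_labelling[OF a] by metis
  then have "card (Domain (sat n a)) = 2 ^ card (Id_on A) * card {U. (U, {}) \<in> sat n a}"
    unfolding A(3) by (intro card_Domain_sat_label) auto
  then show ?thesis using prop_rank_eqI by metis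
qed

lemma card_Id_on: "card (Id_on A) = card A"
proof -
  have "Id_on A = (\<lambda>x. (x, x)) ` A" by auto
  then show ?thesis by (simp add: card_image inj_on_def)
qed

lemma prop_rank_le: assumes a: "a \<in> diagrams n" shows "prop_rank n a \<le> n"
proof -
  obtain f g and A :: "point set set" where A: "A \<subseteq> f ` {1..n}" "A \<subseteq> g ` {1..n}" "a = label_diagram n f (Id_on A) g"
    using diagram_labelling[OF a] by metis
  then have "prop_rank n a = card A" unfolding A(3) by (subst prop_rank_label) (auto simp: card_Id_on)
  also have "\<dots> \<le> card (f ` {1..n})" using A by (intro card_mono) auto
  also have "\<dots> \<le> n" using card_image_le[of "{1..n}" f] by simp
  finally show ?thesis .
qed

lemma prop_rank_flip: assumes a: "a \<in> diagrams n" shows "prop_rank n (flip n a) = prop_rank n a"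
proof -
  obtain f g and A :: "point set set" where A: "A \<subseteq> f ` {1..n}" "A \<subseteq> g ` {1..n}" "a = label_diagram n f (Id_on A) g"
    using diagram_labelling[OF a] by metis
  have "prop_rank n a = card (Id_on A)" "prop_rank n (label_diagram n g (Id_on A) f) = card (Id_on A)"
    unfolding A(3) using A by (auto intro!: prop_rank_label)
  then show ?thesis unfolding A(3) by (simp add: flip_label)
qed

text \<open>Composing with \<open>b\<close> shrinks the domain and enlarges the kernel. If the rank
  is kept, both stay the same, and the product of a diagram with its flip is determined by these
  two.\<close>

lemma prop_rank_compose_left:
  assumes a: "a \<in> diagrams n" and b: "b \<in> diagrams n"
  shows "prop_rank n (compose n a b) \<le> prop_rank n a"
    and "prop_rank n (compose n a b) = prop_rank n a \<Longrightarrow>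
      compose n (compose n a b) (flip n (compose n a b)) = compose n a (flip n a)"
proof -
  let ?c = "compose n a b"
  note c = compose_diagram[OF a b]
  let ?K = "\<lambda>a. {U. (U, {}) \<in> sat n a}"
  have dom: "Domain (sat n ?c) \<subseteq> Domain (sat n a)" using sat_compose[OF a b] by blast
  have ker: "?K a \<subseteq> ?K ?c" using sat_compose[OF a b] sat_empty[of n b] by blast
  have finD: "finite (Domain (sat n a))" by (rule finite_Domain[OF finite_sat])
  have cd: "card (Domain (sat n ?c)) \<le> card (Domain (sat n a))" using card_mono[OF finD dom] .
  have ck: "card (?K a) \<le> card (?K ?c)" using card_mono[OF sat_kernel_finite(1) ker] .
  have "2 ^ prop_rank n ?c * card (?K ?c) \<le> 2 ^ prop_rank n a * card (?K a)"
    using cd unfolding card_Domain_sat[OF a] card_Domain_sat[OF c] .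
  also have "\<dots> \<le> 2 ^ prop_rank n a * card (?K ?c)" using ck by simp
  finally have "(2::nat) ^ prop_rank n ?c \<le> 2 ^ prop_rank n a" using sat_kernel_finite(2)[of n ?c] by simp
  then show "prop_rank n ?c \<le> prop_rank n a" by simp
  assume eq: "prop_rank n ?c = prop_rank n a"
  have "card (Domain (sat n ?c)) = 2 ^ prop_rank n a * card (?K ?c)" using card_Domain_sat[OF c] eq by simp
  moreover have "card (Domain (sat n a)) = 2 ^ prop_rank n a * card (?K a)" by (rule card_Domain_sat[OF a])
  ultimately have k: "card (?K ?c) = card (?K a)" "card (Domain (sat n ?c)) = card (Domain (sat n a))"
    using cd ck by auto
  have D: "Domain (sat n ?c) = Domain (sat n a)" using card_subset_eq[OF finD dom k(2)] .
  have K: "?K a = ?K ?c" using card_subset_eq[OF sat_kernel_finite(1) ker] k(1) by simp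
  have form: "sat n (compose n d (flip n d)) =
      {(U, U'). U \<in> Domain (sat n d) \<and> U' \<in> Domain (sat n d) \<and> sym_diff U U' \<in> ?K d}"
    if d: "d \<in> diagrams n" for d
  proof -
    have "(U, U') \<in> sat n d O (sat n d)\<inverse> \<longleftrightarrow>
      U \<in> Domain (sat n d) \<and> U' \<in> Domain (sat n d) \<and> sym_diff U U' \<in> ?K d" for U U'
      using sat_kernel_translate[of U _ n d U'] by blast
    then show ?thesis by (auto simp: sat_compose[OF d flip_diagram[OF d]] sat_flip[OF d])
  qed
  show "compose n ?c (flip n ?c) = compose n a (flip n a)"
    by (rule sat_inj[of _ n]) (simp_all add: compose_diagram flip_diagram a c form D K)
qed

lemma prop_rank_compose_right:
  assumes a: "a \<in> diagrams n" and b: "b \<in> diagrams n"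
  shows "prop_rank n (compose n a b) \<le> prop_rank n b"
  using prop_rank_compose_left(1)[OF flip_diagram[OF b] flip_diagram[OF a]] a b
  by (simp add: flip_compose[symmetric] prop_rank_flip compose_diagram)

text \<open>Any labelling of \<open>d\<close> induces labellings of its two projections, so it
  agrees with \<open>f\<close> and \<open>g\<close> up to renaming. Carrying the matching of
  \<open>d\<close> along the renaming produces \<open>\<theta>\<close>.\<close>

lemma diagram_between_projections:
  assumes d: "d \<in> diagrams n"
    and A: "A \<subseteq> f ` {1..n}" "compose n d (flip n d) = label_diagram n f (Id_on A) f"
    and B: "B \<subseteq> g ` {1..n}" "compose n (flip n d) d = label_diagram n g (Id_on B) g"
  obtains \<theta> where "d = label_diagram n f \<theta> g" "pbij \<theta>" "Domain \<theta> = A" "Range \<theta> = B"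
proof -
  obtain f' g' and C :: "point set set" where C: "C \<subseteq> f' ` {1..n}" "C \<subseteq> g' ` {1..n}"
    "d = label_diagram n f' (Id_on C) g'"
    using diagram_labelling[OF d] by metis
  have fl: "flip n d = label_diagram n g' (Id_on C) f'" unfolding C(3) by (simp add: flip_label)
  have IC: "Id_on C O Id_on C = Id_on C" by auto
  have "compose n d (flip n d) = label_diagram n f' (Id_on C) f'"
    unfolding fl unfolding C(3) using C by (subst compose_label) (auto simp: IC)
  then have 1: "label_diagram n f (Id_on A) f = label_diagram n f' (Id_on C) f'" using A by simp
  have "compose n (flip n d) d = label_diagram n g' (Id_on C) g'"
    unfolding fl unfolding C(3) using C by (subst compose_label) (auto simp: IC)
  then have 2: "label_diagram n g (Id_on B) g = label_diagram n g' (Id_on C) g'" using B by simp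
  note 1 = 1[unfolded label_diagram_eq_iff[OF pbij_Id_on pbij_Id_on]]
  note 2 = 2[unfolded label_diagram_eq_iff[OF pbij_Id_on pbij_Id_on]]
  have f: "f i = f j \<longleftrightarrow> f' i = f' j" and g: "g i = g j \<longleftrightarrow> g' i = g' j"
    if "i \<in> {1..n}" "j \<in> {1..n}" for i j using 1 2 that by blast+
  have fA: "f i \<in> A \<longleftrightarrow> f' i \<in> C" if "i \<in> {1..n}" for i using 1[rule_format, OF that that] by (simp add: Id_on_iff)
  have gB: "g i \<in> B \<longleftrightarrow> g' i \<in> C" if "i \<in> {1..n}" for i using 2[rule_format, OF that that] by (simp add: Id_on_iff)
  define \<theta> where "\<theta> = {(f i, g j) | i j. i \<in> {1..n} \<and> j \<in> {1..n} \<and> f' i = g' j \<and> f' i \<in> C}"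
  have p: "pbij \<theta>"
  proof -
    have \<theta>D: "\<exists>i j. x = f i \<and> y = g j \<and> i \<in> {1..n} \<and> j \<in> {1..n} \<and> f' i = g' j" if "(x, y) \<in> \<theta>" for x y
      using that unfolding \<theta>_def by blast
    have "y = y'" if "(x, y) \<in> \<theta>" "(x, y') \<in> \<theta>" for x y y'
      using \<theta>D[OF that(1)] \<theta>D[OF that(2)] f g by metis
    moreover have "x = x'" if "(x, y) \<in> \<theta>" "(x', y) \<in> \<theta>" for x x' y
      using \<theta>D[OF that(1)] \<theta>D[OF that(2)] f g by metis
    ultimately show ?thesis by (auto simp: pbij_def single_valued_def)
  qed
  have \<theta>_iff: "(f i, g j) \<in> \<theta> \<longleftrightarrow> (f' i, g' j) \<in> Id_on C" if ij: "i \<in> {1..n}" "j \<in> {1..n}" for i j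
  proof
    assume "(f i, g j) \<in> \<theta>"
    then obtain i' j' where "i' \<in> {1..n}" "j' \<in> {1..n}" "f' i' = g' j'" "f' i' \<in> C" "f i = f i'" "g j = g j'"
      unfolding \<theta>_def by blast
    then show "(f' i, g' j) \<in> Id_on C" using f[of i i'] g[of j j'] ij by (simp add: Id_on_iff)
  qed (use ij in \<open>auto simp: \<theta>_def Id_on_iff\<close>)
  have "label_diagram n f' (Id_on C) g' = label_diagram n f \<theta> g"
    unfolding label_diagram_eq_iff[OF pbij_Id_on p]
    by (intro ballI conjI) (simp_all only: f g \<theta>_iff)
  then have "d = label_diagram n f \<theta> g" using C(3) by simp
  moreover have "Domain \<theta> = A"
  proof (intro equalityI subsetI)
    fix x assume "x \<in> A"
    then obtain i where i: "i \<in> {1..n}" "x = f i" using A by blast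
    then have "f' i \<in> C" using fA \<open>x \<in> A\<close> by blast
    then obtain j where "j \<in> {1..n}" "f' i = g' j" using C by blast
    then show "x \<in> Domain \<theta>" using i \<open>f' i \<in> C\<close> unfolding \<theta>_def by blast
  qed (use fA in \<open>auto simp: \<theta>_def\<close>)
  moreover have "Range \<theta> = B"
  proof (intro equalityI subsetI)
    fix y assume "y \<in> B"
    then obtain j where j: "j \<in> {1..n}" "y = g j" using B by blast
    then have c: "g' j \<in> C" using gB \<open>y \<in> B\<close> by blast
    then obtain i where "i \<in> {1..n}" "g' j = f' i" using C by blast
    then have "(f i, g j) \<in> \<theta>" using j(1) c unfolding \<theta>_def by fastforce
    then show "y \<in> Range \<theta>" using j by blast
  next
    fix y assume "y \<in> Range \<theta>"
    then obtain i j where "i \<in> {1..n}" "j \<in> {1..n}" "f' i = g' j" "f' i \<in> C" "y = g j"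
      unfolding \<theta>_def by blast
    then show "y \<in> B" using gB[of j] by simp
  qed
  ultimately show ?thesis using that p by blast
qed

section \<open>Pairs of diagrams, with operations taken componentwise\<close>

section \<open>Ramified diagrams\<close>

definition rmul :: "nat \<Rightarrow> diagram \<times> diagram \<Rightarrow> diagram \<times> diagram \<Rightarrow> diagram \<times> diagram" where
  "rmul n a b = (compose n (fst a) (fst b), compose n (snd a) (snd b))"

definition rflip :: "nat \<Rightarrow> diagram \<times> diagram \<Rightarrow> diagram \<times> diagram" where
  "rflip n a = (flip n (fst a), flip n (snd a))"

definition rrank :: "nat \<Rightarrow> diagram \<times> diagram \<Rightarrow> nat" where
  "rrank n a = prop_rank n (fst a) + prop_rank n (snd a)"

definition rtwist :: "nat \<Rightarrow> 'k::field \<Rightarrow> 'k \<Rightarrow> diagram \<times> diagram \<Rightarrow> diagram \<times> diagram \<Rightarrow> 'k" where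
  "rtwist n Q1 Q2 a b = Q1 ^ closed_count n (fst a) (fst b) * Q2 ^ closed_count n (snd a) (snd b)"

lemma ramified_iff: "a \<in> ramified_diagrams n \<longleftrightarrow>
    fst a \<in> diagrams n \<and> snd a \<in> diagrams n \<and> sat n (snd a) \<subseteq> sat n (fst a)"
proof (cases a)
  case (Pair a1 a2)
  then show ?thesis using refines_iff_sat[of a1 n a2] unfolding ramified_diagrams_def by auto
qed

lemma finite_ramified: "finite (ramified_diagrams n)"
  by (rule finite_subset[of _ "diagrams n \<times> diagrams n"])
     (use finite_diagrams in \<open>auto simp: ramified_diagrams_def\<close>)

lemma rmul_closed: "a \<in> ramified_diagrams n \<Longrightarrow> b \<in> ramified_diagrams n \<Longrightarrow> rmul n a b \<in> ramified_diagrams n"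
  unfolding ramified_iff by (auto simp: rmul_def compose_diagram sat_compose)

lemma rflip_closed: "a \<in> ramified_diagrams n \<Longrightarrow> rflip n a \<in> ramified_diagrams n"
  unfolding ramified_iff by (auto simp: rflip_def flip_diagram sat_flip)

lemma label_ramified_iff:
  assumes "pbij \<theta>" "pbij \<theta>'"
  shows "(label_diagram n f \<theta> g, label_diagram n f' \<theta>' g') \<in> ramified_diagrams n \<longleftrightarrow>
    (\<forall>i\<in>{1..n}. \<forall>j\<in>{1..n}. (f i = f j \<longrightarrow> f' i = f' j) \<and> (g i = g j \<longrightarrow> g' i = g' j) \<and>
      ((f i, g j) \<in> \<theta> \<longrightarrow> (f' i, g' j) \<in> \<theta>'))"
  using label_refines_iff[OF assms, of n f g f' g'] assms by (simp add: ramified_diagrams_def del: One_nat_def)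

lemma label_ramifiedD:
  assumes "pbij \<theta>" "pbij \<theta>'"
    and a: "(label_diagram n f \<theta> g, label_diagram n f' \<theta>' g') \<in> ramified_diagrams n"
    and i: "i \<in> {1..n}" and j: "j \<in> {1..n}"
  shows "f i = f j \<Longrightarrow> f' i = f' j" "g i = g j \<Longrightarrow> g' i = g' j" "(f i, g j) \<in> \<theta> \<Longrightarrow> (f' i, g' j) \<in> \<theta>'"
proof -
  note R = a[unfolded label_ramified_iff[OF assms(1,2)], THEN bspec, OF i, THEN bspec, OF j]
  show "f i = f j \<Longrightarrow> f' i = f' j" using conjunct1[OF R] by (rule mp)
  show "g i = g j \<Longrightarrow> g' i = g' j" using conjunct1[OF conjunct2[OF R]] by (rule mp)
  show "(f i, g j) \<in> \<theta> \<Longrightarrow> (f' i, g' j) \<in> \<theta>'" using conjunct2[OF conjunct2[OF R]] by (rule mp)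
qed

lemma compose_label_flip:
  "pbij \<theta> \<Longrightarrow> Range \<theta> \<subseteq> g ` {1..n} \<Longrightarrow>
    compose n (label_diagram n f \<theta> g) (flip n (label_diagram n f \<theta> g)) = label_diagram n f (\<theta> O \<theta>\<inverse>) f"
  "pbij \<theta> \<Longrightarrow> Domain \<theta> \<subseteq> f ` {1..n} \<Longrightarrow>
    compose n (flip n (label_diagram n f \<theta> g)) (label_diagram n f \<theta> g) = label_diagram n g (\<theta>\<inverse> O \<theta>) g"
  by (simp_all only: flip_label, (rule compose_label; auto)+)

section \<open>Representatives of the J-classes and the index of a projection\<close>

subsection \<open>Projections in standard form\<close>

text \<open>\<open>(i, r)\<close> stands for strand \<open>r\<close> inside the outer part
  \<open>i\<close>, both counted from 0; \<open>fst\<close> is the passage from inner to outer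
  parts.\<close>

definition inner_labels :: "nat list \<Rightarrow> (nat \<times> nat) set" where
  "inner_labels ls = {(i, r). i < length ls \<and> r < ls ! i}"

text \<open>For positive \<open>n\<close>, the formula of \<open>index_outer\<close> at
  \<open>[]\<close> would give one part through all vertices, hence rank 1 instead of 0.\<close>

definition rep :: "nat \<Rightarrow> nat list \<Rightarrow> diagram \<times> diagram" where
  "rep n ls = (if ls = [] then (discrete_diagram n, discrete_diagram n) else (index_inner n ls, index_outer n ls))"

text \<open>Separates what is used of \<open>rep n ls\<close> from the arithmetic of its blocks.
  Inner labels are injective because an inner part has at most one vertex in each row; for nonempty
  \<open>ls\<close> all outer parts propagate.\<close>

definition std_labels :: "nat \<Rightarrow> nat list \<Rightarrow> (nat \<Rightarrow> nat \<times> nat) \<Rightarrow> (nat \<Rightarrow> nat) \<Rightarrow> bool" where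
  "std_labels n ls lab1 lab2 \<longleftrightarrow>
     rep n ls = (label_diagram n lab1 (Id_on (inner_labels ls)) lab1, label_diagram n lab2 (Id_on {..<length ls}) lab2) \<and>
     inner_labels ls \<subseteq> lab1 ` {1..n} \<and> {..<length ls} \<subseteq> lab2 ` {1..n} \<and> inj_on lab1 {1..n} \<and>
     (\<forall>j\<in>{1..n}. lab1 j \<in> inner_labels ls \<longrightarrow> lab2 j = fst (lab1 j)) \<and>
     (ls \<noteq> [] \<longrightarrow> lab2 ` {1..n} \<subseteq> {..<length ls})"

lemma std_labelsD:
  assumes "std_labels n ls lab1 lab2"
  shows "rep n ls = (label_diagram n lab1 (Id_on (inner_labels ls)) lab1, label_diagram n lab2 (Id_on {..<length ls}) lab2)"
    "inner_labels ls \<subseteq> lab1 ` {1..n}" "{..<length ls} \<subseteq> lab2 ` {1..n}"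
    "\<And>i j. i \<in> {1..n} \<Longrightarrow> j \<in> {1..n} \<Longrightarrow> lab1 i = lab1 j \<Longrightarrow> i = j"
    "\<And>j. j \<in> {1..n} \<Longrightarrow> lab1 j \<in> inner_labels ls \<Longrightarrow> lab2 j = fst (lab1 j)"
    "\<And>j. j \<in> {1..n} \<Longrightarrow> ls \<noteq> [] \<Longrightarrow> lab2 j < length ls"
proof -
  note S = assms[unfolded std_labels_def]
  show "rep n ls = (label_diagram n lab1 (Id_on (inner_labels ls)) lab1, label_diagram n lab2 (Id_on {..<length ls}) lab2)"
    "inner_labels ls \<subseteq> lab1 ` {1..n}" "{..<length ls} \<subseteq> lab2 ` {1..n}" using S by blast+
  show "\<And>i j. i \<in> {1..n} \<Longrightarrow> j \<in> {1..n} \<Longrightarrow> lab1 i = lab1 j \<Longrightarrow> i = j"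
    "\<And>j. j \<in> {1..n} \<Longrightarrow> lab1 j \<in> inner_labels ls \<Longrightarrow> lab2 j = fst (lab1 j)"
    "\<And>j. j \<in> {1..n} \<Longrightarrow> ls \<noteq> [] \<Longrightarrow> lab2 j < length ls"
    using S by (meson inj_onD, blast, blast)
qed

lemma rep_facts:
  assumes "std_labels n ls lab1 lab2"
  shows "rep n ls \<in> ramified_diagrams n" "rmul n (rep n ls) (rep n ls) = rep n ls"
    "rflip n (rep n ls) = rep n ls" "rrank n (rep n ls) = length ls + sum_list ls"
proof -
  note L = std_labelsD[OF assms]
  have IO: "Id_on A O Id_on A = Id_on A" for A :: "'x set" by auto
  show "rep n ls \<in> ramified_diagrams n"
    unfolding L(1) label_ramified_iff[OF pbij_Id_on pbij_Id_on]
  proof (intro ballI conjI impI)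
    fix i j assume ij: "i \<in> {1..n}" "j \<in> {1..n}"
    { assume "lab1 i = lab1 j" then show "lab2 i = lab2 j" using L(4) ij by blast }
    { assume "lab1 i = lab1 j" then show "lab2 i = lab2 j" using L(4) ij by blast }
    assume *: "(lab1 i, lab1 j) \<in> Id_on (inner_labels ls)"
    then have "i = j" "lab1 i \<in> inner_labels ls" using L(4) ij by auto
    then show "(lab2 i, lab2 j) \<in> Id_on {..<length ls}"
      using L(5)[OF ij(1)] by (auto simp: Id_on_iff inner_labels_def)
  qed
  show "rmul n (rep n ls) (rep n ls) = rep n ls"
    unfolding L(1) rmul_def using L(2,3) by (simp add: compose_label IO del: One_nat_def)
  show "rflip n (rep n ls) = rep n ls"
    unfolding L(1) rflip_def by (simp add: flip_label)
  have "inner_labels ls = Sigma {..<length ls} (\<lambda>i. {..<ls ! i})" by (auto simp: inner_labels_def)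
  then have "card (inner_labels ls) = sum_list ls"
    by (simp add: sum_list_sum_nth atLeast0LessThan)
  moreover have "Id_on (inner_labels ls) \<subseteq> lab1 ` {1..n} \<times> lab1 ` {1..n}"
    "Id_on {..<length ls} \<subseteq> lab2 ` {1..n} \<times> lab2 ` {1..n}" using L(2,3) by auto
  ultimately show "rrank n (rep n ls) = length ls + sum_list ls"
    unfolding L(1) rrank_def by (simp add: prop_rank_label card_Id_on del: One_nat_def)
qed

text \<open>Refinement makes the outer label a function \<open>\<phi>\<close> of the inner label,
  and forces the outer part around a propagating inner part to propagate.\<close>

lemma ramified_labelling:
  assumes a: "a \<in> ramified_diagrams n"
  obtains f1 g1 f2 g2 and A1 A2 :: "point set set" and \<phi> where
    "a = (label_diagram n f1 (Id_on A1) g1, label_diagram n f2 (Id_on A2) g2)"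
    "A1 \<subseteq> f1 ` {1..n}" "A1 \<subseteq> g1 ` {1..n}" "A2 \<subseteq> f2 ` {1..n}" "A2 \<subseteq> g2 ` {1..n}"
    "\<And>i. i \<in> {1..n} \<Longrightarrow> \<phi> (f1 i) = f2 i" "\<And>v. v \<in> A1 \<Longrightarrow> \<phi> v \<in> A2"
    "{} \<notin> f1 ` {1..n}" "{} \<notin> f2 ` {1..n}"
proof -
  have d: "fst a \<in> diagrams n" "snd a \<in> diagrams n" using a by (auto simp: ramified_iff)
  obtain f1 g1 and A1 :: "point set set" where 1: "A1 \<subseteq> f1 ` {1..n}" "A1 \<subseteq> g1 ` {1..n}"
    "fst a = label_diagram n f1 (Id_on A1) g1" "{} \<notin> f1 ` {1..n}" using diagram_labelling[OF d(1)] by metis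
  obtain f2 g2 and A2 :: "point set set" where 2: "A2 \<subseteq> f2 ` {1..n}" "A2 \<subseteq> g2 ` {1..n}"
    "snd a = label_diagram n f2 (Id_on A2) g2" "{} \<notin> f2 ` {1..n}" using diagram_labelling[OF d(2)] by metis
  have eq: "a = (label_diagram n f1 (Id_on A1) g1, label_diagram n f2 (Id_on A2) g2)"
    using 1 2 by (metis prod.collapse)
  note R = label_ramifiedD[OF pbij_Id_on pbij_Id_on a[unfolded eq]]
  define \<phi> where "\<phi> v = f2 (inv_into {1..n} f1 v)" for v
  have \<phi>: "\<phi> (f1 i) = f2 i" if i: "i \<in> {1..n}" for i
  proof -
    have "f1 (inv_into {1..n} f1 (f1 i)) = f1 i" "inv_into {1..n} f1 (f1 i) \<in> {1..n}"
      using i f_inv_into_f inv_into_into by (metis imageI)+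
    then show ?thesis unfolding \<phi>_def
      using R(1)[OF _ i] by blast
  qed
  have \<phi>A: "\<phi> v \<in> A2" if v: "v \<in> A1" for v
  proof -
    obtain i where "i \<in> {1..n}" "v = f1 i" using 1(1) v by blast
    moreover obtain j where "j \<in> {1..n}" "v = g1 j" using 1(2) v by blast
    ultimately have ij: "i \<in> {1..n}" "v = f1 i" "j \<in> {1..n}" "v = g1 j" by simp_all
    have "(f1 i, g1 j) \<in> Id_on A1" using v unfolding Id_on_iff ij(2)[symmetric] ij(4)[symmetric] by simp
    then have "(f2 i, g2 j) \<in> Id_on A2"
      by (rule R(3)[OF ij(1,3)])
    then have "f2 i \<in> A2" unfolding Id_on_iff by (rule conjunct2)
    then show ?thesis unfolding ij(2) \<phi>[OF ij(1)] .
  qed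
  show ?thesis by (rule that[OF eq 1(1,2) 2(1,2) _ _ 1(4) 2(4)]) (fact \<phi> \<phi>A)+
qed

lemma label_projection:
  assumes "A1 \<subseteq> f1 ` {1..n}" "A1 \<subseteq> g1 ` {1..n}" "A2 \<subseteq> f2 ` {1..n}" "A2 \<subseteq> g2 ` {1..n}"
    and "a = (label_diagram n f1 (Id_on A1) g1, label_diagram n f2 (Id_on A2) g2)"
  shows "rmul n a (rflip n a) = (label_diagram n f1 (Id_on A1) f1, label_diagram n f2 (Id_on A2) f2)"
proof -
  have IO: "Id_on A O Id_on A = Id_on A" for A :: "'x set" by auto
  show ?thesis unfolding assms(5) rmul_def rflip_def using assms(2,4)
    by (simp add: flip_label compose_label IO del: One_nat_def)
qed

lemma graph_facts:
  assumes "bij_betw \<psi> A B"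
  defines "\<theta> \<equiv> {(v, \<psi> v) | v. v \<in> A}"
  shows "pbij \<theta>" "\<theta> O \<theta>\<inverse> = Id_on A" "\<theta>\<inverse> O \<theta> = Id_on B" "Domain \<theta> = A" "Range \<theta> = B"
proof -
  have inj: "u = v" if "u \<in> A" "v \<in> A" "\<psi> u = \<psi> v" for u v using assms(1) that by (auto simp: bij_betw_def inj_on_def)
  show "pbij \<theta>" using inj by (auto simp: pbij_def single_valued_def \<theta>_def)
  show "\<theta> O \<theta>\<inverse> = Id_on A" using inj by (auto simp: \<theta>_def)
  have "B = \<psi> ` A" using assms(1) by (simp add: bij_betw_def)
  then show "\<theta>\<inverse> O \<theta> = Id_on B" "Range \<theta> = B" by (auto simp: \<theta>_def)
  show "Domain \<theta> = A" by (auto simp: \<theta>_def)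
qed

text \<open>The index of a projection lists the numbers of inner propagating parts in the outer propagating
  parts, in decreasing order.\<close>

lemma reps_exist:
  assumes a: "a \<in> ramified_diagrams n"
    and lab: "\<And>ls. env_size ls \<le> n \<Longrightarrow> \<exists>lab1 lab2. std_labels n ls lab1 lab2"
  shows "\<exists>x\<in>ramified_diagrams n. rmul n x (rflip n x) = rmul n a (rflip n a) \<and>
    rmul n (rflip n x) x \<in> rep n ` level_indices n (rrank n a)"
proof -
  obtain f1 g1 f2 g2 and A1 A2 :: "point set set" and \<phi> where eq:
    "a = (label_diagram n f1 (Id_on A1) g1, label_diagram n f2 (Id_on A2) g2)"
    and A: "A1 \<subseteq> f1 ` {1..n}" "A1 \<subseteq> g1 ` {1..n}" "A2 \<subseteq> f2 ` {1..n}" "A2 \<subseteq> g2 ` {1..n}"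
    and \<phi>: "\<And>i. i \<in> {1..n} \<Longrightarrow> \<phi> (f1 i) = f2 i" "\<And>v. v \<in> A1 \<Longrightarrow> \<phi> v \<in> A2"
    using ramified_labelling[OF a] by metis
  have finA: "finite A1" "finite A2"
    using finite_subset[OF A(1)] finite_subset[OF A(3)] by simp_all
  define fib where "fib v = {x\<in>A1. \<phi> x = v}" for v
  define c where "c v = card (fib v)" for v
  obtain vs0 where vs0: "set vs0 = A2" "distinct vs0" using finite_distinct_list[OF finA(2)] by blast
  \<comment> \<open>\<open>sort_key\<close> arranges the outer parts by increasing number of inner
    strands; \<open>rev\<close> turns this into the order required of an index.\<close>
  define vs where "vs = rev (sort_key c vs0)"
  have vs: "set vs = A2" "distinct vs" using vs0 by (auto simp: vs_def)
  define ls where "ls = map c vs"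
  have "sorted (rev ls)" by (simp add: ls_def vs_def rev_map)
  then have dec: "propagating_index ls" unfolding propagating_index_def by (simp add: sorted_wrt_rev)
  have len: "length ls = card A2" using vs by (simp add: ls_def distinct_card[symmetric])
  have sum: "sum_list ls = card A1"
  proof -
    have "sum_list ls = (\<Sum>v\<in>A2. c v)" unfolding ls_def using vs by (simp add: sum_list_distinct_conv_sum_set)
    also have "\<dots> = card (\<Union>v\<in>A2. fib v)" unfolding c_def
      by (rule card_UN_disjoint[symmetric]) (use finA in \<open>auto simp: fib_def\<close>)
    also have "(\<Union>v\<in>A2. fib v) = A1" using \<phi> by (auto simp: fib_def)
    finally show ?thesis .
  qed
  \<comment> \<open>An outer propagating part has at least one vertex in the top row, and at least
    one there for each inner propagating part that it contains. The top vertices of different outer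
    parts are disjoint.\<close>
  have env: "env_size ls \<le> n"
  proof -
    have "env_size ls = (\<Sum>v\<in>A2. max 1 (c v))"
      unfolding env_size_def ls_def using vs by (simp add: sum_list_distinct_conv_sum_set comp_def)
    also have "\<dots> \<le> (\<Sum>v\<in>A2. card {i\<in>{1..n}. f2 i = v})"
    proof (rule sum_mono)
      fix v assume v: "v \<in> A2"
      let ?I = "{i\<in>{1..n}. f2 i = v}"
      have "?I \<noteq> {}" using A(3) v by blast
      then have "1 \<le> card ?I" by (simp add: Suc_le_eq card_gt_0_iff)
      moreover have "c v \<le> card ?I"
      proof -
        have "fib v \<subseteq> f1 ` ?I"
        proof
          fix x assume x: "x \<in> fib v"
          then obtain i where "i \<in> {1..n}" "x = f1 i" using A(1) unfolding fib_def by blast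
          moreover from this have "f2 i = v" using x \<phi>(1)[of i] unfolding fib_def by simp
          ultimately show "x \<in> f1 ` ?I" by blast
        qed
        then show ?thesis unfolding c_def by (rule surj_card_le[rotated]) simp
      qed
      ultimately show "max 1 (c v) \<le> card ?I" by simp
    qed
    also have "\<dots> = card (\<Union>v\<in>A2. {i\<in>{1..n}. f2 i = v})"
      by (rule card_UN_disjoint[symmetric]) (use finA in auto)
    also have "\<dots> \<le> card {1..n}" by (rule card_mono) auto
    finally show ?thesis by simp
  qed
  have rank: "rrank n a = length ls + sum_list ls"
    unfolding eq rrank_def using A len sum by (simp add: prop_rank_label card_Id_on Id_on_subset_Times del: One_nat_def)
       (subst prop_rank_label; auto simp: card_Id_on)+
  have level: "ls \<in> level_indices n (rrank n a)"
    using dec env rank by (simp add: level_indices_def)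
  obtain lab1 lab2 where std: "std_labels n ls lab1 lab2" using lab[OF env] by blast
  note L = std_labelsD[OF std]
  have "bij_betw ((!) vs) {..<length vs} A2" using bij_betw_nth[of vs "{..<length vs}" A2] vs by simp
  \<comment> \<open>Outer parts are renamed by their position in the decreasing list; an inner part
    is then renamed by that position together with a number within its outer part.\<close>
  define \<psi>2 where "\<psi>2 = inv_into {..<length vs} ((!) vs)"
  have \<psi>2: "bij_betw \<psi>2 A2 {..<length ls}"
    using bij_betw_inv_into[OF \<open>bij_betw ((!) vs) {..<length vs} A2\<close>] by (simp add: \<psi>2_def ls_def)
  have \<psi>2_c: "ls ! (\<psi>2 v) = c v" "\<psi>2 v < length ls" if "v \<in> A2" for v
  proof -
    show *: "\<psi>2 v < length ls" using bij_betwE[OF \<psi>2] that by blast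
    have "vs ! \<psi>2 v = v"
      using bij_betw_inv_into_right[OF \<open>bij_betw ((!) vs) {..<length vs} A2\<close> that] by (simp add: \<psi>2_def)
    then show "ls ! (\<psi>2 v) = c v" using * by (simp add: ls_def)
  qed
  have "\<exists>h. bij_betw h (fib v) {..<c v}" for v
    using ex_bij_betw_finite_nat[of "fib v"] finA unfolding c_def fib_def by (simp add: atLeast0LessThan)
  then obtain h where h: "\<And>v. bij_betw (h v) (fib v) {..<c v}" by metis
  define \<psi>1 where "\<psi>1 v = (\<psi>2 (\<phi> v), h (\<phi> v) v)" for v
  have \<psi>1: "bij_betw \<psi>1 A1 (inner_labels ls)"
  proof (rule bij_betw_imageI)
    show "inj_on \<psi>1 A1"
    proof (rule inj_onI)
      fix u v assume uv: "u \<in> A1" "v \<in> A1" "\<psi>1 u = \<psi>1 v"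
      then have "\<phi> u = \<phi> v" using \<psi>2 \<phi>(2) by (auto simp: \<psi>1_def bij_betw_def inj_on_def)
      moreover from this uv have "h (\<phi> u) u = h (\<phi> u) v" "u \<in> fib (\<phi> u)" "v \<in> fib (\<phi> u)"
        by (auto simp: \<psi>1_def fib_def)
      ultimately show "u = v" using h[of "\<phi> u"] by (auto simp: bij_betw_def inj_on_def)
    qed
    show "\<psi>1 ` A1 = inner_labels ls"
    proof (intro equalityI subsetI)
      fix p assume "p \<in> \<psi>1 ` A1"
      then obtain v where v: "v \<in> A1" "p = \<psi>1 v" by blast
      have "h (\<phi> v) v \<in> {..<c (\<phi> v)}" by (rule bij_betwE[OF h, rule_format]) (use v in \<open>simp add: fib_def\<close>)
      then show "p \<in> inner_labels ls" using v \<psi>2_c[OF \<phi>(2)[OF v(1)]] by (simp add: \<psi>1_def inner_labels_def)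
    next
      fix p assume "p \<in> inner_labels ls"
      then obtain i r where p: "p = (i, r)" "i < length ls" "r < ls ! i" by (auto simp: inner_labels_def)
      have "i \<in> \<psi>2 ` A2" using p(2) bij_betw_imp_surj_on[OF \<psi>2] by simp
      then obtain v where v: "v \<in> A2" "\<psi>2 v = i" by blast
      then have "r \<in> h v ` fib v" using h[of v] p \<psi>2_c[OF v(1)] by (simp add: bij_betw_def)
      then obtain x where "x \<in> fib v" "r = h v x" by blast
      then show "p \<in> \<psi>1 ` A1" using p v by (intro image_eqI[of _ _ x]) (auto simp: \<psi>1_def fib_def)
    qed
  qed
  let ?\<theta>1 = "{(v, \<psi>1 v) | v. v \<in> A1}" and ?\<theta>2 = "{(v, \<psi>2 v) | v. v \<in> A2}"
  note \<theta>1 = graph_facts[OF \<psi>1] and \<theta>2 = graph_facts[OF \<psi>2]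
  \<comment> \<open>The top half of \<open>a\<close>, joined to the standard labels at the bottom:
    its projections are that of \<open>a\<close> and \<open>rep n ls\<close>.\<close>
  let ?x = "(label_diagram n f1 ?\<theta>1 lab1, label_diagram n f2 ?\<theta>2 lab2)"
  note R = label_ramifiedD[OF pbij_Id_on pbij_Id_on a[unfolded eq]]
  have "?x \<in> ramified_diagrams n"
    unfolding label_ramified_iff[OF \<theta>1(1) \<theta>2(1)]
  proof (intro ballI conjI impI)
    fix i j assume ij: "i \<in> {1..n}" "j \<in> {1..n}"
    { assume "f1 i = f1 j" then show "f2 i = f2 j"
by (rule R(1)[OF ij]) }
    { assume "lab1 i = lab1 j" then show "lab2 i = lab2 j" using L(4) ij by blast }
    assume "(f1 i, lab1 j) \<in> ?\<theta>1"
    then have *: "f1 i \<in> A1" "lab1 j = \<psi>1 (f1 i)" by auto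
    then have "lab1 j \<in> inner_labels ls" using \<psi>1 by (auto simp: bij_betw_def)
    then have "lab2 j = \<psi>2 (f2 i)" using L(5)[OF ij(2)] * \<phi>(1)[OF ij(1)] by (simp add: \<psi>1_def)
    moreover have "f2 i \<in> A2" using \<phi>(2)[OF *(1)] \<phi>(1)[OF ij(1)] by simp
    ultimately show "(f2 i, lab2 j) \<in> ?\<theta>2" by blast
  qed
  moreover have "rmul n ?x (rflip n ?x) = rmul n a (rflip n a)"
    unfolding label_projection[OF A eq] unfolding rmul_def rflip_def
    using compose_label_flip(1)[OF \<theta>1(1), of lab1 n f1] compose_label_flip(1)[OF \<theta>2(1), of lab2 n f2]
      \<theta>1(2,5) \<theta>2(2,5) L(2,3) by simp
  moreover have "rmul n (rflip n ?x) ?x = rep n ls"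
    unfolding L(1) rmul_def rflip_def
    using compose_label_flip(2)[OF \<theta>1(1), of f1 n lab1] compose_label_flip(2)[OF \<theta>2(1), of f2 n lab2]
      \<theta>1(3,4) \<theta>2(3,4) A(1,3) by simp
  ultimately show ?thesis using level by blast
qed

lemma proj_between_reps:
  assumes x: "x \<in> ramified_diagrams n"
    and std: "std_labels n ls lab1 lab2" "std_labels n ls' lab1' lab2'"
    and e: "rmul n x (rflip n x) = rep n ls" and f: "rmul n (rflip n x) x = rep n ls'"
  obtains \<theta>1 \<theta>2 where "x = (label_diagram n lab1 \<theta>1 lab1', label_diagram n lab2 \<theta>2 lab2')"
    "pbij \<theta>1" "Domain \<theta>1 = inner_labels ls" "Range \<theta>1 = inner_labels ls'"
    "pbij \<theta>2" "Domain \<theta>2 = {..<length ls}" "Range \<theta>2 = {..<length ls'}"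
    "\<And>p q. (p, q) \<in> \<theta>1 \<Longrightarrow> (fst p, fst q) \<in> \<theta>2"
proof -
  note L = std_labelsD[OF std(1)] and L' = std_labelsD[OF std(2)]
  have d: "fst x \<in> diagrams n" "snd x \<in> diagrams n" using x by (auto simp: ramified_iff)
  obtain \<theta>1 where 1: "fst x = label_diagram n lab1 \<theta>1 lab1'" "pbij \<theta>1" "Domain \<theta>1 = inner_labels ls"
    "Range \<theta>1 = inner_labels ls'"
    by (rule diagram_between_projections[OF d(1) L(2) _ L'(2)]) (use e f L(1) L'(1) in \<open>auto simp: rmul_def rflip_def\<close>)
  obtain \<theta>2 where 2: "snd x = label_diagram n lab2 \<theta>2 lab2'" "pbij \<theta>2" "Domain \<theta>2 = {..<length ls}"
    "Range \<theta>2 = {..<length ls'}"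
    by (rule diagram_between_projections[OF d(2) L(3) _ L'(3)]) (use e f L(1) L'(1) in \<open>auto simp: rmul_def rflip_def\<close>)
  have eq: "x = (label_diagram n lab1 \<theta>1 lab1', label_diagram n lab2 \<theta>2 lab2')" using 1 2 by (metis prod.collapse)
  note R = label_ramifiedD[OF 1(2) 2(2) x[unfolded eq]]
  have "(fst p, fst q) \<in> \<theta>2" if pq: "(p, q) \<in> \<theta>1" for p q
  proof -
    have "p \<in> inner_labels ls" "q \<in> inner_labels ls'" using pq 1 by blast+
    then obtain i j where ij: "i \<in> {1..n}" "p = lab1 i" "j \<in> {1..n}" "q = lab1' j" using L(2) L'(2) by blast
    then have "(lab2 i, lab2' j) \<in> \<theta>2" using R(3)[of i j] pq by simp
    then show ?thesis
      using L(5)[of i] L'(5)[of j] ij \<open>p \<in> inner_labels ls\<close> \<open>q \<in> inner_labels ls'\<close> by simp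
  qed
  then show ?thesis using that[OF eq 1(2,3,4) 2(2,3,4)] by blast
qed

text \<open>All inner strands that start in outer part \<open>i\<close> end in the outer part joined
  to it, and different strands have different ends.\<close>

lemma fibre_le:
  assumes "pbij \<theta>1" "Domain \<theta>1 = inner_labels ls" "Range \<theta>1 = inner_labels ls'"
    and "pbij \<theta>2" "\<And>p q. (p, q) \<in> \<theta>1 \<Longrightarrow> (fst p, fst q) \<in> \<theta>2"
    and "(i, i') \<in> \<theta>2" "i < length ls"
  shows "ls ! i \<le> ls' ! i'"
proof -
  have "\<forall>r\<in>{..<ls ! i}. \<exists>r'. ((i, r), (i', r')) \<in> \<theta>1"
  proof
    fix r assume "r \<in> {..<ls ! i}"
    then have "(i, r) \<in> Domain \<theta>1" using assms(2,7) by (simp add: inner_labels_def)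
    then obtain j r' where *: "((i, r), (j, r')) \<in> \<theta>1" by auto
    then have "(i, j) \<in> \<theta>2" using assms(5) by fastforce
    then have "j = i'" using assms(4,6) by (auto simp: pbij_def dest: single_valuedD)
    then show "\<exists>r'. ((i, r), (i', r')) \<in> \<theta>1" using * by blast
  qed
  then obtain s where s: "\<And>r. r < ls ! i \<Longrightarrow> ((i, r), (i', s r)) \<in> \<theta>1" by (metis lessThan_iff)
  have "inj_on s {..<ls ! i}"
  proof (rule inj_onI)
    fix r r' assume "r \<in> {..<ls ! i}" "r' \<in> {..<ls ! i}" "s r = s r'"
    then have "((i, r), (i', s r)) \<in> \<theta>1" "((i, r'), (i', s r)) \<in> \<theta>1" using s[of r] s[of r'] by auto
    then show "r = r'" using pbij_inj[OF assms(1)] by blast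
  qed
  moreover have "s ` {..<ls ! i} \<subseteq> {..<ls' ! i'}"
  proof clarify
    fix r assume "r < ls ! i"
    then have "(i', s r) \<in> inner_labels ls'" using s assms(3) by blast
    then show "s r < ls' ! i'" by (simp add: inner_labels_def)
  qed
  ultimately have "card {..<ls ! i} \<le> card {..<ls' ! i'}" by (intro card_inj_on_le) auto
  then show ?thesis by simp
qed

text \<open>By \<open>fibre_le\<close>, used for the matchings and for their converses, the outer
  strands join parts with equal entries. The two indices are then equal as multisets, and their
  common ordering makes them equal as lists.\<close>

lemma reps_distinct_index:
  assumes x: "x \<in> ramified_diagrams n"
    and std: "std_labels n ls lab1 lab2" "std_labels n ls' lab1' lab2'"
    and dec: "propagating_index ls" "propagating_index ls'"
    and e: "rmul n x (rflip n x) = rep n ls" and f: "rmul n (rflip n x) x = rep n ls'"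
  shows "ls = ls'"
proof -
  obtain \<theta>1 \<theta>2 where \<theta>: "pbij \<theta>1" "Domain \<theta>1 = inner_labels ls" "Range \<theta>1 = inner_labels ls'"
    "pbij \<theta>2" "Domain \<theta>2 = {..<length ls}" "Range \<theta>2 = {..<length ls'}"
    "\<And>p q. (p, q) \<in> \<theta>1 \<Longrightarrow> (fst p, fst q) \<in> \<theta>2"
    by (rule proj_between_reps[OF x std e f]) blast
  have eq: "ls ! i = ls' ! i'" if i: "(i, i') \<in> \<theta>2" for i i'
  proof (rule antisym)
    have "i < length ls" "i' < length ls'" using i \<theta>(5,6) by blast+
    then show "ls ! i \<le> ls' ! i'" using fibre_le[OF \<theta>(1-4) \<theta>(7) i] by blast
    show "ls' ! i' \<le> ls ! i"
      by (rule fibre_le[of "\<theta>1\<inverse>" ls' ls "\<theta>2\<inverse>"]) (use \<theta> i \<open>i' < length ls'\<close> in auto)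
  qed
  have "\<forall>i\<in>{..<length ls}. \<exists>i'. (i, i') \<in> \<theta>2" using \<theta>(5) by blast
  then obtain t where t: "\<And>i. i < length ls \<Longrightarrow> (i, t i) \<in> \<theta>2" by (metis lessThan_iff)
  have bij: "bij_betw t {..<length ls} {..<length ls'}"
  proof (rule bij_betw_imageI)
    show "inj_on t {..<length ls}"
    proof (rule inj_onI)
      fix i j assume "i \<in> {..<length ls}" "j \<in> {..<length ls}" "t i = t j"
      then have "(i, t i) \<in> \<theta>2" "(j, t i) \<in> \<theta>2" using t[of i] t[of j] by auto
      then show "i = j" using pbij_inj[OF \<theta>(4)] by blast
    qed
    show "t ` {..<length ls} = {..<length ls'}"
    proof (intro equalityI subsetI)
      fix i' assume "i' \<in> {..<length ls'}"
      then obtain i where i: "(i, i') \<in> \<theta>2" using \<theta>(6) by blast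
      then have "i < length ls" using \<theta>(5) by blast
      then have "i' = t i" using t i \<theta>(4) unfolding pbij_def single_valued_def by blast
      then show "i' \<in> t ` {..<length ls}" using \<open>i < length ls\<close> by blast
    qed (use t \<theta>(6) in blast)
  qed
  have m: "mset xs = image_mset ((!) xs) (mset_set {..<length xs})" for xs :: "nat list"
    by (metis atLeast_upt map_nth mset_map mset_upt atLeast0LessThan)
  have "mset ls = image_mset (\<lambda>i. ls' ! t i) (mset_set {..<length ls})"
    unfolding m[of ls] by (rule image_mset_cong) (use eq t in auto)
  also have "\<dots> = image_mset ((!) ls') (image_mset t (mset_set {..<length ls}))"
    by (simp add: image_mset.compositionality comp_def)
  also have "\<dots> = mset ls'"
    using bij unfolding m[of ls'] bij_betw_def by (simp add: image_mset_mset_set)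
  finally have "sort (rev ls) = sort (rev ls')" by (metis mset_rev properties_for_sort sorted_sort mset_sort)
  moreover have "sorted (rev ls)" "sorted (rev ls')"
    using dec by (simp_all add: propagating_index_def sorted_wrt_rev)
  ultimately show ?thesis by (simp add: sorted_sort_id)
qed

text \<open>If all labels propagate, the subset above equals the subset below, so the relation is a
  partial identity; such relations compose by intersection.\<close>

lemma sat_full_label:
  assumes "f ` {1..n} \<subseteq> A"
  shows "sat n (label_diagram n f (Id_on A) f) =
    {(U, W). U = W \<and> U \<subseteq> {1..n} \<and> (\<forall>i\<in>{1..n}. \<forall>j\<in>{1..n}. f i = f j \<longrightarrow> (i \<in> U \<longleftrightarrow> j \<in> U))}"
proof -
  have eq: "(U, W) \<in> sat n (label_diagram n f (Id_on A) f) \<longleftrightarrow>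
     U = W \<and> U \<subseteq> {1..n} \<and> (\<forall>i\<in>{1..n}. \<forall>j\<in>{1..n}. f i = f j \<longrightarrow> (i \<in> U \<longleftrightarrow> j \<in> U))" for U W
  proof
    assume "(U, W) \<in> sat n (label_diagram n f (Id_on A) f)"
    note L = sat_labelD[OF pbij_Id_on this]
    have "i \<in> U \<longleftrightarrow> i \<in> W" if "i \<in> {1..n}" for i
    proof -
      have "f i \<in> A" using assms that by blast
      then show ?thesis using L(5)[OF that that] by (simp add: Id_on_iff)
    qed
    then have "U = W" using L(1,2) by blast
    then show "U = W \<and> U \<subseteq> {1..n} \<and> (\<forall>i\<in>{1..n}. \<forall>j\<in>{1..n}. f i = f j \<longrightarrow> (i \<in> U \<longleftrightarrow> j \<in> U))"
      using L(1,3) by blast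
  next
    assume R: "U = W \<and> U \<subseteq> {1..n} \<and> (\<forall>i\<in>{1..n}. \<forall>j\<in>{1..n}. f i = f j \<longrightarrow> (i \<in> U \<longleftrightarrow> j \<in> U))"
    then have Rf: "i \<in> U \<longleftrightarrow> j \<in> U" if "i \<in> {1..n}" "j \<in> {1..n}" "f i = f j" for i j using that by blast
    have UW: "W = U" "U \<subseteq> {1..n}" using R by auto
    have RI: "i \<in> U \<longleftrightarrow> j \<in> U" if "i \<in> {1..n}" "j \<in> {1..n}" "(f i, f j) \<in> Id_on A" for i j
      by (rule Rf[OF that(1,2)]) (use that(3) in \<open>simp add: Id_on_iff\<close>)
    show "(U, W) \<in> sat n (label_diagram n f (Id_on A) f)" unfolding UW(1)
      by (rule sat_labelI[OF pbij_Id_on UW(2) UW(2)]) (fact Rf Rf RI)+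
  qed
  show ?thesis
  proof (rule equalityI; rule subrelI)
    fix U W assume "(U, W) \<in> sat n (label_diagram n f (Id_on A) f)"
    then show "(U, W) \<in> {(U, W). U = W \<and> U \<subseteq> {1..n} \<and>
        (\<forall>i\<in>{1..n}. \<forall>j\<in>{1..n}. f i = f j \<longrightarrow> (i \<in> U \<longleftrightarrow> j \<in> U))}"
      unfolding eq mem_Collect_eq prod.case .
  next
    fix U W assume "(U, W) \<in> {(U, W). U = W \<and> U \<subseteq> {1..n} \<and>
        (\<forall>i\<in>{1..n}. \<forall>j\<in>{1..n}. f i = f j \<longrightarrow> (i \<in> U \<longleftrightarrow> j \<in> U))}"
    then show "(U, W) \<in> sat n (label_diagram n f (Id_on A) f)"
      unfolding eq mem_Collect_eq prod.case .
  qed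
qed

text \<open>Coarser labels leave fewer saturated subsets, and the composite of two partial
  identities, one inside the other, is the smaller one.\<close>

lemma compose_full_absorb:
  assumes "f ` {1..n} \<subseteq> A" "g ` {1..n} \<subseteq> B"
    and "\<And>i j. i \<in> {1..n} \<Longrightarrow> j \<in> {1..n} \<Longrightarrow> g i = g j \<Longrightarrow> f i = f j"
  shows "compose n (label_diagram n f (Id_on A) f) (label_diagram n g (Id_on B) g) = label_diagram n f (Id_on A) f"
proof (rule sat_inj[of _ n])
  have 1: "sat n (label_diagram n f (Id_on A) f) \<subseteq> sat n (label_diagram n g (Id_on B) g)"
    unfolding sat_full_label[OF assms(1)] sat_full_label[OF assms(2)]
  proof (rule subrelI)
    fix U W
    assume "(U, W) \<in> {(U, W). U = W \<and> U \<subseteq> {1..n} \<and> (\<forall>i\<in>{1..n}. \<forall>j\<in>{1..n}. f i = f j \<longrightarrow> (i \<in> U) = (j \<in> U))}"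
    then have *: "U = W" "U \<subseteq> {1..n}" "\<And>i j. i \<in> {1..n} \<Longrightarrow> j \<in> {1..n} \<Longrightarrow> f i = f j \<Longrightarrow> (i \<in> U) = (j \<in> U)"
      by blast+
    have "\<forall>i\<in>{1..n}. \<forall>j\<in>{1..n}. g i = g j \<longrightarrow> (i \<in> U) = (j \<in> U)"
      by (intro ballI impI *(3) assms(3))
    then show "(U, W) \<in> {(U, W). U = W \<and> U \<subseteq> {1..n} \<and> (\<forall>i\<in>{1..n}. \<forall>j\<in>{1..n}. g i = g j \<longrightarrow> (i \<in> U) = (j \<in> U))}"
      unfolding mem_Collect_eq prod.case by - (intro conjI *(1,2), assumption)
  qed
  have 2: "sat n (label_diagram n g (Id_on B) g) \<subseteq> Id" unfolding sat_full_label[OF assms(2)] by auto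
  have "R O R' = R" if "R \<subseteq> R'" "R' \<subseteq> Id" for R R' :: "'x rel" using that by blast
  from this[OF 1 2]
  have "sat n (label_diagram n f (Id_on A) f) O sat n (label_diagram n g (Id_on B) g) =
      sat n (label_diagram n f (Id_on A) f)" .
  then show "sat n (compose n (label_diagram n f (Id_on A) f) (label_diagram n g (Id_on B) g)) =
      sat n (label_diagram n f (Id_on A) f)" by (simp add: sat_compose)
qed (simp_all add: compose_diagram)

lemma compose_label_Id: "A \<subseteq> f ` {1..n} \<Longrightarrow> A \<subseteq> B \<Longrightarrow>
    compose n (label_diagram n f (Id_on A) f) (label_diagram n f (Id_on B) f) = label_diagram n f (Id_on A) f"
proof -
  assume *: "A \<subseteq> f ` {1..n}" "A \<subseteq> B"
  then have "Id_on A O Id_on B = Id_on A" by auto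
  then show ?thesis using * by (subst compose_label) auto
qed

lemma rrank_label:
  assumes "A1 \<subseteq> f1 ` {1..n}" "A1 \<subseteq> g1 ` {1..n}" "A2 \<subseteq> f2 ` {1..n}" "A2 \<subseteq> g2 ` {1..n}"
  shows "rrank n (label_diagram n f1 (Id_on A1) g1, label_diagram n f2 (Id_on A2) g2) = card A1 + card A2"
proof -
  have "Id_on A1 \<subseteq> f1 ` {1..n} \<times> g1 ` {1..n}" "Id_on A2 \<subseteq> f2 ` {1..n} \<times> g2 ` {1..n}" using assms by auto
  then show ?thesis by (simp add: rrank_def prop_rank_label card_Id_on del: One_nat_def)
qed

lemma rmul_regular: "a \<in> ramified_diagrams n \<Longrightarrow> rmul n (rmul n a (rflip n a)) a = a"
  by (auto simp: ramified_iff rmul_def rflip_def compose_flip_regular prod_eq_iff)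

text \<open>It suffices to raise the projection \<open>p\<close> of \<open>a\<close>: a
  \<open>b\<close> of the next rank with \<open>p b = p\<close> gives
  \<open>a = p a = p b a\<close>. Rank is gained by letting a further part propagate or, when all
  parts do, by splitting one.\<close>

lemma rrank_step:
  assumes a: "a \<in> ramified_diagrams n" and lt: "rrank n a < 2 * n"
  shows "\<exists>b\<in>ramified_diagrams n. rrank n b = Suc (rrank n a) \<and>
    (\<exists>s\<in>ramified_diagrams n. \<exists>t\<in>ramified_diagrams n. a = rmul n (rmul n s b) t)"
proof -
  obtain f1 g1 f2 g2 and A1 A2 :: "point set set" and \<phi> where eq:
    "a = (label_diagram n f1 (Id_on A1) g1, label_diagram n f2 (Id_on A2) g2)"
    and A: "A1 \<subseteq> f1 ` {1..n}" "A1 \<subseteq> g1 ` {1..n}" "A2 \<subseteq> f2 ` {1..n}" "A2 \<subseteq> g2 ` {1..n}"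
    and \<phi>: "\<And>i. i \<in> {1..n} \<Longrightarrow> \<phi> (f1 i) = f2 i" "\<And>v. v \<in> A1 \<Longrightarrow> \<phi> v \<in> A2"
    and ne: "{} \<notin> f1 ` {1..n}" "{} \<notin> f2 ` {1..n}"
    using ramified_labelling[OF a] by metis
  have fin: "finite A1" "finite A2"
    using finite_subset[OF A(1)] finite_subset[OF A(3)] by simp_all
  define p where "p = rmul n a (rflip n a)"
  have p: "p = (label_diagram n f1 (Id_on A1) f1, label_diagram n f2 (Id_on A2) f2)"
    unfolding p_def by (rule label_projection[OF A eq])
  have pM: "p \<in> ramified_diagrams n" unfolding p_def by (intro rmul_closed rflip_closed a)
  have rk: "rrank n a = card A1 + card A2" unfolding eq by (rule rrank_label[OF A])
  have f12: "f2 i = f2 j" if "i \<in> {1..n}" "j \<in> {1..n}" "f1 i = f1 j" for i j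
    using \<phi>(1)[OF that(1)] \<phi>(1)[OF that(2)] that(3) by simp
  have A12: "f2 i \<in> A2" if "i \<in> {1..n}" "f1 i \<in> A1" for i using \<phi>(2)[OF that(2)] \<phi>(1)[OF that(1)] by simp
  have "\<exists>b\<in>ramified_diagrams n. rrank n b = Suc (card A1 + card A2) \<and> rmul n p b = p"
  proof -
    \<comment> \<open>In \<open>1\<close> and \<open>2\<close> an inner or an outer part is made to
      propagate; asking for \<open>f2 i \<in> A2\<close> in \<open>1\<close> keeps the pair
      ramified. In \<open>3\<close> an outer part is split between inner parts, in \<open>4\<close>
      an inner part is split. In \<open>5\<close> the rank is \<open>2 * n\<close>, which is
      excluded.\<close>
    consider (1) i where "i \<in> {1..n}" "f1 i \<notin> A1" "f2 i \<in> A2"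
      | (2) i where "i \<in> {1..n}" "f2 i \<notin> A2"
      | (3) i j where "f1 ` {1..n} \<subseteq> A1" "f2 ` {1..n} \<subseteq> A2" "i \<in> {1..n}" "j \<in> {1..n}" "f2 i = f2 j" "f1 i \<noteq> f1 j"
      | (4) i j where "f1 ` {1..n} \<subseteq> A1" "f2 ` {1..n} \<subseteq> A2" "i \<in> {1..n}" "j \<in> {1..n}" "i \<noteq> j" "f1 i = f1 j"
      | (5) "f1 ` {1..n} \<subseteq> A1" "f2 ` {1..n} \<subseteq> A2" "inj_on f1 {1..n}" "inj_on f2 {1..n}"
    proof (cases "f1 ` {1..n} \<subseteq> A1 \<and> f2 ` {1..n} \<subseteq> A2")
      case False
      then obtain i where "i \<in> {1..n}" "f1 i \<notin> A1 \<or> f2 i \<notin> A2" by blast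
      then show ?thesis using that(1,2) by blast
    next
      case True
      show ?thesis
      proof (cases "inj_on f1 {1..n}")
        case inj1: True
        show ?thesis
        proof (cases "inj_on f2 {1..n}")
          case False
          then obtain i j where "i \<in> {1..n}" "j \<in> {1..n}" "f2 i = f2 j" "i \<noteq> j" by (auto simp: inj_on_def)
          moreover from this have "f1 i \<noteq> f1 j" using inj1 by (auto dest: inj_onD)
          ultimately show ?thesis using that(3) True by blast
        qed (use that(5) True inj1 in blast)
      next
        case False
        then obtain i j where "i \<in> {1..n}" "j \<in> {1..n}" "f1 i = f1 j" "i \<noteq> j" by (auto simp: inj_on_def)
        then show ?thesis using that(4) True by blast
      qed
    qed
    then show ?thesis
    proof cases
      case 1
      let ?B = "insert (f1 i) A1"
      let ?b = "(label_diagram n f1 (Id_on ?B) f1, label_diagram n f2 (Id_on A2) f2)"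
      have B: "?B \<subseteq> f1 ` {1..n}" using A(1) 1 by blast
      have "?b \<in> ramified_diagrams n"
        unfolding label_ramified_iff[OF pbij_Id_on pbij_Id_on]
      proof (intro ballI conjI impI)
        fix j k assume jk: "j \<in> {1..n}" "k \<in> {1..n}"
        { assume "f1 j = f1 k" then show "f2 j = f2 k" by (rule f12[OF jk]) }
        { assume "f1 j = f1 k" then show "f2 j = f2 k" by (rule f12[OF jk]) }
        assume "(f1 j, f1 k) \<in> Id_on ?B"
        then have e: "f1 j = f1 k" and m: "f1 j = f1 i \<or> f1 j \<in> A1" unfolding Id_on_iff by blast+
        have "f2 j \<in> A2" using m A12[OF jk(1)] f12[OF jk(1) 1(1)] 1(3) by metis
        then show "(f2 j, f2 k) \<in> Id_on A2" using f12[OF jk e] by (simp add: Id_on_iff)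
      qed
      moreover have "rrank n ?b = Suc (card A1 + card A2)"
        using rrank_label[OF B B A(3) A(3)] fin 1 by simp
      moreover have "rmul n p ?b = p"
        unfolding p rmul_def fst_conv snd_conv
        using compose_label_Id[OF A(1), of ?B] compose_label_Id[OF A(3), of A2] by blast
      ultimately show ?thesis by blast
    next
      case 2
      let ?B = "insert (f2 i) A2"
      let ?b = "(label_diagram n f1 (Id_on A1) f1, label_diagram n f2 (Id_on ?B) f2)"
      have B: "?B \<subseteq> f2 ` {1..n}" using A(3) 2 by blast
      have "?b \<in> ramified_diagrams n"
        unfolding label_ramified_iff[OF pbij_Id_on pbij_Id_on]
      proof (intro ballI conjI impI)
        fix j k assume jk: "j \<in> {1..n}" "k \<in> {1..n}"
        { assume "f1 j = f1 k" then show "f2 j = f2 k" by (rule f12[OF jk]) }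
        { assume "f1 j = f1 k" then show "f2 j = f2 k" by (rule f12[OF jk]) }
        assume "(f1 j, f1 k) \<in> Id_on A1"
        then have e: "f1 j = f1 k" and m: "f1 j \<in> A1" unfolding Id_on_iff by blast+
        show "(f2 j, f2 k) \<in> Id_on ?B" using A12[OF jk(1) m] f12[OF jk e] by (simp add: Id_on_iff)
      qed
      moreover have "rrank n ?b = Suc (card A1 + card A2)"
        using rrank_label[OF A(1) A(1) B B] fin 2 by simp
      moreover have "rmul n p ?b = p"
        unfolding p rmul_def fst_conv snd_conv
        using compose_label_Id[OF A(1), of A1] compose_label_Id[OF A(3), of ?B] by blast
      ultimately show ?thesis by blast
    next
      case 3
      \<comment> \<open>The inner part of \<open>i\<close> receives an outer part of its own under
        the fresh label \<open>{}\<close>, while \<open>j\<close> keeps the old outer label in use.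
        The rank therefore grows by exactly one.\<close>
      define h where "h k = (if f1 k = f1 i then {} else f2 k)" for k
      let ?B = "insert {} A2"
      let ?b = "(label_diagram n f1 (Id_on A1) f1, label_diagram n h (Id_on ?B) h)"
      have B: "?B \<subseteq> h ` {1..n}"
      proof
        fix v assume "v \<in> ?B"
        then consider "v = {}" | k where "k \<in> {1..n}" "v = f2 k" using A(3) by blast
        then show "v \<in> h ` {1..n}"
        proof cases
          case 1
          then show ?thesis using \<open>i \<in> {1..n}\<close> by (intro image_eqI[of _ _ i]) (simp_all add: h_def)
        next
          case (2 k)
          show ?thesis
          proof (cases "f1 k = f1 i")
            case True
            then have "v = h j" using f12[OF 2(1) 3(3)] 2(2) 3(5,6) by (auto simp: h_def)
            then show ?thesis using 3(4) by blast
          next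
            case False
            then have "v = h k" using 2 by (simp add: h_def)
            then show ?thesis using 2(1) by blast
          qed
        qed
      qed
      have hB: "h ` {1..n} \<subseteq> ?B" using 3(2) by (auto simp: h_def)
      have h12: "h j = h k" if "j \<in> {1..n}" "k \<in> {1..n}" "f1 j = f1 k" for j k
        using f12[OF that] that(3) by (simp add: h_def)
      have hf: "f2 j = f2 k" if "j \<in> {1..n}" "k \<in> {1..n}" "h j = h k" for j k
      proof (cases "f1 j = f1 i"; cases "f1 k = f1 i")
        assume "f1 j = f1 i" "f1 k = f1 i"
        then show ?thesis using f12[OF that(1,2)] by simp
      next
        assume "f1 j = f1 i" "f1 k \<noteq> f1 i"
        then have "f2 k = {}" using that(3) by (simp add: h_def)
        then show ?thesis using ne(2) that(2) by (metis imageI)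
      next
        assume "f1 j \<noteq> f1 i" "f1 k = f1 i"
        then have "f2 j = {}" using that(3) by (simp add: h_def)
        then show ?thesis using ne(2) that(1) by (metis imageI)
      qed (use that(3) in \<open>simp add: h_def\<close>)
      have "?b \<in> ramified_diagrams n"
        unfolding label_ramified_iff[OF pbij_Id_on pbij_Id_on]
      proof (intro ballI conjI impI)
        fix j k assume jk: "j \<in> {1..n}" "k \<in> {1..n}"
        { assume "f1 j = f1 k" then show "h j = h k" by (rule h12[OF jk]) }
        { assume "f1 j = f1 k" then show "h j = h k" by (rule h12[OF jk]) }
        assume "(f1 j, f1 k) \<in> Id_on A1"
        then have "h j = h k" using h12[OF jk] unfolding Id_on_iff by blast
        moreover have "h j \<in> ?B" using hB jk(1) by blast
        ultimately show "(h j, h k) \<in> Id_on ?B" by (simp add: Id_on_iff)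
      qed
      moreover have "rrank n ?b = Suc (card A1 + card A2)"
        using rrank_label[OF A(1) A(1) B B] fin ne(2) A(3) by (subst (asm) card_insert_disjoint) auto
      moreover have "rmul n p ?b = p"
        unfolding p rmul_def fst_conv snd_conv
        using compose_label_Id[OF A(1), of A1] compose_full_absorb[OF 3(2) hB hf] by blast
      ultimately show ?thesis by blast
    next
      case 4
      \<comment> \<open>The vertex \<open>i\<close> is cut off from its inner part under the fresh
        label \<open>{}\<close>, while \<open>j\<close> keeps the old inner label in use.\<close>
      define h where "h k = (if k = i then {} else f1 k)" for k
      let ?B = "insert {} A1"
      let ?b = "(label_diagram n h (Id_on ?B) h, label_diagram n f2 (Id_on A2) f2)"
      have B: "?B \<subseteq> h ` {1..n}"
      proof
        fix v assume "v \<in> ?B"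
        then consider "v = {}" | k where "k \<in> {1..n}" "v = f1 k" using A(1) by blast
        then show "v \<in> h ` {1..n}"
        proof cases
          case 1
          then show ?thesis using 4(3) by (intro image_eqI[of _ _ i]) (simp_all add: h_def)
        next
          case (2 k)
          show ?thesis
          proof (cases "k = i")
            case True
            then have "v = h j" using 2(2) 4(5,6) by (auto simp: h_def)
            then show ?thesis using 4(4) by blast
          next
            case False
            then have "v = h k" using 2 by (simp add: h_def)
            then show ?thesis using 2(1) by blast
          qed
        qed
      qed
      have hB: "h ` {1..n} \<subseteq> ?B" using 4(1) by (auto simp: h_def)
      have hf: "f1 j = f1 k" if "j \<in> {1..n}" "k \<in> {1..n}" "h j = h k" for j k
      proof (cases "j = i"; cases "k = i")
        assume "j = i" "k \<noteq> i"
        then have "f1 k = {}" using that(3) by (simp add: h_def)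
        then show ?thesis using ne(1) that(2) by (metis imageI)
      next
        assume "j \<noteq> i" "k = i"
        then have "f1 j = {}" using that(3) by (simp add: h_def)
        then show ?thesis using ne(1) that(1) by (metis imageI)
      qed (use that(3) in \<open>simp_all add: h_def\<close>)
      have "?b \<in> ramified_diagrams n"
        unfolding label_ramified_iff[OF pbij_Id_on pbij_Id_on]
      proof (intro ballI conjI impI)
        fix j k assume jk: "j \<in> {1..n}" "k \<in> {1..n}"
        { assume "h j = h k" then show "f2 j = f2 k" by (rule f12[OF jk hf[OF jk]]) }
        { assume "h j = h k" then show "f2 j = f2 k" by (rule f12[OF jk hf[OF jk]]) }
        assume "(h j, h k) \<in> Id_on ?B"
        then have "h j = h k" unfolding Id_on_iff by blast
        then have "f2 j = f2 k" by (rule f12[OF jk hf[OF jk]])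
        moreover have "f2 j \<in> A2" using 4(2) jk(1) by blast
        ultimately show "(f2 j, f2 k) \<in> Id_on A2" by (simp add: Id_on_iff)
      qed
      moreover have "rrank n ?b = Suc (card A1 + card A2)"
        using rrank_label[OF B B A(3) A(3)] fin ne(1) A(1) by (subst (asm) card_insert_disjoint) auto
      moreover have "rmul n p ?b = p"
        unfolding p rmul_def fst_conv snd_conv
        using compose_full_absorb[OF 4(1) hB hf] compose_label_Id[OF A(3), of A2] by blast
      ultimately show ?thesis by blast
    next
      case 5
      then have "card (f1 ` {1..n}) = n" "card (f2 ` {1..n}) = n" by (simp_all add: card_image)
      moreover have "A1 = f1 ` {1..n}" "A2 = f2 ` {1..n}" using A 5 by blast+
      ultimately show ?thesis using lt rk by simp
    qed
  qed
  then obtain b where b: "b \<in> ramified_diagrams n" "rrank n b = Suc (rrank n a)" "rmul n p b = p"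
    unfolding rk by blast
  have "a = rmul n (rmul n p b) a" unfolding b(3) unfolding p_def by (rule rmul_regular[OF a, symmetric])
  then show ?thesis using b pM a by blast
qed

text \<open>An inner diagram is the identity on a set of vertices with singletons elsewhere, and two
  of these multiply by intersecting the sets. For nonempty indices the outer diagrams are partial
  identities. The twist is symmetric because both elements are fixed by
  \<open>rflip\<close>.\<close>

lemma rep_commute:
  assumes std: "std_labels n ls lab1 lab2" "std_labels n ls' lab1' lab2'" and ne: "ls \<noteq> []" "ls' \<noteq> []"
  shows "rmul n (rep n ls) (rep n ls') = rmul n (rep n ls') (rep n ls)"
    "rtwist n Q1 Q2 (rep n ls) (rep n ls') = rtwist n Q1 Q2 (rep n ls') (rep n ls)"
proof -
  note L = std_labelsD[OF std(1)] and L' = std_labelsD[OF std(2)]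
  \<comment> \<open>\<open>compose_label\<close> requires a common labelling of the middle row;
    injective labels may be replaced by the vertices themselves.\<close>
  have inner: "\<exists>S\<subseteq>{1..n}. fst (rep n ks) = label_diagram n id (Id_on S) id" if s: "std_labels n ks l1 l2" for ks l1 l2
  proof -
    note K = std_labelsD[OF s]
    have "label_diagram n l1 (Id_on (inner_labels ks)) l1 =
        label_diagram n id (Id_on {j\<in>{1..n}. l1 j \<in> inner_labels ks}) id"
      unfolding label_diagram_eq_iff[OF pbij_Id_on pbij_Id_on]
    proof (intro ballI)
      fix i j assume ij: "i \<in> {1..n}" "j \<in> {1..n}"
      have e: "l1 i = l1 j \<longleftrightarrow> i = j" using K(4)[OF ij] by blast
      show "(l1 i = l1 j) = (id i = id j) \<and> (l1 i = l1 j) = (id i = id j) \<and>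
          ((l1 i, l1 j) \<in> Id_on (inner_labels ks)) = ((id i, id j) \<in> Id_on {j\<in>{1..n}. l1 j \<in> inner_labels ks})"
        using ij by (simp add: Id_on_iff e)
    qed
    moreover have "{j\<in>{1..n}. l1 j \<in> inner_labels ks} \<subseteq> {1..n}" by blast
    ultimately show ?thesis unfolding K(1) fst_conv
      by (intro exI[of _ "{j\<in>{1..n}. l1 j \<in> inner_labels ks}"] conjI)
  qed
  obtain S S' where S: "S \<subseteq> {1..n}" "fst (rep n ls) = label_diagram n id (Id_on S) id"
    and S': "S' \<subseteq> {1..n}" "fst (rep n ls') = label_diagram n id (Id_on S') id"
    using inner[OF std(1)] inner[OF std(2)] by blast
  have IO: "Id_on B O Id_on B' = Id_on (B \<inter> B')" for B B' :: "nat set" by auto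
  have c1: "compose n (fst (rep n ls)) (fst (rep n ls')) = compose n (fst (rep n ls')) (fst (rep n ls))"
    unfolding S(2) S'(2) using S(1) S'(1) by (subst (1 2) compose_label) (auto simp: IO Int_commute)
  have M: "rep n ls \<in> ramified_diagrams n" "rep n ls' \<in> ramified_diagrams n"
    using rep_facts(1) std by blast+
  then have d: "fst (rep n ls) \<in> diagrams n" "snd (rep n ls) \<in> diagrams n"
    "fst (rep n ls') \<in> diagrams n" "snd (rep n ls') \<in> diagrams n" by (simp_all add: ramified_iff)
  have Id: "sat n (snd (rep n ks)) \<subseteq> Id" if "std_labels n ks l1 l2" "ks \<noteq> []" for ks l1 l2
  proof -
    note K = std_labelsD[OF that(1)]
    have "l2 ` {1..n} \<subseteq> {..<length ks}" using K(6) that(2) by auto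
    then show ?thesis unfolding K(1) snd_conv by (simp only: sat_full_label) auto
  qed
  have "R O R' = R' O R" if "R \<subseteq> Id" "R' \<subseteq> Id" for R R' :: "'x rel" using that by blast
  from this[OF Id[OF std(1) ne(1)] Id[OF std(2) ne(2)]]
  have c2: "compose n (snd (rep n ls)) (snd (rep n ls')) = compose n (snd (rep n ls')) (snd (rep n ls))"
    by (intro sat_inj[of _ n]) (simp_all add: d compose_diagram sat_compose)
  show "rmul n (rep n ls) (rep n ls') = rmul n (rep n ls') (rep n ls)"
    unfolding rmul_def c1 c2 ..
  have "flip n (fst (rep n ks)) = fst (rep n ks)" "flip n (snd (rep n ks)) = snd (rep n ks)"
    if "std_labels n ks l1 l2" for ks l1 l2
    using rep_facts(3)[OF that] by (auto simp: rflip_def prod_eq_iff)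
  then have sy: "sym (sat n (fst (rep n ks)))" "sym (sat n (snd (rep n ks)))"
    if "std_labels n ks l1 l2" for ks l1 l2
    using that rep_facts(1)[OF that] sat_flip[of "fst (rep n ks)" n] sat_flip[of "snd (rep n ks)" n]
    by (auto simp: sym_conv_converse_eq ramified_iff)
  have "closed_count n (fst (rep n ls)) (fst (rep n ls')) = closed_count n (fst (rep n ls')) (fst (rep n ls))"
    by (rule closed_count_cong[OF d(1,3,3,1)]) (use sy(1)[OF std(1)] sy(1)[OF std(2)] in \<open>auto dest: symD\<close>)
  moreover have "closed_count n (snd (rep n ls)) (snd (rep n ls')) = closed_count n (snd (rep n ls')) (snd (rep n ls))"
    by (rule closed_count_cong[OF d(2,4,4,2)]) (use sy(2)[OF std(1)] sy(2)[OF std(2)] in \<open>auto dest: symD\<close>)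
  ultimately show "rtwist n Q1 Q2 (rep n ls) (rep n ls') = rtwist n Q1 Q2 (rep n ls') (rep n ls)"
    by (simp add: rtwist_def)
qed

section \<open>Block arithmetic: explicit labels for the distinguished elements\<close>

subsection \<open>The standard labelling\<close>

lemma env_size_take_Suc: "i < length ls \<Longrightarrow> env_size (take (Suc i) ls) = env_size (take i ls) + max 1 (ls ! i)"
  by (simp add: env_size_def take_Suc_conv_app_nth)

lemma env_size_take_mono: "i \<le> j \<Longrightarrow> env_size (take i ls) \<le> env_size (take j ls)"
proof (induction j)
  case (Suc j)
  have "env_size (take j ls) \<le> env_size (take (Suc j) ls)"
    by (cases "j < length ls") (simp_all add: env_size_take_Suc)
  then show ?case using Suc by (cases "i = Suc j") auto
qed simp

lemma block_unique:
  assumes "j \<in> block ls i" "j \<in> block ls i'" shows "i = i'"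
proof (rule ccontr)
  assume "i \<noteq> i'"
  then consider "Suc i \<le> i'" | "Suc i' \<le> i" by linarith
  then show False
    using assms env_size_take_mono[of "Suc i" i' ls] env_size_take_mono[of "Suc i'" i ls]
    by cases (auto simp: block_def)
qed

lemma block_cover:
  assumes "1 \<le> j" "j \<le> env_size ls"
  shows "\<exists>i<length ls. j \<in> block ls i"
proof -
  have "\<exists>i<m. j \<in> block ls i" if "m \<le> length ls" "j \<le> env_size (take m ls)" for m
    using that
  proof (induction m)
    case 0
    then show ?case using assms by (simp add: env_size_def)
  next
    case (Suc m)
    show ?case
    proof (cases "j \<le> env_size (take m ls)")
      case True
      then show ?thesis using Suc by (meson Suc_leD less_SucI)
    next
      case False
      then have "j \<in> block ls m" using Suc by (simp add: block_def)
      then show ?thesis by blast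
    qed
  qed
  from this[of "length ls"] show ?thesis using assms by simp
qed

lemma block_subset: "i < length ls \<Longrightarrow> j \<in> block ls i \<Longrightarrow> 1 \<le> j \<and> j \<le> env_size ls"
  using env_size_take_mono[of "Suc i" "length ls" ls] by (auto simp: block_def)

lemma label_full_quotient:
  assumes "h ` {1..n} \<subseteq> A"
  shows "label_diagram n h (Id_on A) h = (\<lambda>i. {j\<in>{1..n}. h j = i} \<times> {0, 1 :: nat}) ` h ` {1..n}"
proof -
  have cls: "label_rel n h (Id_on A) h `` {(i, s)} = {j\<in>{1..n}. h j = h i} \<times> {0, 1}"
    if "i \<in> {1..n}" "s \<in> {0, 1}" for i s
    using that assms by (auto simp: label_rel_def Id_on_iff image_subset_iff)
  have verts: "verts n = {1..n} \<times> {0, 1}" by (auto simp: row_def)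
  have "label_diagram n h (Id_on A) h = (\<lambda>x. label_rel n h (Id_on A) h `` {x}) ` ({1..n} \<times> {0, 1})"
    unfolding label_diagram_def quotient_def verts by blast
  also have "\<dots> = (\<lambda>i. {j\<in>{1..n}. h j = i} \<times> {0, 1 :: nat}) ` h ` {1..n}"
  proof (intro equalityI subsetI)
    fix q assume "q \<in> (\<lambda>x. label_rel n h (Id_on A) h `` {x}) ` ({1..n} \<times> {0, 1})"
    then obtain i s where "i \<in> {1..n}" "s \<in> {0, 1}" "q = label_rel n h (Id_on A) h `` {(i, s)}" by blast
    then show "q \<in> (\<lambda>i. {j\<in>{1..n}. h j = i} \<times> {0, 1 :: nat}) ` h ` {1..n}" using cls by blast
  next
    fix q assume "q \<in> (\<lambda>i. {j\<in>{1..n}. h j = i} \<times> {0, 1 :: nat}) ` h ` {1..n}"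
    then obtain i where i: "i \<in> {1..n}" "q = {j\<in>{1..n}. h j = h i} \<times> {0, 1}" by blast
    then have "q = label_rel n h (Id_on A) h `` {(i, 0)}" using cls[of i 0] by simp
    then show "q \<in> (\<lambda>x. label_rel n h (Id_on A) h `` {x}) ` ({1..n} \<times> {0, 1})" using i(1) by blast
  qed
  finally show ?thesis .
qed

lemma label_inj_quotient:
  assumes inj: "inj_on h {1..n}"
  shows "label_diagram n h (Id_on A) h =
    {{(j, 0), (j, 1)} | j. j \<in> {1..n} \<and> h j \<in> A} \<union> {{(j, t)} | j t. j \<in> {1..n} \<and> h j \<notin> A \<and> t \<in> {0, 1}}"
proof -
  have inj': "h i = h j \<longleftrightarrow> i = j" if "i \<in> {1..n}" "j \<in> {1..n}" for i j using inj that by (auto dest: inj_onD)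
  have cls: "label_rel n h (Id_on A) h `` {(i, s)} = (if h i \<in> A then {(i, 0), (i, 1)} else {(i, s)})"
    if i: "i \<in> {1..n}" "s \<in> {0, 1}" for i s
  proof -
    have "((i, s), (j, t)) \<in> label_rel n h (Id_on A) h \<longleftrightarrow> j = i \<and> (s = t \<or> h i \<in> A \<and> t \<in> {0, 1})" for j t
    proof (cases "j \<in> {1..n}")
      case True
      then show ?thesis using i inj'[OF i(1) True] inj'[OF True i(1)] by (auto simp: label_rel_def Id_on_iff)
    qed (use i in \<open>auto simp: label_rel_def\<close>)
    then show ?thesis using i by auto
  qed
  have verts: "verts n = {1..n} \<times> {0, 1}" by (auto simp: row_def)
  have "label_diagram n h (Id_on A) h = (\<lambda>x. label_rel n h (Id_on A) h `` {x}) ` ({1..n} \<times> {0, 1})"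
    unfolding label_diagram_def quotient_def verts by blast
  also have "\<dots> = (\<lambda>(i, s). if h i \<in> A then {(i, 0), (i, 1)} else {(i, s)}) ` ({1..n} \<times> {0, 1})"
  proof (rule image_cong[OF refl])
    fix x :: point assume x: "x \<in> {1..n} \<times> {0, 1}"
    obtain i s where i: "x = (i, s)" by fastforce
    show "label_rel n h (Id_on A) h `` {x} = (case x of (i, s) \<Rightarrow> if h i \<in> A then {(i, 0), (i, 1)} else {(i, s)})"
      unfolding i prod.case by (rule cls) (use x i in simp_all)
  qed
  also have "\<dots> = {{(j, 0), (j, 1)} | j. j \<in> {1..n} \<and> h j \<in> A} \<union> {{(j, t)} | j t. j \<in> {1..n} \<and> h j \<notin> A \<and> t \<in> {0, 1}}"
    (is "?f ` _ = ?R")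
  proof (intro equalityI subsetI)
    fix q assume "q \<in> ?f ` ({1..n} \<times> {0, 1})"
    then obtain x where x: "x \<in> {1..n} \<times> {0, 1}" "q = ?f x" by blast
    obtain i s where "x = (i, s)" by fastforce
    then have "i \<in> {1..n}" "s \<in> {0, 1}" "q = (if h i \<in> A then {(i, 0), (i, 1)} else {(i, s)})"
      using x by simp_all
    then show "q \<in> ?R" by (cases "h i \<in> A") auto
  next
    fix q assume "q \<in> ?R"
    then consider i where "i \<in> {1..n}" "h i \<in> A" "q = {(i, 0), (i, 1)}"
      | i s where "i \<in> {1..n}" "h i \<notin> A" "s \<in> {0, 1}" "q = {(i, s)}" by blast
    then show "q \<in> ?f ` ({1..n} \<times> {0, 1})"
    proof cases
      case (1 i)
      then show ?thesis by (intro image_eqI[of _ _ "(i, 0)"]) simp_all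
    next
      case (2 i s)
      then show ?thesis by (intro image_eqI[of _ _ "(i, s)"]) simp_all
    qed
  qed
  finally show ?thesis .
qed

lemma std_labels_exist:
  assumes env: "env_size ls \<le> n"
  shows "\<exists>lab1 lab2. std_labels n ls lab1 lab2"
proof (cases "ls = []")
  case True
  have inj: "inj_on (\<lambda>j. (j, 0::nat)) {1..n}" by (simp add: inj_on_def)
  have "discrete_diagram n = {{(j, t)} | j t. j \<in> {1..n} \<and> t \<in> {0, 1}}"
    by (auto simp: discrete_diagram_def row_def)
  then have "rep n ls = (label_diagram n (\<lambda>j. (j, 0::nat)) (Id_on {}) (\<lambda>j. (j, 0::nat)), label_diagram n id (Id_on {}) id)"
    unfolding label_inj_quotient[OF inj] label_inj_quotient[OF inj_on_id] by (simp add: rep_def True)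
  then have "std_labels n ls (\<lambda>j. (j, 0)) id"
    using inj by (simp add: std_labels_def inner_labels_def True)
  then show ?thesis by blast
next
  case False
  let ?l = "length ls" and ?E = "\<lambda>i. env_size (take i ls)"
  have l: "?l > 0" using False by simp
  \<comment> \<open>Vertices beyond all blocks belong to the last outer part, as in
    \<open>index_outer\<close>.\<close>
  define blk where "blk j = (if j \<le> env_size ls then (THE i. i < ?l \<and> j \<in> block ls i) else ?l - 1)" for j
  have blk: "blk j = i" if "i < ?l" "j \<in> block ls i" for i j
    using that block_subset[OF that] block_unique by (auto simp: blk_def intro!: the_equality)
  have blk_mem: "blk j < ?l" "j \<le> env_size ls \<Longrightarrow> j \<in> block ls (blk j)" if j: "j \<in> {1..n}" for j
  proof -
    have "blk j < ?l \<and> (j \<le> env_size ls \<longrightarrow> j \<in> block ls (blk j))"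
    proof (cases "j \<le> env_size ls")
      case True
      then obtain i where "i < ?l" "j \<in> block ls i" using block_cover j by auto
      then show ?thesis using blk by auto
    qed (use l in \<open>simp add: blk_def\<close>)
    then show "blk j < ?l" "j \<le> env_size ls \<Longrightarrow> j \<in> block ls (blk j)" by auto
  qed
  have S: "j \<in> inner_support ls \<longleftrightarrow> j \<le> env_size ls \<and> ls ! blk j \<ge> 1" if "j \<in> {1..n}" for j
  proof
    assume "j \<in> inner_support ls"
    then obtain i where i: "i < ?l" "ls ! i \<ge> 1" "j \<in> block ls i" by (auto simp: inner_support_def)
    then show "j \<le> env_size ls \<and> ls ! blk j \<ge> 1" using blk[OF i(1,3)] block_subset[OF i(1,3)] by simp
  next
    assume "j \<le> env_size ls \<and> ls ! blk j \<ge> 1"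
    then show "j \<in> inner_support ls" using blk_mem[OF that] unfolding inner_support_def by blast
  qed
  have Sn: "inner_support ls \<subseteq> {1..n}"
    using block_subset env by (fastforce simp: inner_support_def)
  \<comment> \<open>On the inner support the second entry is the offset in the block, from 0. The
    other vertices get a first entry above \<open>length ls\<close>, which lies outside
    \<open>inner_labels\<close> and differs from vertex to vertex.\<close>
  define lab1 where "lab1 j = (if j \<in> inner_support ls then (blk j, j - Suc (?E (blk j))) else (?l + j, 0))" for j
  have in1: "lab1 j \<in> inner_labels ls \<longleftrightarrow> j \<in> inner_support ls" if j: "j \<in> {1..n}" for j
  proof
    assume js: "j \<in> inner_support ls"
    then have "j \<le> env_size ls" "ls ! blk j \<ge> 1" using S[OF j] by auto
    then have "j \<in> block ls (blk j)" using blk_mem[OF j] by blast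
    then have "?E (blk j) < j" "j \<le> ?E (blk j) + ls ! blk j"
      using env_size_take_Suc[OF blk_mem(1)[OF j]] \<open>ls ! blk j \<ge> 1\<close> by (auto simp: block_def)
    then show "lab1 j \<in> inner_labels ls" using js blk_mem(1)[OF j] by (auto simp: lab1_def inner_labels_def)
  qed (auto simp: lab1_def inner_labels_def split: if_splits)
  have inj: "inj_on lab1 {1..n}"
  proof (rule inj_onI)
    fix i j assume ij: "i \<in> {1..n}" "j \<in> {1..n}" "lab1 i = lab1 j"
    show "i = j"
    proof (cases "i \<in> inner_support ls")
      case True
      then have js: "j \<in> inner_support ls" using in1 ij by metis
      have "i \<in> block ls (blk i)" "j \<in> block ls (blk j)"
        using blk_mem ij S True js by blast+
      moreover have "blk i = blk j" "i - Suc (?E (blk i)) = j - Suc (?E (blk j))"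
        using ij(3) True js by (auto simp: lab1_def)
      ultimately show ?thesis by (simp add: block_def) arith
    next
      case False
      then have "j \<notin> inner_support ls" using in1 ij by metis
      then show ?thesis using False ij(3) by (simp add: lab1_def)
    qed
  qed
  have "index_inner n ls = label_diagram n lab1 (Id_on (inner_labels ls)) lab1"
  proof -
    have "{{(j, 0 :: nat), (j, 1 :: nat)} | j. j \<in> inner_support ls} = {{(j, 0), (j, 1)} | j. j \<in> {1..n} \<and> lab1 j \<in> inner_labels ls}"
      using in1 Sn by blast
    moreover have "{{(j, t :: nat)} | j t. j \<in> {1..n} - inner_support ls \<and> t \<in> {0, 1}} =
        {{(j, t)} | j t. j \<in> {1..n} \<and> lab1 j \<notin> inner_labels ls \<and> t \<in> {0, 1}}"
      using in1 by blast
    ultimately show ?thesis unfolding index_inner_def label_inj_quotient[OF inj] by presburger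
  qed
  moreover have blk_im: "blk ` {1..n} = {..<?l}"
  proof (intro equalityI subsetI)
    fix i assume i: "i \<in> {..<?l}"
    \<comment> \<open>A block has a first vertex even if its entry is 0, by the \<open>max 1\<close>
      in \<open>env_size\<close>; hence every outer label is attained.\<close>
    then have "Suc (?E i) \<in> block ls i" using env_size_take_Suc[of i ls] by (auto simp: block_def)
    then have "blk (Suc (?E i)) = i" "Suc (?E i) \<in> {1..n}" using blk block_subset env i by fastforce+
    then show "i \<in> blk ` {1..n}" by (metis imageI)
  qed (use blk_mem(1) in auto)
  moreover have "index_outer n ls = label_diagram n blk (Id_on {..<?l}) blk"
  proof -
    have fib: "{j\<in>{1..n}. blk j = i} = (if Suc i < ?l then block ls i else block ls i \<union> {env_size ls <.. n})"
      if i: "i < ?l" for i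
    proof (intro equalityI subsetI)
      fix j assume j: "j \<in> {j\<in>{1..n}. blk j = i}"
      then show "j \<in> (if Suc i < ?l then block ls i else block ls i \<union> {env_size ls <.. n})"
        using blk_mem[of j] i by (cases "j \<le> env_size ls") (auto simp: blk_def split: if_splits)
    next
      fix j assume j: "j \<in> (if Suc i < ?l then block ls i else block ls i \<union> {env_size ls <.. n})"
      show "j \<in> {j\<in>{1..n}. blk j = i}"
      proof (cases "j \<in> block ls i")
        case True
        then show ?thesis using blk[OF i True] block_subset[OF i True] env by simp
      next
        case False
        then have "j > env_size ls" "j \<le> n" "i = ?l - 1" using j i by (auto split: if_splits)
        then show ?thesis by (simp add: blk_def)
      qed
    qed
    have "label_diagram n blk (Id_on {..<?l}) blk = (\<lambda>i. {j\<in>{1..n}. blk j = i} \<times> {0, 1 :: nat}) ` {..<?l}"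
      using label_full_quotient[of blk n "{..<?l}"] blk_im by simp
    also have "\<dots> = {({j\<in>{1..n}. blk j = ?l - 1} \<times> {0, 1})} \<union> {{j\<in>{1..n}. blk j = i} \<times> {0, 1} | i. Suc i < ?l}"
    proof -
      have im: "{..<?l} = insert (?l - 1) {i. Suc i < ?l}" using l by auto
      show ?thesis unfolding im by blast
    qed
    also have "\<dots> = index_outer n ls"
    proof -
      have "{j\<in>{1..n}. blk j = ?l - 1} = block ls (?l - 1) \<union> {env_size ls <.. n}" using fib[of "?l - 1"] l by simp
      moreover have "{{j\<in>{1..n}. blk j = i} \<times> {0, 1 :: nat} | i. Suc i < ?l} = {block ls i \<times> {0, 1} | i. Suc i < ?l}"
        using fib by (metis (no_types, lifting) Suc_lessD)
      ultimately show ?thesis unfolding index_outer_def by blast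
    qed
    finally show ?thesis by simp
  qed
  moreover have "inner_labels ls \<subseteq> lab1 ` {1..n}"
  proof
    fix q assume "q \<in> inner_labels ls"
    then obtain i r where q: "q = (i, r)" "i < ?l" "r < ls ! i" by (auto simp: inner_labels_def)
    let ?j = "Suc (?E i + r)"
    have b: "?j \<in> block ls i" using q env_size_take_Suc[OF q(2)] by (auto simp: block_def)
    then have "blk ?j = i" "?j \<in> inner_support ls" using blk q by (auto simp: inner_support_def)
    then have "lab1 ?j = q" using q by (simp add: lab1_def)
    then show "q \<in> lab1 ` {1..n}" using Sn \<open>?j \<in> inner_support ls\<close> by (metis imageI subsetD)
  qed
  moreover have "blk j = fst (lab1 j)" if "j \<in> {1..n}" "lab1 j \<in> inner_labels ls" for j
    using that in1 by (simp add: lab1_def)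
  ultimately have "std_labels n ls lab1 blk"
    using False inj by (simp add: std_labels_def rep_def)
  then show ?thesis by blast
qed

section \<open>Products of wreath products acting on inner and outer strands\<close>

section \<open>The groups of units of the corners\<close>

lemma wreath_sym_simps:
  "x \<in> carrier (wreath_sym G m) \<longleftrightarrow> fst x \<in> (\<Pi>\<^sub>E i\<in>{1..m}. carrier G) \<and> snd x permutes {1..m}"
  "x \<otimes>\<^bsub>wreath_sym G m\<^esub> y =
    (\<lambda>i\<in>{1..m}. fst x i \<otimes>\<^bsub>G\<^esub> fst y (inv_into UNIV (snd x) i), snd x \<circ> snd y)"
  "\<one>\<^bsub>wreath_sym G m\<^esub> = (\<lambda>i\<in>{1..m}. \<one>\<^bsub>G\<^esub>, id)"
  by (auto simp: wreath_sym_def sym_group_carrier mem_Times_iff split: prod.splits)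

lemma wreath_sym_monoid:
  assumes G: "Group.monoid G"
  shows "Group.monoid (wreath_sym G m)"
proof -
  interpret G: Group.monoid G by fact
  have inv_mem: "inv_into UNIV p i \<in> {1..m}" if "p permutes {1..m}" "i \<in> {1..m}" for p i
    using permutes_in_image[OF permutes_inv[OF that(1)]] that(2) by simp
  show ?thesis
  proof (rule Group.monoidI)
    fix x y assume x: "x \<in> carrier (wreath_sym G m)" and y: "y \<in> carrier (wreath_sym G m)"
    have "fst x i \<otimes>\<^bsub>G\<^esub> fst y (inv_into UNIV (snd x) i) \<in> carrier G" if i: "i \<in> {1..m}" for i
    proof -
      have "fst x i \<in> carrier G" "fst y (inv_into UNIV (snd x) i) \<in> carrier G"
        using x y i inv_mem[of "snd x" i] unfolding wreath_sym_simps(1) by blast+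
      then show ?thesis by simp
    qed
    moreover have "snd x \<circ> snd y permutes {1..m}"
      using x y unfolding wreath_sym_simps(1) by (blast intro: permutes_compose)
    ultimately show "x \<otimes>\<^bsub>wreath_sym G m\<^esub> y \<in> carrier (wreath_sym G m)"
      unfolding wreath_sym_simps by simp
  next
    show "\<one>\<^bsub>wreath_sym G m\<^esub> \<in> carrier (wreath_sym G m)"
      unfolding wreath_sym_simps by (simp add: permutes_id[unfolded id_def] permutes_id)
  next
    fix x y z assume x: "x \<in> carrier (wreath_sym G m)" and y: "y \<in> carrier (wreath_sym G m)"
      and z: "z \<in> carrier (wreath_sym G m)"
    have px: "snd x permutes {1..m}" and py: "snd y permutes {1..m}" using x y unfolding wreath_sym_simps by auto
    have inv_comp: "inv_into UNIV (snd x \<circ> snd y) = inv_into UNIV (snd y) \<circ> inv_into UNIV (snd x)"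
      by (rule o_inv_distrib) (use px py permutes_bij in blast)+
    have "fst x i \<otimes>\<^bsub>G\<^esub> fst y (inv_into UNIV (snd x) i) \<otimes>\<^bsub>G\<^esub> fst z (inv_into UNIV (snd y) (inv_into UNIV (snd x) i)) =
        fst x i \<otimes>\<^bsub>G\<^esub> (fst y (inv_into UNIV (snd x) i) \<otimes>\<^bsub>G\<^esub> fst z (inv_into UNIV (snd y) (inv_into UNIV (snd x) i)))"
      if i: "i \<in> {1..m}" for i
    proof (rule G.m_assoc)
      note j = inv_mem[OF px i] and k = inv_mem[OF py inv_mem[OF px i]]
      show "fst x i \<in> carrier G" using x i unfolding wreath_sym_simps by blast
      show "fst y (inv_into UNIV (snd x) i) \<in> carrier G" using y j unfolding wreath_sym_simps by blast
      show "fst z (inv_into UNIV (snd y) (inv_into UNIV (snd x) i)) \<in> carrier G"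
        using z k unfolding wreath_sym_simps by blast
    qed
    then show "x \<otimes>\<^bsub>wreath_sym G m\<^esub> y \<otimes>\<^bsub>wreath_sym G m\<^esub> z = x \<otimes>\<^bsub>wreath_sym G m\<^esub> (y \<otimes>\<^bsub>wreath_sym G m\<^esub> z)"
      unfolding wreath_sym_simps fst_conv snd_conv inv_comp
      using inv_mem[OF px] by (auto intro!: restrict_ext)
  next
    fix x assume x: "x \<in> carrier (wreath_sym G m)"
    have c: "fst x i \<in> carrier G" if "i \<in> {1..m}" for i using x that unfolding wreath_sym_simps by blast
    have px: "snd x permutes {1..m}" and e: "fst x \<in> extensional {1..m}"
      using x unfolding wreath_sym_simps PiE_def by auto
    have "restrict (\<lambda>i. \<one>\<^bsub>G\<^esub> \<otimes>\<^bsub>G\<^esub> fst x i) {1..m} = fst x"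
      by (rule extensionalityI[OF restrict_extensional e]) (simp add: c)
    then show "\<one>\<^bsub>wreath_sym G m\<^esub> \<otimes>\<^bsub>wreath_sym G m\<^esub> x = x"
      unfolding wreath_sym_simps fst_conv snd_conv by (auto simp: prod_eq_iff cong: restrict_cong)
    have "restrict (\<lambda>i. fst x i \<otimes>\<^bsub>G\<^esub> \<one>\<^bsub>G\<^esub>) {1..m} = fst x"
      by (rule extensionalityI[OF restrict_extensional e]) (simp add: c)
    then show "x \<otimes>\<^bsub>wreath_sym G m\<^esub> \<one>\<^bsub>wreath_sym G m\<^esub> = x"
      unfolding wreath_sym_simps fst_conv snd_conv using inv_mem[OF px]
      by (auto simp: prod_eq_iff cong: restrict_cong)
  qed
qed

lemma product_group_monoid:
  assumes "\<And>i. i \<in> I \<Longrightarrow> Group.monoid (G i)"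
  shows "Group.monoid (product_group I G)"
proof (rule Group.monoidI)
  fix x y z
  assume x: "x \<in> carrier (product_group I G)" and y: "y \<in> carrier (product_group I G)"
  have c: "x i \<in> carrier (G i)" "y i \<in> carrier (G i)" if "i \<in> I" for i using x y that by auto
  show "x \<otimes>\<^bsub>product_group I G\<^esub> y \<in> carrier (product_group I G)"
    using c assms by (auto intro!: Group.monoid.m_closed)
  assume z: "z \<in> carrier (product_group I G)"
  have d: "z i \<in> carrier (G i)" if "i \<in> I" for i using z that by auto
  show "x \<otimes>\<^bsub>product_group I G\<^esub> y \<otimes>\<^bsub>product_group I G\<^esub> z = x \<otimes>\<^bsub>product_group I G\<^esub> (y \<otimes>\<^bsub>product_group I G\<^esub> z)"
    using c d assms by (auto intro!: restrict_ext simp: Group.monoid.m_assoc)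
next
  show "\<one>\<^bsub>product_group I G\<^esub> \<in> carrier (product_group I G)"
    using assms by (auto intro!: Group.monoid.one_closed)
next
  fix x assume x: "x \<in> carrier (product_group I G)"
  then have c: "x i \<in> carrier (G i)" if "i \<in> I" for i using that by auto
  have e: "x \<in> extensional I" using x by (simp add: PiE_def)
  show "\<one>\<^bsub>product_group I G\<^esub> \<otimes>\<^bsub>product_group I G\<^esub> x = x"
    unfolding mult_product_group one_product_group
    by (rule extensionalityI[OF restrict_extensional e]) (simp add: c assms Group.monoid.l_one)
  show "x \<otimes>\<^bsub>product_group I G\<^esub> \<one>\<^bsub>product_group I G\<^esub> = x"
    unfolding mult_product_group one_product_group
    by (rule extensionalityI[OF restrict_extensional e]) (simp add: c assms Group.monoid.r_one)
qed

lemma index_group_monoid: "Group.monoid (index_group ls)"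
  unfolding index_group_def
  by (intro product_group_monoid wreath_sym_monoid group.is_monoid sym_group_is_group)

lemma index_group_finite: "finite (carrier (index_group ls))"
proof -
  have "finite (carrier (wreath_sym (sym_group u) m))" for u m
  proof -
    have "finite (carrier (sym_group k))" for k by (simp add: sym_group_def finite_permutations)
    then show ?thesis unfolding wreath_sym_def by (simp add: finite_PiE)
  qed
  then show ?thesis unfolding index_group_def by (simp add: finite_PiE)
qed

text \<open>The factor of \<open>index_group\<close> at \<open>u\<close> permutes the numbers from 1
  to \<open>count_list ls u\<close>; the numbering tells which block of \<open>ls\<close> each of
  them stands for.\<close>

lemma block_numbering:
  "\<exists>\<kappa>. \<forall>u. bij_betw (\<kappa> u) {i. i < length ls \<and> ls ! i = u} {1..count_list ls u}"
proof -
  have "card {i. i < length ls \<and> ls ! i = u} = count_list ls u" for u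
    unfolding count_list_eq_length_filter length_filter_conv_card by (metis (no_types, lifting))
  then have "\<exists>h. bij_betw h {i. i < length ls \<and> ls ! i = u} {1..count_list ls u}" for u
    by (intro finite_same_card_bij) auto
  then show ?thesis by metis
qed

type_synonym wreath_family = "nat \<Rightarrow> (nat \<Rightarrow> nat \<Rightarrow> nat) \<times> (nat \<Rightarrow> nat)"

context
  fixes ls :: "nat list" and \<kappa> :: "nat \<Rightarrow> nat \<Rightarrow> nat"
  assumes \<kappa>: "\<And>u. bij_betw (\<kappa> u) {i. i < length ls \<and> ls ! i = u} {1..count_list ls u}"
begin

definition unnum :: "nat \<Rightarrow> nat \<Rightarrow> nat" where
  "unnum u = inv_into {i. i < length ls \<and> ls ! i = u} (\<kappa> u)"

lemma unnum:
  "i < length ls \<Longrightarrow> \<kappa> (ls ! i) i \<in> {1..count_list ls (ls ! i)}"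
  "i < length ls \<Longrightarrow> unnum (ls ! i) (\<kappa> (ls ! i) i) = i"
  "c \<in> {1..count_list ls u} \<Longrightarrow> unnum u c < length ls \<and> ls ! unnum u c = u"
  "c \<in> {1..count_list ls u} \<Longrightarrow> \<kappa> u (unnum u c) = c"
proof -
  show "i < length ls \<Longrightarrow> \<kappa> (ls ! i) i \<in> {1..count_list ls (ls ! i)}" using bij_betwE[OF \<kappa>[of "ls ! i"]] by simp
  show "i < length ls \<Longrightarrow> unnum (ls ! i) (\<kappa> (ls ! i) i) = i"
    unfolding unnum_def using bij_betw_inv_into_left[OF \<kappa>[of "ls ! i"], of i] by simp
  show "c \<in> {1..count_list ls u} \<Longrightarrow> unnum u c < length ls \<and> ls ! unnum u c = u"
    using bij_betwE[OF bij_betw_inv_into[OF \<kappa>[of u]]] unfolding unnum_def by blast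
  show "c \<in> {1..count_list ls u} \<Longrightarrow> \<kappa> u (unnum u c) = c"
    unfolding unnum_def by (rule bij_betw_inv_into_right[OF \<kappa>])
qed

text \<open>The number of the block to which block \<open>i\<close> is moved, among the blocks with
  the same entry.\<close>

definition slot :: "wreath_family \<Rightarrow> nat \<Rightarrow> nat" where "slot F i = snd (F (ls ! i)) (\<kappa> (ls ! i) i)"
definition act_outer :: "wreath_family \<Rightarrow> nat \<Rightarrow> nat" where "act_outer F i = unnum (ls ! i) (slot F i)"
text \<open>The component of \<open>F\<close> is taken at the slot reached, in agreement with the
  product of \<open>wreath_sym\<close>, whose entries are indexed by target positions.
  \<open>Suc\<close> and \<open>- 1\<close> translate between strands counted from 0 and
  permutations of \<open>{1..u}\<close>.\<close>

definition act_inner :: "wreath_family \<Rightarrow> nat \<times> nat \<Rightarrow> nat \<times> nat" where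
  "act_inner F q = (act_outer F (fst q), fst (F (ls ! fst q)) (slot F (fst q)) (Suc (snd q)) - 1)"

lemma index_groupD:
  assumes "F \<in> carrier (index_group ls)" "u \<in> set ls"
  shows "snd (F u) permutes {1..count_list ls u}"
    "\<And>c. c \<in> {1..count_list ls u} \<Longrightarrow> fst (F u) c permutes {1..u}"
proof -
  have "F u \<in> carrier (wreath_sym (sym_group u) (count_list ls u))"
    using assms unfolding index_group_def by auto
  then show "snd (F u) permutes {1..count_list ls u}"
    "\<And>c. c \<in> {1..count_list ls u} \<Longrightarrow> fst (F u) c permutes {1..u}"
    unfolding wreath_sym_simps sym_group_carrier[symmetric] by (blast, blast dest: PiE_mem)
qed

lemma slot: assumes F: "F \<in> carrier (index_group ls)" and i: "i < length ls"
  shows "slot F i \<in> {1..count_list ls (ls ! i)}"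
  using permutes_in_image[OF index_groupD(1)[OF F, of "ls ! i"]] unnum(1)[OF i] i unfolding slot_def by simp

lemma act_outer:
  assumes F: "F \<in> carrier (index_group ls)" and i: "i < length ls"
  shows "act_outer F i < length ls" "ls ! act_outer F i = ls ! i" "\<kappa> (ls ! i) (act_outer F i) = slot F i"
  using unnum(3,4)[OF slot[OF F i]] unfolding act_outer_def by auto

lemma act_inner_bound:
  assumes F: "F \<in> carrier (index_group ls)" and i: "i < length ls" and r: "r < ls ! i"
  shows "fst (F (ls ! i)) (slot F i) (Suc r) \<in> {1..ls ! i}"
  using permutes_in_image[OF index_groupD(2)[OF F nth_mem[OF i] slot[OF F i]], of "Suc r"] r by simp

lemma act_inner_closed:
  assumes F: "F \<in> carrier (index_group ls)" and q: "q \<in> inner_labels ls"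
  shows "act_inner F q \<in> inner_labels ls"
proof -
  obtain i r where q': "q = (i, r)" "i < length ls" "r < ls ! i" using q by (auto simp: inner_labels_def)
  show ?thesis using act_inner_bound[OF F q'(2,3)] act_outer[OF F q'(2)]
    unfolding q'(1) act_inner_def inner_labels_def by auto
qed

lemma index_group_mult:
  assumes "u \<in> set ls"
  shows "(F \<otimes>\<^bsub>index_group ls\<^esub> G) u =
    (\<lambda>i\<in>{1..count_list ls u}. fst (F u) i \<circ> fst (G u) (inv_into UNIV (snd (F u)) i), snd (F u) \<circ> snd (G u))"
  using assms unfolding index_group_def by (simp add: wreath_sym_simps sym_group_mult)

lemma slot_mult:
  assumes F: "F \<in> carrier (index_group ls)" and G: "G \<in> carrier (index_group ls)" and i: "i < length ls"
  shows "slot (F \<otimes>\<^bsub>index_group ls\<^esub> G) i = slot F (act_outer G i)"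
  unfolding slot_def[of "F \<otimes>\<^bsub>index_group ls\<^esub> G"] slot_def[of F] index_group_mult[OF nth_mem[OF i]]
  using act_outer[OF G i] by (simp add: slot_def)

lemma act_outer_mult:
  assumes F: "F \<in> carrier (index_group ls)" and G: "G \<in> carrier (index_group ls)" and i: "i < length ls"
  shows "act_outer (F \<otimes>\<^bsub>index_group ls\<^esub> G) i = act_outer F (act_outer G i)"
  unfolding act_outer_def[of "F \<otimes>\<^bsub>index_group ls\<^esub> G"] act_outer_def[of F]
  using slot_mult[OF F G i] act_outer[OF G i] by simp

text \<open>At the final position the product composes the component of \<open>F\<close> there with
  that of \<open>G\<close> at the preimage under the permutation of \<open>F\<close>. This preimage
  is the slot to which \<open>G\<close> has moved the block.\<close>

lemma act_inner_mult:
  assumes F: "F \<in> carrier (index_group ls)" and G: "G \<in> carrier (index_group ls)" and q: "q \<in> inner_labels ls"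
  shows "act_inner (F \<otimes>\<^bsub>index_group ls\<^esub> G) q = act_inner F (act_inner G q)"
proof -
  obtain i r where q': "q = (i, r)" "i < length ls" "r < ls ! i" using q by (auto simp: inner_labels_def)
  note i = q'(2)
  let ?u = "ls ! i" and ?j = "act_outer G i"
  note j = act_outer[OF G i]
  have s: "slot F ?j \<in> {1..count_list ls ?u}" using slot[OF F j(1)] j(2) by simp
  have pF: "snd (F ?u) permutes {1..count_list ls ?u}" by (rule index_groupD(1)[OF F nth_mem[OF i]])
  have "slot F ?j = snd (F ?u) (slot G i)" unfolding slot_def[of F] j(2) j(3) ..
  then have inv: "inv_into UNIV (snd (F ?u)) (slot F ?j) = slot G i"
    using permutes_inverses(2)[OF pF] by simp
  have "fst ((F \<otimes>\<^bsub>index_group ls\<^esub> G) ?u) (slot F ?j) = fst (F ?u) (slot F ?j) \<circ> fst (G ?u) (slot G i)"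
    unfolding index_group_mult[OF nth_mem[OF i]] using s inv by simp
  moreover have "Suc (fst (G ?u) (slot G i) (Suc r) - 1) = fst (G ?u) (slot G i) (Suc r)"
    using act_inner_bound[OF G i q'(3)] by simp
  ultimately show ?thesis
    unfolding q'(1) act_inner_def fst_conv snd_conv slot_mult[OF F G i] act_outer_mult[OF F G i] j(2) by simp
qed

lemma act_one:
  shows "i < length ls \<Longrightarrow> act_outer \<one>\<^bsub>index_group ls\<^esub> i = i"
    and "q \<in> inner_labels ls \<Longrightarrow> act_inner \<one>\<^bsub>index_group ls\<^esub> q = q"
proof -
  have one: "\<one>\<^bsub>index_group ls\<^esub> u = (\<lambda>i\<in>{1..count_list ls u}. id, id)" if "u \<in> set ls" for u
    using that unfolding index_group_def by (simp add: wreath_sym_simps sym_group_one)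
  have s: "slot \<one>\<^bsub>index_group ls\<^esub> i = \<kappa> (ls ! i) i" if "i < length ls" for i
    unfolding slot_def one[OF nth_mem[OF that]] by simp
  show o: "act_outer \<one>\<^bsub>index_group ls\<^esub> i = i" if "i < length ls" for i
    unfolding act_outer_def s[OF that] by (rule unnum(2)[OF that])
  show "act_inner \<one>\<^bsub>index_group ls\<^esub> q = q" if q: "q \<in> inner_labels ls"
  proof -
    have i: "fst q < length ls" using q by (auto simp: inner_labels_def)
    show ?thesis unfolding act_inner_def o[OF i] s[OF i] one[OF nth_mem[OF i]]
      using unnum(1)[OF i] by simp
  qed
qed

lemma act_inj:
  assumes F: "F \<in> carrier (index_group ls)"
  shows "inj_on (act_outer F) {..<length ls}" "inj_on (act_inner F) (inner_labels ls)"
proof -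
  have si: "i = j" if "i < length ls" "j < length ls" "ls ! i = ls ! j" "slot F i = slot F j" for i j
  proof -
    have "\<kappa> (ls ! i) i = \<kappa> (ls ! i) j"
      using that permutes_inj[OF index_groupD(1)[OF F nth_mem[OF that(1)]]] by (simp add: slot_def inj_eq)
    then show ?thesis using unnum(2)[OF that(1)] unnum(2)[OF that(2)] that(3) by metis
  qed
  show io: "inj_on (act_outer F) {..<length ls}"
  proof (rule inj_onI)
    fix i j assume ij: "i \<in> {..<length ls}" "j \<in> {..<length ls}" "act_outer F i = act_outer F j"
    then have "ls ! i = ls ! j" using act_outer(2)[OF F, of i] act_outer(2)[OF F, of j] by simp
    moreover from this have "slot F i = slot F j"
      using ij act_outer(3)[OF F, of i] act_outer(3)[OF F, of j] by simp
    ultimately show "i = j" using si ij by simp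
  qed
  show "inj_on (act_inner F) (inner_labels ls)"
  proof (rule inj_onI)
    fix p q assume pq: "p \<in> inner_labels ls" "q \<in> inner_labels ls" "act_inner F p = act_inner F q"
    obtain i r where p: "p = (i, r)" "i < length ls" "r < ls ! i" using pq by (auto simp: inner_labels_def)
    obtain j t where q: "q = (j, t)" "j < length ls" "t < ls ! j" using pq by (auto simp: inner_labels_def)
    have "act_outer F i = act_outer F j" using pq(3) unfolding p(1) q(1) act_inner_def by simp
    then have ij: "i = j" using io p q by (auto dest: inj_onD)
    have "fst (F (ls ! i)) (slot F i) (Suc r) = fst (F (ls ! i)) (slot F i) (Suc t)"
      using pq(3) act_inner_bound[OF F p(2,3)] act_inner_bound[OF F q(2,3)] unfolding p(1) q(1) act_inner_def ij by auto
    then have "Suc r = Suc t"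
      using permutes_inj[OF index_groupD(2)[OF F nth_mem[OF p(2)] slot[OF F p(2)]]] by (auto dest: injD)
    then show "p = q" using p q ij by simp
  qed
qed

lemma act_bij:
  assumes F: "F \<in> carrier (index_group ls)"
  shows "bij_betw (act_outer F) {..<length ls} {..<length ls}" "bij_betw (act_inner F) (inner_labels ls) (inner_labels ls)"
proof -
  have fin: "finite (inner_labels ls)"
  proof -
    have "inner_labels ls = Sigma {..<length ls} (\<lambda>i. {..<ls ! i})" by (auto simp: inner_labels_def)
    then show ?thesis by simp
  qed
  have "act_outer F ` {..<length ls} = {..<length ls}"
    by (rule endo_inj_surj) (use act_inj[OF F] act_outer(1)[OF F] in auto)
  then show "bij_betw (act_outer F) {..<length ls} {..<length ls}" using act_inj[OF F] by (simp add: bij_betw_def)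
  have "act_inner F ` inner_labels ls = inner_labels ls"
    by (rule endo_inj_surj[OF fin]) (use act_inj[OF F] act_inner_closed[OF F] in auto)
  then show "bij_betw (act_inner F) (inner_labels ls) (inner_labels ls)" using act_inj[OF F] by (simp add: bij_betw_def)
qed

text \<open>Compatible bijections determine the family: the permutation of the blocks with entry
  \<open>u\<close> is \<open>s2\<close> read through the numbering, and the component at a position
  is \<open>s1\<close> on the block that \<open>s2\<close> brings there.\<close>

lemma act_surj:
  assumes s2: "bij_betw s2 {..<length ls} {..<length ls}" and l2: "\<And>i. i < length ls \<Longrightarrow> ls ! s2 i = ls ! i"
    and s1: "bij_betw s1 (inner_labels ls) (inner_labels ls)"
    and s12: "\<And>q. q \<in> inner_labels ls \<Longrightarrow> fst (s1 q) = s2 (fst q)"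
  shows "\<exists>F\<in>carrier (index_group ls). (\<forall>i<length ls. act_outer F i = s2 i) \<and>
    (\<forall>q\<in>inner_labels ls. act_inner F q = s1 q)"
proof -
  define t2 where "t2 = inv_into {..<length ls} s2"
  have t2: "t2 i < length ls" "s2 (t2 i) = i" if "i < length ls" for i
    using that bij_betwE[OF bij_betw_inv_into[OF s2]] bij_betw_inv_into_right[OF s2] by (auto simp: t2_def)
  have ts: "t2 (s2 i) = i" if "i < length ls" for i
    using that bij_betw_inv_into_left[OF s2] by (simp add: t2_def)
  have s2c: "s2 i < length ls" if "i < length ls" for i using bij_betwE[OF s2] that by simp
  have t2l: "ls ! t2 i = ls ! i" if "i < length ls" for i using l2[OF t2(1)[OF that]] t2(2)[OF that] by simp
  \<comment> \<open>Outside the numbers in use the value is the identity, as \<open>permutes\<close>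
    demands; the same holds for \<open>f\<close>.\<close>
  define p where "p u c = (if c \<in> {1..count_list ls u} then \<kappa> u (s2 (unnum u c)) else c)" for u c
  \<comment> \<open>\<open>t2\<close> leads from the target position back to the block on which
    \<open>s1\<close> has to be read.\<close>
  define f where "f u c r = (if r \<in> {1..u} then Suc (snd (s1 (t2 (unnum u c), r - 1))) else r)" for u c r
  define F where "F = (\<lambda>u\<in>set ls. (\<lambda>c\<in>{1..count_list ls u}. f u c, p u))"
  have pc: "p u c \<in> {1..count_list ls u}" if "c \<in> {1..count_list ls u}" for u c
  proof -
    note i = unnum(3)[OF that]
    have "ls ! s2 (unnum u c) = u" "s2 (unnum u c) < length ls" using l2 s2c i by auto
    then show ?thesis using unnum(1)[of "s2 (unnum u c)"] that by (simp add: p_def)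
  qed
  have p_perm: "p u permutes {1..count_list ls u}" for u
  proof (rule bij_imp_permutes)
    have inj: "inj_on (p u) {1..count_list ls u}"
    proof (rule inj_onI)
      fix c d assume cd: "c \<in> {1..count_list ls u}" "d \<in> {1..count_list ls u}" "p u c = p u d"
      note i = unnum(3)[OF cd(1)] and j = unnum(3)[OF cd(2)]
      have "ls ! s2 (unnum u c) = u" "s2 (unnum u c) < length ls"
        "ls ! s2 (unnum u d) = u" "s2 (unnum u d) < length ls" using l2 s2c i j by auto
      moreover have "\<kappa> u (s2 (unnum u c)) = \<kappa> u (s2 (unnum u d))" using cd by (simp add: p_def)
      ultimately have "s2 (unnum u c) = s2 (unnum u d)" using unnum(2) by metis
      then have "unnum u c = unnum u d" using ts i j by metis
      then show "c = d" using unnum(4)[OF cd(1)] unnum(4)[OF cd(2)] by metis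
    qed
    have "p u ` {1..count_list ls u} = {1..count_list ls u}"
      by (rule endo_inj_surj) (use pc inj in auto)
    then show "bij_betw (p u) {1..count_list ls u} {1..count_list ls u}" using inj by (simp add: bij_betw_def)
  qed (auto simp: p_def)
  have s1c: "snd (s1 (i, r)) < ls ! i" "s1 (i, r) = (s2 i, snd (s1 (i, r)))" if "i < length ls" "r < ls ! i" for i r
  proof -
    have q: "(i, r) \<in> inner_labels ls" using that by (simp add: inner_labels_def)
    show *: "s1 (i, r) = (s2 i, snd (s1 (i, r)))" using s12[OF q] by (simp add: prod_eq_iff)
    have "s1 (i, r) \<in> inner_labels ls" using bij_betwE[OF s1] q by blast
    then have "snd (s1 (i, r)) < ls ! s2 i" by (subst (asm) *) (simp add: inner_labels_def)
    then show "snd (s1 (i, r)) < ls ! i" using l2[OF that(1)] by simp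
  qed
  have f_perm: "f u c permutes {1..u}" if c: "c \<in> {1..count_list ls u}" for u c
  proof (rule bij_imp_permutes)
    let ?i = "t2 (unnum u c)"
    have i: "?i < length ls" "ls ! ?i = u" using unnum(3)[OF c] t2(1) t2l by auto
    have inj: "inj_on (f u c) {1..u}"
    proof (rule inj_onI)
      fix r t assume rt: "r \<in> {1..u}" "t \<in> {1..u}" "f u c r = f u c t"
      then have b: "r - 1 < ls ! ?i" "t - 1 < ls ! ?i" using i by auto
      have "snd (s1 (?i, r - 1)) = snd (s1 (?i, t - 1))" using rt by (simp add: f_def)
      then have "s1 (?i, r - 1) = s1 (?i, t - 1)" using s1c(2)[OF i(1) b(1)] s1c(2)[OF i(1) b(2)] by metis
      moreover have "(?i, r - 1) \<in> inner_labels ls" "(?i, t - 1) \<in> inner_labels ls"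
        using b i by (auto simp: inner_labels_def)
      ultimately have "r - 1 = t - 1" using bij_betw_imp_inj_on[OF s1] by (auto dest: inj_onD)
      then show "r = t" using rt by auto
    qed
    have "f u c r \<in> {1..u}" if "r \<in> {1..u}" for r
    proof -
      have "r - 1 < ls ! ?i" using i that by auto
      then show ?thesis using s1c(1)[OF i(1), of "r - 1"] that i(2) by (simp add: f_def Suc_le_eq)
    qed
    then have "f u c ` {1..u} = {1..u}" by (intro endo_inj_surj) (use inj in auto)
    then show "bij_betw (f u c) {1..u} {1..u}" using inj by (simp add: bij_betw_def)
  qed (auto simp: f_def)
  have "F \<in> carrier (index_group ls)"
    unfolding index_group_def carrier_product_group F_def
    by (rule restrict_PiE_iff[THEN iffD2])
       (use p_perm f_perm in \<open>auto simp: wreath_sym_simps sym_group_carrier\<close>)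
  moreover have sl: "slot F i = \<kappa> (ls ! i) (s2 i)" if "i < length ls" for i
    using that unnum(1,2)[OF that] by (simp add: slot_def F_def p_def)
  moreover have ao: "act_outer F i = s2 i" if "i < length ls" for i
    unfolding act_outer_def sl[OF that] using unnum(2)[OF s2c[OF that]] l2[OF that] by simp
  moreover have "act_inner F q = s1 q" if q: "q \<in> inner_labels ls" for q
  proof -
    obtain i r where q': "q = (i, r)" "i < length ls" "r < ls ! i" using q by (auto simp: inner_labels_def)
    note i = q'(2)
    have k: "\<kappa> (ls ! i) (s2 i) \<in> {1..count_list ls (ls ! i)}" "unnum (ls ! i) (\<kappa> (ls ! i) (s2 i)) = s2 i"
      using unnum(1,2)[OF s2c[OF i]] l2[OF i] by auto
    have "fst (F (ls ! i)) (\<kappa> (ls ! i) (s2 i)) (Suc r) = Suc (snd (s1 (i, r)))"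
      using i k q'(3) ts[OF i] by (simp add: F_def f_def)
    then show ?thesis
      unfolding q'(1) act_inner_def fst_conv snd_conv ao[OF i] sl[OF i] using s1c(2)[OF i q'(3)] by simp
  qed
  ultimately show ?thesis by blast
qed

end

text \<open>The function runs from the range to the domain, so that \<open>\<theta> O \<eta>\<close>
  corresponds to composing the functions in the same order and the later map is a
  homomorphism.\<close>

lemma pbij_as_function:
  assumes "pbij \<theta>" "Domain \<theta> = A" "Range \<theta> = B"
  shows "\<exists>s. bij_betw s B A \<and> \<theta> = {(s q, q) | q. q \<in> B}"
proof -
  have "\<forall>q\<in>B. \<exists>p. (p, q) \<in> \<theta>" using assms(3) by blast
  then obtain s where s: "\<And>q. q \<in> B \<Longrightarrow> (s q, q) \<in> \<theta>" by metis
  have eq: "\<theta> = {(s q, q) | q. q \<in> B}"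
  proof (rule equalityI; rule subrelI)
    fix p q assume pq: "(p, q) \<in> \<theta>"
    then have "q \<in> B" using assms(3) by blast
    moreover from this have "p = s q" using pbij_inj[OF assms(1) pq s] by blast
    ultimately show "(p, q) \<in> {(s q, q) | q. q \<in> B}" by blast
  qed (use s in blast)
  have "bij_betw s B A"
  proof (rule bij_betw_imageI)
    show "inj_on s B"
    proof (rule inj_onI)
      fix q q' assume "q \<in> B" "q' \<in> B" "s q = s q'"
      then have "(s q, q) \<in> \<theta>" "(s q, q') \<in> \<theta>" using s[of q] s[of q'] by simp_all
      then show "q = q'" by (rule pbij_fun[OF assms(1)])
    qed
    show "s ` B = A" using assms(2) unfolding eq by blast
  qed
  then show ?thesis using eq by blast
qed

lemma graph_converse: "{(s q, q) | q. q \<in> B} = {(q, s q) | q. q \<in> B}\<inverse>"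
  by auto

lemma graph_cong: "(\<And>q. q \<in> B \<Longrightarrow> f q = g q) \<Longrightarrow> {(f q, q) | q. q \<in> B} = {(g q, q) | q. q \<in> B}"
  by force

lemma graph_relcomp:
  assumes "\<And>q. q \<in> B \<Longrightarrow> h q \<in> B \<and> k q = f (h q)"
  shows "{(k q, q) | q. q \<in> B} = {(f q, q) | q. q \<in> B} O {(h q, q) | q. q \<in> B}"
proof -
  have "{(k q, q) | q. q \<in> B} = {(f (h q), q) | q. q \<in> B}" by (rule graph_cong) (use assms in blast)
  also have "\<dots> = {(f q, q) | q. q \<in> B} O {(h q, q) | q. q \<in> B}" using assms by blast
  finally show ?thesis .
qed

text \<open>A diagram with both projections equal to \<open>rep n ls\<close> is a permutation of the
  inner strands lying over one of the outer strands. The latter preserves the entries of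
  \<open>ls\<close>, so the pair amounts to an element of the product of wreath products.\<close>

lemma index_group_units:
  assumes std: "std_labels n ls lab1 lab2"
  shows "\<exists>\<phi>. \<phi> ` carrier (index_group ls) =
      {d \<in> ramified_diagrams n. rmul n d (rflip n d) = rep n ls \<and> rmul n (rflip n d) d = rep n ls} \<and>
    (\<forall>g\<in>carrier (index_group ls). \<forall>h\<in>carrier (index_group ls).
      \<phi> (g \<otimes>\<^bsub>index_group ls\<^esub> h) = rmul n (\<phi> g) (\<phi> h)) \<and>
    \<phi> \<one>\<^bsub>index_group ls\<^esub> = rep n ls"
proof -
  note L = std_labelsD[OF std]
  obtain \<kappa> where \<kappa>: "\<And>u. bij_betw (\<kappa> u) {i. i < length ls \<and> ls ! i = u} {1..count_list ls u}"
    using block_numbering by blast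
  let ?G = "index_group ls" and ?I = "inner_labels ls" and ?O = "{..<length ls}"
  let ?s1 = "act_inner ls \<kappa>" and ?s2 = "act_outer ls \<kappa>"
  define t1 where "t1 F = {(?s1 F q, q) | q. q \<in> ?I}" for F
  define t2 where "t2 F = {(?s2 F i, i) | i. i \<in> ?O}" for F
  define \<phi> where "\<phi> F = (label_diagram n lab1 (t1 F) lab1, label_diagram n lab2 (t2 F) lab2)" for F
  have t1: "pbij (t1 F)" "t1 F O (t1 F)\<inverse> = Id_on ?I" "(t1 F)\<inverse> O t1 F = Id_on ?I" "Domain (t1 F) = ?I" "Range (t1 F) = ?I"
    if "F \<in> carrier ?G" for F
    using graph_facts[OF act_bij(2)[OF \<kappa> that]] unfolding t1_def graph_converse by simp_all
  have t2: "pbij (t2 F)" "t2 F O (t2 F)\<inverse> = Id_on ?O" "(t2 F)\<inverse> O t2 F = Id_on ?O" "Domain (t2 F) = ?O" "Range (t2 F) = ?O"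
    if "F \<in> carrier ?G" for F
    using graph_facts[OF act_bij(1)[OF \<kappa> that]] unfolding t2_def graph_converse by simp_all
  have mem: "\<phi> F \<in> ramified_diagrams n" if F: "F \<in> carrier ?G" for F
    unfolding \<phi>_def label_ramified_iff[OF t1(1)[OF F] t2(1)[OF F]]
  proof (intro ballI conjI impI)
    fix i j assume ij: "i \<in> {1..n}" "j \<in> {1..n}"
    { assume "lab1 i = lab1 j" then show "lab2 i = lab2 j" using L(4)[OF ij] by simp }
    { assume "lab1 i = lab1 j" then show "lab2 i = lab2 j" using L(4)[OF ij] by simp }
    assume "(lab1 i, lab1 j) \<in> t1 F"
    then have *: "lab1 j \<in> ?I" "lab1 i = ?s1 F (lab1 j)" by (auto simp: t1_def)
    then have "lab1 i \<in> ?I" using act_inner_closed[OF \<kappa> F] by simp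
    then have "lab2 i = ?s2 F (lab2 j)"
      using L(5)[OF ij(1)] L(5)[OF ij(2) *(1)] *(2) by (simp add: act_inner_def[OF \<kappa>])
    moreover have "lab2 j \<in> ?O" using L(5)[OF ij(2) *(1)] *(1) by (auto simp: inner_labels_def)
    ultimately show "(lab2 i, lab2 j) \<in> t2 F" unfolding t2_def by blast
  qed
  have unit: "rmul n (\<phi> F) (rflip n (\<phi> F)) = rep n ls" "rmul n (rflip n (\<phi> F)) (\<phi> F) = rep n ls"
    if F: "F \<in> carrier ?G" for F
    unfolding L(1) \<phi>_def rmul_def rflip_def fst_conv snd_conv
    using compose_label_flip(1)[OF t1(1)[OF F], of lab1 n lab1] compose_label_flip(1)[OF t2(1)[OF F], of lab2 n lab2]
      compose_label_flip(2)[OF t1(1)[OF F], of lab1 n lab1] compose_label_flip(2)[OF t2(1)[OF F], of lab2 n lab2]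
      t1(2-5)[OF F] t2(2-5)[OF F] L(2,3) by simp_all
  have mult: "\<phi> (F \<otimes>\<^bsub>?G\<^esub> H) = rmul n (\<phi> F) (\<phi> H)" if F: "F \<in> carrier ?G" and H: "H \<in> carrier ?G" for F H
  proof -
    have "t1 (F \<otimes>\<^bsub>?G\<^esub> H) = t1 F O t1 H"
    proof -
      have "?s1 H q \<in> ?I \<and> ?s1 (F \<otimes>\<^bsub>?G\<^esub> H) q = ?s1 F (?s1 H q)" if "q \<in> ?I" for q
        using act_inner_mult[OF \<kappa> F H that] act_inner_closed[OF \<kappa> H that] by simp
      then show ?thesis unfolding t1_def by (rule graph_relcomp)
    qed
    moreover have "t2 (F \<otimes>\<^bsub>?G\<^esub> H) = t2 F O t2 H"
    proof -
      have "?s2 H q \<in> ?O \<and> ?s2 (F \<otimes>\<^bsub>?G\<^esub> H) q = ?s2 F (?s2 H q)" if "q \<in> ?O" for q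
        using act_outer_mult[OF \<kappa> F H, of q] act_outer(1)[OF \<kappa> H, of q] that by simp
      then show ?thesis unfolding t2_def by (rule graph_relcomp)
    qed
    ultimately show ?thesis
      unfolding \<phi>_def rmul_def fst_conv snd_conv
      using compose_label[OF t1(1)[OF F] t1(1)[OF H], of lab1 n lab1 lab1]
        compose_label[OF t2(1)[OF F] t2(1)[OF H], of lab2 n lab2 lab2] t1(4,5)[OF F] t2(4,5)[OF F] L(2,3)
      by (simp add: le_infI1)
  qed
  have one: "\<phi> \<one>\<^bsub>?G\<^esub> = rep n ls"
  proof -
    have id: "{(q, q) | q. q \<in> B} = Id_on B" for B :: "'x set" by auto
    have "t1 \<one>\<^bsub>?G\<^esub> = Id_on ?I"
      unfolding t1_def id[symmetric] by (rule graph_cong) (rule act_one(2)[OF \<kappa>])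
    moreover have "t2 \<one>\<^bsub>?G\<^esub> = Id_on ?O"
      unfolding t2_def id[symmetric] by (rule graph_cong) (simp add: act_one(1)[OF \<kappa>])
    ultimately show ?thesis unfolding \<phi>_def L(1) by simp
  qed
  have surj: "\<exists>F\<in>carrier ?G. d = \<phi> F"
    if d: "d \<in> ramified_diagrams n" "rmul n d (rflip n d) = rep n ls" "rmul n (rflip n d) d = rep n ls" for d
  proof -
    obtain \<theta>1 \<theta>2 where \<theta>: "d = (label_diagram n lab1 \<theta>1 lab1, label_diagram n lab2 \<theta>2 lab2)"
      "pbij \<theta>1" "Domain \<theta>1 = ?I" "Range \<theta>1 = ?I" "pbij \<theta>2" "Domain \<theta>2 = ?O" "Range \<theta>2 = ?O"
      "\<And>p q. (p, q) \<in> \<theta>1 \<Longrightarrow> (fst p, fst q) \<in> \<theta>2"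
      by (rule proj_between_reps[OF d(1) std std d(2,3)]) blast
    obtain s1 where s1: "bij_betw s1 ?I ?I" "\<theta>1 = {(s1 q, q) | q. q \<in> ?I}"
      using pbij_as_function[OF \<theta>(2-4)] by blast
    obtain s2 where s2: "bij_betw s2 ?O ?O" "\<theta>2 = {(s2 i, i) | i. i \<in> ?O}"
      using pbij_as_function[OF \<theta>(5-7)] by blast
    \<comment> \<open>The inner strands of two outer parts joined by \<open>d\<close> inject into
      each other, by \<open>fibre_le\<close> for the matchings and for their converses.\<close>
    have s2l: "ls ! s2 i = ls ! i" if i: "i < length ls" for i
    proof (rule antisym)
      have m: "(s2 i, i) \<in> \<theta>2" using i s2(2) by blast
      have b: "s2 i < length ls" using bij_betwE[OF s2(1)] i by simp
      show "ls ! s2 i \<le> ls ! i" by (rule fibre_le[OF \<theta>(2-5) \<theta>(8) m b])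
      show "ls ! i \<le> ls ! s2 i"
        by (rule fibre_le[of "\<theta>1\<inverse>" ls ls "\<theta>2\<inverse>"]) (use \<theta> m i in auto)
    qed
    have s12: "fst (s1 q) = s2 (fst q)" if q: "q \<in> ?I" for q
    proof -
      have "(s1 q, q) \<in> \<theta>1" using q s1(2) by blast
      then have "(fst (s1 q), fst q) \<in> \<theta>2" by (rule \<theta>(8))
      then show ?thesis using s2(2) by blast
    qed
    obtain F where F: "F \<in> carrier ?G" "\<And>i. i < length ls \<Longrightarrow> ?s2 F i = s2 i" "\<And>q. q \<in> ?I \<Longrightarrow> ?s1 F q = s1 q"
      using act_surj[OF \<kappa> s2(1) s2l s1(1) s12] by blast
    have "t1 F = \<theta>1" unfolding t1_def s1(2) by (rule graph_cong) (rule F(3))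
    moreover have "t2 F = \<theta>2" unfolding t2_def s2(2) by (rule graph_cong) (simp add: F(2))
    ultimately show ?thesis using F(1) \<theta>(1) unfolding \<phi>_def by blast
  qed
  have "\<phi> ` carrier ?G = {d \<in> ramified_diagrams n. rmul n d (rflip n d) = rep n ls \<and> rmul n (rflip n d) d = rep n ls}"
    using mem unit surj by blast
  then show ?thesis using mult one by blast
qed

section \<open>Diagram pairs as a ranked star-monoid, and the resulting chain\<close>

section \<open>The ramified partition algebra\<close>

lemma level_index_std:
  assumes "ls \<in> level_indices n m"
  obtains lab1 lab2 where "std_labels n ls lab1 lab2"
  using std_labels_exist[of ls n] assms unfolding level_indices_def by blast

lemma rep_level:
  assumes "ls \<in> level_indices n m"
  shows "rep n ls \<in> ramified_diagrams n" "rmul n (rep n ls) (rep n ls) = rep n ls"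
    "rflip n (rep n ls) = rep n ls" "rrank n (rep n ls) = m"
proof -
  obtain lab1 lab2 where s: "std_labels n ls lab1 lab2" by (rule level_index_std[OF assms])
  show "rep n ls \<in> ramified_diagrams n" "rmul n (rep n ls) (rep n ls) = rep n ls"
    "rflip n (rep n ls) = rep n ls" "rrank n (rep n ls) = m"
    using rep_facts[OF s] assms by (simp_all add: level_indices_def)
qed

text \<open>Neither summand of the rank can grow, so equality of the sums gives equality of both,
  and stability holds in each component.\<close>

lemma rrank_mul_left:
  assumes a: "a \<in> ramified_diagrams n" and b: "b \<in> ramified_diagrams n"
  shows "rrank n (rmul n a b) \<le> rrank n a"
    and "rrank n (rmul n a b) = rrank n a \<Longrightarrow>
      rmul n (rmul n a b) (rflip n (rmul n a b)) = rmul n a (rflip n a)"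
proof -
  have d: "fst a \<in> diagrams n" "snd a \<in> diagrams n" "fst b \<in> diagrams n" "snd b \<in> diagrams n"
    using a b by (auto simp: ramified_iff)
  note 1 = prop_rank_compose_left[OF d(1,3)] and 2 = prop_rank_compose_left[OF d(2,4)]
  show "rrank n (rmul n a b) \<le> rrank n a" using 1(1) 2(1) by (simp add: rrank_def rmul_def)
  assume "rrank n (rmul n a b) = rrank n a"
  then have "prop_rank n (compose n (fst a) (fst b)) = prop_rank n (fst a)"
    "prop_rank n (compose n (snd a) (snd b)) = prop_rank n (snd a)"
    using 1(1) 2(1) by (simp_all add: rrank_def rmul_def)
  then show "rmul n (rmul n a b) (rflip n (rmul n a b)) = rmul n a (rflip n a)"
    using 1(2) 2(2) by (simp add: rmul_def rflip_def)
qed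

lemma identity_ramified: "(identity_diagram n, identity_diagram n) \<in> ramified_diagrams n"
  by (simp add: ramified_iff identity_in_diagrams)

text \<open>The condition on \<open>Q1 * Q2\<close> enters through \<open>twist_nz\<close>: it makes
  every structure constant invertible.\<close>

lemma ramified_algebra_locale:
  fixes Q1 Q2 :: "'k::field"
  assumes Q: "Q1 * Q2 \<noteq> 0"
  shows "ranked_star_monoid (ramified_diagrams n) (identity_diagram n, identity_diagram n) (rmul n)
    (rtwist n Q1 Q2) (rflip n) (rrank n) (2 * n) (\<lambda>m. rep n ` level_indices n m)"
proof (unfold_locales)
  have D: "fst a \<in> diagrams n" "snd a \<in> diagrams n" if "a \<in> ramified_diagrams n" for a
    using that by (auto simp: ramified_iff)
  show "finite (ramified_diagrams n)" by (rule finite_ramified)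
  show "(identity_diagram n, identity_diagram n) \<in> ramified_diagrams n" by (rule identity_ramified)
  fix a assume a: "a \<in> ramified_diagrams n"
  note Da = D[OF a]
  show "rmul n (identity_diagram n, identity_diagram n) a = a" "rmul n a (identity_diagram n, identity_diagram n) = a"
    using Da by (simp_all add: rmul_def compose_identity)
  show "rtwist n Q1 Q2 (identity_diagram n, identity_diagram n) a = 1"
    "rtwist n Q1 Q2 a (identity_diagram n, identity_diagram n) = 1"
    using Da by (simp_all add: rtwist_def compose_identity)
  show "rflip n a \<in> ramified_diagrams n" by (rule rflip_closed[OF a])
  show "rflip n (rflip n a) = a" using Da by (simp add: rflip_def flip_flip)
  show "rmul n (rmul n a (rflip n a)) a = a" by (rule rmul_regular[OF a])
  show "rrank n a \<le> 2 * n" using prop_rank_le[OF Da(1)] prop_rank_le[OF Da(2)] by (simp add: rrank_def)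
  show "\<exists>x\<in>ramified_diagrams n. rmul n x (rflip n x) = rmul n a (rflip n a) \<and>
      rmul n (rflip n x) x \<in> rep n ` level_indices n (rrank n a)"
    by (rule reps_exist[OF a std_labels_exist])
  show "rrank n a < 2 * n \<Longrightarrow> \<exists>b\<in>ramified_diagrams n. rrank n b = Suc (rrank n a) \<and>
      (\<exists>s\<in>ramified_diagrams n. \<exists>t\<in>ramified_diagrams n. a = rmul n (rmul n s b) t)"
    by (rule rrank_step[OF a])
  show "m \<le> 2 * n \<Longrightarrow> rmul n a (rflip n a) \<in> rep n ` level_indices n m \<Longrightarrow>
      rmul n (rflip n a) a \<in> rep n ` level_indices n m \<Longrightarrow> rmul n a (rflip n a) = rmul n (rflip n a) a" for m
  proof -
    assume "rmul n a (rflip n a) \<in> rep n ` level_indices n m" "rmul n (rflip n a) a \<in> rep n ` level_indices n m"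
    then obtain ls ls' where ls: "ls \<in> level_indices n m" "rmul n a (rflip n a) = rep n ls"
      "ls' \<in> level_indices n m" "rmul n (rflip n a) a = rep n ls'" by blast
    obtain l1 l2 where s: "std_labels n ls l1 l2" by (rule level_index_std[OF ls(1)])
    obtain l1' l2' where s': "std_labels n ls' l1' l2'" by (rule level_index_std[OF ls(3)])
    have "ls = ls'"
      by (rule reps_distinct_index[OF a s s' _ _ ls(2,4)]) (use ls in \<open>auto simp: level_indices_def\<close>)
    then show ?thesis using ls by simp
  qed
  fix b assume b: "b \<in> ramified_diagrams n"
  note Db = D[OF b]
  show "rmul n a b \<in> ramified_diagrams n" by (rule rmul_closed[OF a b])
  show "rtwist n Q1 Q2 a b \<noteq> 0" using Q by (simp add: rtwist_def)
  show "rflip n (rmul n a b) = rmul n (rflip n b) (rflip n a)"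
    using Da Db by (simp add: rflip_def rmul_def flip_compose)
  show "rtwist n Q1 Q2 a b = rtwist n Q1 Q2 (rmul n (rflip n a) a) (rmul n b (rflip n b))"
    using Da Db closed_count_proj[of _ n] by (simp add: rtwist_def rmul_def rflip_def)
  show "rrank n (rmul n a b) \<le> rrank n a" by (rule rrank_mul_left(1)[OF a b])
  show "rrank n (rmul n a b) \<le> rrank n b"
    using prop_rank_compose_right[OF Da(1) Db(1)] prop_rank_compose_right[OF Da(2) Db(2)]
    by (simp add: rrank_def rmul_def)
  show "rrank n (rmul n a b) = rrank n a \<Longrightarrow>
      rmul n (rmul n a b) (rflip n (rmul n a b)) = rmul n a (rflip n a)"
    by (rule rrank_mul_left(2)[OF a b])
  fix c assume c: "c \<in> ramified_diagrams n"
  note Dc = D[OF c]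
  show "rmul n (rmul n a b) c = rmul n a (rmul n b c)"
    using Da Db Dc by (simp add: rmul_def compose_assoc)
  show "rtwist n Q1 Q2 a b * rtwist n Q1 Q2 (rmul n a b) c = rtwist n Q1 Q2 a (rmul n b c) * rtwist n Q1 Q2 b c"
    using closed_count_cocycle[OF Da(1) Db(1) Dc(1)] closed_count_cocycle[OF Da(2) Db(2) Dc(2)]
    by (simp add: rtwist_def rmul_def mult_ac power_add[symmetric] add_ac)
next
  fix m e assume "e \<in> rep n ` level_indices n m"
  then show "e \<in> ramified_diagrams n \<and> rmul n e e = e \<and> rflip n e = e \<and> rrank n e = m"
    using rep_level by blast
next
  have "[] \<in> level_indices n 0" by (simp add: level_indices_def propagating_index_def env_size_def)
  then show "\<exists>a\<in>ramified_diagrams n. rrank n a = 0" using rep_level by blast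
qed

theorem proposition11:
  fixes n :: nat and Q1 Q2 :: "'k::field"
  assumes "n \<ge> 1"
    and "\<And>ls. propagating_index ls \<Longrightarrow> env_size ls \<le> n \<Longrightarrow>
           semisimple_ring (group_algebra (index_group ls) :: ('k, _ \<Rightarrow>\<^sub>0 'k) module)"
    and "Q1 * Q2 \<noteq> 0"
  shows "(\<exists>E. level_idempotents n Q1 Q2 E) \<and>
    (\<forall>E. level_idempotents n Q1 Q2 E \<longrightarrow>
       quasi_hereditary (ramified_partition_algebra n Q1 Q2) \<and>
       heredity_chain (ramified_partition_algebra n Q1 Q2) (2 * n)
         (\<lambda>m. sandwich (ramified_partition_algebra n Q1 Q2)
                (if m = 0 then empty_idempotent n Q1 Q2 else E m)))"
proof -
  let ?\<Lambda> = "\<lambda>m. rep n ` level_indices n m"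
  interpret R: ranked_star_monoid "ramified_diagrams n" "(identity_diagram n, identity_diagram n)" "rmul n"
    "rtwist n Q1 Q2" "rflip n" "rrank n" "2 * n" ?\<Lambda>
    by (rule ramified_algebra_locale[OF assms(3)])
  have P: "ramified_partition_algebra n Q1 Q2 = R.alg"
  proof -
    have "(\<lambda>(a1, a2) (b1, b2). Poly_Mapping.single (compose n a1 b1, compose n a2 b2)
            (Q1 ^ closed_count n a1 b1 * Q2 ^ closed_count n a2 b2)) =
        (\<lambda>a b. Poly_Mapping.single (rmul n a b) (rtwist n Q1 Q2 a b))"
      by (auto simp: fun_eq_iff rmul_def rtwist_def)
    then show ?thesis unfolding ramified_partition_algebra_def R.alg_def by simp
  qed
  have ne: "ls \<noteq> []" if "ls \<in> level_indices n m" "m \<ge> 1" for ls m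
    using that by (auto simp: level_indices_def)
  have gen: "generate (add_monoid R.alg) (\<Union>ls\<in>level_indices n m. sandwich R.alg (index_element n ls)) = R.span (Suc m)"
    if m: "m \<in> {1..2 * n}" for m
  proof -
    \<comment> \<open>At positive level every index is nonempty, so \<open>rep\<close> is the
      distinguished pair, here with coefficient 1.\<close>
    have "(\<Union>ls\<in>level_indices n m. sandwich R.alg (index_element n ls)) =
        (\<Union>e\<in>?\<Lambda> m. sandwich R.alg (Poly_Mapping.single e 1))"
      using ne m by (auto simp: index_element_def rep_def)
    then show ?thesis using R.sandwich_reps_span[of m "\<lambda>_. 1"] m by simp
  qed
  \<comment> \<open>The prescribed ideals are the \<open>R.span (Suc m)\<close>, so all choices of
    level idempotents lead to the same chain.\<close>
  have lev: "level_idempotents n Q1 Q2 E \<longleftrightarrow>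
      (\<forall>m\<in>{1..2 * n}. idempotent R.alg (E m) \<and> sandwich R.alg (E m) = R.span (Suc m))" for E
    unfolding level_idempotents_def P Let_def using gen by auto
  have "\<exists>E. idempotent R.alg E \<and> sandwich R.alg E = R.span (Suc m)" if m: "m \<in> {1..2 * n}" for m
  proof (rule R.span_idempotent_ex)
    show "m \<le> 2 * n" using m by simp
    fix e f assume "e \<in> ?\<Lambda> m" "f \<in> ?\<Lambda> m"
    then obtain ls ls' where ls: "ls \<in> level_indices n m" "e = rep n ls" "ls' \<in> level_indices n m" "f = rep n ls'"
      by blast
    obtain l1 l2 where s: "std_labels n ls l1 l2" by (rule level_index_std[OF ls(1)])
    obtain l1' l2' where s': "std_labels n ls' l1' l2'" by (rule level_index_std[OF ls(3)])
    show "rmul n e f = rmul n f e \<and> rtwist n Q1 Q2 e f = rtwist n Q1 Q2 f e"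
      using rep_commute[OF s s'] ne ls m by simp
  qed
  then have ex: "\<exists>E. level_idempotents n Q1 Q2 E" unfolding lev by metis
  have zero: "sandwich R.alg (empty_idempotent n Q1 Q2) = R.span (Suc 0)"
  proof -
    have l0: "level_indices n 0 = {[]}"
      by (auto simp: level_indices_def propagating_index_def env_size_def)
    have e: "empty_idempotent n Q1 Q2 = Poly_Mapping.single (rep n []) (inverse ((Q1 * Q2) ^ n))"
      by (simp add: empty_idempotent_def rep_def)
    have "rep n [] \<in> ramified_diagrams n" using rep_level(1)[of "[]" n 0] l0 by simp
    then have "ideal (sandwich R.alg (empty_idempotent n Q1 Q2)) R.alg"
      unfolding e by (intro R.A.sandwich_ideal) simp
    then have sg: "subgroup (sandwich R.alg (empty_idempotent n Q1 Q2)) (add_monoid R.alg)"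
      by (rule additive_subgroup.a_subgroup[OF ideal.axioms(1)])
    \<comment> \<open>Level 0 has a single index, so the union in
      \<open>R.sandwich_reps_span\<close> is one ideal, an additive group already, and
      \<open>generate\<close> does not enlarge it.\<close>
    have "generate (add_monoid R.alg) (sandwich R.alg (empty_idempotent n Q1 Q2)) =
        sandwich R.alg (empty_idempotent n Q1 Q2)"
      by (rule equalityI[OF group.generate_subgroup_incl[OF R.A.a_group subset_refl sg]])
         (blast intro: generate.incl)
    moreover have "generate (add_monoid R.alg) (sandwich R.alg (empty_idempotent n Q1 Q2)) = R.span (Suc 0)"
      using R.sandwich_reps_span[of 0 "\<lambda>_. inverse ((Q1 * Q2) ^ n)"] assms(3) unfolding l0 e by simp
    ultimately show ?thesis by simp
  qed
  have chain: "heredity_chain R.alg (2 * n) (\<lambda>m. sandwich R.alg (if m = 0 then empty_idempotent n Q1 Q2 else E m))"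
    if E: "level_idempotents n Q1 Q2 E" for E
  proof (rule R.heredity_chain_span)
    fix m assume m: "m \<le> 2 * n"
    show "sandwich R.alg (if m = 0 then empty_idempotent n Q1 Q2 else E m) = R.span (Suc m)"
      using E[unfolded lev] zero m by auto
    fix e assume e: "e \<in> ?\<Lambda> m"
    then obtain ls where ls: "ls \<in> level_indices n m" "e = rep n ls" by blast
    obtain l1 l2 where s: "std_labels n ls l1 l2" by (rule level_index_std[OF ls(1)])
    obtain \<phi> where \<phi>: "\<phi> ` carrier (index_group ls) =
        {d \<in> ramified_diagrams n. rmul n d (rflip n d) = e \<and> rmul n (rflip n d) d = e}"
      "\<And>g h. g \<in> carrier (index_group ls) \<Longrightarrow> h \<in> carrier (index_group ls) \<Longrightarrow>
        \<phi> (g \<otimes>\<^bsub>index_group ls\<^esub> h) = rmul n (\<phi> g) (\<phi> h)"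
      "\<phi> \<one>\<^bsub>index_group ls\<^esub> = e"
      using index_group_units[OF s] unfolding ls(2) by blast
    have ss: "semisimple_ring (group_algebra (index_group ls) :: ('k, _ \<Rightarrow>\<^sub>0 'k) module)"
      using assms(2) ls(1) by (simp add: level_indices_def)
    show "semisimple_ring (corner_ring (R.layer_quot m) (R.proj m (R.idem e)))"
      by (rule R.corner_semisimple[OF m e index_group_monoid index_group_finite]) (rule ss \<phi> | assumption)+
  qed
  show ?thesis unfolding P using ex chain by (auto simp: quasi_hereditary_def)
qed

end
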